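(* Let $\phi,\psi,Y$ be as in the context. Then the process $Y^{\mathrm{N^*N}}=\mathrm N^r(\mathrm N^{*,l}(Y))$ equals the two-sided reflection $[\mathrm N^{*,l}\mathrm N^{*,r}](Y)$ of $Y$ in $[-1,1]$ in law.
   Context: $\phi$ is a nonnegative Borel measure on $(0,\infty)$ with $\int_{(0,\infty)}(y^2\wedge y)\,\phi(dy)<\infty$ and $\int_{(0,1)}y\,\phi(dy)=\infty$; $\psi(\xi)=\int_{(0,\infty)}(e^{-\xi y}-1+\xi y)\,\phi(dy)$, $\Re\xi\ge0$. $Y$ is the càdlàg spectrally positive Lévy process with $\mathbb E_0[e^{-\xi Y_1}]=e^{\psi(\xi)}$, started in $[-1,1]$. For real càdlàg paths $f$ on $[0,\infty)$: left reflection at $-1$ is $\mathrm N^{*,l}(f)(t)=f(t)-\inf_{s\le t}\{(f(s)+1)\wedge0\}$. Right fast-forwarding at $1$ is $\mathrm N^r(f)=f(A_f^{-1})$ with $A_f(t)=\int_0^t\mathbf 1_{\{f(z)<1\}}dz$ and $A_f^{-1}(t)=\inf\{s>0:A_f(s)>t\}$, for paths spending infinite Lebesgue time in $(-\infty,1)$ (almost surely the case for $\mathrm N^{*,l}(Y)$). Two-sided reflection in $[-1,1]$ of a path $f$ with $f(0)\in[-1,1]$ is $[\mathrm N^{*,l}\mathrm N^{*,r}](f)=f+\eta_{-1}-\eta_1$, where $\eta_{-1},\eta_1$ are the càdlàg non-decreasing functions with $\eta_{-1}(0)=\eta_1(0)=0$ such that $[\mathrm N^{*,l}\mathrm N^{*,r}](f)$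 takes values in $[-1,1]$ and \[ \int_0^\infty\mathbf 1_{\{[\mathrm N^{*,l}\mathrm N^{*,r}](f)(t)>-1\}}\,d\eta_{-1}(t)=0,\qquad \int_0^\infty\mathbf 1_{\{[\mathrm N^{*,l}\mathrm N^{*,r}](f)(t)<1\}}\,d\eta_{1}(t)=0 . \] *)

theory Defs
  imports "HOL-Probability.Probability"
begin

section \<open>The jump measure and the Laplace exponent\<close>

definition admissible_jump_measure :: "real measure \<Rightarrow> bool" where
  "admissible_jump_measure \<phi> \<longleftrightarrow>
     sets \<phi> = sets (restrict_space borel {0<..}) \<and>
     (\<integral>\<^sup>+ y. ennreal (min (y\<^sup>2) y) \<partial>\<phi>) < \<infinity> \<and>
     (\<integral>\<^sup>+ y \<in> {0<..<1}. ennreal y \<partial>\<phi>) = \<infinity>"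

definition laplace_exponent :: "real measure \<Rightarrow> complex \<Rightarrow> complex" where
  "laplace_exponent \<phi> \<xi> =
     (\<integral> y. (exp (- \<xi> * of_real y) - 1 + \<xi> * of_real y) \<partial>\<phi>)"


section \<open>Paths\<close>

text \<open>
  A path on \<open>[0,\<infinity>)\<close> is a function on the reals of which only the values at
  nonnegative times matter.
\<close>

definition cadlag :: "(real \<Rightarrow> real) \<Rightarrow> bool" where
  "cadlag f \<longleftrightarrow>
     (\<forall>t\<ge>0. (f \<longlongrightarrow> f t) (at_right t)) \<and>
     (\<forall>t>0. \<exists>l. (f \<longlongrightarrow> l) (at_left t))"

text \<open>
  The Borel sets of the Skorokhod topology on the space of cadlag paths
  are generated by the coordinate maps, so that space is, as a measurable space, the trace of
  the product space on the cadlag paths.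
\<close>

definition cadlag_space :: "(real \<Rightarrow> real) measure" where
  "cadlag_space =
     restrict_space (Pi\<^sub>M {0..} (\<lambda>_. borel)) {f. cadlag f}"

text \<open>
  Measurability is part of the definition because \<^const>\<open>distr\<close> is meaningless without it.
\<close>

definition equal_in_law ::
    "'a measure \<Rightarrow> ('a \<Rightarrow> real \<Rightarrow> real) \<Rightarrow> ('a \<Rightarrow> real \<Rightarrow> real) \<Rightarrow> bool" where
  "equal_in_law M X Z \<longleftrightarrow>
     (\<lambda>\<omega>. restrict (X \<omega>) {0..}) \<in> M \<rightarrow>\<^sub>M cadlag_space \<and>
     (\<lambda>\<omega>. restrict (Z \<omega>) {0..}) \<in> M \<rightarrow>\<^sub>M cadlag_space \<and>
     distr M cadlag_space (\<lambda>\<omega>. restrict (X \<omega>) {0..}) =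
     distr M cadlag_space (\<lambda>\<omega>. restrict (Z \<omega>) {0..})"


section \<open>The Levy process\<close>

text \<open>
  The starting point \<open>Y 0\<close> may be random; it is then independent of the increments (it is
  the member with index \<open>0\<close> of the independent family below).
\<close>

definition cadlag_levy_process :: "'a measure \<Rightarrow> (real \<Rightarrow> 'a \<Rightarrow> real) \<Rightarrow> bool" where
  "cadlag_levy_process M Y \<longleftrightarrow>
     prob_space M \<and>
     (\<forall>t\<ge>0. Y t \<in> borel_measurable M) \<and>
     (\<forall>\<omega>\<in>space M. cadlag (\<lambda>t. Y t \<omega>)) \<and>
     (\<forall>\<tau> n. \<tau> 0 = 0 \<and> mono \<tau> \<longrightarrow>
        prob_space.indep_vars M (\<lambda>_. borel)
          (\<lambda>i \<omega>. case i of 0 \<Rightarrow> Y 0 \<omega> | Suc j \<Rightarrow> Y (\<tau> (Suc j)) \<omega> - Y (\<tau> j) \<omega>)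
          {..n::nat}) \<and>
     (\<forall>s\<ge>0. \<forall>t\<ge>0.
        distr M borel (\<lambda>\<omega>. Y (s + t) \<omega> - Y s \<omega>) = distr M borel (\<lambda>\<omega>. Y t \<omega> - Y 0 \<omega>))"

text \<open>
  Spectral positivity needs no clause of its own: the exponent determines the law of the
  increments and identifies \<open>\<phi>\<close>, which lives on \<open>(0,\<infinity>)\<close>, as the jump measure.  The law
  of \<open>Y 1\<close> for the process started from \<open>0\<close> is that of \<open>Y 1 - Y 0\<close>.  The exponential is
  integrable, since the right-hand side is never \<open>0\<close>.
\<close>

definition has_laplace_exponent ::
    "'a measure \<Rightarrow> (real \<Rightarrow> 'a \<Rightarrow> real) \<Rightarrow> (complex \<Rightarrow> complex) \<Rightarrow> bool" where
  "has_laplace_exponent M Y \<psi> \<longleftrightarrow>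
     (\<forall>\<xi>. Re \<xi> \<ge> 0 \<longrightarrow>
        (\<integral> \<omega>. exp (- \<xi> * of_real (Y 1 \<omega> - Y 0 \<omega>)) \<partial>M) = exp (\<psi> \<xi>))"


section \<open>Path transformations\<close>

definition reflect_left :: "(real \<Rightarrow> real) \<Rightarrow> real \<Rightarrow> real" where
  "reflect_left f t = f t - (INF s\<in>{0..t}. min (f s + 1) 0)"

definition time_below :: "(real \<Rightarrow> real) \<Rightarrow> real \<Rightarrow> real" where
  "time_below f t = (LINT z:{0..t}|lborel. indicator {z. f z < 1} z)"

definition time_below_inv :: "(real \<Rightarrow> real) \<Rightarrow> real \<Rightarrow> real" where
  "time_below_inv f t = Inf {s. s > 0 \<and> time_below f s > t}"

text \<open>
  Fast-forwarding is only meaningful for paths spending infinite time in \<open>(-\<infinity>,1)\<close>; any other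
  path is sent to the zero path.
\<close>

definition fast_forward_right :: "(real \<Rightarrow> real) \<Rightarrow> real \<Rightarrow> real" where
  "fast_forward_right f =
     (if emeasure lborel {z. 0 \<le> z \<and> f z < 1} = \<infinity> then f \<circ> time_below_inv f else (\<lambda>_. 0))"

text \<open>
  The regulators are extended by \<open>0\<close> to negative times, which makes them non-decreasing and
  right-continuous on the whole line; thus \<^const>\<open>interval_measure\<close> is their Stieltjes measure.
\<close>

definition regulator :: "(real \<Rightarrow> real) \<Rightarrow> bool" where
  "regulator \<eta> \<longleftrightarrow> cadlag \<eta> \<and> mono_on {0..} \<eta> \<and> (\<forall>t\<le>0. \<eta> t = 0)"

definition two_sided_regulators ::
    "(real \<Rightarrow> real) \<Rightarrow> (real \<Rightarrow> real) \<Rightarrow> (real \<Rightarrow> real) \<Rightarrow> bool" where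
  "two_sided_regulators f \<eta>l \<eta>r \<longleftrightarrow>
     regulator \<eta>l \<and> regulator \<eta>r \<and>
     (\<forall>t\<ge>0. f t + \<eta>l t - \<eta>r t \<in> {-1..1}) \<and>
     (\<integral>\<^sup>+ t. indicator {t. 0 \<le> t \<and> f t + \<eta>l t - \<eta>r t > -1} t \<partial>interval_measure \<eta>l) = 0 \<and>
     (\<integral>\<^sup>+ t. indicator {t. 0 \<le> t \<and> f t + \<eta>l t - \<eta>r t < 1} t \<partial>interval_measure \<eta>r) = 0"

definition two_sided_reflection :: "(real \<Rightarrow> real) \<Rightarrow> real \<Rightarrow> real" where
  "two_sided_reflection f t =
     (let (\<eta>l, \<eta>r) = (THE p. two_sided_regulators f (fst p) (snd p)) in f t + \<eta>l t - \<eta>r t)"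

end

theory Submission
  imports Defs
begin

text \<open>
  The increments of \<open>Y\<close> over a dyadic grid are i.i.d.  Reflect the resulting walk at \<open>-1\<close> and keep only
  the increments that start below \<open>1 - \<epsilon>\<close>.  Whether an increment is kept depends on the past alone, so
  the kept increments are again i.i.d. with the same law (optional skipping), and the walk reflected in
  \<open>[-1,1]\<close> that they drive has exactly the law of the walk reflected in \<open>[-1,1]\<close> and driven by all
  increments, which tends to the two-sided reflection of \<open>Y\<close>.  On the other hand \<open>Y\<close> has no negative
  jumps, hence the one-sided walk re-enters below \<open>1 - \<epsilon>\<close> almost continuously after an excursion, and the
  walk driven by the kept increments stays within \<open>\<epsilon> + o(1)\<close> of the one-sided walk with its excursions
  above \<open>1 - \<epsilon>\<close> removed.  Refining the grid and then letting \<open>\<epsilon>\<close> tend to \<open>0\<close> turns the latter into the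
  fast-forwarded path.  The reflected path spends infinite time below \<open>1\<close>: restarting \<open>Y\<close> when it has first
  dropped by one unit shows that this time is the sum of a positive number and a variable of the same law.
\<close>

section \<open>Cadlag paths\<close>

text \<open>The margin \<epsilon> is forced by the level 1 itself: while the path sits exactly at 1,
  convergence of the walk to it does not tell on which side of 1 the walk lies, so the number of
  steps below 1 need not approximate the time below 1. The number of steps below 1 - \<epsilon> is
  asymptotically between the times that the path spends below 1 - \<epsilon> and below 1, which
  suffices once \<epsilon> tends to 0. Optional skipping needs infinitely many kept increments on
  every outcome, so all increments after a time i are kept as well; taking \<epsilon> = 1/(i+1)
  couples both truncations into one index. The target time is moved from t to t + \<epsilon>, so
  that the step reached lies to the right of the value of the inverse clock, where right-continuity
  applies. The Laplace exponent enters in three ways: growth of at most order l^2 for large l makes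
  downward steps small, order o(l) at 0 gives mean zero, and positivity at 1 excludes a degenerate
  process. The last two make Y unbounded below, without which it could not be restarted.\<close>

lemma cadlag_right_eps:
  assumes "cadlag f" "0 \<le> t" "0 < e"
  obtains d where "0 < d" "\<And>u. t \<le> u \<Longrightarrow> u < t + d \<Longrightarrow> \<bar>f u - f t\<bar> < e"
proof -
  have "(f \<longlongrightarrow> f t) (at_right t)" using assms by (auto simp: cadlag_def)
  then have "\<forall>\<^sub>F u in at_right t. dist (f u) (f t) < e" using assms(3) by (rule tendstoD)
  then obtain b where b: "b > t" "\<And>u. t < u \<Longrightarrow> u < b \<Longrightarrow> dist (f u) (f t) < e"
    by (auto simp: eventually_at_right_field)
  show ?thesis
  proof (rule that[of "b - t"])
    show "0 < b - t" using b by simp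
    fix u assume "t \<le> u" "u < t + (b - t)"
    then show "\<bar>f u - f t\<bar> < e" using b(2)[of u] assms(3) by (cases "u = t") (auto simp: dist_real_def)
  qed
qed

lemma cadlag_left_eps:
  assumes "cadlag f" "0 < t"
  obtains l where "\<And>e. 0 < e \<Longrightarrow> \<exists>d>0. \<forall>u. t - d < u \<longrightarrow> u < t \<longrightarrow> \<bar>f u - l\<bar> < e"
proof -
  obtain l where l: "(f \<longlongrightarrow> l) (at_left t)" using assms by (auto simp: cadlag_def)
  show ?thesis
  proof (rule that[of l])
    fix e :: real assume "0 < e"
    then have "\<forall>\<^sub>F u in at_left t. dist (f u) l < e" using l by (auto dest: tendstoD)
    then obtain b where b: "b < t" "\<And>u. b < u \<Longrightarrow> u < t \<Longrightarrow> dist (f u) l < e"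
      by (auto simp: eventually_at_left_field)
    then show "\<exists>d>0. \<forall>u. t - d < u \<longrightarrow> u < t \<longrightarrow> \<bar>f u - l\<bar> < e"
      by (intro exI[of _ "t - b"]) (auto simp: dist_real_def)
  qed
qed

lemma cadlagI:
  assumes "\<And>t e. 0 \<le> t \<Longrightarrow> 0 < e \<Longrightarrow> \<exists>d>0. \<forall>u. t < u \<longrightarrow> u < t + d \<longrightarrow> \<bar>f u - f t\<bar> < e"
    and "\<And>t. 0 < t \<Longrightarrow> \<exists>l. \<forall>e>0. \<exists>d>0. \<forall>u. 0 \<le> u \<longrightarrow> t - d < u \<longrightarrow> u < t \<longrightarrow> \<bar>f u - l\<bar> < e"
  shows "cadlag f"
  unfolding cadlag_def
proof (intro conjI allI impI)
  fix t :: real assume t: "0 \<le> t"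
  show "(f \<longlongrightarrow> f t) (at_right t)"
  proof (rule tendstoI)
    fix e :: real assume "0 < e"
    then obtain d where "d > 0" "\<forall>u. t < u \<longrightarrow> u < t + d \<longrightarrow> \<bar>f u - f t\<bar> < e"
      using assms(1)[OF t] by blast
    then show "\<forall>\<^sub>F u in at_right t. dist (f u) (f t) < e"
      unfolding eventually_at_right_field dist_real_def by (intro exI[of _ "t + d"]) auto
  qed
next
  fix t :: real assume t: "0 < t"
  then obtain l where l: "\<forall>e>0. \<exists>d>0. \<forall>u. 0 \<le> u \<longrightarrow> t - d < u \<longrightarrow> u < t \<longrightarrow> \<bar>f u - l\<bar> < e"
    using assms(2) by blast
  have "(f \<longlongrightarrow> l) (at_left t)"
  proof (rule tendstoI)
    fix e :: real assume "0 < e"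
    then obtain d where "d > 0" "\<forall>u. 0 \<le> u \<longrightarrow> t - d < u \<longrightarrow> u < t \<longrightarrow> \<bar>f u - l\<bar> < e"
      using l by blast
    then show "\<forall>\<^sub>F u in at_left t. dist (f u) l < e"
      unfolding eventually_at_left_field dist_real_def using t
      by (intro exI[of _ "max 0 (t - d)"]) auto
  qed
  then show "\<exists>l. (f \<longlongrightarrow> l) (at_left t)" by blast
qed

lemma cadlag_cong:
  assumes "cadlag f" "\<And>t. 0 \<le> t \<Longrightarrow> f t = g t"
  shows "cadlag g"
proof (rule cadlagI)
  fix t e :: real assume "0 \<le> t" "0 < e"
  from cadlag_right_eps[OF assms(1) this] obtain d where
    "d > 0" "\<And>u. t \<le> u \<Longrightarrow> u < t + d \<Longrightarrow> \<bar>f u - f t\<bar> < e" by blast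
  then show "\<exists>d>0. \<forall>u. t < u \<longrightarrow> u < t + d \<longrightarrow> \<bar>g u - g t\<bar> < e"
    using assms(2) \<open>0 \<le> t\<close> by (intro exI[of _ d]) auto
next
  fix t :: real assume "0 < t"
  from cadlag_left_eps[OF assms(1) this] obtain l where
    l: "\<And>e. 0 < e \<Longrightarrow> \<exists>d>0. \<forall>u. t - d < u \<longrightarrow> u < t \<longrightarrow> \<bar>f u - l\<bar> < e" by blast
  show "\<exists>l. \<forall>e>0. \<exists>d>0. \<forall>u. 0 \<le> u \<longrightarrow> t - d < u \<longrightarrow> u < t \<longrightarrow> \<bar>g u - l\<bar> < e"
    using l assms(2) by (intro exI[of _ l]) metis
qed

lemma cadlag_restrict [simp]: "cadlag (restrict f {0..}) \<longleftrightarrow> cadlag f"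
  using cadlag_cong[of f "restrict f {0..}"] cadlag_cong[of "restrict f {0..}" f] by auto

lemma cadlag_tendsto:
  assumes "cadlag f" "0 \<le> t" "(u \<longlongrightarrow> t) F" "\<forall>\<^sub>F n in F. t \<le> u n"
  shows "((\<lambda>n. f (u n)) \<longlongrightarrow> f t) F"
proof (rule tendstoI)
  fix e :: real assume "0 < e"
  from cadlag_right_eps[OF assms(1,2) this] obtain d where
    d: "d > 0" "\<And>u. t \<le> u \<Longrightarrow> u < t + d \<Longrightarrow> \<bar>f u - f t\<bar> < e" by blast
  have "\<forall>\<^sub>F n in F. u n < t + d" using assms(3) d(1) by (intro order_tendstoD(2)) auto
  with assms(4) show "\<forall>\<^sub>F n in F. dist (f (u n)) (f t) < e"
    by eventually_elim (auto simp: dist_real_def d)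
qed

text \<open>Bisection leaves only short intervals around one point \<open>x\<close>, where
  \<open>{x}\<close> serves as \<open>S\<close>: the path is close to \<open>f x\<close> on the
  right of \<open>x\<close> and to its left limit on the left. The interval is half-open because a
  jump at \<open>s\<close> is already contained in \<open>f s\<close>.\<close>

lemma cadlag_partition:
  assumes f: "cadlag f" and "0 \<le> T" "0 < e"
  obtains S where "finite S"
    "\<And>s t. 0 \<le> s \<Longrightarrow> s \<le> t \<Longrightarrow> t \<le> T \<Longrightarrow> S \<inter> {s<..t} = {} \<Longrightarrow> \<bar>f s - f t\<bar> < e"
proof -
  define P where "P a b \<longleftrightarrow> (\<exists>S. finite S \<and> (\<forall>s t. 0 \<le> s \<longrightarrow> a \<le> s \<longrightarrow> s \<le> t \<longrightarrow> t \<le> b \<longrightarrow>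
      S \<inter> {s<..t} = {} \<longrightarrow> \<bar>f s - f t\<bar> < e))" for a b
  have "P 0 T"
  proof (rule Bolzano[OF \<open>0 \<le> T\<close>])
    fix a b c :: real assume ab: "P a b" and bc: "P b c" and le: "a \<le> b" "b \<le> c"
    from ab obtain S1 where S1: "finite S1" "\<And>s t. 0 \<le> s \<Longrightarrow> a \<le> s \<Longrightarrow> s \<le> t \<Longrightarrow> t \<le> b \<Longrightarrow>
      S1 \<inter> {s<..t} = {} \<Longrightarrow> \<bar>f s - f t\<bar> < e" unfolding P_def by blast
    from bc obtain S2 where S2: "finite S2" "\<And>s t. 0 \<le> s \<Longrightarrow> b \<le> s \<Longrightarrow> s \<le> t \<Longrightarrow> t \<le> c \<Longrightarrow>
      S2 \<inter> {s<..t} = {} \<Longrightarrow> \<bar>f s - f t\<bar> < e" unfolding P_def by blast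
    show "P a c" unfolding P_def
    proof (intro exI[of _ "insert b (S1 \<union> S2)"] conjI allI impI)
      fix s t :: real
      assume st: "0 \<le> s" "a \<le> s" "s \<le> t" "t \<le> c" "insert b (S1 \<union> S2) \<inter> {s<..t} = {}"
      then have "b \<le> s \<or> t \<le> b" by auto
      then show "\<bar>f s - f t\<bar> < e" using st S1(2)[of s t] S2(2)[of s t] by blast
    qed (use S1 S2 in auto)
  next
    fix x :: real assume x: "0 \<le> x" "x \<le> T"
    obtain d1 where d1: "d1 > 0" "\<And>u. x \<le> u \<Longrightarrow> u < x + d1 \<Longrightarrow> \<bar>f u - f x\<bar> < e/2"
      using cadlag_right_eps[OF f x(1), of "e/2"] \<open>0 < e\<close> by auto
    obtain d2 l where d2: "d2 > 0" "\<And>u. 0 \<le> u \<Longrightarrow> x - d2 < u \<Longrightarrow> u < x \<Longrightarrow> \<bar>f u - l\<bar> < e/2"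
    proof (cases "x = 0")
      case True
      then show ?thesis using that[of 1] by auto
    next
      case False
      then have "0 < x" using x by auto
      from cadlag_left_eps[OF f this] \<open>0 < e\<close> show ?thesis using that
        by (metis half_gt_zero)
    qed
    show "\<exists>d>0. \<forall>a b. a \<le> x \<and> x \<le> b \<and> b - a < d \<longrightarrow> P a b"
    proof (intro exI[of _ "min d1 d2"] conjI allI impI)
      fix a b assume ab: "a \<le> x \<and> x \<le> b \<and> b - a < min d1 d2"
      show "P a b" unfolding P_def
      proof (intro exI[of _ "{x}"] conjI allI impI)
        fix s t :: real assume st: "0 \<le> s" "a \<le> s" "s \<le> t" "t \<le> b" "{x} \<inter> {s<..t} = {}"
        then consider "x \<le> s" | "t < x" by fastforce
        then show "\<bar>f s - f t\<bar> < e"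
        proof cases
          case 1
          then show ?thesis using d1(2)[of s] d1(2)[of t] st ab by (auto simp: abs_if split: if_splits)
        next
          case 2
          then show ?thesis using d2(2)[of s] d2(2)[of t] st ab by (auto simp: abs_if split: if_splits)
        qed
      qed auto
    qed (use d1 d2 in auto)
  qed
  then show ?thesis using that unfolding P_def by blast
qed

lemma cadlag_bounded:
  assumes f: "cadlag f"
  obtains B where "0 \<le> B" "\<And>t. 0 \<le> t \<Longrightarrow> t \<le> T \<Longrightarrow> \<bar>f t\<bar> \<le> B"
proof (cases "0 \<le> T")
  case True
  obtain S where S: "finite S"
    "\<And>s t. 0 \<le> s \<Longrightarrow> s \<le> t \<Longrightarrow> t \<le> T \<Longrightarrow> S \<inter> {s<..t} = {} \<Longrightarrow> \<bar>f s - f t\<bar> < 1"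
    using cadlag_partition[OF f True, of 1] by auto
  \<comment> \<open>Every time is joined, without crossing \<open>S\<close>, to the last point of
    \<open>insert 0 S\<close> before it; this costs at most 1.\<close>
  define B where "B = (\<Sum>s\<in>insert 0 S. \<bar>f s\<bar>) + 1"
  show ?thesis
  proof (rule that[of B])
    show "0 \<le> B" unfolding B_def by (intro add_nonneg_nonneg sum_nonneg) auto
    fix t assume t: "0 \<le> t" "t \<le> T"
    define A where "A = insert 0 S \<inter> {0..t}"
    have A: "finite A" "A \<noteq> {}" using S(1) t by (auto simp: A_def)
    define s where "s = Max A"
    have "s \<in> A" using Max_in[OF A] by (simp only: s_def)
    then have s: "s \<in> insert 0 S" "0 \<le> s" "s \<le> t" unfolding A_def by auto
    have "S \<inter> {s<..t} = {}"
    proof (rule ccontr)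
      assume "S \<inter> {s<..t} \<noteq> {}"
      then obtain r where r: "r \<in> S" "s < r" "r \<le> t" by auto
      then have "r \<in> A" using s by (auto simp: A_def)
      then show False using r Max_ge[OF A(1)] by (auto simp: s_def not_le[symmetric])
    qed
    then have "\<bar>f s - f t\<bar> < 1" using S(2) s t by auto
    moreover have "\<bar>f s\<bar> \<le> (\<Sum>s\<in>insert 0 S. \<bar>f s\<bar>)"
      using S(1) s by (intro member_le_sum) auto
    ultimately show "\<bar>f t\<bar> \<le> B" unfolding B_def by linarith
  qed
next
  case False
  then show ?thesis using that[of 0] by auto
qed

lemma mono_on_left_limit:
  fixes a :: "real \<Rightarrow> real"
  assumes "mono_on {0..} a" "0 < t"
  shows "\<exists>l. \<forall>e>0. \<exists>d>0. \<forall>u. 0 \<le> u \<longrightarrow> t - d < u \<longrightarrow> u < t \<longrightarrow> \<bar>a u - l\<bar> < e"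
proof -
  define l where "l = (SUP u\<in>{0..<t}. a u)"
  have bdd: "bdd_above (a ` {0..<t})"
    using assms(2) by (intro bdd_aboveI2[of _ _ "a t"] mono_onD[OF assms(1)]) auto
  have ne: "a ` {0..<t} \<noteq> {}" using assms by auto
  show ?thesis
  proof (rule exI[of _ l], intro allI impI)
    fix e :: real assume "0 < e"
    then have "l - e < (SUP u\<in>{0..<t}. a u)" by (simp add: l_def)
    then obtain v where v: "0 \<le> v" "v < t" "l - e < a v"
      using less_cSUP_iff[OF _ bdd] assms by auto
    show "\<exists>d>0. \<forall>u. 0 \<le> u \<longrightarrow> t - d < u \<longrightarrow> u < t \<longrightarrow> \<bar>a u - l\<bar> < e"
    proof (intro exI[of _ "t - v"] conjI allI impI)
      fix u assume u: "0 \<le> u" "t - (t - v) < u" "u < t"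
      have "a v \<le> a u" using u v by (intro mono_onD[OF assms(1)]) auto
      moreover have "a u \<le> l" unfolding l_def using u by (intro cSUP_upper bdd) auto
      ultimately show "\<bar>a u - l\<bar> < e" using v \<open>0 < e\<close> by auto
    qed (use v in auto)
  qed
qed

lemma mono_on_right_cont_cadlag:
  assumes "mono_on {0..} a"
    and "\<And>t e. 0 \<le> t \<Longrightarrow> 0 < e \<Longrightarrow> \<exists>d>0. \<forall>u. t < u \<longrightarrow> u < t + d \<longrightarrow> \<bar>a u - a t\<bar> < (e::real)"
  shows "cadlag a"
  using assms mono_on_left_limit by (intro cadlagI) blast+

lemma cadlag_add:
  assumes "cadlag f" "cadlag g" shows "cadlag (\<lambda>t. f t + g t)"
  using assms unfolding cadlag_def
  by (intro conjI allI impI) (blast intro: tendsto_add)+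

lemma cadlag_diff:
  assumes "cadlag f" "cadlag g" shows "cadlag (\<lambda>t. f t - g t)"
  using assms unfolding cadlag_def
  by (intro conjI allI impI) (blast intro: tendsto_diff)+

lemma cadlag_const [simp]: "cadlag (\<lambda>t. c)"
  unfolding cadlag_def by auto

lemma cadlag_shift:
  assumes "cadlag f" "0 \<le> s" shows "cadlag (\<lambda>t. f (s + t))"
proof (rule cadlagI)
  fix t e :: real assume "0 \<le> t" "0 < e"
  then have "0 \<le> s + t" using assms by auto
  from cadlag_right_eps[OF assms(1) this \<open>0 < e\<close>] obtain d where
    "d > 0" "\<And>u. s + t \<le> u \<Longrightarrow> u < s + t + d \<Longrightarrow> \<bar>f u - f (s + t)\<bar> < e" by blast
  then show "\<exists>d>0. \<forall>u. t < u \<longrightarrow> u < t + d \<longrightarrow> \<bar>f (s + u) - f (s + t)\<bar> < e"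
    by (intro exI[of _ d]) auto
next
  fix t :: real assume "0 < t"
  then have "0 < s + t" using assms by auto
  from cadlag_left_eps[OF assms(1) this] obtain l where
    l: "\<And>e. 0 < e \<Longrightarrow> \<exists>d>0. \<forall>u. s + t - d < u \<longrightarrow> u < s + t \<longrightarrow> \<bar>f u - l\<bar> < e" by blast
  show "\<exists>l. \<forall>e>0. \<exists>d>0. \<forall>u. 0 \<le> u \<longrightarrow> t - d < u \<longrightarrow> u < t \<longrightarrow> \<bar>f (s + u) - l\<bar> < e"
  proof (rule exI[of _ l], intro allI impI)
    fix e :: real assume "0 < e"
    from l[OF this] obtain d where "d > 0" "\<forall>u. s + t - d < u \<longrightarrow> u < s + t \<longrightarrow> \<bar>f u - l\<bar> < e" by blast
    then show "\<exists>d>0. \<forall>u. 0 \<le> u \<longrightarrow> t - d < u \<longrightarrow> u < t \<longrightarrow> \<bar>f (s + u) - l\<bar> < e"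
      by (intro exI[of _ d]) auto
  qed
qed

section \<open>The Skorokhod problem in \<open>[-1,1]\<close>\<close>

text \<open>Measure-free form of the condition that the Stieltjes measure of \<open>a\<close> is
  carried by the times satisfying \<open>P\<close>: the second clause forbids growth over a
  half-open interval free of \<open>P\<close>, the third forbids a jump at a single time where
  \<open>P\<close> fails.\<close>

definition grows_only :: "(real \<Rightarrow> real) \<Rightarrow> (real \<Rightarrow> bool) \<Rightarrow> bool" where
  "grows_only a P \<longleftrightarrow> mono_on {0..} a \<and>
     (\<forall>s t. 0 \<le> s \<longrightarrow> s < t \<longrightarrow> (\<forall>u. s < u \<longrightarrow> u \<le> t \<longrightarrow> \<not> P u) \<longrightarrow> a t = a s) \<and>
     (\<forall>t e. 0 < t \<longrightarrow> \<not> P t \<longrightarrow> 0 < e \<longrightarrow> (\<exists>d>0. \<forall>u. 0 \<le> u \<longrightarrow> t - d < u \<longrightarrow> u < t \<longrightarrow> a t \<le> a u + e))"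

lemma grows_onlyD:
  assumes "grows_only a P"
  shows "mono_on {0..} a"
    and "\<And>s t. 0 \<le> s \<Longrightarrow> s < t \<Longrightarrow> (\<And>u. s < u \<Longrightarrow> u \<le> t \<Longrightarrow> \<not> P u) \<Longrightarrow> a t = a s"
    and "\<And>t e. 0 < t \<Longrightarrow> \<not> P t \<Longrightarrow> 0 < e \<Longrightarrow> \<exists>d>0. \<forall>u. 0 \<le> u \<longrightarrow> t - d < u \<longrightarrow> u < t \<longrightarrow> a t \<le> a u + e"
  using assms unfolding grows_only_def by blast+

lemma grows_only_add:
  assumes a: "grows_only a P" and b: "grows_only b Q"
  shows "grows_only (\<lambda>t. a t + b t) (\<lambda>t. P t \<or> Q t)"
  unfolding grows_only_def
proof (intro conjI allI impI)
  show "mono_on {0..} (\<lambda>t. a t + b t)"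
    using grows_onlyD(1)[OF a] grows_onlyD(1)[OF b] by (auto simp: mono_on_def intro: add_mono)
next
  fix s t :: real assume "0 \<le> s" "s < t" "\<forall>u. s < u \<longrightarrow> u \<le> t \<longrightarrow> \<not> (P u \<or> Q u)"
  then show "a t + b t = a s + b s"
    using grows_onlyD(2)[OF a, of s t] grows_onlyD(2)[OF b, of s t] by auto
next
  fix t e :: real assume t: "0 < t" "\<not> (P t \<or> Q t)" "0 < e"
  obtain d1 where d1: "d1 > 0" "\<And>u. 0 \<le> u \<Longrightarrow> t - d1 < u \<Longrightarrow> u < t \<Longrightarrow> a t \<le> a u + e/2"
    using grows_onlyD(3)[OF a, of t "e/2"] t by auto
  obtain d2 where d2: "d2 > 0" "\<And>u. 0 \<le> u \<Longrightarrow> t - d2 < u \<Longrightarrow> u < t \<Longrightarrow> b t \<le> b u + e/2"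
    using grows_onlyD(3)[OF b, of t "e/2"] t by auto
  show "\<exists>d>0. \<forall>u. 0 \<le> u \<longrightarrow> t - d < u \<longrightarrow> u < t \<longrightarrow> a t + b t \<le> a u + b u + e"
  proof (intro exI[of _ "min d1 d2"] conjI allI impI)
    fix u assume u: "0 \<le> u" "t - min d1 d2 < u" "u < t"
    then have "t - d1 < u" "t - d2 < u" by auto
    then show "a t + b t \<le> a u + b u + e" using d1(2)[of u] d2(2)[of u] u by linarith
  qed (use d1 d2 in auto)
qed

text \<open>Only \<open>a\<close> raises the difference, and it may do so only at times where the
  difference is at most \<open>c\<close>. Beyond the supremum \<open>s\<close> of the times at which
  the bound holds, \<open>P\<close> cannot occur, so \<open>a\<close> is frozen there; a jump at
  \<open>s\<close> itself is excluded by the third clause of \<open>grows_only\<close>. With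
  \<open>c = 0\<close> this is the comparison principle behind uniqueness, with \<open>c = e\<close>
  the stability of the reflection under sampling.\<close>

lemma drift_bound:
  assumes a: "grows_only a P" and b: "mono_on {0..} b" and "a 0 - b 0 \<le> c"
    and c: "\<And>t. 0 \<le> t \<Longrightarrow> t \<le> T \<Longrightarrow> P t \<Longrightarrow> a t - b t \<le> c"
    and t: "0 \<le> t" "t \<le> T"
  shows "a t - b t \<le> (c::real)"
proof (rule ccontr)
  assume gt: "\<not> a t - b t \<le> c"
  define A where "A = {u. 0 \<le> u \<and> u \<le> t \<and> a u - b u \<le> c}"
  have A0: "0 \<in> A" using t assms(3) by (auto simp: A_def)
  have bdd: "bdd_above A" by (intro bdd_aboveI[of _ t]) (auto simp: A_def)
  define s where "s = Sup A"
  have s0: "0 \<le> s" using A0 bdd by (simp add: s_def cSup_upper)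
  have st: "s \<le> t" unfolding s_def using A0 by (intro cSup_least) (auto simp: A_def)
  have above: "c < a u - b u" if "s < u" "u \<le> t" for u
  proof (rule ccontr)
    assume "\<not> c < a u - b u"
    then have "u \<in> A" using that s0 by (auto simp: A_def)
    then have "u \<le> s" using bdd by (simp add: s_def cSup_upper)
    then show False using that by auto
  qed
  show False
  proof (cases "a s - b s \<le> c")
    case True
    then have "s < t" using gt st by (cases "s = t") auto
    have "a t = a s"
    proof (rule grows_onlyD(2)[OF a s0 \<open>s < t\<close>])
      fix u assume u: "s < u" "u \<le> t"
      then show "\<not> P u" using above[of u] c[of u] s0 t by auto
    qed
    moreover have "b s \<le> b t" using s0 st by (intro mono_onD[OF b]) auto
    ultimately show False using True gt by auto
  next
    case False
    then have "s > 0" using s0 assms(3) by (cases "s = 0") auto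
    have "\<not> P s" using c[of s] False s0 st t by auto
    define e where "e = (a s - b s - c) / 2"
    have "0 < e" using False by (auto simp: e_def)
    from grows_onlyD(3)[OF a \<open>s > 0\<close> \<open>\<not> P s\<close> this] obtain d where
      d: "d > 0" "\<And>u. 0 \<le> u \<Longrightarrow> s - d < u \<Longrightarrow> u < s \<Longrightarrow> a s \<le> a u + e" by blast
    have "s - d < Sup A" using d by (simp add: s_def)
    moreover have "A \<noteq> {}" using A0 by blast
    ultimately obtain u where u: "u \<in> A" "s - d < u" using less_cSup_iff[OF _ bdd] by blast
    have "u \<le> s" using u bdd by (simp add: s_def cSup_upper)
    have "u \<noteq> s" using u False by (auto simp: A_def)
    have "0 \<le> u" "a u - b u \<le> c" using u by (auto simp: A_def)
    then have "a s \<le> a u + e" using d(2)[of u] u \<open>u \<le> s\<close> \<open>u \<noteq> s\<close> by auto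
    moreover have "b u \<le> b s" using \<open>0 \<le> u\<close> \<open>u \<le> s\<close> by (intro mono_onD[OF b]) auto
    ultimately have "a s - b s - c \<le> e" using \<open>a u - b u \<le> c\<close> by linarith
    then show False using \<open>0 < e\<close> by (auto simp: e_def)
  qed
qed

section \<open>Comparison and uniqueness of the regulators\<close>

definition skorokhod_pair :: "(real \<Rightarrow> real) \<Rightarrow> (real \<Rightarrow> real) \<Rightarrow> (real \<Rightarrow> real) \<Rightarrow> bool" where
  "skorokhod_pair f L U \<longleftrightarrow> regulator L \<and> regulator U \<and>
     (\<forall>t\<ge>0. f t + L t - U t \<in> {-1..1}) \<and>
     grows_only L (\<lambda>t. f t + L t - U t = -1) \<and> grows_only U (\<lambda>t. f t + L t - U t = 1)"

text \<open>The difference of the two reflected paths is \<open>(L + U') - (L' + U)\<close>, in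
  which \<open>f\<close> has cancelled. It can grow only when the first path is at \<open>-1\<close>
  or the second at \<open>1\<close>, and in both cases the first is not above the second, since both
  stay in the interval.\<close>

lemma skorokhod_pair_le:
  assumes s: "skorokhod_pair f L U" and s': "skorokhod_pair f L' U'" and "0 \<le> t"
  shows "f t + L t - U t \<le> f t + L' t - U' t"
proof -
  have "(L t + U' t) - (L' t + U t) \<le> 0"
  proof (rule drift_bound[where T = t and a = "\<lambda>t. L t + U' t" and b = "\<lambda>t. L' t + U t"])
    show "grows_only (\<lambda>t. L t + U' t) (\<lambda>t. f t + L t - U t = -1 \<or> f t + L' t - U' t = 1)"
      using s s' by (intro grows_only_add) (auto simp: skorokhod_pair_def)
    show "mono_on {0..} (\<lambda>t. L' t + U t)"
      using s s' by (auto simp: skorokhod_pair_def regulator_def mono_on_def intro!: add_mono)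
    show "(L 0 + U' 0) - (L' 0 + U 0) \<le> 0"
      using s s' by (auto simp: skorokhod_pair_def regulator_def)
    fix t :: real assume "0 \<le> t"
    then have "f t + L t - U t \<in> {-1..1}" "f t + L' t - U' t \<in> {-1..1}"
      using s s' by (auto simp: skorokhod_pair_def)
    moreover assume "f t + L t - U t = -1 \<or> f t + L' t - U' t = 1"
    ultimately show "(L t + U' t) - (L' t + U t) \<le> 0" by auto
  qed (use \<open>0 \<le> t\<close> in auto)
  then show ?thesis by simp
qed

text \<open>Comparison identifies the reflected paths but not the two regulators separately. Here
  the equality of two functions growing on the same set passes beyond \<open>s\<close> as long as
  that set is not met right after \<open>s\<close>: neither function jumps at \<open>s\<close>, and
  both stay constant afterwards.\<close>

lemma grows_only_eq_extend:
  assumes a: "grows_only a P" and b: "grows_only b P" and eq: "\<And>u. 0 \<le> u \<Longrightarrow> u < s \<Longrightarrow> a u = b u"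
    and "a 0 = b 0" and "0 \<le> s" and d: "0 < d" "\<And>u. s \<le> u \<Longrightarrow> u < s + d \<Longrightarrow> \<not> P u"
    and v: "s \<le> v" "v < s + d"
  shows "a v = b v"
proof -
  have "a s = b s"
  proof (cases "s = 0")
    case False
    then have "0 < s" using \<open>0 \<le> s\<close> by auto
    have "\<not> P s" using d(2)[of s] d(1) by auto
    have close: "\<bar>a s - b s\<bar> \<le> e" if e: "0 < e" for e
    proof -
      obtain d1 where d1: "d1 > 0" "\<And>u. 0 \<le> u \<Longrightarrow> s - d1 < u \<Longrightarrow> u < s \<Longrightarrow> a s \<le> a u + e"
        using grows_onlyD(3)[OF a \<open>0 < s\<close> \<open>\<not> P s\<close> e] by blast
      obtain d2 where d2: "d2 > 0" "\<And>u. 0 \<le> u \<Longrightarrow> s - d2 < u \<Longrightarrow> u < s \<Longrightarrow> b s \<le> b u + e"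
        using grows_onlyD(3)[OF b \<open>0 < s\<close> \<open>\<not> P s\<close> e] by blast
      define u where "u = s - min s (min d1 d2) / 2"
      have u: "0 \<le> u" "u < s" "s - d1 < u" "s - d2 < u"
        using \<open>0 < s\<close> d1(1) d2(1) by (auto simp: u_def min_def)
      have "a u \<le> a s" "b u \<le> b s"
        using u by (auto intro!: mono_onD[OF grows_onlyD(1)[OF a]] mono_onD[OF grows_onlyD(1)[OF b]])
      then show ?thesis using d1(2)[of u] d2(2)[of u] eq[of u] u by (auto simp: abs_le_iff)
    qed
    then have "\<bar>a s - b s\<bar> \<le> 0" by (rule field_le_epsilon) auto
    then show ?thesis by simp
  qed (use assms in simp)
  moreover have "a v = a s" if "s < v" using that v d(2) \<open>0 \<le> s\<close> by (intro grows_onlyD(2)[OF a]) auto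
  moreover have "b v = b s" if "s < v" using that v d(2) \<open>0 \<le> s\<close> by (intro grows_onlyD(2)[OF b]) auto
  ultimately show ?thesis using v by (metis order_le_less)
qed

text \<open>Comparison in both directions gives \<open>L - U = L' - U'\<close>. From the first time
  of disagreement on, the reflected path stays off one of the two barriers for a while, so the
  regulator of that barrier is frozen and hence equal in both pairs; the other one then agrees
  through the difference.\<close>

lemma skorokhod_pair_unique:
  assumes f: "cadlag f" and s: "skorokhod_pair f L U" and s': "skorokhod_pair f L' U'"
  shows "L = L' \<and> U = U'"
proof -
  define X where "X t = f t + L t - U t" for t
  have X': "f t + L' t - U' t = X t" if "0 \<le> t" for t
    using skorokhod_pair_le[OF s s' that] skorokhod_pair_le[OF s' s that] by (auto simp: X_def)
  have reg: "regulator L" "regulator U" "regulator L'" "regulator U'"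
    using s s' by (auto simp: skorokhod_pair_def)
  have X: "cadlag X" unfolding X_def using reg f by (intro cadlag_diff cadlag_add) (auto simp: regulator_def)
  have cong: "grows_only a Q" if "grows_only a P" "\<And>t. 0 \<le> t \<Longrightarrow> P t = Q t" for a P Q
    using that unfolding grows_only_def by (meson less_le_trans less_imp_le le_less_trans)
  have gL: "grows_only L (\<lambda>t. X t = -1)" and gU: "grows_only U (\<lambda>t. X t = 1)"
    using s by (auto simp: skorokhod_pair_def X_def)
  have gL': "grows_only L' (\<lambda>t. X t = -1)"
    by (rule cong[of _ "\<lambda>t. f t + L' t - U' t = -1"]) (use s' in \<open>auto simp: skorokhod_pair_def X'\<close>)
  have gU': "grows_only U' (\<lambda>t. X t = 1)"
    by (rule cong[of _ "\<lambda>t. f t + L' t - U' t = 1"]) (use s' in \<open>auto simp: skorokhod_pair_def X'\<close>)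
  have LU: "L t = L' t \<longleftrightarrow> U t = U' t" if "0 \<le> t" for t using X'[OF that] by (auto simp: X_def)
  have zero: "L t = 0" "U t = 0" "L' t = 0" "U' t = 0" if "t \<le> 0" for t
    using reg that by (auto simp: regulator_def)
  have main: "L t = L' t" if "0 \<le> t" for t
  proof (rule ccontr)
    assume neq: "L t \<noteq> L' t"
    define A where "A = {u. 0 \<le> u \<and> L u \<noteq> L' u}"
    have tA: "t \<in> A" using neq that by (auto simp: A_def)
    have bdd: "bdd_below A" by (intro bdd_belowI[of _ 0]) (auto simp: A_def)
    define s where "s = Inf A"
    have s0: "0 \<le> s" unfolding s_def using tA by (intro cInf_greatest) (auto simp: A_def)
    have below: "L u = L' u" if "0 \<le> u" "u < s" for u
      using that cInf_lower[OF _ bdd, of u] by (auto simp: s_def A_def not_le[symmetric])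
    have "\<exists>d>0. \<forall>u. s \<le> u \<longrightarrow> u < s + d \<longrightarrow> L u = L' u"
    proof (cases "X s = 1")
      case True
      obtain d where d: "d > 0" "\<And>u. s \<le> u \<Longrightarrow> u < s + d \<Longrightarrow> \<bar>X u - X s\<bar> < 1"
        using cadlag_right_eps[OF X s0, of 1] by auto
      have "L u = L' u" if "s \<le> u" "u < s + d" for u
      proof (rule grows_only_eq_extend[OF gL gL' below])
        fix v assume "s \<le> v" "v < s + d"
        then show "X v \<noteq> - 1" using d(2)[of v] True by auto
      qed (use d s0 zero that in auto)
      then show ?thesis using d by blast
    next
      case False
      then have "X s < 1" using s s0 unfolding skorokhod_pair_def X_def by force
      then obtain d where d: "d > 0" "\<And>u. s \<le> u \<Longrightarrow> u < s + d \<Longrightarrow> \<bar>X u - X s\<bar> < 1 - X s"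
        using cadlag_right_eps[OF X s0, of "1 - X s"] by auto
      have "U u = U' u" if "s \<le> u" "u < s + d" for u
      proof (rule grows_only_eq_extend[OF gU gU'])
        fix v assume "s \<le> v" "v < s + d"
        then show "X v \<noteq> 1" using d(2)[of v] by auto
      qed (use d s0 zero that below LU in auto)
      then show ?thesis using d LU s0 by (intro exI[of _ d]) auto
    qed
    then obtain d where d: "d > 0" "\<And>u. s \<le> u \<Longrightarrow> u < s + d \<Longrightarrow> L u = L' u" by blast
    have "Inf A < s + d" using d by (simp add: s_def)
    moreover have "A \<noteq> {}" using tA by blast
    ultimately obtain u where "u \<in> A" "u < s + d" using cInf_less_iff[OF _ bdd] by blast
    moreover have "s \<le> u" using \<open>u \<in> A\<close> bdd by (simp add: s_def cInf_lower)
    ultimately show False using d(2)[of u] by (auto simp: A_def)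
  qed
  show ?thesis
  proof (intro conjI ext)
    fix t show "L t = L' t" using main[of t] zero[of t] by (cases "0 \<le> t") auto
    show "U t = U' t" using main[of t] zero[of t] LU[of t] by (cases "0 \<le> t") auto
  qed
qed

section \<open>Existence of the regulators\<close>

lemma grows_onlyI:
  assumes mono: "mono_on {0..} a"
    and right: "\<And>t e. 0 \<le> t \<Longrightarrow> 0 < e \<Longrightarrow> \<exists>d>0. \<forall>u. t < u \<longrightarrow> u < t + d \<longrightarrow> \<bar>a u - a t\<bar> < e"
    and const: "\<And>t. 0 < t \<Longrightarrow> \<not> P t \<Longrightarrow> \<exists>d>0. \<forall>u. t \<le> u \<longrightarrow> u < t + d \<longrightarrow> a u = a t"
    and left: "\<And>t e. 0 < t \<Longrightarrow> \<not> P t \<Longrightarrow> 0 < e \<Longrightarrow> \<exists>d>0. \<forall>u. 0 \<le> u \<longrightarrow> t - d < u \<longrightarrow> u < t \<longrightarrow> a t \<le> a u + (e::real)"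
  shows "grows_only a P"
  unfolding grows_only_def
proof (intro conjI allI impI)
  fix s t :: real assume st: "0 \<le> s" "s < t" and nP: "\<forall>u. s < u \<longrightarrow> u \<le> t \<longrightarrow> \<not> P u"
  have eq: "a t = a r" if r: "s < r" "r \<le> t" for r
  proof -
    \<comment> \<open>Continuous induction: the supremum of the times at which \<open>a\<close>
      still has the value \<open>a r\<close> is attained by \<open>left\<close>, and
      \<open>const\<close> leads beyond it unless it is \<open>t\<close>.\<close>
    define A where "A = {u. r \<le> u \<and> u \<le> t \<and> a u = a r}"
    have rA: "r \<in> A" using r by (auto simp: A_def)
    have bdd: "bdd_above A" by (intro bdd_aboveI[of _ t]) (auto simp: A_def)
    define m where "m = Sup A"
    have rm: "r \<le> m" using rA bdd by (simp add: m_def cSup_upper)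
    have mt: "m \<le> t" unfolding m_def using rA by (intro cSup_least) (auto simp: A_def)
    have m: "0 < m" "\<not> P m" using rm mt st r nP by auto
    have "a m \<le> a r + e" if e: "0 < e" for e
    proof -
      obtain d where d: "d > 0" "\<And>u. 0 \<le> u \<Longrightarrow> m - d < u \<Longrightarrow> u < m \<Longrightarrow> a m \<le> a u + e"
        using left[OF m e] by blast
      have "m - d < Sup A" using d by (simp add: m_def)
      moreover have "A \<noteq> {}" using rA by blast
      ultimately obtain u where u: "u \<in> A" "m - d < u" using less_cSup_iff[OF _ bdd] by blast
      then have "u \<le> m" "a u = a r" "0 \<le> u" using bdd st r by (auto simp: m_def cSup_upper A_def)
      then show ?thesis using d(2)[of u] u e by (cases "u = m") auto
    qed
    then have "a m \<le> a r" by (rule field_le_epsilon)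
    moreover have "a r \<le> a m" using rm st r by (intro mono_onD[OF mono]) auto
    ultimately have am: "a m = a r" by simp
    obtain d where d: "d > 0" "\<And>u. m \<le> u \<Longrightarrow> u < m + d \<Longrightarrow> a u = a m" using const[OF m] by blast
    have "m = t"
    proof (rule ccontr)
      assume "m \<noteq> t"
      define u where "u = min t (m + d / 2)"
      have "m < u" "u \<le> t" "u < m + d" using mt \<open>m \<noteq> t\<close> d(1) by (auto simp: u_def)
      then have "u \<in> A" using d(2)[of u] am rm by (auto simp: A_def)
      then have "u \<le> m" using bdd by (simp add: m_def cSup_upper)
      then show False using \<open>m < u\<close> by simp
    qed
    then show ?thesis using am by simp
  qed
  \<comment> \<open>\<open>P\<close> may hold at \<open>s\<close>, so the value there is reached
    only through right-continuity.\<close>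
  have "\<bar>a t - a s\<bar> \<le> 0 + e" if e: "0 < e" for e
  proof -
    obtain d where d: "d > 0" "\<And>u. s < u \<Longrightarrow> u < s + d \<Longrightarrow> \<bar>a u - a s\<bar> < e"
      using right[OF st(1) e] by blast
    define u where "u = min t (s + d / 2)"
    have "s < u" "u \<le> t" "u < s + d" using st d(1) by (auto simp: u_def)
    then show ?thesis using d(2)[of u] eq[of u] by auto
  qed
  then have "\<bar>a t - a s\<bar> \<le> 0" by (rule field_le_epsilon)
  then show "a t = a s" by simp
qed (use mono left in auto)

lemma grows_only_cong:
  assumes "grows_only a P" "\<And>t. 0 \<le> t \<Longrightarrow> P t = Q t"
  shows "grows_only a Q"
  unfolding grows_only_def
proof (intro conjI allI impI)
  fix s t :: real assume "0 \<le> s" "s < t" "\<forall>u. s < u \<longrightarrow> u \<le> t \<longrightarrow> \<not> Q u"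
  then show "a t = a s" using assms(2) by (intro grows_onlyD(2)[OF assms(1)]) auto
next
  fix t e :: real assume "0 < t" "\<not> Q t" "0 < e"
  then show "\<exists>d>0. \<forall>u. 0 \<le> u \<longrightarrow> t - d < u \<longrightarrow> u < t \<longrightarrow> a t \<le> a u + e"
    using assms(2)[of t] by (intro grows_onlyD(3)[OF assms(1)]) auto
qed (rule grows_onlyD(1)[OF assms(1)])

text \<open>The inequalities say that \<open>f + a - b\<close> stays in \<open>[-1,1]\<close>, but
  each is written as a lower bound for one function that increases with the other. In this form it
  is visible that the infima of the first and of the second components, taken separately, again
  satisfy them.\<close>

definition supersolution :: "(real \<Rightarrow> real) \<Rightarrow> (real \<Rightarrow> real) \<Rightarrow> (real \<Rightarrow> real) \<Rightarrow> bool" where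
  "supersolution f a b \<longleftrightarrow> mono_on {0..} a \<and> mono_on {0..} b \<and>
     (\<forall>t\<ge>0. 0 \<le> a t \<and> 0 \<le> b t \<and> - 1 - f t + b t \<le> a t \<and> f t + a t - 1 \<le> b t)"

lemma supersolutionD:
  assumes "supersolution f a b"
  shows "mono_on {0..} a" "mono_on {0..} b"
    and "0 \<le> t \<Longrightarrow> 0 \<le> a t" "0 \<le> t \<Longrightarrow> 0 \<le> b t"
    and "0 \<le> t \<Longrightarrow> - 1 - f t + b t \<le> a t" "0 \<le> t \<Longrightarrow> f t + a t - 1 \<le> b t"
  using assms unfolding supersolution_def by blast+

text \<open>The distance 1 is the half-width of the interval:
  \<open>\<bar>b t - a t - f t\<bar> \<le> 1\<close> is exactly the pair of inequalities of a
  supersolution. Bisection again leaves a single point \<open>z\<close>, near which \<open>f\<close>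
  is close to one of two constants.\<close>

lemma cadlag_near_bv:
  assumes f: "cadlag f" and "x \<le> y"
  shows "\<exists>a b C. 0 \<le> C \<and> (\<forall>s t. 0 \<le> s \<longrightarrow> x \<le> s \<longrightarrow> s \<le> t \<longrightarrow> t \<le> y \<longrightarrow> 0 \<le> a s \<and> a s \<le> a t \<and> a t \<le> C \<and>
     0 \<le> b s \<and> b s \<le> b t \<and> b t \<le> C \<and> \<bar>b t - a t - f t\<bar> \<le> (1::real))"
proof -
  define good where "good a b C x y \<longleftrightarrow> 0 \<le> C \<and> (\<forall>s t. 0 \<le> s \<longrightarrow> x \<le> s \<longrightarrow> s \<le> t \<longrightarrow> t \<le> y \<longrightarrow> 0 \<le> a s \<and> a s \<le> a t \<and> a t \<le> C \<and>
     0 \<le> b s \<and> b s \<le> b t \<and> b t \<le> C \<and> \<bar>b t - a t - f t\<bar> \<le> 1)" for a b :: "real \<Rightarrow> real" and C x y :: real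
  have goodD: "0 \<le> a s \<and> a s \<le> a t \<and> a t \<le> C \<and> 0 \<le> b s \<and> b s \<le> b t \<and> b t \<le> C \<and> \<bar>b t - a t - f t\<bar> \<le> 1"
    if "good a b C x y" "0 \<le> s" "x \<le> s" "s \<le> t" "t \<le> y" for a b C x y s t
    using that unfolding good_def by blast
  have "\<exists>a b C. good a b C x y"
  proof (rule Bolzano[OF \<open>x \<le> y\<close>])
    fix p q r :: real assume pq: "\<exists>a b C. good a b C p q" and qr: "\<exists>a b C. good a b C q r" and le: "p \<le> q" "q \<le> r"
    from pq obtain a1 b1 C1 where 1: "good a1 b1 C1 p q" by blast
    from qr obtain a2 b2 C2 where 2: "good a2 b2 C2 q r" by blast
    have C: "0 \<le> C1" "0 \<le> C2" using 1 2 by (auto simp: good_def)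
    \<comment> \<open>Adding \<open>C1\<close> to both functions from \<open>q\<close> on keeps
      \<open>b - a\<close> and makes the pieces fit together monotonically, since \<open>C1\<close>
      bounds the pieces before \<open>q\<close>.\<close>
    define a b where "a t = (if t < q then a1 t else a2 t + C1)"
      and "b t = (if t < q then b1 t else b2 t + C1)" for t
    have "good a b (C1 + C2) p r" unfolding good_def
    proof (intro conjI[of "0 \<le> C1 + C2"] allI impI)
      fix s t assume st: "0 \<le> s" "p \<le> s" "s \<le> t" "t \<le> r"
      consider (lo) "t < q" | (mid) "s < q" "q \<le> t" | (hi) "q \<le> s" by linarith
      then show "0 \<le> a s \<and> a s \<le> a t \<and> a t \<le> C1 + C2 \<and> 0 \<le> b s \<and> b s \<le> b t \<and> b t \<le> C1 + C2 \<and> \<bar>b t - a t - f t\<bar> \<le> 1"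
      proof cases
        case lo
        then have "a s = a1 s" "a t = a1 t" "b s = b1 s" "b t = b1 t" using st by (auto simp: a_def b_def)
        moreover have "t \<le> q" using lo by simp
        moreover from goodD[OF 1 st(1-3) this]
        have "0 \<le> a1 s \<and> a1 s \<le> a1 t \<and> a1 t \<le> C1 \<and> 0 \<le> b1 s \<and> b1 s \<le> b1 t \<and> b1 t \<le> C1 \<and> \<bar>b1 t - a1 t - f t\<bar> \<le> 1" .
        ultimately show ?thesis using C by simp
      next
        case mid
        then have "a s = a1 s" "a t = a2 t + C1" "b s = b1 s" "b t = b2 t + C1" by (auto simp: a_def b_def)
        moreover have "s \<le> q" "0 \<le> t" using mid st by auto
        moreover note goodD[OF 1 st(1,2) order_refl this(1)] goodD[OF 2 this(2) mid(2) order_refl st(4)]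
        ultimately show ?thesis using C by simp
      next
        case hi
        then have "a s = a2 s + C1" "a t = a2 t + C1" "b s = b2 s + C1" "b t = b2 t + C1"
          using st by (auto simp: a_def b_def)
        moreover note goodD[OF 2 st(1) hi st(3,4)]
        ultimately show ?thesis using C by simp
      qed
    qed (use C in auto)
    then show "\<exists>a b C. good a b C p r" by blast
  next
    fix z :: real assume z: "x \<le> z" "z \<le> y"
    obtain d1 where d1: "d1 > 0" "\<And>u. 0 \<le> u \<Longrightarrow> z \<le> u \<Longrightarrow> u < z + d1 \<Longrightarrow> \<bar>f u - f z\<bar> < 1"
    proof (cases "0 \<le> z")
      case True
      then show ?thesis using cadlag_right_eps[OF f, of z 1] that by (metis zero_less_one)
    next
      case False
      then show ?thesis using that[of "- z"] by auto
    qed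
    obtain d2 l where d2: "d2 > 0" "\<And>u. 0 \<le> u \<Longrightarrow> z - d2 < u \<Longrightarrow> u < z \<Longrightarrow> \<bar>f u - l\<bar> < 1"
    proof (cases "0 < z")
      case False
      then show ?thesis using that[of 1] by auto
    next
      case True
      from cadlag_left_eps[OF f this] show ?thesis using that
        by (metis zero_less_one)
    qed
    \<comment> \<open>\<open>b - a\<close> is \<open>l\<close> before \<open>z\<close> and
      \<open>f z\<close> afterwards; the multiples of the absolute values only make both functions
      nonnegative and nondecreasing.\<close>
    define a b where "a t = (if t < z then \<bar>l\<bar> else 2 * \<bar>l\<bar> + \<bar>l\<bar> + \<bar>f z\<bar>)"
      and "b t = (if t < z then \<bar>l\<bar> + l else 2 * \<bar>l\<bar> + \<bar>l\<bar> + \<bar>f z\<bar> + f z)" for t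
    show "\<exists>d>0. \<forall>p q. p \<le> z \<and> z \<le> q \<and> q - p < d \<longrightarrow> (\<exists>a b C. good a b C p q)"
    proof (intro exI[of _ "min d1 d2"] conjI allI impI)
      fix p q assume pq: "p \<le> z \<and> z \<le> q \<and> q - p < min d1 d2"
      have "good a b (3 * \<bar>l\<bar> + 2 * \<bar>f z\<bar>) p q" unfolding good_def
      proof (intro conjI[of "0 \<le> 3 * \<bar>l\<bar> + 2 * \<bar>f z\<bar>"] allI impI)
        fix s t assume st: "0 \<le> s" "p \<le> s" "s \<le> t" "t \<le> q"
        have 1: "\<bar>f t - f z\<bar> < 1" if "z \<le> t" using d1(2)[of t] st pq that by auto
        have 2: "\<bar>f t - l\<bar> < 1" if "t < z" using d2(2)[of t] st pq that by auto
        have 3: "\<bar>b t - a t - f t\<bar> \<le> 1" using 1 2 by (cases "t < z") (auto simp: a_def b_def)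
        have 4: "0 \<le> a s \<and> a s \<le> a t \<and> a t \<le> 3 * \<bar>l\<bar> + 2 * \<bar>f z\<bar>"
          using st by (auto simp: a_def)
        have 5: "0 \<le> b s \<and> b s \<le> b t \<and> b t \<le> 3 * \<bar>l\<bar> + 2 * \<bar>f z\<bar>"
          using st abs_ge_self[of l] abs_ge_minus_self[of l] abs_ge_self[of "f z"] abs_ge_minus_self[of "f z"]
          unfolding b_def by (auto simp del: abs_ge_self abs_ge_minus_self)
        show "0 \<le> a s \<and> a s \<le> a t \<and> a t \<le> 3 * \<bar>l\<bar> + 2 * \<bar>f z\<bar> \<and> 0 \<le> b s \<and> b s \<le> b t \<and>
            b t \<le> 3 * \<bar>l\<bar> + 2 * \<bar>f z\<bar> \<and> \<bar>b t - a t - f t\<bar> \<le> 1"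
          using 3 4 5 by blast
      qed auto
      then show "\<exists>a b C. good a b C p q" by blast
    qed (use d1 d2 in auto)
  qed
  then show ?thesis unfolding good_def by blast
qed

text \<open>The local pairs on unit intervals are stacked: on the \<open>k\<close>-th one both
  functions are raised by the sum of the bounds on all earlier ones, which leaves their difference
  unchanged.\<close>

lemma supersolution_exists:
  assumes f: "cadlag f"
  shows "\<exists>a b. supersolution f a b"
proof -
  have "\<forall>k::nat. \<exists>a b C. 0 \<le> C \<and> (\<forall>s t. 0 \<le> s \<longrightarrow> real k \<le> s \<longrightarrow> s \<le> t \<longrightarrow> t \<le> real k + 1 \<longrightarrow> 0 \<le> a s \<and> a s \<le> a t \<and> a t \<le> C \<and>
     0 \<le> b s \<and> b s \<le> b t \<and> b t \<le> C \<and> \<bar>b t - a t - f t\<bar> \<le> (1::real))"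
    using cadlag_near_bv[OF f] by auto
  then obtain a b C where C: "\<And>k. 0 \<le> C k" and ab: "\<And>k s t. 0 \<le> s \<Longrightarrow> real k \<le> s \<Longrightarrow> s \<le> t \<Longrightarrow> t \<le> real k + 1 \<Longrightarrow>
      0 \<le> a k s \<and> a k s \<le> a k t \<and> a k t \<le> C k \<and> 0 \<le> b k s \<and> b k s \<le> b k t \<and> b k t \<le> C k \<and> \<bar>b k t - a k t - f t\<bar> \<le> (1::real)"
    by metis
  define n where "n t = nat \<lfloor>t\<rfloor>" for t :: real
  define A B where "A t = a (n t) t + (\<Sum>i<n t. C i)" and "B t = b (n t) t + (\<Sum>i<n t. C i)" for t
  have n: "real (n t) \<le> t" "t \<le> real (n t) + 1" if "0 \<le> t" for t
    using that unfolding n_def by linarith+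
  have n_mono: "n s \<le> n t" if "s \<le> t" for s t using that by (auto simp: n_def intro: nat_mono floor_mono)
  have mono: "A s \<le> A t \<and> B s \<le> B t" if st: "0 \<le> s" "s \<le> t" for s t
  proof (cases "n s = n t")
    case True
    then show ?thesis using ab[of s "n s" t] n[of s] n[of t] st by (auto simp: A_def B_def)
  next
    case False
    then have "n s < n t" using n_mono[OF st(2)] by auto
    then have "(\<Sum>i<Suc (n s). C i) \<le> (\<Sum>i<n t. C i)" using C by (intro sum_mono2) auto
    moreover have "a (n s) s \<le> C (n s)" "b (n s) s \<le> C (n s)"
      using ab[of s "n s" s] n[of s] st by auto
    moreover have "0 \<le> a (n t) t" "0 \<le> b (n t) t" using ab[of t "n t" t] n[of t] st by auto
    ultimately show ?thesis by (auto simp: A_def B_def)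
  qed
  have "supersolution f A B" unfolding supersolution_def
  proof (intro conjI allI impI)
    show "mono_on {0..} A" "mono_on {0..} B" using mono by (auto intro!: mono_onI)
    fix t :: real assume "0 \<le> t"
    then have ab: "0 \<le> a (n t) t" "0 \<le> b (n t) t" "\<bar>b (n t) t - a (n t) t - f t\<bar> \<le> 1"
      using ab[of t "n t" t] n[of t] by auto
    have "0 \<le> (\<Sum>i<n t. C i)" using C by (intro sum_nonneg) auto
    then show "0 \<le> A t" "0 \<le> B t" using ab by (auto simp: A_def B_def)
    show "- 1 - f t + B t \<le> A t" "f t + A t - 1 \<le> B t" using ab by (auto simp: A_def B_def abs_le_iff)
  qed
  then show ?thesis by blast
qed

lemma mono_on_right_limit:
  assumes "mono_on {0..} a" "0 \<le> t"
  obtains l where "(a::real \<Rightarrow> real) t \<le> l" "\<And>u. t < u \<Longrightarrow> l \<le> a u"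
    "\<And>e. 0 < e \<Longrightarrow> \<exists>d>0. \<forall>u. t < u \<longrightarrow> u < t + d \<longrightarrow> a u < l + e"
proof (rule that)
  let ?l = "INF u\<in>{t<..}. a u"
  have bdd: "bdd_below (a ` {t<..})"
    using assms by (intro bdd_belowI2[of _ "a t"] mono_onD[OF assms(1)]) auto
  show "a t \<le> ?l" using assms by (intro cINF_greatest mono_onD[OF assms(1)]) auto
  show "?l \<le> a u" if "t < u" for u using that by (intro cINF_lower bdd) auto
  show "\<exists>d>0. \<forall>u. t < u \<longrightarrow> u < t + d \<longrightarrow> a u < ?l + e" if "0 < e" for e
  proof -
    have "?l < ?l + e" using that by simp
    then obtain v where v: "t < v" "a v < ?l + e" using cINF_less_iff[OF _ bdd, of "?l + e"] by auto
    show ?thesis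
    proof (intro exI[of _ "v - t"] conjI allI impI)
      fix u assume u: "t < u" "u < t + (v - t)"
      have "a u \<le> a v" using u assms(2) by (intro mono_onD[OF assms(1)]) auto
      then show "a u < ?l + e" using v by simp
    qed (use v in auto)
  qed
qed

text \<open>The regulators are the smallest nonnegative nondecreasing solution of the inequalities
  \<open>a \<ge> b - f - 1\<close>, \<open>b \<ge> a + f - 1\<close>.\<close>

lemma supersolution_least:
  assumes f: "cadlag f"
  obtains L U where "supersolution f L U" "\<And>a b t. supersolution f a b \<Longrightarrow> 0 \<le> t \<Longrightarrow> L t \<le> a t \<and> U t \<le> b t"
    "\<And>t. t < 0 \<Longrightarrow> L t = 0" "\<And>t. t < 0 \<Longrightarrow> U t = 0"
proof -
  define S where "S = {(a, b). supersolution f a b}"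
  have ne: "S \<noteq> {}" using supersolution_exists[OF f] by (auto simp: S_def)
  define L U where "L t = (if t < 0 then 0 else INF p\<in>S. fst p t)"
    and "U t = (if t < 0 then 0 else INF p\<in>S. snd p t)" for t
  have bdd: "bdd_below ((\<lambda>p. fst p t) ` S)" "bdd_below ((\<lambda>p. snd p t) ` S)" if "0 \<le> t" for t
  proof -
    show "bdd_below ((\<lambda>p. fst p t) ` S)"
      by (rule bdd_belowI2[of _ 0]) (use that supersolutionD(3,4)[of f _ _ t] in \<open>fastforce simp: S_def\<close>)
    show "bdd_below ((\<lambda>p. snd p t) ` S)"
      by (rule bdd_belowI2[of _ 0]) (use that supersolutionD(3,4)[of f _ _ t] in \<open>fastforce simp: S_def\<close>)
  qed
  have low: "L t \<le> a t \<and> U t \<le> b t" if "supersolution f a b" "0 \<le> t" for a b t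
    using cINF_lower[OF bdd(1)[OF that(2)], of "(a,b)"] cINF_lower[OF bdd(2)[OF that(2)], of "(a,b)"] that
    by (auto simp: L_def U_def S_def)
  have great: "c \<le> L t" if "0 \<le> t" "\<And>a b. supersolution f a b \<Longrightarrow> c \<le> a t" for c t
  proof -
    have "c \<le> (INF p\<in>S. fst p t)" using that by (intro cINF_greatest ne) (auto simp: S_def)
    then show ?thesis using that by (simp add: L_def)
  qed
  have great': "c \<le> U t" if "0 \<le> t" "\<And>a b. supersolution f a b \<Longrightarrow> c \<le> b t" for c t
  proof -
    have "c \<le> (INF p\<in>S. snd p t)" using that by (intro cINF_greatest ne) (auto simp: S_def)
    then show ?thesis using that by (simp add: U_def)
  qed
  have "supersolution f L U" unfolding supersolution_def
  proof (intro conjI allI impI)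
    show "mono_on {0..} L"
    proof (rule mono_onI, rule great)
      fix s t :: real and a b assume st: "s \<in> {0..}" "t \<in> {0..}" "s \<le> t" and ab: "supersolution f a b"
      then show "L s \<le> a t"
        using low[OF ab, of s] mono_onD[OF supersolutionD(1)[OF ab] st] by simp
    qed auto
    show "mono_on {0..} U"
    proof (rule mono_onI, rule great')
      fix s t :: real and a b assume st: "s \<in> {0..}" "t \<in> {0..}" "s \<le> t" and ab: "supersolution f a b"
      then show "U s \<le> b t"
        using low[OF ab, of s] mono_onD[OF supersolutionD(2)[OF ab] st] by simp
    qed auto
    fix t :: real assume t: "0 \<le> t"
    show "0 \<le> L t" by (rule great[OF t]) (rule supersolutionD(3)[OF _ t])
    show "0 \<le> U t" by (rule great'[OF t]) (rule supersolutionD(4)[OF _ t])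
    show "- 1 - f t + U t \<le> L t"
    proof (rule great[OF t])
      fix a b assume ab: "supersolution f a b"
      then show "- 1 - f t + U t \<le> a t" using low[OF ab t] supersolutionD(5,6)[OF ab t] by linarith
    qed
    show "f t + L t - 1 \<le> U t"
    proof (rule great'[OF t])
      fix a b assume ab: "supersolution f a b"
      then show "f t + L t - 1 \<le> b t" using low[OF ab t] supersolutionD(5,6)[OF ab t] by linarith
    qed
  qed
  then show ?thesis using that low by (auto simp: L_def U_def)
qed

definition least_supersolution :: "(real \<Rightarrow> real) \<Rightarrow> (real \<Rightarrow> real) \<Rightarrow> (real \<Rightarrow> real) \<Rightarrow> bool" where
  "least_supersolution f L U \<longleftrightarrow> supersolution f L U \<and>
     (\<forall>a b t. supersolution f a b \<longrightarrow> 0 \<le> t \<longrightarrow> L t \<le> a t \<and> U t \<le> b t)"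

text \<open>Turning the path upside down exchanges the barriers. Every property of \<open>L\<close>
  proved below for a least supersolution thereby also holds for \<open>U\<close>.\<close>

lemma supersolution_swap: "supersolution (\<lambda>t. - f t) b a \<longleftrightarrow> supersolution f a b"
  unfolding supersolution_def by (auto simp: algebra_simps)

lemma least_supersolution_swap:
  "least_supersolution f L U \<Longrightarrow> least_supersolution (\<lambda>t. - f t) U L"
  unfolding least_supersolution_def using supersolution_swap
  by (metis supersolution_swap minus_minus)

lemma cadlag_uminus: "cadlag f \<Longrightarrow> cadlag (\<lambda>t. - f t)"
  using cadlag_diff[of "\<lambda>_. 0" f] by simp

context
  fixes f L U :: "real \<Rightarrow> real"
  assumes f: "cadlag f" and least: "least_supersolution f L U"
begin

lemma least_supersolution_sup: "supersolution f L U"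
  using least by (simp add: least_supersolution_def)

text \<open>All consequences of minimality pass through this bound. If the lower barrier asks for no
  more than \<open>m\<close> up to time \<open>w\<close>, then capping \<open>L\<close> at
  \<open>m\<close> on that stretch leaves a supersolution: lowering \<open>L\<close> only relaxes
  the inequality for \<open>U\<close>.\<close>

lemma least_supersolution_bound:
  assumes "0 \<le> w" "0 \<le> m" "\<And>u. 0 \<le> u \<Longrightarrow> u \<le> w \<Longrightarrow> U u - f u - 1 \<le> m"
  shows "L w \<le> m"
proof -
  note S = supersolutionD[OF least_supersolution_sup]
  define a where "a t = (if t \<le> w then min (L t) m else L t)" for t
  have "supersolution f a U" unfolding supersolution_def
  proof (intro conjI allI impI)
    show "mono_on {0..} a"
    proof (rule mono_onI)
      fix s t :: real assume "s \<in> {0..}" "t \<in> {0..}" "s \<le> t"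
      then show "a s \<le> a t" using mono_onD[OF S(1), of s t] by (auto simp: a_def)
    qed
    show "mono_on {0..} U" by (rule S(2))
    fix t :: real assume t: "0 \<le> t"
    show "0 \<le> a t" using S(3)[OF t] assms(2) by (auto simp: a_def)
    show "0 \<le> U t" by (rule S(4)[OF t])
    show "- 1 - f t + U t \<le> a t" using S(5)[OF t] assms(3)[OF t] by (auto simp: a_def)
    have "a t \<le> L t" by (auto simp: a_def)
    then show "f t + a t - 1 \<le> U t" using S(6)[OF t] by linarith
  qed
  then have "L w \<le> a w" using least assms(1) by (auto simp: least_supersolution_def)
  then show ?thesis by (simp add: a_def)
qed

text \<open>\<open>l\<close> and \<open>r\<close> stand for the right limits of \<open>L\<close> and
  \<open>U\<close> at \<open>t\<close>. On a short stretch after \<open>t\<close> the barrier asks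
  for at most \<open>r - f t - 1\<close> up to a small error, so \<open>L\<close> cannot rise
  further. The bound still contains a possible jump of \<open>U\<close>; the mirrored bound will
  exclude it.\<close>

lemma least_supersolution_right:
  assumes t: "0 \<le> t" and l: "L t \<le> l" "\<And>u. t < u \<Longrightarrow> l \<le> L u"
    and r: "U t \<le> r" "\<And>e. 0 < e \<Longrightarrow> \<exists>d>0. \<forall>u. t < u \<longrightarrow> u < t + d \<longrightarrow> U u < r + e"
  shows "l \<le> max (L t) (r - f t - 1)"
proof (rule field_le_epsilon)
  note S = supersolutionD[OF least_supersolution_sup]
  fix e :: real assume e: "0 < e"
  obtain d1 where d1: "d1 > 0" "\<And>u. t \<le> u \<Longrightarrow> u < t + d1 \<Longrightarrow> \<bar>f u - f t\<bar> < e/2"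
    using cadlag_right_eps[OF f t, of "e/2"] e by auto
  obtain d2 where d2: "d2 > 0" "\<And>u. t < u \<Longrightarrow> u < t + d2 \<Longrightarrow> U u < r + e/2"
    using r(2)[of "e/2"] e by auto
  define w where "w = t + min d1 d2 / 2"
  have w: "t < w" "w < t + d1" "w < t + d2" using d1(1) d2(1) by (auto simp: w_def min_def)
  have "L w \<le> max (L t) (r - f t - 1) + e"
  proof (rule least_supersolution_bound)
    show "0 \<le> max (L t) (r - f t - 1) + e" using S(3)[OF t] e by auto
    fix u assume u: "0 \<le> u" "u \<le> w"
    show "U u - f u - 1 \<le> max (L t) (r - f t - 1) + e"
    proof (cases "u \<le> t")
      case True
      then have "L u \<le> L t" using u by (intro mono_onD[OF S(1)]) auto
      then show ?thesis using S(5)[OF u(1)] e by auto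
    next
      case False
      then have "U u < r + e/2" "\<bar>f u - f t\<bar> < e/2" using d1(2)[of u] d2(2)[of u] u w by auto
      then have "U u - f u - 1 \<le> r - f t - 1 + e" by linarith
      then show ?thesis by linarith
    qed
  qed (use w t in auto)
  then show "l \<le> max (L t) (r - f t - 1) + e" using l(2)[OF w(1)] by simp
qed

text \<open>The left limit \<open>l\<close> covers the demand of the barrier before
  \<open>t\<close>, so a jump at \<open>t\<close> could only come from the demand
  \<open>U t - f t - 1\<close> at \<open>t\<close> itself. That demand is strictly below
  \<open>L t\<close> when the reflected path is off \<open>-1\<close>.\<close>

lemma least_supersolution_left:
  assumes t: "0 < t" and X: "f t + L t - U t \<noteq> - 1" and e: "0 < e"
  shows "\<exists>d>0. \<forall>u. 0 \<le> u \<longrightarrow> t - d < u \<longrightarrow> u < t \<longrightarrow> L t \<le> L u + e"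
proof -
  note S = supersolutionD[OF least_supersolution_sup]
  obtain l where l: "\<And>e. 0 < e \<Longrightarrow> \<exists>d>0. \<forall>u. 0 \<le> u \<longrightarrow> t - d < u \<longrightarrow> u < t \<longrightarrow> \<bar>L u - l\<bar> < e"
    using mono_on_left_limit[OF S(1) t] by blast
  have le: "L s \<le> l" if s: "0 \<le> s" "s < t" for s
  proof (rule field_le_epsilon)
    fix e :: real assume "0 < e"
    then obtain d where d: "d > 0" "\<And>u. 0 \<le> u \<Longrightarrow> t - d < u \<Longrightarrow> u < t \<Longrightarrow> \<bar>L u - l\<bar> < e" using l by blast
    define u where "u = max s (t - d / 2)"
    have u: "0 \<le> u" "s \<le> u" "t - d < u" "u < t" using s d(1) by (auto simp: u_def)
    have "L s \<le> L u" using u s by (intro mono_onD[OF S(1)]) auto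
    then show "L s \<le> l + e" using d(2)[OF u(1,3,4)] by auto
  qed
  have l0: "0 \<le> l" using le[of 0] S(3)[of 0] t by auto
  have "L t \<le> max l (U t - f t - 1)"
  proof (rule least_supersolution_bound)
    fix u assume u: "0 \<le> u" "u \<le> t"
    then show "U u - f u - 1 \<le> max l (U t - f t - 1)"
      using le[of u] S(5)[of u] by (cases "u = t") auto
  qed (use t l0 in auto)
  moreover have "U t - f t - 1 < L t" using S(5)[of t] X t by (simp add: order_le_less)
  ultimately have Lt: "L t \<le> l" by auto
  obtain d where d: "d > 0" "\<And>u. 0 \<le> u \<Longrightarrow> t - d < u \<Longrightarrow> u < t \<Longrightarrow> \<bar>L u - l\<bar> < e" using l[OF e] by blast
  show ?thesis using d(1)
  proof (intro exI[of _ d] conjI allI impI)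
    fix u assume "0 \<le> u" "t - d < u" "u < t"
    then show "L t \<le> L u + e" using d(2)[of u] Lt by auto
  qed
qed

end

text \<open>The least supersolution is the pair of regulators. Its minimality yields the zero
  initial values, right-continuity and the growth conditions; the inequalities themselves keep the
  reflected path in \<open>[-1,1]\<close>.\<close>

lemma skorokhod_pair_exists:
  assumes f: "cadlag f" and f0: "f 0 \<in> {-1..1}"
  shows "\<exists>L U. skorokhod_pair f L U"
proof -
  obtain L U where sup: "supersolution f L U" and low: "\<And>a b t. supersolution f a b \<Longrightarrow> 0 \<le> t \<Longrightarrow> L t \<le> a t \<and> U t \<le> b t"
    and neg: "\<And>t. t < 0 \<Longrightarrow> L t = 0" "\<And>t. t < 0 \<Longrightarrow> U t = 0"
    using supersolution_least[OF f] by metis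
  have least: "least_supersolution f L U" using sup low by (auto simp: least_supersolution_def)
  note least' = least_supersolution_swap[OF least]
  note f' = cadlag_uminus[OF f]
  note S = supersolutionD[OF sup]
  have "L 0 \<le> max 0 (U 0 - f 0 - 1)"
    by (rule least_supersolution_bound[OF f least]) auto
  moreover have "U 0 \<le> max 0 (L 0 - - f 0 - 1)"
    by (rule least_supersolution_bound[OF f' least']) auto
  moreover have "0 \<le> L 0" "0 \<le> U 0" using S(3,4)[of 0] by auto
  ultimately have zero: "L 0 = 0" "U 0 = 0" using f0 by (auto simp: max_def split: if_splits)
  have right: "(\<exists>d>0. \<forall>u. t < u \<longrightarrow> u < t + d \<longrightarrow> \<bar>L u - L t\<bar> < e) \<and>
      (\<exists>d>0. \<forall>u. t < u \<longrightarrow> u < t + d \<longrightarrow> \<bar>U u - U t\<bar> < e)" if t: "0 \<le> t" and e: "0 < e" for t e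
  proof -
    obtain l where l: "L t \<le> l" "\<And>u. t < u \<Longrightarrow> l \<le> L u"
      "\<And>e. 0 < e \<Longrightarrow> \<exists>d>0. \<forall>u. t < u \<longrightarrow> u < t + d \<longrightarrow> L u < l + e"
      using mono_on_right_limit[OF S(1) t] by metis
    obtain r where r: "U t \<le> r" "\<And>u. t < u \<Longrightarrow> r \<le> U u"
      "\<And>e. 0 < e \<Longrightarrow> \<exists>d>0. \<forall>u. t < u \<longrightarrow> u < t + d \<longrightarrow> U u < r + e"
      using mono_on_right_limit[OF S(2) t] by metis
    have "l \<le> max (L t) (r - f t - 1)" by (rule least_supersolution_right[OF f least t l(1,2) r(1,3)])
    moreover have "r \<le> max (U t) (l - - f t - 1)" by (rule least_supersolution_right[OF f' least' t r(1,2) l(1,3)])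
    \<comment> \<open>If both right limits exceeded the values, adding the two bounds would give
      \<open>0 \<le> - 2\<close>. If only one did, it would be bounded by the demand at
      \<open>t\<close>, which the supersolution already meets.\<close>
    ultimately have eq: "l = L t" "r = U t"
      using l(1) r(1) S(5,6)[OF t] by (auto simp: max_def split: if_splits)
    obtain d where d: "d > 0" "\<forall>u. t < u \<longrightarrow> u < t + d \<longrightarrow> L u < l + e" using l(3)[OF e] by blast
    obtain d' where d': "d' > 0" "\<forall>u. t < u \<longrightarrow> u < t + d' \<longrightarrow> U u < r + e" using r(3)[OF e] by blast
    have "\<forall>u. t < u \<longrightarrow> u < t + d \<longrightarrow> \<bar>L u - L t\<bar> < e" using d(2) l(2) eq by force
    moreover have "\<forall>u. t < u \<longrightarrow> u < t + d' \<longrightarrow> \<bar>U u - U t\<bar> < e" using d'(2) r(2) eq by force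
    ultimately show ?thesis using d(1) d'(1) by blast
  qed
  have cad: "cadlag L" "cadlag U" using right by (auto intro!: mono_on_right_cont_cadlag S(1,2))
  have reg: "regulator L" "regulator U"
    using cad S(1,2) zero neg by (auto simp: regulator_def order_le_less)
  \<comment> \<open>Stated for arbitrary data because it is applied to the mirrored problem as well.
    The slack \<open>g\<close> between \<open>L\<close> and the demand of the lower barrier is
    shared equally by the oscillations of \<open>f\<close> and \<open>U\<close> to the right of
    \<open>t\<close>.\<close>
  have const: "\<exists>d>0. \<forall>u. t \<le> u \<longrightarrow> u < t + d \<longrightarrow> L u = L t"
    if f: "cadlag f" and least: "least_supersolution f L U" and U: "cadlag U" and t: "0 < t" and X: "f t + L t - U t \<noteq> -1"
    for f L U and t :: real
  proof -
    note S = supersolutionD[OF least_supersolution_sup[OF f least]]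
    define g where "g = L t - (U t - f t - 1)"
    have g: "0 < g / 2" using S(5)[of t] X t by (simp add: order_le_less g_def)
    have t0: "0 \<le> t" using t by simp
    obtain d1 where d1: "d1 > 0" "\<And>u. t \<le> u \<Longrightarrow> u < t + d1 \<Longrightarrow> \<bar>f u - f t\<bar> < g/2"
      using cadlag_right_eps[OF f t0 g] by blast
    obtain d2 where d2: "d2 > 0" "\<And>u. t \<le> u \<Longrightarrow> u < t + d2 \<Longrightarrow> \<bar>U u - U t\<bar> < g/2"
      using cadlag_right_eps[OF U t0 g] by blast
    show ?thesis
    proof (intro exI[of _ "min d1 d2"] conjI allI impI)
      fix u assume u: "t \<le> u" "u < t + min d1 d2"
      have "L u \<le> L t"
      proof (rule least_supersolution_bound[OF f least])
        show "0 \<le> L t" by (rule S(3)[OF t0])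
        fix v assume v: "0 \<le> v" "v \<le> u"
        show "U v - f v - 1 \<le> L t"
        proof (cases "v \<le> t")
          case True
          then have "L v \<le> L t" using v by (intro mono_onD[OF S(1)]) auto
          then show ?thesis using S(5)[OF v(1)] by auto
        next
          case False
          then have v': "t \<le> v" "v < t + d1" "v < t + d2" using v u by auto
          have "f t - g/2 < f v" "U v < U t + g/2"
            using d1(2)[OF v'(1,2), THEN abs_less_iff[THEN iffD1]] d2(2)[OF v'(1,3), THEN abs_less_iff[THEN iffD1]]
            by linarith+
          moreover have "g / 2 + g / 2 = L t - (U t - f t - 1)" unfolding g_def by simp
          ultimately show ?thesis by linarith
        qed
      qed (use u t in auto)
      moreover have "L t \<le> L u" using u t by (intro mono_onD[OF S(1)]) auto
      ultimately show "L u = L t" by simp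
    qed (use d1 d2 in auto)
  qed
  have gL: "grows_only L (\<lambda>t. f t + L t - U t = -1)"
    using right const[OF f least cad(2)] least_supersolution_left[OF f least]
    by (intro grows_onlyI S(1)) auto
  have "grows_only U (\<lambda>t. - f t + U t - L t = -1)"
    using right const[OF f' least' cad(1)] least_supersolution_left[OF f' least']
    by (intro grows_onlyI S(2)) auto
  then have gU: "grows_only U (\<lambda>t. f t + L t - U t = 1)"
    by (rule grows_only_cong) auto
  have "f t + L t - U t \<in> {-1..1}" if "0 \<le> t" for t using S(5,6)[OF that] by auto
  then show ?thesis using reg gL gU unfolding skorokhod_pair_def by blast
qed

section \<open>Complementarity as a Stieltjes integral\<close>

lemma regulator_mono: "regulator a \<Longrightarrow> x \<le> y \<Longrightarrow> a x \<le> a y"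
proof -
  assume a: "regulator a" and xy: "x \<le> y"
  have zero: "a t = 0" if "t \<le> 0" for t using a that by (simp add: regulator_def)
  have mono: "a s \<le> a t" if "0 \<le> s" "s \<le> t" for s t
    using a that by (intro mono_onD[of "{0..}" a]) (auto simp: regulator_def)
  consider "0 \<le> x" | "x \<le> 0" "0 \<le> y" | "y \<le> 0" by linarith
  then show "a x \<le> a y"
  proof cases
    case 1
    then show ?thesis using mono xy by simp
  next
    case 2
    then show ?thesis using mono[of 0 y] zero[of x] zero[of 0] by simp
  next
    case 3
    then show ?thesis using zero[of x] zero[of y] xy by simp
  qed
qed

lemma regulator_right_cont: "regulator a \<Longrightarrow> continuous (at_right t) a"
proof (cases "0 \<le> t")
  case True
  then show "regulator a \<Longrightarrow> continuous (at_right t) a"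
    by (auto simp: regulator_def cadlag_def continuous_within)
next
  case False
  assume a: "regulator a"
  have "\<forall>\<^sub>F u in at_right t. a u = 0"
    using a False by (auto simp: eventually_at_right_field regulator_def intro!: exI[of _ 0])
  then have "(a \<longlongrightarrow> 0) (at_right t)" by (rule tendsto_eventually)
  moreover have "a t = 0" using a False by (auto simp: regulator_def)
  ultimately show ?thesis by (simp add: continuous_within)
qed

lemma emeasure_regulator_Ioc:
  assumes "regulator a" "s \<le> t"
  shows "emeasure (interval_measure a) {s<..t} = ennreal (a t - a s)"
  by (rule emeasure_interval_measure_Ioc[OF assms(2) regulator_mono[OF assms(1)] regulator_right_cont[OF assms(1)]])

text \<open>\<open>P\<close> need not be measurable, so only Borel sets avoiding \<open>P\<close>
  are tested, and these are null by domination: half-open intervals give constancy, and single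
  points, as limits of shrinking intervals, exclude jumps.\<close>

lemma grows_only_of_integral:
  assumes a: "regulator a"
    and int: "(\<integral>\<^sup>+ t. indicator {t. 0 \<le> t \<and> \<not> P t} t \<partial>interval_measure a) = 0"
  shows "grows_only a P"
proof -
  have null: "emeasure (interval_measure a) A = 0"
    if "A \<in> sets borel" "\<And>t. t \<in> A \<Longrightarrow> 0 \<le> t \<and> \<not> P t" for A
  proof -
    have "emeasure (interval_measure a) A = (\<integral>\<^sup>+ t. indicator A t \<partial>interval_measure a)"
      using that by simp
    also have "\<dots> \<le> (\<integral>\<^sup>+ t. indicator {t. 0 \<le> t \<and> \<not> P t} t \<partial>interval_measure a)"
      using that(2) by (intro nn_integral_mono) (auto split: split_indicator)
    finally show ?thesis using int by simp
  qed
  show ?thesis unfolding grows_only_def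
  proof (intro conjI allI impI)
    show "mono_on {0..} a" using a by (simp add: regulator_def)
    fix s t :: real assume st: "0 \<le> s" "s < t" "\<forall>u. s < u \<longrightarrow> u \<le> t \<longrightarrow> \<not> P u"
    have "emeasure (interval_measure a) {s<..t} = 0" by (rule null) (use st in auto)
    then show "a t = a s"
      using emeasure_regulator_Ioc[OF a, of s t] regulator_mono[OF a, of s t] st by (auto simp: ennreal_eq_0_iff)
  next
    fix t e :: real assume t: "0 < t" "\<not> P t" "0 < e"
    show "\<exists>d>0. \<forall>u. 0 \<le> u \<longrightarrow> t - d < u \<longrightarrow> u < t \<longrightarrow> a t \<le> a u + e"
    proof -
      obtain l where l: "\<And>e. 0 < e \<Longrightarrow> \<exists>d>0. \<forall>u. 0 \<le> u \<longrightarrow> t - d < u \<longrightarrow> u < t \<longrightarrow> \<bar>a u - l\<bar> < e"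
        using mono_on_left_limit[of a t] a t by (auto simp: regulator_def)
      have le: "a s \<le> l" if s: "s < t" for s
      proof (rule field_le_epsilon)
        fix e :: real assume "0 < e"
        then obtain d where d: "d > 0" "\<And>u. 0 \<le> u \<Longrightarrow> t - d < u \<Longrightarrow> u < t \<Longrightarrow> \<bar>a u - l\<bar> < e" using l by blast
        define u where "u = max (max s 0) (t - d / 2)"
        have u: "0 \<le> u" "s \<le> u" "t - d < u" "u < t" using s t d(1) by (auto simp: u_def)
        have "a s \<le> a u" using u by (intro regulator_mono[OF a])
        then show "a s \<le> l + e" using d(2)[OF u(1,3,4)] by auto
      qed
      have "a t \<le> l"
      proof -
        have "emeasure (interval_measure a) {t} = 0" by (rule null) (use t in auto)
        have "(\<lambda>n. emeasure (interval_measure a) {t - inverse (real (Suc n))<..t}) \<longlonglongrightarrow>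
            emeasure (interval_measure a) (\<Inter>n. {t - inverse (real (Suc n))<..t})"
        proof (rule Lim_emeasure_decseq)
          show "decseq (\<lambda>n. {t - inverse (real (Suc n))<..t})"
            by (intro decseq_SucI) (auto simp: field_simps intro: order.strict_trans1)
          show "emeasure (interval_measure a) {t - inverse (real (Suc n))<..t} \<noteq> \<infinity>" for n
            by (subst emeasure_regulator_Ioc[OF a]) auto
        qed auto
        also have "(\<Inter>n. {t - inverse (real (Suc n))<..t}) = {t}"
        proof -
          have "x = t" if "\<And>n. t - inverse (real (Suc n)) < x" "x \<le> t" for x
          proof (rule ccontr)
            assume "x \<noteq> t"
            then have "0 < t - x" using that by auto
            from reals_Archimedean[OF this] obtain n where "inverse (real (Suc n)) < t - x" by blast
            then show False using that(1)[of n] by auto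
          qed
          then show ?thesis by auto
        qed
        finally have lim: "(\<lambda>n. ennreal (a t - a (t - inverse (real (Suc n))))) \<longlonglongrightarrow> 0"
          using \<open>emeasure (interval_measure a) {t} = 0\<close> by (simp add: emeasure_regulator_Ioc[OF a])
        have "ennreal (a t - l) \<le> 0"
        proof (rule LIMSEQ_le_const[OF lim], intro exI allI impI)
          fix n
          show "ennreal (a t - l) \<le> ennreal (a t - a (t - inverse (real (Suc n))))"
            using le[of "t - inverse (real (Suc n))"] by (intro ennreal_leI) auto
        qed
        then show ?thesis by (simp add: ennreal_eq_0_iff)
      qed
      obtain d where d: "d > 0" "\<And>u. 0 \<le> u \<Longrightarrow> t - d < u \<Longrightarrow> u < t \<Longrightarrow> \<bar>a u - l\<bar> < e" using l[OF t(3)] by blast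
      show ?thesis using d(1)
      proof (intro exI[of _ d] conjI allI impI)
        fix u assume "0 \<le> u" "t - d < u" "u < t"
        then show "a t \<le> a u + e" using d(2)[of u] \<open>a t \<le> l\<close> by auto
      qed
    qed
  qed
qed

text \<open>The times without \<open>P\<close> are covered by countably many null sets, one for each
  rational \<open>q\<close>: the times from which \<open>P\<close> stays absent up to
  \<open>q\<close> form an interval, and \<open>a\<close> has no growth on it. By \<open>op\<close>,
  every time where \<open>P\<close> fails is followed by such a \<open>q\<close>.\<close>

lemma integral_of_grows_only:
  assumes a: "regulator a" and g: "grows_only a P"
    and op: "\<And>t. 0 \<le> t \<Longrightarrow> \<not> P t \<Longrightarrow> \<exists>d>0. \<forall>u. t \<le> u \<longrightarrow> u < t + d \<longrightarrow> \<not> P u"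
  shows "(\<integral>\<^sup>+ t. indicator {t. 0 \<le> t \<and> \<not> P t} t \<partial>interval_measure a) = 0"
proof -
  let ?M = "interval_measure a"
  have single: "{t} \<in> null_sets ?M" if t: "0 \<le> t" "\<not> P t" for t
  proof -
    have small: "emeasure ?M {t} \<le> ennreal e" if e: "0 < e" for e
    proof -
      obtain d where d: "d > 0" "\<And>u. t - d < u \<Longrightarrow> u < t \<Longrightarrow> a t \<le> a u + e"
      \<comment> \<open>There is no atom at 0 because a regulator vanishes at 0 and before.\<close>
      proof (cases "t = 0")
        case True
        then show ?thesis using that[of 1] a e by (auto simp: regulator_def)
      next
        case False
        then have "0 < t" using t by simp
        from grows_onlyD(3)[OF g this t(2) e] obtain d where
          "d > 0" "\<And>u. 0 \<le> u \<Longrightarrow> t - d < u \<Longrightarrow> u < t \<Longrightarrow> a t \<le> a u + e" by blast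
        then show ?thesis using \<open>0 < t\<close> by (intro that[of "min d t"]) auto
      qed
      have "emeasure ?M {t} \<le> emeasure ?M {t - d/2<..t}"
        using d by (intro emeasure_mono) auto
      also have "\<dots> = ennreal (a t - a (t - d/2))" using d by (intro emeasure_regulator_Ioc a) auto
      also have "\<dots> \<le> ennreal e" using d(2)[of "t - d/2"] d(1) by (intro ennreal_leI) auto
      finally show ?thesis .
    qed
    have "emeasure ?M {t} \<le> 0"
    proof (rule ennreal_le_epsilon)
      fix e :: real assume "0 < e"
      then show "emeasure ?M {t} \<le> 0 + ennreal e" using small[of e] by (simp only: add_0_left)
    qed
    then show ?thesis by (auto simp: null_sets_def)
  qed
  define B where "B q = {t. 0 \<le> t \<and> t < q \<and> (\<forall>u. t \<le> u \<longrightarrow> u \<le> q \<longrightarrow> \<not> P u)}" for q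
  \<comment> \<open>The left end point is included only if \<open>P\<close> fails there; otherwise
    it may carry mass.\<close>
  define N where "N q = (if B q = {} then {} else {Inf (B q)<..q} \<union> (if Inf (B q) \<in> B q then {Inf (B q)} else {}))" for q
  have bdd: "bdd_below (B q)" for q by (intro bdd_belowI[of _ 0]) (auto simp: B_def)
  have "N q \<in> null_sets ?M" for q
  proof (cases "B q = {}")
    case False
    define i where "i = Inf (B q)"
    have i0: "0 \<le> i" unfolding i_def using False by (intro cInf_greatest) (auto simp: B_def)
    have eq: "a q = a s" if "s \<in> B q" for s
      using that by (intro grows_onlyD(2)[OF g]) (auto simp: B_def)
    have iq: "i \<le> q" using False cInf_lower[OF _ bdd] by (force simp: i_def B_def)
    have "a q \<le> a i + e" if e: "0 < e" for e
    proof -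
      obtain d where d: "d > 0" "\<And>u. i \<le> u \<Longrightarrow> u < i + d \<Longrightarrow> \<bar>a u - a i\<bar> < e"
        using cadlag_right_eps[of a i e] a i0 e by (auto simp: regulator_def)
      have "Inf (B q) < i + d" using d by (simp add: i_def)
      then obtain s where s: "s \<in> B q" "s < i + d" using cInf_less_iff[OF False bdd] by blast
      moreover have "i \<le> s" using s bdd by (simp add: i_def cInf_lower)
      ultimately show ?thesis using d(2)[of s] eq[of s] by auto
    qed
    then have "a q \<le> a i" by (rule field_le_epsilon)
    then have "emeasure ?M {i<..q} = 0"
      using iq regulator_mono[OF a iq] by (subst emeasure_regulator_Ioc[OF a]) auto
    then have "{i<..q} \<in> null_sets ?M" by (auto simp: null_sets_def)
    moreover have "{i} \<in> null_sets ?M" if "i \<in> B q" using that by (intro single) (auto simp: B_def)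
    ultimately have "{i<..q} \<union> (if i \<in> B q then {i} else {}) \<in> null_sets ?M"
      by (intro null_sets.Un) auto
    then show ?thesis using False by (simp only: N_def i_def[symmetric] if_False)
  qed (simp add: N_def)
  then have N: "(\<Union>q\<in>\<rat>. N q) \<in> null_sets ?M" by (intro null_sets_UN') (auto simp: countable_rat)
  have sub: "{t. 0 \<le> t \<and> \<not> P t} \<subseteq> (\<Union>q\<in>\<rat>. N q)"
  proof safe
    fix t assume t: "0 \<le> t" "\<not> P t"
    from op[OF this] obtain d where d: "d > 0" "\<And>u. t \<le> u \<Longrightarrow> u < t + d \<Longrightarrow> \<not> P u" by blast
    obtain q where q: "q \<in> \<rat>" "t < q" "q < t + d" using Rats_dense_in_real[of t "t + d"] d by auto
    have tB: "t \<in> B q" using t q d by (auto simp: B_def)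
    then have "Inf (B q) \<le> t" using bdd by (simp add: cInf_lower)
    then have "t \<in> N q" using tB q by (auto simp: N_def)
    then show "t \<in> (\<Union>q\<in>\<rat>. N q)" using q by blast
  qed
  have "(\<integral>\<^sup>+ t. indicator {t. 0 \<le> t \<and> \<not> P t} t \<partial>?M) \<le> (\<integral>\<^sup>+ t. indicator (\<Union>q\<in>\<rat>. N q) t \<partial>?M)"
    using sub by (intro nn_integral_mono) (auto split: split_indicator)
  also have "\<dots> = emeasure ?M (\<Union>q\<in>\<rat>. N q)" using N by (intro nn_integral_indicator) (auto simp: null_sets_def)
  also have "\<dots> = 0" using N by (auto simp: null_sets_def)
  finally show ?thesis by simp
qed

text \<open>Inside \<open>[-1,1]\<close>, being off a barrier means differing from its level, and
  right-continuity of the reflected path makes the set of such times open to the right, as the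
  passage from growth to integrals requires.\<close>

lemma two_sided_regulators_iff:
  assumes f: "cadlag f"
  shows "two_sided_regulators f L U \<longleftrightarrow> skorokhod_pair f L U"
proof -
  define X where "X t = f t + L t - U t" for t
  have main: "(\<integral>\<^sup>+ t. indicator {t. 0 \<le> t \<and> X t > -1} t \<partial>interval_measure L) = 0 \<longleftrightarrow> grows_only L (\<lambda>t. X t = -1)"
    "(\<integral>\<^sup>+ t. indicator {t. 0 \<le> t \<and> X t < 1} t \<partial>interval_measure U) = 0 \<longleftrightarrow> grows_only U (\<lambda>t. X t = 1)"
    if r: "regulator L" "regulator U" and X: "\<forall>t\<ge>0. X t \<in> {-1..1}"
  proof -
    have cX: "cadlag X" unfolding X_def using r f by (intro cadlag_diff cadlag_add) (auto simp: regulator_def)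
    have op: "\<exists>d>0. \<forall>u. t \<le> u \<longrightarrow> u < t + d \<longrightarrow> \<not> X u = c" if t: "0 \<le> t" and c: "\<not> X t = c" for t c
    proof -
      obtain d where "d > 0" "\<And>u. t \<le> u \<Longrightarrow> u < t + d \<Longrightarrow> \<bar>X u - X t\<bar> < \<bar>X t - c\<bar>"
        using cadlag_right_eps[OF cX t, of "\<bar>X t - c\<bar>"] c by auto
      then show ?thesis by (metis abs_minus_commute less_irrefl)
    qed
    have 1: "{t. 0 \<le> t \<and> X t > -1} = {t. 0 \<le> t \<and> \<not> X t = -1}" using X by force
    have 2: "{t. 0 \<le> t \<and> X t < 1} = {t. 0 \<le> t \<and> \<not> X t = 1}" using X by force
    show "(\<integral>\<^sup>+ t. indicator {t. 0 \<le> t \<and> X t > -1} t \<partial>interval_measure L) = 0 \<longleftrightarrow> grows_only L (\<lambda>t. X t = -1)"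
      unfolding 1 using grows_only_of_integral[OF r(1), of "\<lambda>t. X t = -1"] integral_of_grows_only[OF r(1), of "\<lambda>t. X t = -1"] op by blast
    show "(\<integral>\<^sup>+ t. indicator {t. 0 \<le> t \<and> X t < 1} t \<partial>interval_measure U) = 0 \<longleftrightarrow> grows_only U (\<lambda>t. X t = 1)"
      unfolding 2 using grows_only_of_integral[OF r(2), of "\<lambda>t. X t = 1"] integral_of_grows_only[OF r(2), of "\<lambda>t. X t = 1"] op by blast
  qed
  show ?thesis unfolding two_sided_regulators_def skorokhod_pair_def X_def[symmetric] using main by blast
qed

lemma two_sided_reflection_eq:
  assumes f: "cadlag f" and s: "skorokhod_pair f L U"
  shows "two_sided_reflection f = (\<lambda>t. f t + L t - U t)"
proof
  fix t
  have "(THE p. two_sided_regulators f (fst p) (snd p)) = (L, U)"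
    using skorokhod_pair_unique[OF f] s by (intro the_equality) (auto simp: two_sided_regulators_iff[OF f])
  then show "two_sided_reflection f t = f t + L t - U t" by (simp add: two_sided_reflection_def)
qed

section \<open>Reflected random walks\<close>

primrec walk1 :: "real \<Rightarrow> (nat \<Rightarrow> real) \<Rightarrow> nat \<Rightarrow> real" where
  "walk1 x \<xi> 0 = x"
| "walk1 x \<xi> (Suc k) = max (-1) (walk1 x \<xi> k + \<xi> k)"

primrec walk2 :: "real \<Rightarrow> (nat \<Rightarrow> real) \<Rightarrow> nat \<Rightarrow> real" where
  "walk2 x \<xi> 0 = x"
| "walk2 x \<xi> (Suc k) = max (-1) (min 1 (walk2 x \<xi> k + \<xi> k))"

section \<open>Sampling the two reflections on a fine grid\<close>

definition grid_step :: "(real \<Rightarrow> real) \<Rightarrow> real \<Rightarrow> nat \<Rightarrow> real" where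
  "grid_step f h k = f (real (Suc k) * h) - f (real k * h)"

lemma finite_min_gap:
  assumes "finite (S :: real set)"
  obtains g where "0 < g" "\<And>x y. x \<in> S \<Longrightarrow> y \<in> S \<Longrightarrow> x < y \<Longrightarrow> g \<le> y - x"
proof -
  \<comment> \<open>The element 1 keeps the minimum defined when \<open>S\<close> has no two
    distinct points.\<close>
  define D where "D = insert 1 ((\<lambda>(x, y). y - x) ` {(x, y) \<in> S \<times> S. x < y})"
  have "finite {(x, y) \<in> S \<times> S. x < y}" by (rule finite_subset[of _ "S \<times> S"]) (use assms in auto)
  then have fin: "finite D" unfolding D_def by simp
  show ?thesis
  proof (rule that[of "Min D"])
    have "D \<noteq> {}" by (simp add: D_def)
    then show "0 < Min D" using fin by (subst Min_gr_iff) (auto simp: D_def)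
    fix x y assume "x \<in> S" "y \<in> S" "x < y"
    then have "y - x \<in> D" unfolding D_def by (intro insertI2 image_eqI[of _ _ "(x, y)"]) auto
    then show "Min D \<le> y - x" using fin by (intro Min_le)
  qed
qed

text \<open>The time change \<open>g\<close> is \<open>\<lfloor>t/h\<rfloor>\<close>, raised by one as soon as a large jump of \<open>f\<close> has happened in
  the current grid cell; this makes the sampled path uniformly close to \<open>f\<close>.\<close>

lemma sampling_time_change:
  assumes f: "cadlag f" and T: "0 \<le> T" and e: "0 < e"
  shows "\<exists>h0>0. \<forall>h. 0 < h \<longrightarrow> h < h0 \<longrightarrow> (\<exists>g::real \<Rightarrow> nat.
    (\<forall>s t. s \<le> t \<longrightarrow> g s \<le> g t) \<and> (\<forall>k. g (real k * h) = k) \<and>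
    (\<forall>t. 0 \<le> t \<longrightarrow> t \<le> T \<longrightarrow> \<bar>f (real (g t) * h) - f t\<bar> < e) \<and>
    (\<forall>s t i. 0 \<le> s \<longrightarrow> g s < i \<longrightarrow> i \<le> g t \<longrightarrow> (\<exists>u. s < u \<and> u \<le> t \<and> g u = i)) \<and>
    (\<forall>t>0. \<exists>d>0. \<forall>u. t - d < u \<longrightarrow> u < t \<longrightarrow> g t \<le> Suc (g u)))"
proof -
  have "0 \<le> T + 1" using T by simp
  then obtain S where S: "finite S" "\<And>s t. 0 \<le> s \<Longrightarrow> s \<le> t \<Longrightarrow> t \<le> T + 1 \<Longrightarrow> S \<inter> {s<..t} = {} \<Longrightarrow> \<bar>f s - f t\<bar> < e"
    using cadlag_partition[OF f _ e] by metis
  obtain gap where gap: "0 < gap" "\<And>x y. x \<in> S \<Longrightarrow> y \<in> S \<Longrightarrow> x < y \<Longrightarrow> gap \<le> y - x"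
    using finite_min_gap[OF S(1)] by blast
  show ?thesis
  \<comment> \<open>A mesh below \<open>gap\<close> leaves at most one point of \<open>S\<close> in
    a cell, so one early advance of \<open>g\<close> suffices; a mesh below 1 keeps the next grid
    point inside \<open>[0, T + 1]\<close>, where \<open>S\<close> controls the oscillation.\<close>
  proof (intro exI[of _ "min 1 gap"] conjI allI impI)
    show "0 < min 1 gap" using gap by simp
    fix h :: real assume h: "0 < h" "h < min 1 gap"
    define q where "q t = nat \<lfloor>t / h\<rfloor>" for t :: real
    define g where "g t = q t + (if \<exists>s\<in>S. real (q t) * h < s \<and> s \<le> t then 1 else 0)" for t
    have q: "real (q t) * h \<le> t" "t < real (Suc (q t)) * h" if "0 \<le> t" for t
    proof -
      have "real (q t) \<le> t / h" "t / h < real (q t) + 1" using that h unfolding q_def by auto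
      then show "real (q t) * h \<le> t" "t < real (Suc (q t)) * h" using h by (auto simp: field_simps)
    qed
    have q_neg: "q t = 0" if "t < 0" for t
      using that h by (simp add: q_def divide_neg_pos floor_le_zero less_imp_le)
    have q_mono: "q s \<le> q t" if "s \<le> t" for s t
      using that h by (auto simp: q_def intro!: nat_mono floor_mono divide_right_mono)
    have q_grid: "q (real k * h) = k" for k using h by (simp add: q_def)
    have g_q: "q t \<le> g t" "g t \<le> Suc (q t)" for t by (auto simp: g_def)
    have g_mono: "g s \<le> g t" if st: "s \<le> t" for s t
    proof (cases "q s = q t")
      case True
      then show ?thesis using st by (auto simp: g_def)
    next
      case False
      then have "q s < q t" using q_mono[OF st] by simp
      then show ?thesis using g_q[of s] g_q[of t] by simp
    qed
    have g_grid: "g (real k * h) = k" for k by (auto simp: g_def q_grid)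
    have close: "\<bar>f (real (g t) * h) - f t\<bar> < e" if t: "0 \<le> t" "t \<le> T" for t
    proof (cases "\<exists>s\<in>S. real (q t) * h < s \<and> s \<le> t")
      case False
      then have "\<bar>f (real (q t) * h) - f t\<bar> < e" using q[OF t(1)] t h by (intro S(2)) auto
      moreover have "g t = q t" unfolding g_def if_not_P[OF False] by simp
      ultimately show ?thesis by simp
    next
      case True
      then obtain s where s: "s \<in> S" "real (q t) * h < s" "s \<le> t" by blast
      \<comment> \<open>The only point of \<open>S\<close> in this cell is already past, so nothing
        separates \<open>t\<close> from the next grid point.\<close>
      have "S \<inter> {t<..real (Suc (q t)) * h} = {}"
      proof (rule ccontr)
        assume "S \<inter> {t<..real (Suc (q t)) * h} \<noteq> {}"
        then obtain r where r: "r \<in> S" "t < r" "r \<le> real (Suc (q t)) * h" by auto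
        then have "gap \<le> r - s" using s by (intro gap(2)) auto
        moreover have "r - s < h" using r s by (auto simp: algebra_simps)
        ultimately show False using h by simp
      qed
      moreover have "real (Suc (q t)) * h \<le> T + 1" using q(1)[OF t(1)] t h by (auto simp: algebra_simps)
      ultimately have "\<bar>f t - f (real (Suc (q t)) * h)\<bar> < e" using q[OF t(1)] t by (intro S(2)) auto
      moreover have "g t = Suc (q t)" unfolding g_def if_P[OF True] by simp
      ultimately show ?thesis by (simp only: abs_minus_commute)
    qed
    have attained: "\<exists>u. s < u \<and> u \<le> t \<and> g u = i" if s: "0 \<le> s" and i: "g s < i" "i \<le> g t" for s t i
    proof (cases "g t = i")
      case True
      then have "s < t" using i g_mono[of t s] by (cases "s < t") auto
      then show ?thesis using True by blast
    next
      case False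
      then have iq: "i \<le> q t" using i g_q[of t] by simp
      have t0: "0 \<le> t" using q_neg[of t] iq i by (cases "0 \<le> t") auto
      have "q s < i" using g_q[of s] i by simp
      then have "real (Suc (q s)) * h \<le> real i * h" using h by (intro mult_right_mono) auto
      then have "s < real i * h" using q(2)[OF s] by linarith
      moreover have "real i * h \<le> real (q t) * h" using iq h by (intro mult_right_mono) auto
      then have "real i * h \<le> t" using q(1)[OF t0] by linarith
      ultimately show ?thesis using g_grid[of i] by blast
    qed
    have left: "\<exists>d>0. \<forall>u. t - d < u \<longrightarrow> u < t \<longrightarrow> g t \<le> Suc (g u)" if t: "0 < t" for t
    proof (cases "real (q t) * h < t")
      case True
      show ?thesis
      proof (intro exI[of _ "t - real (q t) * h"] conjI allI impI)
        fix u assume "t - (t - real (q t) * h) < u" "u < t"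
        then have "q t \<le> g u" using g_mono[of "real (q t) * h" u] g_grid by simp
        then show "g t \<le> Suc (g u)" using g_q[of t] by simp
      qed (use True in simp)
    next
      case False
      then have "t = real (q t) * h" using q(1)[of t] t by simp
      then have gt: "g t = q t" using g_grid by metis
      have "q t \<noteq> 0" using \<open>t = real (q t) * h\<close> t by (cases "q t = 0") auto
      then obtain k where k: "q t = Suc k" by (cases "q t") auto
      show ?thesis
      proof (intro exI[of _ h] conjI allI impI)
        fix u assume "t - h < u" "u < t"
        then have "real k * h \<le> u" using \<open>t = real (q t) * h\<close> k by (auto simp: algebra_simps)
        then have "k \<le> g u" using g_mono[of "real k * h" u] g_grid by simp
        then show "g t \<le> Suc (g u)" using gt k by simp
      qed (use h in simp)
    qed
    show "\<exists>g::real \<Rightarrow> nat.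
      (\<forall>s t. s \<le> t \<longrightarrow> g s \<le> g t) \<and> (\<forall>k. g (real k * h) = k) \<and>
      (\<forall>t. 0 \<le> t \<longrightarrow> t \<le> T \<longrightarrow> \<bar>f (real (g t) * h) - f t\<bar> < e) \<and>
      (\<forall>s t i. 0 \<le> s \<longrightarrow> g s < i \<longrightarrow> i \<le> g t \<longrightarrow> (\<exists>u. s < u \<and> u \<le> t \<and> g u = i)) \<and>
      (\<forall>t>0. \<exists>d>0. \<forall>u. t - d < u \<longrightarrow> u < t \<longrightarrow> g t \<le> Suc (g u))"
      using g_mono g_grid close attained left by (intro exI[of _ g] conjI) blast+
  qed
qed

text \<open>\<open>attained\<close> guarantees that every index passed by the clock \<open>g\<close>
  is its value at some time, so growth at an index outside \<open>P\<close> cannot be skipped over;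
  \<open>left\<close> limits a jump of \<open>g\<close> to one index, so the step into
  \<open>g t\<close> is the only one to be checked there.\<close>

lemma grows_only_time_change:
  fixes g :: "real \<Rightarrow> nat"
  assumes mono: "\<And>s t. s \<le> t \<Longrightarrow> g s \<le> g t"
    and attained: "\<And>s t i. 0 \<le> s \<Longrightarrow> g s < i \<Longrightarrow> i \<le> g t \<Longrightarrow> \<exists>u. s < u \<and> u \<le> t \<and> g u = i"
    and left: "\<And>t. 0 < t \<Longrightarrow> \<exists>d>0. \<forall>u. t - d < u \<longrightarrow> u < t \<longrightarrow> g t \<le> Suc (g u)"
    and a: "\<And>k. a k \<le> a (Suc k)" and P: "\<And>k. \<not> P (Suc k) \<Longrightarrow> a (Suc k) = a k"
  shows "grows_only (\<lambda>t. a (g t)) (\<lambda>t. P (g t))"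
proof -
  have inc: "a i \<le> a j" if "i \<le> j" for i j using lift_Suc_mono_le[of a] a that by blast
  show ?thesis unfolding grows_only_def
  proof (intro conjI allI impI)
    show "mono_on {0..} (\<lambda>t. a (g t))" using inc mono by (auto intro!: mono_onI)
    fix s t :: real assume st: "0 \<le> s" "s < t" "\<forall>u. s < u \<longrightarrow> u \<le> t \<longrightarrow> \<not> P (g u)"
    have eq: "a i = a (g s)" if "g s \<le> i" "i \<le> g t" for i
      using that
    proof (induction rule: dec_induct)
      case (step i)
      then obtain u where "s < u" "u \<le> t" "g u = Suc i" using attained[OF st(1), of "Suc i" t] by auto
      then show ?case using P[of i] st step by auto
    qed simp
    show "a (g t) = a (g s)" using mono[of s t] st(2) by (intro eq) simp_all
  next
    fix t e :: real assume t: "0 < t" "\<not> P (g t)" "0 < e"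
    obtain d where d: "d > 0" "\<And>u. t - d < u \<Longrightarrow> u < t \<Longrightarrow> g t \<le> Suc (g u)" using left[OF t(1)] by blast
    show "\<exists>d>0. \<forall>u. 0 \<le> u \<longrightarrow> t - d < u \<longrightarrow> u < t \<longrightarrow> a (g t) \<le> a (g u) + e"
    proof (intro exI[of _ d] conjI allI impI)
      fix u assume "0 \<le> u" "t - d < u" "u < t"
      then have "g t \<le> g u \<or> g t = Suc (g u)" using d(2)[of u] by auto
      then have "a (g t) \<le> a (g u)" using inc[of "g t" "g u"] P[of "g u"] t(2) by auto
      then show "a (g t) \<le> a (g u) + e" using t by simp
    qed (rule d(1))
  qed
qed

text \<open>Read along the time change \<open>g\<close>, the walk solves the Skorokhod problem for
  the sampled path, with regulators \<open>l\<close> and \<open>u\<close>. The two inputs differ by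
  less than \<open>e\<close>, so two applications of \<open>drift_bound\<close> keep the
  contributions of the regulators within \<open>e\<close> of each other. At grid points the inputs
  coincide, hence the same bound \<open>e\<close> for the reflected values.\<close>

lemma walk2_sampling:
  assumes f: "cadlag f" and f0: "f 0 \<in> {-1..1}" and T: "0 \<le> T" and e: "0 < e"
  shows "\<exists>h0>0. \<forall>h. 0 < h \<longrightarrow> h < h0 \<longrightarrow> (\<forall>k. real k * h \<le> T \<longrightarrow>
    \<bar>walk2 (f 0) (grid_step f h) k - two_sided_reflection f (real k * h)\<bar> \<le> e)"
proof -
  obtain h0 where h0: "0 < h0" "\<And>h. 0 < h \<Longrightarrow> h < h0 \<Longrightarrow> \<exists>g::real \<Rightarrow> nat.
    (\<forall>s t. s \<le> t \<longrightarrow> g s \<le> g t) \<and> (\<forall>k. g (real k * h) = k) \<and>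
    (\<forall>t. 0 \<le> t \<longrightarrow> t \<le> T \<longrightarrow> \<bar>f (real (g t) * h) - f t\<bar> < e) \<and>
    (\<forall>s t i. 0 \<le> s \<longrightarrow> g s < i \<longrightarrow> i \<le> g t \<longrightarrow> (\<exists>u. s < u \<and> u \<le> t \<and> g u = i)) \<and>
    (\<forall>t>0. \<exists>d>0. \<forall>u. t - d < u \<longrightarrow> u < t \<longrightarrow> g t \<le> Suc (g u))"
    using sampling_time_change[OF f T e] by blast
  obtain L U where LU: "skorokhod_pair f L U" using skorokhod_pair_exists[OF f f0] by blast
  show ?thesis
  proof (intro exI[of _ h0] conjI allI impI)
    fix h k assume h: "0 < h" "h < h0" and k: "real k * h \<le> T"
    obtain g :: "real \<Rightarrow> nat" where g: "\<And>s t. s \<le> t \<Longrightarrow> g s \<le> g t" "\<And>k. g (real k * h) = k"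
      "\<And>t. 0 \<le> t \<Longrightarrow> t \<le> T \<Longrightarrow> \<bar>f (real (g t) * h) - f t\<bar> < e"
      "\<And>s t i. 0 \<le> s \<Longrightarrow> g s < i \<Longrightarrow> i \<le> g t \<Longrightarrow> \<exists>u. s < u \<and> u \<le> t \<and> g u = i"
      "\<And>t. 0 < t \<Longrightarrow> \<exists>d>0. \<forall>u. t - d < u \<longrightarrow> u < t \<longrightarrow> g t \<le> Suc (g u)"
      using h0(2)[OF h] by blast
    define r where "r = walk2 (f 0) (grid_step f h)"
    define y where "y k = r k + grid_step f h k" for k
    define l u where "l k = (\<Sum>i<k. max 0 (- 1 - y i))" and "u k = (\<Sum>i<k. max 0 (y i - 1))" for k
    have rS: "r (Suc k) = max (-1) (min 1 (y k))" for k by (simp add: r_def y_def)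
    have r_eq: "r k = f (real k * h) + l k - u k" for k
    proof (induction k)
      case 0
      then show ?case by (simp add: r_def l_def u_def)
    next
      case (Suc k)
      have "r (Suc k) = y k + max 0 (- 1 - y k) - max 0 (y k - 1)" unfolding rS by auto
      then show ?case using Suc unfolding y_def l_def u_def grid_step_def by simp
    qed
    have r_bd: "r k \<in> {-1..1}" for k using f0 by (cases k) (auto simp: r_def)
    have gl: "grows_only (\<lambda>t. l (g t)) (\<lambda>t. r (g t) = -1)"
      by (rule grows_only_time_change[where P = "\<lambda>k. r k = -1", OF g(1,4,5)]) (auto simp: l_def rS max_def split: if_splits)
    have gu: "grows_only (\<lambda>t. u (g t)) (\<lambda>t. r (g t) = 1)"
      by (rule grows_only_time_change[where P = "\<lambda>k. r k = 1", OF g(1,4,5)]) (auto simp: u_def rS max_def split: if_splits)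
    define X where "X t = f t + L t - U t" for t
    have X: "grows_only L (\<lambda>t. X t = -1)" "grows_only U (\<lambda>t. X t = 1)" "L 0 = 0" "U 0 = 0"
      "\<And>t. 0 \<le> t \<Longrightarrow> X t \<in> {-1..1}"
      using LU by (auto simp: skorokhod_pair_def X_def regulator_def)
    have g0: "g 0 = 0" using g(2)[of 0] by simp
    have mono: "mono_on {0..} (\<lambda>t. a t + b t)" if "grows_only a P" "grows_only b Q" for a b P Q
      using grows_onlyD(1)[OF that(1)] grows_onlyD(1)[OF that(2)] by (auto simp: mono_on_def intro: add_mono)
    have kh: "0 \<le> real k * h" using h by simp
    have up: "(L (real k * h) + u (g (real k * h))) - (l (g (real k * h)) + U (real k * h)) \<le> e"
    proof (rule drift_bound[where T = T and a = "\<lambda>t. L t + u (g t)" and b = "\<lambda>t. l (g t) + U t", OF grows_only_add[OF X(1) gu] mono[OF gl X(2)] _ _ kh k])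
      fix t assume t: "0 \<le> t" "t \<le> T" and "X t = -1 \<or> r (g t) = 1"
      then have "X t - r (g t) \<le> 0" using X(5)[of t] r_bd[of "g t"] by auto
      then show "(L t + u (g t)) - (l (g t) + U t) \<le> e"
        using g(3)[OF t] unfolding X_def r_eq by (simp add: abs_less_iff)
    qed (use X g0 e in \<open>auto simp: l_def u_def\<close>)
    have down: "(U (real k * h) + l (g (real k * h))) - (u (g (real k * h)) + L (real k * h)) \<le> e"
    proof (rule drift_bound[where T = T and a = "\<lambda>t. U t + l (g t)" and b = "\<lambda>t. u (g t) + L t", OF grows_only_add[OF X(2) gl] mono[OF gu X(1)] _ _ kh k])
      fix t assume t: "0 \<le> t" "t \<le> T" and "X t = 1 \<or> r (g t) = - 1"
      then have "r (g t) - X t \<le> 0" using X(5)[of t] r_bd[of "g t"] by auto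
      then show "(U t + l (g t)) - (u (g t) + L t) \<le> e"
        using g(3)[OF t] unfolding X_def r_eq by (simp add: abs_less_iff)
    qed (use X g0 e in \<open>auto simp: l_def u_def\<close>)
    have "X (real k * h) - r k = (L (real k * h) + u k) - (l k + U (real k * h))"
      unfolding X_def r_eq by simp
    then have "\<bar>r k - X (real k * h)\<bar> \<le> e" using up down unfolding g(2) by (simp add: abs_le_iff)
    then show "\<bar>walk2 (f 0) (grid_step f h) k - two_sided_reflection f (real k * h)\<bar> \<le> e"
      unfolding two_sided_reflection_eq[OF f LU] r_def X_def .
  qed (rule h0(1))
qed

lemma bdd_below_reflect:
  assumes "cadlag f" shows "bdd_below ((\<lambda>s. min (f s + 1) 0) ` {0..t})"
proof -
  obtain B where "\<And>s. 0 \<le> s \<Longrightarrow> s \<le> t \<Longrightarrow> \<bar>f s\<bar> \<le> B" using cadlag_bounded[OF assms, of t] by blast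
  then show ?thesis by (intro bdd_belowI2[of _ "- B - 1"]) (force simp: min_def)
qed

text \<open>The difference \<open>m\<close> between path and walk is a running minimum over grid
  points. It dominates the infimum over all times, and each time \<open>s\<close> in that infimum
  has the grid point \<open>real (g s) * h\<close> as a substitute with nearly the same
  value.\<close>

lemma walk1_sampling:
  assumes f: "cadlag f" and f0: "-1 \<le> f 0" and T: "0 \<le> T" and e: "0 < e"
  shows "\<exists>h0>0. \<forall>h. 0 < h \<longrightarrow> h < h0 \<longrightarrow> (\<forall>k. real k * h \<le> T \<longrightarrow>
    \<bar>walk1 (f 0) (grid_step f h) k - reflect_left f (real k * h)\<bar> \<le> e)"
proof -
  obtain h0 where h0: "0 < h0" "\<And>h. 0 < h \<Longrightarrow> h < h0 \<Longrightarrow> \<exists>g::real \<Rightarrow> nat.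
    (\<forall>s t. s \<le> t \<longrightarrow> g s \<le> g t) \<and> (\<forall>k. g (real k * h) = k) \<and>
    (\<forall>t. 0 \<le> t \<longrightarrow> t \<le> T \<longrightarrow> \<bar>f (real (g t) * h) - f t\<bar> < e) \<and>
    (\<forall>s t i. 0 \<le> s \<longrightarrow> g s < i \<longrightarrow> i \<le> g t \<longrightarrow> (\<exists>u. s < u \<and> u \<le> t \<and> g u = i)) \<and>
    (\<forall>t>0. \<exists>d>0. \<forall>u. t - d < u \<longrightarrow> u < t \<longrightarrow> g t \<le> Suc (g u))"
    using sampling_time_change[OF f T e] by blast
  show ?thesis
  proof (intro exI[of _ h0] conjI allI impI)
    fix h k assume h: "0 < h" "h < h0" and k: "real k * h \<le> T"
    obtain g :: "real \<Rightarrow> nat" where g: "\<And>s t. s \<le> t \<Longrightarrow> g s \<le> g t" "\<And>k. g (real k * h) = k"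
      "\<And>t. 0 \<le> t \<Longrightarrow> t \<le> T \<Longrightarrow> \<bar>f (real (g t) * h) - f t\<bar> < e"
      using h0(2)[OF h] by blast
    define m where "m k = f (real k * h) - walk1 (f 0) (grid_step f h) k" for k
    have mS: "m (Suc k) = min (m k) (f (real (Suc k) * h) + 1)" for k
      by (simp add: m_def grid_step_def)
    have m0: "m 0 = 0" by (simp add: m_def)
    have m_le: "m k \<le> 0 \<and> (\<forall>i\<le>k. m k \<le> f (real i * h) + 1)" for k
    proof (induction k)
      case (Suc k)
      then show ?case by (auto simp: mS le_Suc_eq min_le_iff_disj simp del: of_nat_Suc)
    qed (use m0 f0 in auto)
    define I where "I t = (INF s\<in>{0..t}. min (f s + 1) 0)" for t
    have I_le: "I t \<le> min (f s + 1) 0" if "0 \<le> s" "s \<le> t" for s t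
      unfolding I_def using that by (intro cINF_lower bdd_below_reflect f) auto
    have "I (real k * h) \<le> m k" for k
    proof (induction k)
      case 0
      then show ?case using I_le[of 0 0] by (simp add: m0)
    next
      case (Suc k)
      have "I (real (Suc k) * h) \<le> I (real k * h)"
        unfolding I_def using h by (intro cINF_superset_mono bdd_below_reflect f) (auto simp: algebra_simps)
      moreover have "I (real (Suc k) * h) \<le> f (real (Suc k) * h) + 1"
        using I_le[of "real (Suc k) * h" "real (Suc k) * h"] h by simp
      ultimately show ?case using Suc unfolding mS by simp
    qed
    moreover have "m k - e \<le> I (real k * h)"
      unfolding I_def
    proof (rule cINF_greatest)
      fix s assume s: "s \<in> {0..real k * h}"
      then have "g s \<le> k" using g(1)[of s "real k * h"] g(2) by simp
      then have "m k \<le> f (real (g s) * h) + 1" using m_le by blast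
      then show "m k - e \<le> min (f s + 1) 0" using m_le[of k] g(3)[of s] s k e by (auto simp: abs_less_iff)
    qed (use h in auto)
    ultimately have "\<bar>m k - I (real k * h)\<bar> \<le> e" using e by (auto simp: abs_le_iff)
    moreover have "walk1 (f 0) (grid_step f h) k - reflect_left f (real k * h) = - (m k - I (real k * h))"
      by (simp add: m_def I_def reflect_left_def)
    ultimately show "\<bar>walk1 (f 0) (grid_step f h) k - reflect_left f (real k * h)\<bar> \<le> e"
      by (simp only: abs_minus_cancel)
  qed (rule h0(1))
qed

section \<open>Fast-forwarding\<close>

lemma cadlag_reflect_left:
  assumes f: "cadlag f"
  shows "cadlag (reflect_left f)"
proof -
  define I where "I t = (INF s\<in>{0..t}. min (f s + 1) 0)" for t
  have I_mono: "I u \<le> I t" if "0 \<le> t" "t \<le> u" for t u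
    unfolding I_def using that by (intro cINF_superset_mono bdd_below_reflect f) auto
  have "cadlag (\<lambda>t. - I t)"
  proof (rule mono_on_right_cont_cadlag)
    show "mono_on {0..} (\<lambda>t. - I t)" using I_mono by (auto intro!: mono_onI)
    fix t e :: real assume t: "0 \<le> t" and e: "0 < e"
    obtain d where d: "d > 0" "\<And>u. t \<le> u \<Longrightarrow> u < t + d \<Longrightarrow> \<bar>f u - f t\<bar> < e/2"
      using cadlag_right_eps[OF f t, of "e/2"] e by auto
    show "\<exists>d>0. \<forall>u. t < u \<longrightarrow> u < t + d \<longrightarrow> \<bar>- I u - - I t\<bar> < e"
    proof (intro exI[of _ d] conjI allI impI)
      fix u assume u: "t < u" "u < t + d"
      have "I t - e/2 \<le> I u" unfolding I_def[of u]
      proof (rule cINF_greatest)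
        fix s assume s: "s \<in> {0..u}"
        show "I t - e/2 \<le> min (f s + 1) 0"
        proof (cases "s \<le> t")
          case True
          then have "I t \<le> min (f s + 1) 0" unfolding I_def using s
            by (intro cINF_lower bdd_below_reflect f) auto
          then show ?thesis using e by simp
        next
          case False
          have "I t \<le> min (f t + 1) 0" unfolding I_def using t
            by (intro cINF_lower bdd_below_reflect f) auto
          moreover have "\<bar>f s - f t\<bar> < e/2" using False s u by (intro d(2)) auto
          ultimately show ?thesis using e by linarith
        qed
      qed (use t u in auto)
      then show "\<bar>- I u - - I t\<bar> < e" using I_mono[of t u] t u e by (simp add: abs_less_iff)
    qed (rule d(1))
  qed
  then have "cadlag (\<lambda>t. f t + - I t)" by (rule cadlag_add[OF f])
  then show ?thesis by (rule cadlag_cong) (simp add: reflect_left_def I_def)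
qed

lemma dyadic_ceiling_tendsto:
  assumes "0 \<le> (t::real)"
  shows "(\<lambda>n. real (nat \<lceil>t * 2 ^ n\<rceil>) * (1/2) ^ n) \<longlonglongrightarrow> t"
    and "t \<le> real (nat \<lceil>t * 2 ^ n\<rceil>) * (1/2) ^ n" and "real (nat \<lceil>t * 2 ^ n\<rceil>) * (1/2) ^ n < t + (1/2) ^ n"
proof -
  have eq: "real (nat \<lceil>t * 2 ^ n\<rceil>) = real_of_int \<lceil>t * 2 ^ n\<rceil>" for n
  proof -
    have "0 \<le> t * 2 ^ n" using assms by simp
    then have "0 \<le> \<lceil>t * 2 ^ n\<rceil>" by linarith
    then show ?thesis by simp
  qed
  have le: "t \<le> real (nat \<lceil>t * 2 ^ n\<rceil>) * (1/2) ^ n" for n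
    using le_of_int_ceiling[of "t * 2 ^ n"] unfolding eq by (simp add: power_one_over field_simps)
  have lt: "real (nat \<lceil>t * 2 ^ n\<rceil>) * (1/2) ^ n < t + (1/2) ^ n" for n
    using ceiling_correct[of "t * 2 ^ n"] unfolding eq by (simp add: power_one_over field_simps)
  show "t \<le> real (nat \<lceil>t * 2 ^ n\<rceil>) * (1/2) ^ n" "real (nat \<lceil>t * 2 ^ n\<rceil>) * (1/2) ^ n < t + (1/2) ^ n"
    by (rule le lt)+
  have "(\<lambda>n. t + (1/2::real) ^ n) \<longlonglongrightarrow> t + 0" by (intro tendsto_intros) auto
  then have up: "(\<lambda>n. t + (1/2::real) ^ n) \<longlonglongrightarrow> t" by simp
  show "(\<lambda>n. real (nat \<lceil>t * 2 ^ n\<rceil>) * (1/2) ^ n) \<longlonglongrightarrow> t"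
    by (rule tendsto_sandwich[OF always_eventually[OF allI[OF le]]
        always_eventually[OF allI[OF less_imp_le[OF lt]]] tendsto_const up])
qed

text \<open>Rounding the random time up to dyadics leaves countably many values, and
  right-continuity recovers the value at \<open>\<tau>\<close> in the limit.\<close>

lemma cadlag_eval_measurable:
  assumes X: "\<And>t. 0 \<le> t \<Longrightarrow> X t \<in> borel_measurable K"
    and cad: "\<And>x. x \<in> space K \<Longrightarrow> cadlag (\<lambda>t. X t x)"
    and \<tau>: "\<tau> \<in> borel_measurable K" and pos: "\<And>x. x \<in> space K \<Longrightarrow> 0 \<le> \<tau> x"
  shows "(\<lambda>x. X (\<tau> x) x) \<in> borel_measurable K"
proof (rule borel_measurable_LIMSEQ_real)
  fix x assume x: "x \<in> space K"
  show "(\<lambda>n. X (real (nat \<lceil>\<tau> x * 2 ^ n\<rceil>) * (1/2) ^ n) x) \<longlonglongrightarrow> X (\<tau> x) x"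
    using dyadic_ceiling_tendsto[OF pos[OF x]]
    by (intro cadlag_tendsto[OF cad[OF x] pos[OF x]] always_eventually) auto
next
  fix n
  have "(\<lambda>x. nat \<lceil>\<tau> x * 2 ^ n\<rceil>) \<in> measurable K (count_space UNIV)" using \<tau> by measurable
  then show "(\<lambda>x. X (real (nat \<lceil>\<tau> x * 2 ^ n\<rceil>) * (1/2) ^ n) x) \<in> borel_measurable K"
    by (rule measurable_compose_countable[rotated]) (auto intro: X)
qed

text \<open>On the product space the time coordinate itself acts as the random time of the preceding
  lemma.\<close>

lemma cadlag_joint_measurable:
  assumes X: "\<And>t. 0 \<le> t \<Longrightarrow> X t \<in> borel_measurable N"
    and cad: "\<And>x. x \<in> space N \<Longrightarrow> cadlag (\<lambda>t. X t x)"
  shows "(\<lambda>(t, x). X (max t 0) x) \<in> borel_measurable (borel \<Otimes>\<^sub>M N)"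
proof -
  have "(\<lambda>p. X (max (fst p) 0) (snd p)) \<in> borel_measurable (borel \<Otimes>\<^sub>M N)"
  proof (rule cadlag_eval_measurable[where X = "\<lambda>t p. X t (snd p)"])
    fix t :: real assume "0 \<le> t"
    then show "(\<lambda>p. X t (snd p)) \<in> borel_measurable (borel \<Otimes>\<^sub>M N)"
      using X[of t] by (intro measurable_compose[OF measurable_snd])
  qed (auto simp: space_pair_measure cad)
  then show ?thesis by (simp add: case_prod_unfold)
qed

lemma cadlag_borel:
  assumes "cadlag f" shows "(\<lambda>t. f (max t 0)) \<in> borel_measurable borel"
  by (rule cadlag_eval_measurable[where X = "\<lambda>t x. f t"]) (use assms in auto)

lemma sublevel_sets_borel:
  assumes "cadlag f"
  shows "{z. 0 \<le> z \<and> f z < c} \<in> sets borel"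
proof -
  have "{z. 0 \<le> z \<and> f z < c} = {z. 0 \<le> z \<and> f (max z 0) < c}" by (auto simp: max_def)
  also have "\<dots> \<in> sets borel" using cadlag_borel[OF assms] by simp
  finally show ?thesis .
qed

section \<open>The clock of the time below 1 and its inverse\<close>

lemma time_below_eq:
  "time_below f t = measure lborel {z. 0 \<le> z \<and> z \<le> t \<and> f z < 1}"
proof -
  have "time_below f t = (LINT z|lborel. indicator {z. 0 \<le> z \<and> z \<le> t \<and> f z < 1} z)"
    unfolding time_below_def set_lebesgue_integral_def
    by (intro Bochner_Integration.integral_cong) (auto split: split_indicator)
  then show ?thesis by simp
qed

context
  fixes f :: "real \<Rightarrow> real"
  assumes f: "cadlag f"
begin

lemma time_below_sets: "{z. 0 \<le> z \<and> z \<le> t \<and> f z < 1} \<in> sets lborel"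
proof -
  have "{z. 0 \<le> z \<and> z \<le> t \<and> f z < 1} = {z. 0 \<le> z \<and> f z < 1} \<inter> {..t}" by auto
  then show ?thesis using sublevel_sets_borel[OF f, of 1] by simp
qed

lemma time_below_emeasure: "emeasure lborel {z. 0 \<le> z \<and> z \<le> t \<and> f z < 1} = ennreal (time_below f t)"
proof -
  have "emeasure lborel {z. 0 \<le> z \<and> z \<le> t \<and> f z < 1} \<le> emeasure lborel {0..t}"
    by (intro emeasure_mono) auto
  also have "\<dots> < \<infinity>" by (cases "0 \<le> t") auto
  finally show ?thesis unfolding time_below_eq by (intro emeasure_eq_ennreal_measure) auto
qed

lemma time_below_nonneg: "0 \<le> time_below f t"
  by (simp add: time_below_eq)

lemma time_below_nonpos: assumes "t \<le> 0" shows "time_below f t = 0"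
proof -
  have "emeasure lborel {z. 0 \<le> z \<and> z \<le> t \<and> f z < 1} \<le> emeasure lborel {0::real}"
    by (rule emeasure_mono) (use assms in auto)
  then show ?thesis using time_below_emeasure[of t] time_below_nonneg[of t] by (simp add: ennreal_eq_0_iff)
qed

lemma time_below_mono: assumes "s \<le> t" shows "time_below f s \<le> time_below f t"
proof -
  have "emeasure lborel {z. 0 \<le> z \<and> z \<le> s \<and> f z < 1} \<le> emeasure lborel {z. 0 \<le> z \<and> z \<le> t \<and> f z < 1}"
    using time_below_sets assms by (intro emeasure_mono) auto
  then show ?thesis unfolding time_below_emeasure using time_below_nonneg by simp
qed

lemma time_below_lipschitz: assumes "s \<le> t" shows "time_below f t \<le> time_below f s + (t - s)"
proof -
  have "emeasure lborel {z. 0 \<le> z \<and> z \<le> t \<and> f z < 1} \<le> emeasure lborel ({z. 0 \<le> z \<and> z \<le> s \<and> f z < 1} \<union> {s..t})"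
    using time_below_sets[of s] assms by (intro emeasure_mono) auto
  also have "\<dots> \<le> emeasure lborel {z. 0 \<le> z \<and> z \<le> s \<and> f z < 1} + emeasure lborel {s..t}"
    using time_below_sets by (intro emeasure_subadditive) auto
  finally have "ennreal (time_below f t) \<le> ennreal (time_below f s + (t - s))"
    unfolding time_below_emeasure using assms time_below_nonneg by (simp add: ennreal_plus)
  then show ?thesis using assms time_below_nonneg[of s] by (subst (asm) ennreal_le_iff) auto
qed

context
  assumes inf: "emeasure lborel {z. 0 \<le> z \<and> f z < 1} = \<infinity>"
begin

lemma time_below_unbounded: "\<exists>s>0. t < time_below f s"
proof (rule ccontr)
  assume "\<not> (\<exists>s>0. t < time_below f s)"
  then have le: "time_below f s \<le> t" if "0 < s" for s using that by force
  have "(\<lambda>n. emeasure lborel {z. 0 \<le> z \<and> z \<le> real n \<and> f z < 1}) \<longlonglongrightarrow>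
      emeasure lborel (\<Union>n. {z. 0 \<le> z \<and> z \<le> real n \<and> f z < 1})"
    using time_below_sets by (intro Lim_emeasure_incseq) (auto intro!: incseq_SucI)
  also have "(\<Union>n. {z. 0 \<le> z \<and> z \<le> real n \<and> f z < 1}) = {z. 0 \<le> z \<and> f z < 1}"
    using real_arch_simple by auto
  finally have lim: "(\<lambda>n. ennreal (time_below f (real n))) \<longlonglongrightarrow> \<infinity>" unfolding time_below_emeasure inf .
  have "\<infinity> \<le> ennreal t"
    by (rule LIMSEQ_le_const2[OF lim]) (use le in \<open>auto intro!: exI[of _ 1] ennreal_leI\<close>)
  then show False by (simp add: top_unique)
qed

lemma time_below_inv_nonneg: "0 \<le> time_below_inv f t"
  unfolding time_below_inv_def using time_below_unbounded[of t] by (intro cInf_greatest) auto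

lemma time_below_inv_le: assumes "t < time_below f s" "0 \<le> t" shows "time_below_inv f t \<le> s"
proof -
  have "0 < s" using assms time_below_nonpos[of s] by (cases "0 < s") auto
  then show ?thesis unfolding time_below_inv_def using assms
    by (intro cInf_lower bdd_belowI[of _ 0]) auto
qed

lemma less_time_below: assumes "time_below_inv f t < s" shows "t < time_below f s"
proof -
  have "\<exists>r. r \<in> {s. 0 < s \<and> t < time_below f s} \<and> r < s"
    using assms time_below_unbounded[of t] unfolding time_below_inv_def
    by (subst (asm) cInf_less_iff) (auto intro!: bdd_belowI[of _ 0])
  then obtain r where "t < time_below f r" "r < s" by auto
  then show ?thesis using time_below_mono[of r s] by simp
qed

text \<open>The clock is 1-Lipschitz, so it cannot jump over the value \<open>t\<close>.\<close>

lemma time_below_at_inv: assumes "0 \<le> t" shows "time_below f (time_below_inv f t) = t"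
proof (rule antisym)
  let ?s = "time_below_inv f t"
  have "time_below f ?s \<le> t + e" if "0 < e" for e
  proof (rule ccontr)
    assume "\<not> time_below f ?s \<le> t + e"
    then have "t + e < time_below f ?s" by simp
    also have "\<dots> \<le> time_below f (?s - e) + e" using time_below_lipschitz[of "?s - e" ?s] that by simp
    finally have "?s \<le> ?s - e" using assms by (intro time_below_inv_le) auto
    then show False using that by simp
  qed
  then show "time_below f ?s \<le> t" by (rule field_le_epsilon)
  show "t \<le> time_below f ?s"
  proof (rule field_le_epsilon)
    fix e :: real assume e: "0 < e"
    then have "t < time_below f (?s + e)" by (intro less_time_below) auto
    then show "t \<le> time_below f ?s + e" using time_below_lipschitz[of ?s "?s + e"] e by simp
  qed
qed

lemma time_below_inv_strict: assumes "0 \<le> s" "s < t" shows "time_below_inv f s < time_below_inv f t"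
proof (rule ccontr)
  assume "\<not> ?thesis"
  then have "time_below f (time_below_inv f t) \<le> time_below f (time_below_inv f s)"
    by (intro time_below_mono) simp
  then show False using time_below_at_inv[of s] time_below_at_inv[of t] assms by simp
qed

lemma fast_forward_eq: "fast_forward_right f t = f (time_below_inv f t)"
  using inf by (simp add: fast_forward_right_def)

text \<open>On the right, the inverse clock is right-continuous. On the left, it approaches its left
  limit \<open>b\<close> strictly from below, because it is strictly increasing, so the left limit
  of \<open>f\<close> at \<open>b\<close> is the one that counts; \<open>b\<close> is smaller than
  the value at \<open>t\<close> when an excursion is cut out there.\<close>

lemma cadlag_fast_forward_inf: "cadlag (fast_forward_right f)"
proof (rule cadlagI)
  fix t e :: real assume t: "0 \<le> t" and e: "0 < e"
  let ?s = "time_below_inv f t"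
  obtain d where d: "d > 0" "\<And>u. ?s \<le> u \<Longrightarrow> u < ?s + d \<Longrightarrow> \<bar>f u - f ?s\<bar> < e"
    using cadlag_right_eps[OF f time_below_inv_nonneg e] by blast
  have A: "t < time_below f (?s + d / 2)" using d(1) by (intro less_time_below) auto
  show "\<exists>d>0. \<forall>u. t < u \<longrightarrow> u < t + d \<longrightarrow> \<bar>fast_forward_right f u - fast_forward_right f t\<bar> < e"
  proof (intro exI[of _ "time_below f (?s + d / 2) - t"] conjI allI impI)
    fix u assume u: "t < u" "u < t + (time_below f (?s + d / 2) - t)"
    then have "time_below_inv f u \<le> ?s + d / 2" using t by (intro time_below_inv_le) auto
    then show "\<bar>fast_forward_right f u - fast_forward_right f t\<bar> < e"
      unfolding fast_forward_eq using time_below_inv_strict[OF t u(1)] d(1) by (intro d(2)) auto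
  qed (use A in simp)
next
  fix t :: real assume t: "0 < t"
  define b where "b = (SUP u\<in>{0..<t}. time_below_inv f u)"
  have bdd: "bdd_above (time_below_inv f ` {0..<t})"
    using time_below_inv_strict t by (intro bdd_aboveI2[of _ _ "time_below_inv f t"]) (auto intro: less_imp_le)
  have lt: "time_below_inv f u < b" if u: "0 \<le> u" "u < t" for u
  proof -
    have "time_below_inv f u < time_below_inv f ((u + t) / 2)" using u by (intro time_below_inv_strict) auto
    also have "\<dots> \<le> b" unfolding b_def using u by (intro cSUP_upper bdd) auto
    finally show ?thesis .
  qed
  have "0 < b" using lt[of 0] time_below_inv_nonneg[of 0] t by simp
  from cadlag_left_eps[OF f this] obtain l where
    l: "\<And>e. 0 < e \<Longrightarrow> \<exists>d>0. \<forall>u. b - d < u \<longrightarrow> u < b \<longrightarrow> \<bar>f u - l\<bar> < e" by blast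
  show "\<exists>l. \<forall>e>0. \<exists>d>0. \<forall>u. 0 \<le> u \<longrightarrow> t - d < u \<longrightarrow> u < t \<longrightarrow> \<bar>fast_forward_right f u - l\<bar> < e"
  proof (rule exI[of _ l], intro allI impI)
    fix e :: real assume "0 < e"
    from l[OF this] obtain d where d: "d > 0" "\<And>u. b - d < u \<Longrightarrow> u < b \<Longrightarrow> \<bar>f u - l\<bar> < e" by blast
    have "b - d < b" using d by simp
    then obtain v where v: "0 \<le> v" "v < t" "b - d < time_below_inv f v"
      using t less_cSUP_iff[OF _ bdd, of "b - d"] unfolding b_def by auto
    show "\<exists>d>0. \<forall>u. 0 \<le> u \<longrightarrow> t - d < u \<longrightarrow> u < t \<longrightarrow> \<bar>fast_forward_right f u - l\<bar> < e"
    proof (intro exI[of _ "t - v"] conjI allI impI)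
      fix u assume u: "0 \<le> u" "t - (t - v) < u" "u < t"
      then have "time_below_inv f v < time_below_inv f u" using v by (intro time_below_inv_strict) auto
      then show "\<bar>fast_forward_right f u - l\<bar> < e"
        unfolding fast_forward_eq using v lt[of u] u by (intro d(2)) auto
    qed (use v in auto)
  qed
qed

end

lemma cadlag_fast_forward: "cadlag (fast_forward_right f)"
proof (cases "emeasure lborel {z. 0 \<le> z \<and> f z < 1} = \<infinity>")
  case True
  then show ?thesis by (rule cadlag_fast_forward_inf)
next
  case False
  then have "fast_forward_right f = (\<lambda>_. 0)" by (simp add: fast_forward_right_def)
  then show ?thesis by simp
qed

end

section \<open>Measurability and equality in law\<close>

text \<open>By right-continuity the rationals suffice for the infimum, except at the end point
  \<open>t\<close>, which has no admissible times to its right and is therefore added to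
  \<open>D\<close>.\<close>

lemma reflect_left_measurable:
  assumes X: "\<And>t. 0 \<le> t \<Longrightarrow> X t \<in> borel_measurable K"
    and cad: "\<And>x. x \<in> space K \<Longrightarrow> cadlag (\<lambda>t. X t x)" and t: "0 \<le> t"
  shows "(\<lambda>x. reflect_left (\<lambda>t. X t x) t) \<in> borel_measurable K"
proof -
  define D where "D = insert t ({0..t} \<inter> \<rat>)"
  have D: "countable D" "D \<noteq> {}" "D \<subseteq> {0..t}"
    using t by (simp_all add: D_def countable_Int2[OF countable_rat])
  have bdd: "bdd_below ((\<lambda>s. min (X s x + 1) 0) ` A)" if "x \<in> space K" "A \<subseteq> {0..t}" for x A
    by (rule bdd_below_mono[OF bdd_below_reflect[OF cad[OF that(1)], of t] image_mono[OF that(2)]])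
  have eq: "(INF s\<in>{0..t}. min (X s x + 1) 0) = (INF s\<in>D. min (X s x + 1) 0)" if x: "x \<in> space K" for x
  proof (rule antisym)
    show "(INF s\<in>{0..t}. min (X s x + 1) 0) \<le> (INF s\<in>D. min (X s x + 1) 0)"
      by (rule cINF_superset_mono) (use D bdd[OF x] in auto)
    show "(INF s\<in>D. min (X s x + 1) 0) \<le> (INF s\<in>{0..t}. min (X s x + 1) 0)"
    proof (rule cINF_greatest)
      fix s assume s: "s \<in> {0..t}"
      show "(INF s\<in>D. min (X s x + 1) 0) \<le> min (X s x + 1) 0"
      proof (cases "s = t")
        case True
        then show ?thesis using D by (intro cINF_lower bdd x) (auto simp: D_def)
      next
        case False
        have "(INF s\<in>D. min (X s x + 1) 0) \<le> min (X s x + 1) 0 + e" if e: "0 < e" for e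
        proof -
          obtain d where d: "d > 0" "\<And>u. s \<le> u \<Longrightarrow> u < s + d \<Longrightarrow> \<bar>X u x - X s x\<bar> < e"
            using cadlag_right_eps[OF cad[OF x] _ e, of s] s by auto
          obtain r where r: "r \<in> \<rat>" "s < r" "r < min t (s + d)"
            using Rats_dense_in_real[of s "min t (s + d)"] s False d by auto
          then have "(INF s\<in>D. min (X s x + 1) 0) \<le> min (X r x + 1) 0"
            using D s by (intro cINF_lower bdd x) (auto simp: D_def)
          moreover have "\<bar>X r x - X s x\<bar> < e" using r by (intro d(2)) auto
          ultimately show ?thesis using e by linarith
        qed
        then show ?thesis by (rule field_le_epsilon)
      qed
    qed (use t in auto)
  qed
  have "(\<lambda>x. X t x - (INF s\<in>D. min (X s x + 1) 0)) \<in> borel_measurable K"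
  proof (intro borel_measurable_diff X t borel_measurable_cINF D(1))
    fix s assume "s \<in> D"
    then have "X s \<in> borel_measurable K" using D by (intro X) auto
    then show "(\<lambda>x. min (X s x + 1) 0) \<in> borel_measurable K" by measurable
  qed (use bdd D in auto)
  then show ?thesis by (rule measurable_cong[THEN iffD1, rotated]) (simp add: reflect_left_def eq)
qed

text \<open>The time spent in a set is the Lebesgue measure of a section of a jointly measurable
  set.\<close>

lemma occupation_measurable:
  assumes X: "\<And>t. 0 \<le> t \<Longrightarrow> X t \<in> borel_measurable K"
    and cad: "\<And>x. x \<in> space K \<Longrightarrow> cadlag (\<lambda>t. X t x)"
  shows "(\<lambda>x. emeasure lborel {z. 0 \<le> z \<and> X z x < c}) \<in> borel_measurable K"
    and "(\<lambda>x. time_below (\<lambda>t. X t x) t) \<in> borel_measurable K"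
proof -
  have J: "(\<lambda>(t, x). X (max t 0) x) \<in> borel_measurable (borel \<Otimes>\<^sub>M K)"
    by (rule cadlag_joint_measurable[OF X cad])
  have swap: "(\<lambda>(x, z). X (max z 0) x) \<in> borel_measurable (K \<Otimes>\<^sub>M lborel)"
  proof -
    have "(\<lambda>(t, x). X (max t 0) x) \<in> borel_measurable (lborel \<Otimes>\<^sub>M K)"
      using J by (subst measurable_cong_sets[OF sets_pair_measure_cong[OF sets_lborel refl] refl])
    from measurable_compose[OF measurable_pair_swap' this] show ?thesis
      by (simp add: case_prod_unfold)
  qed
  have [measurable]: "(\<lambda>p. X (max (snd p) 0) (fst p)) \<in> borel_measurable (K \<Otimes>\<^sub>M lborel)"
    using swap by (simp add: case_prod_unfold)
  have [measurable]: "snd \<in> borel_measurable (K \<Otimes>\<^sub>M lborel)"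
    using measurable_snd[of K lborel] by (simp add: measurable_def)
  have "{(x, z). x \<in> space K \<and> 0 \<le> z \<and> X (max z 0) x < c} \<in> sets (K \<Otimes>\<^sub>M lborel)"
  proof -
    have "{p \<in> space (K \<Otimes>\<^sub>M lborel). 0 \<le> snd p \<and> X (max (snd p) 0) (fst p) < c} \<in> sets (K \<Otimes>\<^sub>M lborel)"
      by measurable
    then show ?thesis by (simp add: space_pair_measure case_prod_unfold mem_Times_iff)
  qed
  from lborel.measurable_emeasure_Pair[OF this]
  show "(\<lambda>x. emeasure lborel {z. 0 \<le> z \<and> X z x < c}) \<in> borel_measurable K"
    by (rule measurable_cong[THEN iffD1, rotated]) (auto intro!: arg_cong[where f = "emeasure lborel"] simp: max_def)
  have "{(x, z). x \<in> space K \<and> 0 \<le> z \<and> z \<le> t \<and> X (max z 0) x < 1} \<in> sets (K \<Otimes>\<^sub>M lborel)"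
  proof -
    have "{p \<in> space (K \<Otimes>\<^sub>M lborel). 0 \<le> snd p \<and> snd p \<le> t \<and> X (max (snd p) 0) (fst p) < 1} \<in> sets (K \<Otimes>\<^sub>M lborel)"
      by measurable
    then show ?thesis by (simp add: space_pair_measure case_prod_unfold mem_Times_iff)
  qed
  from lborel.measurable_emeasure_Pair[OF this]
  have "(\<lambda>x. emeasure lborel {z. 0 \<le> z \<and> z \<le> t \<and> X z x < 1}) \<in> borel_measurable K"
    by (rule measurable_cong[THEN iffD1, rotated]) (auto intro!: arg_cong[where f = "emeasure lborel"] simp: max_def)
  then show "(\<lambda>x. time_below (\<lambda>t. X t x) t) \<in> borel_measurable K"
    unfolding time_below_eq measure_def by measurable
qed

text \<open>The inverse clock lies below \<open>y\<close> exactly when the clock exceeds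
  \<open>t\<close> at some rational time below \<open>y\<close>, which reduces its measurability to
  that of countably many occupation times. Where the total time is finite, \<open>\<tau>\<close>
  gets the default 0, so that it is a nonnegative time on every outcome.\<close>

lemma fast_forward_measurable:
  assumes X: "\<And>t. 0 \<le> t \<Longrightarrow> X t \<in> borel_measurable K"
    and cad: "\<And>x. x \<in> space K \<Longrightarrow> cadlag (\<lambda>t. X t x)" and t: "0 \<le> t"
  shows "(\<lambda>x. fast_forward_right (\<lambda>t. X t x) t) \<in> borel_measurable K"
proof -
  define inf where "inf x \<longleftrightarrow> emeasure lborel {z. 0 \<le> z \<and> X z x < 1} = \<infinity>" for x
  have inf: "Measurable.pred K inf"
  proof -
    have [measurable]: "(\<lambda>x. emeasure lborel {z. 0 \<le> z \<and> X z x < 1}) \<in> borel_measurable K"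
      by (rule occupation_measurable(1)[OF X cad])
    show ?thesis unfolding inf_def by measurable
  qed
  define \<tau> where "\<tau> x = (if inf x then time_below_inv (\<lambda>t. X t x) t else 0)" for x
  have tau: "\<tau> \<in> borel_measurable K"
  proof (rule borel_measurableI_less)
    fix y
    have "{x \<in> space K. \<tau> x < y} = {x \<in> space K. (inf x \<and> (\<exists>r\<in>\<rat>. r < y \<and> t < time_below (\<lambda>t. X t x) r)) \<or> (\<not> inf x \<and> 0 < y)}"
    proof (intro Collect_cong conj_cong refl)
      fix x assume x: "x \<in> space K"
      show "\<tau> x < y \<longleftrightarrow> (inf x \<and> (\<exists>r\<in>\<rat>. r < y \<and> t < time_below (\<lambda>t. X t x) r)) \<or> (\<not> inf x \<and> 0 < y)"
      proof (cases "inf x")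
        case True
        note i = True[unfolded inf_def]
        have "(time_below_inv (\<lambda>t. X t x) t < y) \<longleftrightarrow> (\<exists>r\<in>\<rat>. r < y \<and> t < time_below (\<lambda>t. X t x) r)"
        proof
          assume "time_below_inv (\<lambda>t. X t x) t < y"
          then obtain r where "r \<in> \<rat>" "time_below_inv (\<lambda>t. X t x) t < r" "r < y" using Rats_dense_in_real by blast
          then show "\<exists>r\<in>\<rat>. r < y \<and> t < time_below (\<lambda>t. X t x) r"
            using less_time_below[OF cad[OF x] i] by blast
        next
          assume "\<exists>r\<in>\<rat>. r < y \<and> t < time_below (\<lambda>t. X t x) r"
          then show "time_below_inv (\<lambda>t. X t x) t < y" using time_below_inv_le[OF cad[OF x] i _ t] by force
        qed
        then show ?thesis using True by (simp add: \<tau>_def)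
      qed (simp add: \<tau>_def)
    qed
    also have "\<dots> \<in> sets K"
    proof -
      have [measurable]: "(\<lambda>x. time_below (\<lambda>t. X t x) r) \<in> borel_measurable K" for r
        by (rule occupation_measurable(2)[OF X cad])
      have "Measurable.pred K (\<lambda>x. \<exists>r\<in>\<rat>. r < y \<and> t < time_below (\<lambda>t. X t x) r)"
      proof -
        have "{x \<in> space K. \<exists>r\<in>\<rat>. r < y \<and> t < time_below (\<lambda>t. X t x) r} =
            (\<Union>r\<in>\<rat>. {x \<in> space K. r < y \<and> t < time_below (\<lambda>t. X t x) r})" by auto
        also have "\<dots> \<in> sets K" by (intro sets.countable_UN'[OF countable_rat] image_subsetI) measurable
        finally show ?thesis by (simp add: pred_def)
      qed
      then show ?thesis using inf by measurable
    qed
    finally show "{x \<in> space K. \<tau> x < y} \<in> sets K" .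
  qed
  have "(\<lambda>x. X (\<tau> x) x) \<in> borel_measurable K"
    by (rule cadlag_eval_measurable[OF X cad tau])
       (auto simp: \<tau>_def inf_def intro: time_below_inv_nonneg cad)
  then have "(\<lambda>x. if inf x then X (\<tau> x) x else 0) \<in> borel_measurable K" using inf by measurable
  then show ?thesis
    by (rule measurable_cong[THEN iffD1, rotated]) (simp add: fast_forward_right_def inf_def \<tau>_def)
qed

section \<open>Determining the law of a path by continuous test functions\<close>

lemma measurable_cadlag_space:
  assumes "\<And>t. 0 \<le> t \<Longrightarrow> (\<lambda>\<omega>. X \<omega> t) \<in> borel_measurable M" and "\<And>\<omega>. \<omega> \<in> space M \<Longrightarrow> cadlag (X \<omega>)"
  shows "(\<lambda>\<omega>. restrict (X \<omega>) {0..}) \<in> M \<rightarrow>\<^sub>M cadlag_space"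
  unfolding cadlag_space_def
proof (rule measurable_restrict_space2)
  show "(\<lambda>\<omega>. restrict (X \<omega>) {0..}) \<in> M \<rightarrow>\<^sub>M Pi\<^sub>M {0..} (\<lambda>_. borel)"
    by (rule measurable_restrict) (use assms in auto)
qed (use assms in auto)

lemma finite_borel_measure_eqI:
  assumes "finite_measure N1" "finite_measure N2" "sets N1 = sets borel" "sets N2 = sets borel"
    and g: "\<And>g :: real \<Rightarrow> real. continuous_on UNIV g \<Longrightarrow> (\<And>x. 0 \<le> g x \<and> g x \<le> 1) \<Longrightarrow> (\<integral>x. g x \<partial>N1) = (\<integral>x. g x \<partial>N2)"
  shows "N1 = (N2 :: real measure)"
proof (rule cdf_unique')
  interpret N1: finite_measure N1 by fact
  interpret N2: finite_measure N2 by fact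
  show "finite_borel_measure N1" "finite_borel_measure N2"
    using assms by (auto simp: finite_borel_measure_def finite_borel_measure_axioms_def)
  show "cdf N1 = cdf N2"
  proof
    fix a :: real
    \<comment> \<open>Ramps that fall from 1 at \<open>a\<close> to 0 with slope \<open>- n\<close>;
      they tend to the indicator of the half-line, so the distribution functions agree in the
      limit.\<close>
    define g where "g n x = max 0 (min 1 (1 - real n * (x - a)))" for n x
    have lim: "(\<lambda>n. \<integral>x. g n x \<partial>N) \<longlonglongrightarrow> (\<integral>x. (indicator {..a} x :: real) \<partial>N)"
      if "finite_measure N" "sets N = sets borel" for N
    proof (rule integral_dominated_convergence[where w = "\<lambda>_. 1"])
      interpret finite_measure N by fact
      show "integrable N (\<lambda>_. 1::real)" by simp
      show "indicator {..a} \<in> borel_measurable N" using that(2) by (simp cong: measurable_cong_sets)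
      show "g n \<in> borel_measurable N" for n
        unfolding g_def using that(2) by (subst measurable_cong_sets[OF that(2) refl]) measurable
      show "AE x in N. (\<lambda>n. g n x) \<longlonglongrightarrow> indicator {..a} x"
      proof (intro AE_I2)
        fix x
        show "(\<lambda>n. g n x) \<longlonglongrightarrow> indicator {..a} x"
        proof (cases "x \<le> a")
          case True
          then have "real n * (x - a) \<le> 0" for n by (simp add: mult_nonneg_nonpos)
          then have "g n x = 1" for n by (simp add: g_def)
          then show ?thesis using True by simp
        next
          case False
          obtain m where m: "1 / (x - a) < real m" using reals_Archimedean2 by blast
          have "g n x = 0" if "n \<ge> m" for n
          proof -
            have "1 / (x - a) < real n" using m that by linarith
            then have "1 < real n * (x - a)" using False by (simp add: field_simps)
            then show ?thesis by (simp add: g_def)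
          qed
          then have "(\<lambda>n. g n x) \<longlonglongrightarrow> 0" by (intro tendsto_eventually eventually_sequentiallyI)
          then show ?thesis using False by simp
        qed
      qed
      show "AE x in N. norm (g n x) \<le> 1" for n by (simp add: g_def)
    qed
    have "(\<integral>x. g n x \<partial>N1) = (\<integral>x. g n x \<partial>N2)" for n
      by (rule g) (auto simp: g_def intro!: continuous_intros)
    then have "(\<integral>x. (indicator {..a} x :: real) \<partial>N1) = (\<integral>x. (indicator {..a} x :: real) \<partial>N2)"
      using lim[OF assms(1,3)] lim[OF assms(2,4)] LIMSEQ_unique by (simp only:)
    then show "cdf N1 a = cdf N2 a"
      using assms(3,4) by (simp add: cdf_def sets_eq_imp_space_eq[OF assms(3)] sets_eq_imp_space_eq[OF assms(4)])
  qed
qed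

text \<open>The factors \<open>F\<close> and \<open>G\<close> are absorbed as densities; the laws of
  \<open>X\<close> and \<open>Z\<close> under the resulting finite measures agree on continuous
  functions and therefore on Borel sets.\<close>

lemma expectation_borel_extend:
  fixes X Z :: "'a \<Rightarrow> real" and F G :: "'a \<Rightarrow> real"
  assumes M: "prob_space M" and X: "X \<in> borel_measurable M" and Z: "Z \<in> borel_measurable M"
    and F: "F \<in> borel_measurable M" and G: "G \<in> borel_measurable M"
    and FG: "\<And>x. 0 \<le> F x \<and> F x \<le> 1" "\<And>x. 0 \<le> G x \<and> G x \<le> 1"
    and eq: "\<And>g :: real \<Rightarrow> real. continuous_on UNIV g \<Longrightarrow> (\<And>x. 0 \<le> g x \<and> g x \<le> 1) \<Longrightarrow>
        (\<integral>x. g (X x) * F x \<partial>M) = (\<integral>x. g (Z x) * G x \<partial>M)"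
    and A: "A \<in> sets borel"
  shows "(\<integral>x. indicator A (X x) * F x \<partial>M) = (\<integral>x. indicator A (Z x) * G x \<partial>M)"
proof -
  interpret prob_space M by (rule M)
  note [measurable] = X Z F G A
  define N1 where "N1 = distr (density M (\<lambda>x. ennreal (F x))) borel X"
  define N2 where "N2 = distr (density M (\<lambda>x. ennreal (G x))) borel Z"
  have fin: "finite_measure (distr (density M (\<lambda>x. ennreal (F x))) borel X)"
    if "F \<in> borel_measurable M" "X \<in> borel_measurable M" "\<And>x. 0 \<le> F x \<and> F x \<le> 1" for F X :: "'a \<Rightarrow> real"
  proof (rule finite_measureI)
    have "emeasure (distr (density M (\<lambda>x. ennreal (F x))) borel X) (space (distr (density M (\<lambda>x. ennreal (F x))) borel X))
        = (\<integral>\<^sup>+x. ennreal (F x) \<partial>M)"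
      using that by (simp add: emeasure_distr emeasure_density cong: nn_integral_cong)
    also have "\<dots> \<le> (\<integral>\<^sup>+x. 1 \<partial>M)" using that by (intro nn_integral_mono) (auto simp: ennreal_le_1)
    also have "\<dots> = 1" by (simp add: emeasure_space_1)
    finally show "emeasure (distr (density M (\<lambda>x. ennreal (F x))) borel X) (space (distr (density M (\<lambda>x. ennreal (F x))) borel X)) \<noteq> \<infinity>"
      by (auto simp: top_unique)
  qed
  have int: "(\<integral>y. g y \<partial>distr (density M (\<lambda>x. ennreal (F x))) borel X) = (\<integral>x. g (X x) * F x \<partial>M)"
    if "F \<in> borel_measurable M" "X \<in> borel_measurable M" "\<And>x. 0 \<le> F x \<and> F x \<le> 1" "g \<in> borel_measurable borel"
    for F X :: "'a \<Rightarrow> real" and g :: "real \<Rightarrow> real"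
    using that by (subst integral_distr) (auto simp: integral_density mult.commute)
  have "N1 = N2"
  proof (rule finite_borel_measure_eqI)
    fix g :: "real \<Rightarrow> real" assume g: "continuous_on UNIV g" "\<And>x. 0 \<le> g x \<and> g x \<le> 1"
    have "g \<in> borel_measurable borel" using g(1) by (rule borel_measurable_continuous_onI)
    then show "(\<integral>x. g x \<partial>N1) = (\<integral>x. g x \<partial>N2)"
      unfolding N1_def N2_def using int[OF F X FG(1)] int[OF G Z FG(2)] eq[OF g] by simp
  next
    show "finite_measure N1" unfolding N1_def by (rule fin[OF F X FG(1)])
    show "finite_measure N2" unfolding N2_def by (rule fin[OF G Z FG(2)])
  qed (simp_all add: N1_def N2_def)
  then have "(\<integral>y. indicator A y \<partial>N1) = (\<integral>y. (indicator A y :: real) \<partial>N2)" by simp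
  then show ?thesis unfolding N1_def N2_def
    using int[OF F X FG(1), of "indicator A"] int[OF G Z FG(2), of "indicator A"] by simp
qed

text \<open>Coordinates are upgraded from continuous functions to indicators one at a time. The set
  \<open>I\<close> of coordinates already upgraded makes the mixed products of the intermediate
  stages available to the induction.\<close>

lemma finite_dim_extend:
  fixes X Z :: "'a \<Rightarrow> real \<Rightarrow> real"
  assumes M: "prob_space M" and J: "finite J"
    and X: "\<And>t. t \<in> J \<Longrightarrow> (\<lambda>\<omega>. X \<omega> t) \<in> borel_measurable M"
    and Z: "\<And>t. t \<in> J \<Longrightarrow> (\<lambda>\<omega>. Z \<omega> t) \<in> borel_measurable M"
    and eq: "\<And>g :: real \<Rightarrow> real \<Rightarrow> real. (\<And>t. continuous_on UNIV (g t)) \<Longrightarrow> (\<And>t x. 0 \<le> g t x \<and> g t x \<le> 1) \<Longrightarrow>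
        (\<integral>\<omega>. (\<Prod>t\<in>J. g t (X \<omega> t)) \<partial>M) = (\<integral>\<omega>. (\<Prod>t\<in>J. g t (Z \<omega> t)) \<partial>M)"
    and I: "I \<subseteq> J"
  shows "(\<And>t. t \<in> I \<Longrightarrow> \<exists>A\<in>sets borel. g t = indicator A) \<Longrightarrow>
      (\<And>t. t \<notin> I \<Longrightarrow> continuous_on UNIV (g t)) \<Longrightarrow> (\<And>t x. 0 \<le> g t x \<and> g t x \<le> (1::real)) \<Longrightarrow>
      (\<integral>\<omega>. (\<Prod>t\<in>J. g t (X \<omega> t)) \<partial>M) = (\<integral>\<omega>. (\<Prod>t\<in>J. g t (Z \<omega> t)) \<partial>M)"
  using finite_subset[OF I J] I
proof (induction I arbitrary: g rule: finite_induct)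
  case empty
  then show ?case by (intro eq) auto
next
  case (insert s I)
  obtain A where A: "A \<in> sets borel" "g s = indicator A" using insert.prems(1) by blast
  have gm: "g t \<in> borel_measurable borel" for t
    using insert.prems(1)[of t] insert.prems(2)[of t]
    by (cases "t \<in> insert s I") (auto intro: borel_measurable_continuous_onI)
  have bd: "0 \<le> (\<Prod>t\<in>J - {s}. g t (W t)) \<and> (\<Prod>t\<in>J - {s}. g t (W t)) \<le> 1" for W
    using insert.prems(3) by (auto intro!: prod_nonneg prod_le_1)
  have s: "s \<in> J" using insert.prems by auto
  have split: "(\<Prod>t\<in>J. g t (W t)) = indicator A (W s) * (\<Prod>t\<in>J - {s}. g t (W t))" for W
    using prod.remove[OF J s, of "\<lambda>t. g t (W t)"] A by simp
  show ?case unfolding split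
  proof (rule expectation_borel_extend[OF M X[OF s] Z[OF s] _ _ bd bd _ A(1)])
    show "(\<lambda>\<omega>. \<Prod>t\<in>J - {s}. g t (X \<omega> t)) \<in> borel_measurable M"
      by (intro borel_measurable_prod measurable_compose[OF X gm]) auto
    show "(\<lambda>\<omega>. \<Prod>t\<in>J - {s}. g t (Z \<omega> t)) \<in> borel_measurable M"
      by (intro borel_measurable_prod measurable_compose[OF Z gm]) auto
    fix k :: "real \<Rightarrow> real" assume k: "continuous_on UNIV k" "\<And>x. 0 \<le> k x \<and> k x \<le> 1"
    have eqk: "(\<Prod>t\<in>J. (g(s := k)) t (W t)) = k (W s) * (\<Prod>t\<in>J - {s}. g t (W t))" for W
      using prod.remove[OF J s, of "\<lambda>t. (g(s := k)) t (W t)"] by simp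
    have "(\<integral>\<omega>. (\<Prod>t\<in>J. (g(s := k)) t (X \<omega> t)) \<partial>M) = (\<integral>\<omega>. (\<Prod>t\<in>J. (g(s := k)) t (Z \<omega> t)) \<partial>M)"
    proof (rule insert.IH)
      show "\<exists>A\<in>sets borel. (g(s := k)) t = indicator A" if "t \<in> I" for t
        using insert.prems(1)[of t] insert.hyps that by auto
      show "continuous_on UNIV ((g(s := k)) t)" if "t \<notin> I" for t
        using insert.prems(2)[of t] k that by (cases "t = s") auto
      show "0 \<le> (g(s := k)) t x \<and> (g(s := k)) t x \<le> 1" for t x
        using insert.prems(3)[of t x] k(2)[of x] by simp
      show "I \<subseteq> J" using insert.prems by auto
    qed
    then show "(\<integral>\<omega>. k (X \<omega> s) * (\<Prod>t\<in>J - {s}. g t (X \<omega> t)) \<partial>M) = (\<integral>\<omega>. k (Z \<omega> s) * (\<Prod>t\<in>J - {s}. g t (Z \<omega> t)) \<partial>M)"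
      unfolding eqk .
  qed
qed

text \<open>Weak limits deliver only integrals of products of continuous functions of finitely many
  coordinates. These determine the measures of cylinder sets, hence the law on the product space;
  the law on the trace space is read off because the paths of both families are cadlag.\<close>

lemma equal_in_lawI:
  fixes X Z :: "'a \<Rightarrow> real \<Rightarrow> real"
  assumes M: "prob_space M"
    and X: "\<And>t. 0 \<le> t \<Longrightarrow> (\<lambda>\<omega>. X \<omega> t) \<in> borel_measurable M" "\<And>\<omega>. \<omega> \<in> space M \<Longrightarrow> cadlag (X \<omega>)"
    and Z: "\<And>t. 0 \<le> t \<Longrightarrow> (\<lambda>\<omega>. Z \<omega> t) \<in> borel_measurable M" "\<And>\<omega>. \<omega> \<in> space M \<Longrightarrow> cadlag (Z \<omega>)"
    and eq: "\<And>J (g :: real \<Rightarrow> real \<Rightarrow> real). finite J \<Longrightarrow> J \<subseteq> {0..} \<Longrightarrow> (\<And>t. continuous_on UNIV (g t)) \<Longrightarrow>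
        (\<And>t x. 0 \<le> g t x \<and> g t x \<le> 1) \<Longrightarrow>
        (\<integral>\<omega>. (\<Prod>t\<in>J. g t (X \<omega> t)) \<partial>M) = (\<integral>\<omega>. (\<Prod>t\<in>J. g t (Z \<omega> t)) \<partial>M)"
  shows "equal_in_law M X Z"
proof -
  interpret prob_space M by (rule M)
  define P where "P = Pi\<^sub>M {0..} (\<lambda>_::real. borel :: real measure)"
  let ?X = "\<lambda>\<omega>. restrict (X \<omega>) {0..}" and ?Z = "\<lambda>\<omega>. restrict (Z \<omega>) {0..}"
  have mX: "?X \<in> M \<rightarrow>\<^sub>M cadlag_space" by (rule measurable_cadlag_space) (auto intro: X)
  have mZ: "?Z \<in> M \<rightarrow>\<^sub>M cadlag_space" by (rule measurable_cadlag_space) (auto intro: Z)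
  have pX: "?X \<in> M \<rightarrow>\<^sub>M P" unfolding P_def by (rule measurable_restrict) (auto intro: X)
  have pZ: "?Z \<in> M \<rightarrow>\<^sub>M P" unfolding P_def by (rule measurable_restrict) (auto intro: Z)
  have em: "emeasure (distr M P (\<lambda>\<omega>. restrict (V \<omega>) {0..})) (prod_emb {0..} (\<lambda>_. borel) J (Pi\<^sub>E J A)) =
      ennreal (\<integral>\<omega>. (\<Prod>t\<in>J. indicator (A t) (V \<omega> t)) \<partial>M)"
    if J: "finite J" "J \<subseteq> {0..}" and A: "\<And>t. t \<in> J \<Longrightarrow> A t \<in> sets borel"
      and V: "\<And>t. 0 \<le> t \<Longrightarrow> (\<lambda>\<omega>. V \<omega> t) \<in> borel_measurable M" for J A and V :: "'a \<Rightarrow> real \<Rightarrow> real"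
  proof -
    have pV: "(\<lambda>\<omega>. restrict (V \<omega>) {0..}) \<in> M \<rightarrow>\<^sub>M P" unfolding P_def by (rule measurable_restrict) (auto intro: V)
    have "emeasure (distr M P (\<lambda>\<omega>. restrict (V \<omega>) {0..})) (prod_emb {0..} (\<lambda>_. borel) J (Pi\<^sub>E J A)) =
        emeasure M ((\<lambda>\<omega>. restrict (V \<omega>) {0..}) -` prod_emb {0..} (\<lambda>_. borel) J (Pi\<^sub>E J A) \<inter> space M)"
      by (intro emeasure_distr pV) (auto simp: P_def intro!: sets_PiM_I J A)
    also have "(\<lambda>\<omega>. restrict (V \<omega>) {0..}) -` prod_emb {0..} (\<lambda>_. borel) J (Pi\<^sub>E J A) \<inter> space M =
        {\<omega> \<in> space M. \<forall>t\<in>J. V \<omega> t \<in> A t}"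
      using J by (auto simp: prod_emb_def PiE_iff subset_iff)
    also have "emeasure M \<dots> = ennreal (measure M \<dots>)" by (simp add: emeasure_eq_measure)
    also have "measure M {\<omega> \<in> space M. \<forall>t\<in>J. V \<omega> t \<in> A t} = (\<integral>\<omega>. indicator {\<omega> \<in> space M. \<forall>t\<in>J. V \<omega> t \<in> A t} \<omega> \<partial>M)"
    proof -
      have "{\<omega> \<in> space M. \<forall>t\<in>J. V \<omega> t \<in> A t} \<inter> space M = {\<omega> \<in> space M. \<forall>t\<in>J. V \<omega> t \<in> A t}" by auto
      then show ?thesis by (simp only: Bochner_Integration.integral_indicator)
    qed
    also have "\<dots> = (\<integral>\<omega>. (\<Prod>t\<in>J. indicator (A t) (V \<omega> t)) \<partial>M)"
    proof (rule Bochner_Integration.integral_cong[OF refl])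
      fix \<omega> assume w: "\<omega> \<in> space M"
      show "indicator {\<omega> \<in> space M. \<forall>t\<in>J. V \<omega> t \<in> A t} \<omega> = (\<Prod>t\<in>J. indicator (A t) (V \<omega> t) :: real)"
      proof (cases "\<forall>t\<in>J. V \<omega> t \<in> A t")
        case True
        then show ?thesis using w by simp
      next
        case False
        then have "(\<Prod>t\<in>J. indicator (A t) (V \<omega> t) :: real) = 0" using J(1) by (intro prod_zero) (auto simp: indicator_def)
        then show ?thesis using False by simp
      qed
    qed
    finally show ?thesis .
  qed
  have P: "distr M P ?X = distr M P ?Z"
  proof (rule measure_eqI_PiM_infinite[where I = "{0..}" and M = "\<lambda>_. borel"])
    fix A and J :: "real set" assume J: "finite J" "J \<subseteq> {0..}" and A: "\<And>t. t \<in> J \<Longrightarrow> A t \<in> sets (borel :: real measure)"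
    define g where "g t = (if t \<in> J then indicator (A t) else (\<lambda>_. 1) :: real \<Rightarrow> real)" for t
    have "(\<integral>\<omega>. (\<Prod>t\<in>J. g t (X \<omega> t)) \<partial>M) = (\<integral>\<omega>. (\<Prod>t\<in>J. g t (Z \<omega> t)) \<partial>M)"
    proof (rule finite_dim_extend[where I = J and J = J and M = M and X = X and Z = Z and g = g])
      show "(\<integral>\<omega>. (\<Prod>t\<in>J. k t (X \<omega> t)) \<partial>M) = (\<integral>\<omega>. (\<Prod>t\<in>J. k t (Z \<omega> t)) \<partial>M)"
        if "\<And>t. continuous_on UNIV (k t)" "\<And>t x. 0 \<le> k t x \<and> k t x \<le> 1" for k :: "real \<Rightarrow> real \<Rightarrow> real"
        using that by (rule eq[OF J])
      show "\<exists>A\<in>sets borel. g t = indicator A" if "t \<in> J" for t using that A by (auto simp: g_def)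
      show "continuous_on UNIV (g t)" if "t \<notin> J" for t using that by (simp add: g_def)
      show "0 \<le> g t x \<and> g t x \<le> 1" for t x by (simp add: g_def indicator_def)
    qed (use M J X Z in auto)
    then have "(\<integral>\<omega>. (\<Prod>t\<in>J. indicator (A t) (X \<omega> t) :: real) \<partial>M) = (\<integral>\<omega>. (\<Prod>t\<in>J. indicator (A t) (Z \<omega> t)) \<partial>M)"
      by (simp add: g_def cong: prod.cong)
    then show "emeasure (distr M P ?X) (prod_emb {0..} (\<lambda>_. borel) J (Pi\<^sub>E J A)) =
        emeasure (distr M P ?Z) (prod_emb {0..} (\<lambda>_. borel) J (Pi\<^sub>E J A))"
      using em[OF J A X(1)] em[OF J A Z(1)] by simp
  next
    interpret D: prob_space "distr M P ?X" by (rule prob_space_distr[OF pX])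
    show "finite_measure (distr M P ?X)" by unfold_locales
  qed (simp_all add: P_def)
  have "distr M cadlag_space ?X = distr M cadlag_space ?Z"
  proof (rule measure_eqI)
    fix B assume "B \<in> sets (distr M cadlag_space ?X)"
    then have B: "B \<in> sets cadlag_space" by simp
    then obtain C where C: "C \<in> sets P" "B = {f. cadlag f} \<inter> C"
      unfolding cadlag_space_def P_def[symmetric] by (auto simp: sets_restrict_space)
    have pre: "(\<lambda>\<omega>. restrict (V \<omega>) {0..}) -` B \<inter> space M = (\<lambda>\<omega>. restrict (V \<omega>) {0..}) -` C \<inter> space M"
      if "\<And>\<omega>. \<omega> \<in> space M \<Longrightarrow> cadlag (V \<omega>)" for V :: "'a \<Rightarrow> real \<Rightarrow> real"
      using that by (auto simp: C(2))
    have "emeasure M (?X -` C \<inter> space M) = emeasure M (?Z -` C \<inter> space M)"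
      using arg_cong[OF P, of "\<lambda>N. emeasure N C"] C(1) by (simp add: emeasure_distr pX pZ)
    then show "emeasure (distr M cadlag_space ?X) B = emeasure (distr M cadlag_space ?Z) B"
      using B by (simp add: emeasure_distr mX mZ pre X Z)
  qed simp
  then show ?thesis using mX mZ by (simp add: equal_in_law_def)
qed

section \<open>Optional skipping\<close>

definition sel_count :: "(nat \<Rightarrow> 'b \<Rightarrow> bool) \<Rightarrow> nat \<Rightarrow> 'b \<Rightarrow> nat" where
  "sel_count Q j w = card {i. i < j \<and> Q i w}"

text \<open>Positions are numbered from 0. With fewer than \<open>k + 1\<close> selected indices the
  value says nothing, which is why every rule used below selects all indices from some point
  on.\<close>

definition sel_pos :: "(nat \<Rightarrow> 'b \<Rightarrow> bool) \<Rightarrow> nat \<Rightarrow> 'b \<Rightarrow> nat" where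
  "sel_pos Q k w = (LEAST i. Q i w \<and> sel_count Q i w = k)"

lemma sel_count_0 [simp]: "sel_count Q 0 w = 0"
  by (simp add: sel_count_def)

lemma sel_count_Suc: "sel_count Q (Suc j) w = sel_count Q j w + (if Q j w then 1 else 0)"
proof -
  have "{i. i < Suc j \<and> Q i w} = (if Q j w then insert j {i. i < j \<and> Q i w} else {i. i < j \<and> Q i w})"
    by (auto simp: less_Suc_eq)
  then show ?thesis by (simp add: sel_count_def)
qed

lemma sel_count_mono: "i \<le> j \<Longrightarrow> sel_count Q i w \<le> sel_count Q j w"
  unfolding sel_count_def by (intro card_mono) auto

lemma sel_count_ge: "(\<And>j. J \<le> j \<Longrightarrow> Q j w) \<Longrightarrow> m \<le> sel_count Q (J + m) w"
  by (induction m) (auto simp: sel_count_Suc)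

lemma sel_pos_unique:
  assumes "Q i w" "Q j w" "sel_count Q i w = sel_count Q j w" shows "i = j"
proof (rule ccontr)
  have *: False if "i < j" "Q i w" "sel_count Q i w = sel_count Q j w" for i j
    using sel_count_mono[of "Suc i" j Q w] that by (simp add: sel_count_Suc)
  assume "i \<noteq> j"
  then show False using *[of i j] *[of j i] assms by (cases "i < j") auto
qed

lemma sel_pos_exists:
  assumes "k < sel_count Q j w" shows "\<exists>i<j. Q i w \<and> sel_count Q i w = k"
  using assms
proof (induction j)
  case (Suc j)
  show ?case
  proof (cases "k < sel_count Q j w")
    case True
    then show ?thesis using Suc by (auto intro: less_SucI)
  next
    case False
    then show ?thesis using Suc.prems by (intro exI[of _ j]) (auto simp: sel_count_Suc split: if_splits)
  qed
qed simp

lemma sel_pos_eq: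
  assumes "Q i w" "sel_count Q i w = k" shows "sel_pos Q k w = i"
  unfolding sel_pos_def
proof (rule Least_equality)
  fix j assume "Q j w \<and> sel_count Q j w = k"
  then have "j = i" using assms by (intro sel_pos_unique[of Q j w i]) auto
  then show "i \<le> j" by simp
qed (use assms in simp)

lemma sel_pos:
  assumes "k < sel_count Q j w"
  shows "Q (sel_pos Q k w) w" "sel_count Q (sel_pos Q k w) w = k" "sel_pos Q k w < j"
proof -
  obtain i where i: "i < j" "Q i w" "sel_count Q i w = k" using sel_pos_exists[OF assms] by blast
  then have "sel_pos Q k w = i" by (intro sel_pos_eq)
  then show "Q (sel_pos Q k w) w" "sel_count Q (sel_pos Q k w) w = k" "sel_pos Q k w < j"
    using i by simp_all
qed

text \<open>Entry 0 is the starting point, with a law of its own; only the entries from 1 on share a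
  law.\<close>

locale iid_increments = prob_space M for M :: "'a measure" +
  fixes V :: "nat \<Rightarrow> 'a \<Rightarrow> real"
  assumes indep: "\<And>n. indep_vars (\<lambda>_. borel) V {..n}"
    and ident: "\<And>i. distr M borel (V (Suc i)) = distr M borel (V 1)"
begin

abbreviation path_space :: "nat \<Rightarrow> (nat \<Rightarrow> real) measure" where
  "path_space j \<equiv> Pi\<^sub>M {..j} (\<lambda>_. borel)"

lemma V_measurable [measurable]: "V i \<in> borel_measurable M"
  using indep[of i] unfolding indep_vars_def by auto

text \<open>Rule \<open>j\<close> sees the entries \<open>0..j\<close> and decides about entry
  \<open>Suc j\<close>, so it is predictable. Besides measurability, dependence on these entries
  alone is demanded pointwise, since rules are evaluated at whole sequences.\<close>

definition adapted :: "(nat \<Rightarrow> (nat \<Rightarrow> real) \<Rightarrow> bool) \<Rightarrow> bool" where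
  "adapted Q \<longleftrightarrow> (\<forall>j. Measurable.pred (path_space j) (Q j)) \<and>
     (\<forall>j w w'. (\<forall>i\<le>j. w i = w' i) \<longrightarrow> Q j w = Q j w')"

lemma adapted_pred:
  assumes "adapted Q" "i \<le> j" shows "Measurable.pred (path_space j) (Q i)"
proof -
  have "(\<lambda>w. restrict w {..i}) \<in> path_space j \<rightarrow>\<^sub>M path_space i"
    using assms(2) by (intro measurable_restrict_subset) auto
  then have "Measurable.pred (path_space j) (\<lambda>w. Q i (restrict w {..i}))"
    using assms(1) unfolding adapted_def by (intro measurable_compose[of _ "path_space j" "path_space i" "Q i"]) auto
  moreover have "Q i (restrict w {..i}) = Q i w" for w
    using assms(1) unfolding adapted_def by (metis atMost_iff restrict_apply)
  ultimately show ?thesis by simp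
qed

lemma adapted_cong: "adapted Q \<Longrightarrow> (\<And>i. i \<le> j \<Longrightarrow> w i = w' i) \<Longrightarrow> Q j w = Q j w'"
  unfolding adapted_def by blast

lemma sel_count_measurable:
  assumes Q: "adapted Q" shows "j \<le> Suc n \<Longrightarrow> sel_count Q j \<in> path_space n \<rightarrow>\<^sub>M count_space UNIV"
proof (induction j)
  case (Suc j)
  have [measurable]: "Measurable.pred (path_space n) (Q j)" using Suc.prems by (intro adapted_pred Q) auto
  have [measurable]: "sel_count Q j \<in> path_space n \<rightarrow>\<^sub>M count_space UNIV" using Suc by auto
  show ?case unfolding sel_count_Suc by measurable
next
  case 0
  have "sel_count Q 0 = (\<lambda>w. 0)" by (auto simp: fun_eq_iff)
  then show ?case by simp
qed

lemma sel_count_cong: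
  assumes Q: "adapted Q" and "\<And>i. i < j \<Longrightarrow> w i = w' i" shows "sel_count Q j w = sel_count Q j w'"
proof -
  have "Q i w = Q i w'" if "i < j" for i using that assms(2) by (intro adapted_cong[OF Q]) auto
  then show ?thesis unfolding sel_count_def by (intro arg_cong[where f = card]) auto
qed

text \<open>Independence makes the joint law of the past and the next entry a product, to which
  Tonelli's theorem applies.\<close>

lemma nn_integral_past_future:
  assumes F [measurable]: "F \<in> borel_measurable (path_space j \<Otimes>\<^sub>M borel)"
  shows "(\<integral>\<^sup>+\<omega>. F (\<lambda>i\<in>{..j}. V i \<omega>, V (Suc j) \<omega>) \<partial>M) =
    (\<integral>\<^sup>+w. \<integral>\<^sup>+x. F (w, x) \<partial>distr M borel (V (Suc j)) \<partial>distr M (path_space j) (\<lambda>\<omega>. \<lambda>i\<in>{..j}. V i \<omega>))"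
proof -
  let ?W = "\<lambda>\<omega>. \<lambda>i\<in>{..j}. V i \<omega>" and ?W' = "\<lambda>\<omega>. \<lambda>i\<in>{Suc j}. V i \<omega>"
  let ?P = "Pi\<^sub>M {Suc j} (\<lambda>_. borel :: real measure)"
  have "indep_var (path_space j) ?W ?P ?W'"
    by (rule indep_var_restrict[OF indep[of "Suc j"]]) auto
  then have eq: "distr M (path_space j \<Otimes>\<^sub>M ?P) (\<lambda>\<omega>. (?W \<omega>, ?W' \<omega>)) = distr M (path_space j) ?W \<Otimes>\<^sub>M distr M ?P ?W'"
    unfolding indep_var_distribution_eq by simp
  have [measurable]: "?W \<in> M \<rightarrow>\<^sub>M path_space j" "?W' \<in> M \<rightarrow>\<^sub>M ?P" by measurable
  interpret N': prob_space "distr M ?P ?W'" by (rule prob_space_distr) measurable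
  have F': "(\<lambda>(w, y). F (w, y (Suc j))) \<in> borel_measurable (path_space j \<Otimes>\<^sub>M ?P)" by measurable
  have "(\<integral>\<^sup>+\<omega>. F (?W \<omega>, V (Suc j) \<omega>) \<partial>M) =
      (\<integral>\<^sup>+p. (\<lambda>(w, y). F (w, y (Suc j))) p \<partial>distr M (path_space j \<Otimes>\<^sub>M ?P) (\<lambda>\<omega>. (?W \<omega>, ?W' \<omega>)))"
    using F' by (subst nn_integral_distr) auto
  also have "\<dots> = (\<integral>\<^sup>+w. \<integral>\<^sup>+y. F (w, y (Suc j)) \<partial>distr M ?P ?W' \<partial>distr M (path_space j) ?W)"
    unfolding eq by (subst N'.nn_integral_fst[symmetric]) (use F' in \<open>auto simp: cong: measurable_cong_sets\<close>)
  also have "\<dots> = (\<integral>\<^sup>+w. \<integral>\<^sup>+x. F (w, x) \<partial>distr M borel (V (Suc j)) \<partial>distr M (path_space j) ?W)"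
  proof (rule nn_integral_cong)
    fix w assume "w \<in> space (distr M (path_space j) ?W)"
    then have [simp]: "w \<in> space (path_space j)" by simp
    have [measurable]: "(\<lambda>x. F (w, x)) \<in> borel_measurable borel" by measurable
    have "(\<integral>\<^sup>+y. F (w, y (Suc j)) \<partial>distr M ?P ?W') = (\<integral>\<^sup>+\<omega>. F (w, V (Suc j) \<omega>) \<partial>M)"
      by (subst nn_integral_distr) auto
    also have "\<dots> = (\<integral>\<^sup>+x. F (w, x) \<partial>distr M borel (V (Suc j)))"
      by (subst nn_integral_distr) auto
    finally show "(\<integral>\<^sup>+y. F (w, y (Suc j)) \<partial>distr M ?P ?W') = (\<integral>\<^sup>+x. F (w, x) \<partial>distr M borel (V (Suc j)))" .
  qed
  finally show ?thesis .
qed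

text \<open>The functional below, in which every selected increment has been observed
  and the remaining ones replaced by their probabilities, is a martingale.\<close>

lemma optional_skipping_rect:
  assumes Q: "adapted Q" and late: "\<And>j w. J \<le> j \<Longrightarrow> Q j w"
    and B: "\<And>k. B k \<in> sets borel" "B0 \<in> sets borel"
  shows "emeasure M {\<omega> \<in> space M. V 0 \<omega> \<in> B0 \<and> (\<forall>k<m. V (Suc (sel_pos Q k (\<lambda>i. V i \<omega>))) \<omega> \<in> B k)} =
    emeasure M {\<omega> \<in> space M. V 0 \<omega> \<in> B0} * (\<Prod>k<m. emeasure (distr M borel (V 1)) (B k))"
proof -
  \<comment> \<open>From position \<open>m\<close> on the constraint is void, so selections beyond
    the first \<open>m\<close> do not affect the functional \<open>u\<close>.\<close>
  define C where "C k = (if k < m then B k else UNIV)" for k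
  have C [measurable]: "C k \<in> sets borel" for k using B by (auto simp: C_def)
  note [measurable] = B
  define \<mu> where "\<mu> = distr M borel (V 1)"
  interpret \<mu>: prob_space \<mu> unfolding \<mu>_def by (rule prob_space_distr) measurable
  have [measurable_cong]: "sets \<mu> = sets borel" by (simp add: \<mu>_def)
  define c where "c k = emeasure \<mu> (C k)" for k
  define tail where "tail i = (\<Prod>k\<in>{i..<m}. c k)" for i
  have c1: "c k = 1" if "m \<le> k" for k using that \<mu>.emeasure_space_1 by (simp add: c_def C_def \<mu>_def)
  have tail: "c i * tail (Suc i) = tail i" for i
  proof (cases "i < m")
    case True
    then show ?thesis by (simp add: tail_def prod.atLeast_Suc_lessThan)
  next
    case False
    then show ?thesis using c1 by (simp add: tail_def)
  qed
  define ok where "ok j w \<longleftrightarrow> w 0 \<in> B0 \<and> (\<forall>i<j. Q i w \<longrightarrow> w (Suc i) \<in> C (sel_count Q i w))" for j and w :: "nat \<Rightarrow> real"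
  \<comment> \<open>\<open>ok\<close> records that the selections made before step \<open>j\<close>
    met their constraints; \<open>tail\<close> is the probability assigned to those still
    outstanding.\<close>
  define u where "u j w = (if ok j w then 1 else 0) * tail (sel_count Q j w)" for j and w :: "nat \<Rightarrow> real"
  have ok_meas: "Measurable.pred (path_space j) (ok j)" for j
  proof -
    have 0: "Measurable.pred (path_space j) (\<lambda>w. w 0 \<in> B0)" by measurable
    have "Measurable.pred (path_space j) (\<lambda>w. i < j \<longrightarrow> Q i w \<longrightarrow> w (Suc i) \<in> C (sel_count Q i w))" for i
    proof (cases "i < j")
      case True
      have [measurable]: "Measurable.pred (path_space j) (Q i)" using True by (intro adapted_pred Q) auto
      have [measurable]: "sel_count Q i \<in> path_space j \<rightarrow>\<^sub>M count_space UNIV" using True by (intro sel_count_measurable Q) auto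
      have [measurable]: "(\<lambda>w. w (Suc i)) \<in> borel_measurable (path_space j)"
        using True by (intro measurable_component_singleton) auto
      have [measurable]: "Measurable.pred (path_space j) (\<lambda>w. w (Suc i) \<in> C (sel_count Q i w))"
        by (rule measurable_compose_countable[where g = "sel_count Q i" and f = "\<lambda>k w. w (Suc i) \<in> C k"]) measurable
      show ?thesis by measurable
    qed simp
    then have 1: "Measurable.pred (path_space j) (\<lambda>w. \<forall>i. i < j \<longrightarrow> Q i w \<longrightarrow> w (Suc i) \<in> C (sel_count Q i w))"
      by (intro pred_intros_countable)
    show ?thesis unfolding ok_def pred_def
      by (rule sets.sets_Collect_conj[OF 1[unfolded pred_def] 0[unfolded pred_def]])
  qed
  have u_meas [measurable]: "u j \<in> borel_measurable (path_space j)" for j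
  proof -
    have [measurable]: "sel_count Q j \<in> path_space j \<rightarrow>\<^sub>M count_space UNIV" by (intro sel_count_measurable Q) auto
    show ?thesis unfolding u_def using ok_meas[of j] by measurable
  qed
  have ok_cong: "ok j w = ok j w'" if "\<And>i. i \<le> j \<Longrightarrow> w i = w' i" for j w w'
  proof -
    have "Q i w = Q i w'" "sel_count Q i w = sel_count Q i w'" "w (Suc i) = w' (Suc i)" if "i < j" for i
      using that \<open>\<And>i. i \<le> j \<Longrightarrow> w i = w' i\<close> by (auto intro!: adapted_cong[OF Q] sel_count_cong[OF Q])
    then show ?thesis using that[of 0] unfolding ok_def by auto
  qed
  have u_cong: "u j w = u j w'" if "\<And>i. i \<le> j \<Longrightarrow> w i = w' i" for j w w'
    using that ok_cong[of j w w'] sel_count_cong[OF Q, of j w w'] by (simp add: u_def)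
  have step: "(\<integral>\<^sup>+\<omega>. u (Suc j) (\<lambda>i. V i \<omega>) \<partial>M) = (\<integral>\<^sup>+\<omega>. u j (\<lambda>i. V i \<omega>) \<partial>M)" for j
  proof -
    let ?W = "\<lambda>\<omega>. \<lambda>i\<in>{..j}. V i \<omega>"
    let ?N = "distr M (path_space j) ?W"
    \<comment> \<open>This is \<open>u (Suc j)\<close> as a function of the past and of the next
      entry; integrating out that entry turns its indicator into a factor \<open>c\<close>, which
      \<open>tail\<close> absorbs.\<close>
    define F where "F p = (if ok j (fst p) then 1 else 0) * (if Q j (fst p) then indicator (C (sel_count Q j (fst p))) (snd p) * tail (Suc (sel_count Q j (fst p)))
        else tail (sel_count Q j (fst p)))" for p :: "(nat \<Rightarrow> real) \<times> real"
    have W [measurable]: "?W \<in> M \<rightarrow>\<^sub>M path_space j" by measurable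
    interpret N: prob_space ?N by (rule prob_space_distr[OF W])
    have \<mu>j: "distr M borel (V (Suc j)) = \<mu>" using ident unfolding \<mu>_def by simp
    have F_meas [measurable]: "F \<in> borel_measurable (path_space j \<Otimes>\<^sub>M borel)"
    proof -
      have 1[measurable]: "Measurable.pred (path_space j) (ok j)" "Measurable.pred (path_space j) (Q j)"
        using ok_meas adapted_pred[OF Q, of j j] by auto
      have 2[measurable]: "sel_count Q j \<in> path_space j \<rightarrow>\<^sub>M count_space UNIV" by (intro sel_count_measurable Q) auto
      have 3[measurable]: "(\<lambda>p. sel_count Q j (fst p)) \<in> path_space j \<Otimes>\<^sub>M borel \<rightarrow>\<^sub>M count_space UNIV"
        by measurable
      have 4[measurable]: "(\<lambda>p. indicator (C (sel_count Q j (fst p))) (snd p) :: ennreal) \<in> borel_measurable (path_space j \<Otimes>\<^sub>M borel)"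
        by (rule measurable_compose_countable[OF _ 3, where f = "\<lambda>k p. indicator (C k) (snd p)"]) measurable
      show ?thesis unfolding F_def by measurable
    qed
    have FV: "u (Suc j) (\<lambda>i. V i \<omega>) = F (?W \<omega>, V (Suc j) \<omega>)" for \<omega>
    proof -
      have 1: "ok j (?W \<omega>) = ok j (\<lambda>i. V i \<omega>)" by (rule ok_cong) simp
      have 2: "Q j (?W \<omega>) = Q j (\<lambda>i. V i \<omega>)" by (rule adapted_cong[OF Q]) simp
      have 3: "sel_count Q j (?W \<omega>) = sel_count Q j (\<lambda>i. V i \<omega>)" by (rule sel_count_cong[OF Q]) simp
      have 4: "ok (Suc j) (\<lambda>i. V i \<omega>) \<longleftrightarrow> ok j (\<lambda>i. V i \<omega>) \<and> (Q j (\<lambda>i. V i \<omega>) \<longrightarrow> V (Suc j) \<omega> \<in> C (sel_count Q j (\<lambda>i. V i \<omega>)))"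
        unfolding ok_def by (auto simp: less_Suc_eq)
      show ?thesis unfolding u_def F_def fst_conv snd_conv 1 2 3 4 sel_count_Suc by (auto simp: indicator_def)
    qed
    have "(\<integral>\<^sup>+\<omega>. u (Suc j) (\<lambda>i. V i \<omega>) \<partial>M) = (\<integral>\<^sup>+w. \<integral>\<^sup>+x. F (w, x) \<partial>\<mu> \<partial>?N)"
      unfolding FV using nn_integral_past_future[OF F_meas] \<mu>j by simp
    also have "\<dots> = (\<integral>\<^sup>+w. u j w \<partial>?N)"
    proof (rule nn_integral_cong)
      fix w
      have "(\<integral>\<^sup>+x. F (w, x) \<partial>\<mu>) = (if ok j w then 1 else 0) * (if Q j w then c (sel_count Q j w) * tail (Suc (sel_count Q j w)) else tail (sel_count Q j w))"
        by (auto simp: F_def nn_integral_multc c_def \<mu>.emeasure_space_1)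
      then show "(\<integral>\<^sup>+x. F (w, x) \<partial>\<mu>) = u j w" by (simp add: u_def tail)
    qed
    also have "\<dots> = (\<integral>\<^sup>+\<omega>. u j (?W \<omega>) \<partial>M)" by (rule nn_integral_distr) measurable
    also have "\<dots> = (\<integral>\<^sup>+\<omega>. u j (\<lambda>i. V i \<omega>) \<partial>M)" by (intro nn_integral_cong u_cong) simp
    finally show ?thesis .
  qed
  have "(\<integral>\<^sup>+\<omega>. u j (\<lambda>i. V i \<omega>) \<partial>M) = (\<integral>\<^sup>+\<omega>. u 0 (\<lambda>i. V i \<omega>) \<partial>M)" for j
    by (induction j) (simp_all add: step)
  then have "(\<integral>\<^sup>+\<omega>. u (J + m) (\<lambda>i. V i \<omega>) \<partial>M) = (\<integral>\<^sup>+\<omega>. u 0 (\<lambda>i. V i \<omega>) \<partial>M)" .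
  moreover have "(\<integral>\<^sup>+\<omega>. u 0 (\<lambda>i. V i \<omega>) \<partial>M) = emeasure M {\<omega> \<in> space M. V 0 \<omega> \<in> B0} * (\<Prod>k<m. emeasure \<mu> (B k))"
  proof -
    have "(\<integral>\<^sup>+\<omega>. u 0 (\<lambda>i. V i \<omega>) \<partial>M) = (\<integral>\<^sup>+\<omega>. indicator {\<omega> \<in> space M. V 0 \<omega> \<in> B0} \<omega> * tail 0 \<partial>M)"
      by (intro nn_integral_cong) (auto simp: u_def ok_def)
    also have "\<dots> = emeasure M {\<omega> \<in> space M. V 0 \<omega> \<in> B0} * tail 0"
      by (subst nn_integral_multc) auto
    also have "tail 0 = (\<Prod>k<m. emeasure \<mu> (B k))" by (simp add: tail_def c_def C_def atLeast0LessThan)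
    finally show ?thesis .
  qed
  moreover have "(\<integral>\<^sup>+\<omega>. u (J + m) (\<lambda>i. V i \<omega>) \<partial>M) =
      emeasure M {\<omega> \<in> space M. V 0 \<omega> \<in> B0 \<and> (\<forall>k<m. V (Suc (sel_pos Q k (\<lambda>i. V i \<omega>))) \<omega> \<in> B k)}"
  proof -
    \<comment> \<open>All indices from \<open>J\<close> on are selected, so after
      \<open>J + m\<close> steps all \<open>m\<close> constraints have been decided and
      \<open>tail\<close> is 1.\<close>
    have ge: "m \<le> sel_count Q (J + m) w" for w by (rule sel_count_ge) (rule late)
    have ok_eq: "ok (J + m) w \<longleftrightarrow> w 0 \<in> B0 \<and> (\<forall>k<m. w (Suc (sel_pos Q k w)) \<in> B k)" for w
    proof (safe)
      assume "ok (J + m) w"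
      then show "w 0 \<in> B0" by (simp add: ok_def)
      fix k assume k: "k < m"
      then have k': "k < sel_count Q (J + m) w" using ge[of w] by simp
      show "w (Suc (sel_pos Q k w)) \<in> B k"
        using \<open>ok (J + m) w\<close> sel_pos[OF k'] k unfolding ok_def C_def by (metis (mono_tags))
    next
      assume *: "w 0 \<in> B0" "\<forall>k<m. w (Suc (sel_pos Q k w)) \<in> B k"
      show "ok (J + m) w" unfolding ok_def C_def using * sel_pos_eq[of Q _ w] by auto
    qed
    have u_eq: "u (J + m) w = (if w 0 \<in> B0 \<and> (\<forall>k<m. w (Suc (sel_pos Q k w)) \<in> B k) then 1 else 0)" for w
      using ge[of w] by (simp add: u_def ok_eq tail_def)
    let ?S = "{\<omega> \<in> space M. V 0 \<omega> \<in> B0 \<and> (\<forall>k<m. V (Suc (sel_pos Q k (\<lambda>i. V i \<omega>))) \<omega> \<in> B k)}"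
    have S: "?S = {\<omega> \<in> space M. ok (J + m) (\<lambda>i\<in>{..J + m}. V i \<omega>)}"
      using ok_eq ok_cong[of "J + m"] by (intro Collect_cong conj_cong refl) (metis (mono_tags, lifting) atMost_iff restrict_apply)
    have "Measurable.pred M (\<lambda>\<omega>. ok (J + m) (\<lambda>i\<in>{..J + m}. V i \<omega>))"
      by (rule measurable_compose[OF _ ok_meas]) measurable
    then have S_sets: "?S \<in> sets M" unfolding S by measurable
    have "(\<integral>\<^sup>+\<omega>. u (J + m) (\<lambda>i. V i \<omega>) \<partial>M) = (\<integral>\<^sup>+\<omega>. indicator ?S \<omega> \<partial>M)"
      by (intro nn_integral_cong) (simp add: u_eq)
    also have "\<dots> = emeasure M ?S" using S_sets by (rule nn_integral_indicator)
    finally show ?thesis .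
  qed
  ultimately show ?thesis by (simp add: \<mu>_def)
qed

definition selected :: "(nat \<Rightarrow> (nat \<Rightarrow> real) \<Rightarrow> bool) \<Rightarrow> nat \<Rightarrow> 'a \<Rightarrow> real" where
  "selected Q k \<omega> = (case k of 0 \<Rightarrow> V 0 \<omega> | Suc k \<Rightarrow> V (Suc (sel_pos Q k (\<lambda>i. V i \<omega>))) \<omega>)"

lemma selected_measurable:
  assumes Q: "adapted Q" shows "selected Q k \<in> borel_measurable M"
proof (cases k)
  case 0
  have "selected Q 0 = V 0" by (simp add: selected_def fun_eq_iff)
  then show ?thesis using 0 by simp
next
  case (Suc l)
  have W [measurable]: "(\<lambda>\<omega>. \<lambda>i\<in>{..j}. V i \<omega>) \<in> M \<rightarrow>\<^sub>M path_space j" for j by measurable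
  have [measurable]: "Measurable.pred M (\<lambda>\<omega>. Q j (\<lambda>i. V i \<omega>))" for j
  proof -
    have "Measurable.pred M (\<lambda>\<omega>. Q j (\<lambda>i\<in>{..j}. V i \<omega>))"
      by (rule measurable_compose[OF W adapted_pred[OF Q order_refl]])
    moreover have "Q j (\<lambda>i\<in>{..j}. V i \<omega>) = Q j (\<lambda>i. V i \<omega>)" for \<omega> by (rule adapted_cong[OF Q]) simp
    ultimately show ?thesis by simp
  qed
  have [measurable]: "(\<lambda>\<omega>. sel_count Q j (\<lambda>i. V i \<omega>)) \<in> M \<rightarrow>\<^sub>M count_space UNIV" for j
  proof -
    have "(\<lambda>\<omega>. sel_count Q j (\<lambda>i\<in>{..j}. V i \<omega>)) \<in> M \<rightarrow>\<^sub>M count_space UNIV"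
      by (rule measurable_compose[OF W sel_count_measurable[OF Q]]) simp
    moreover have "sel_count Q j (\<lambda>i\<in>{..j}. V i \<omega>) = sel_count Q j (\<lambda>i. V i \<omega>)" for \<omega>
      by (rule sel_count_cong[OF Q]) simp
    ultimately show ?thesis by simp
  qed
  have "(\<lambda>\<omega>. sel_pos Q l (\<lambda>i. V i \<omega>)) \<in> M \<rightarrow>\<^sub>M count_space UNIV"
    unfolding sel_pos_def by measurable
  then have "(\<lambda>\<omega>. V (Suc (sel_pos Q l (\<lambda>i. V i \<omega>))) \<omega>) \<in> borel_measurable M"
    by (rule measurable_compose_countable[rotated]) measurable
  then show ?thesis by (simp add: selected_def[abs_def] Suc)
qed

text \<open>The value on a rectangle involves only the laws of the entries 0 and 1 and not the rule.
  Applied to the rule \<open>T\<close> that selects everything, the same formula describes the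
  original sequence.\<close>

lemma optional_skipping:
  assumes Q: "adapted Q" and late: "\<And>j w. J \<le> j \<Longrightarrow> Q j w"
  shows "distr M (path_space m) (\<lambda>\<omega>. \<lambda>k\<in>{..m}. selected Q k \<omega>) = distr M (path_space m) (\<lambda>\<omega>. \<lambda>k\<in>{..m}. V k \<omega>)"
proof -
  have rect: "emeasure (distr M (path_space m) (\<lambda>\<omega>. \<lambda>k\<in>{..m}. selected Q k \<omega>)) (Pi\<^sub>E {..m} A) =
      emeasure M {\<omega> \<in> space M. V 0 \<omega> \<in> A 0} * (\<Prod>k<m. emeasure (distr M borel (V 1)) (A (Suc k)))"
    if Q: "adapted Q" and late: "\<And>j w. J \<le> j \<Longrightarrow> Q j w" and A: "\<And>i. i \<in> {..m} \<Longrightarrow> A i \<in> sets borel" for Q J A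
  proof -
    define B where "B k = (if k < m then A (Suc k) else UNIV)" for k
    have "emeasure (distr M (path_space m) (\<lambda>\<omega>. \<lambda>k\<in>{..m}. selected Q k \<omega>)) (Pi\<^sub>E {..m} A) =
        emeasure M ((\<lambda>\<omega>. \<lambda>k\<in>{..m}. selected Q k \<omega>) -` Pi\<^sub>E {..m} A \<inter> space M)"
      using A by (intro emeasure_distr measurable_restrict selected_measurable Q sets_PiM_I_finite) auto
    also have "(\<lambda>\<omega>. \<lambda>k\<in>{..m}. selected Q k \<omega>) -` Pi\<^sub>E {..m} A \<inter> space M =
        {\<omega> \<in> space M. V 0 \<omega> \<in> A 0 \<and> (\<forall>k<m. V (Suc (sel_pos Q k (\<lambda>i. V i \<omega>))) \<omega> \<in> B k)}"
    proof -
      have all: "(\<forall>k\<le>m. P k) \<longleftrightarrow> P 0 \<and> (\<forall>k<m. P (Suc k))" for P :: "nat \<Rightarrow> bool"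
        by (metis Suc_leI Suc_le_eq le0 not0_implies_Suc)
      have "(\<lambda>k\<in>{..m}. selected Q k \<omega>) \<in> Pi\<^sub>E {..m} A \<longleftrightarrow> (\<forall>k\<le>m. selected Q k \<omega> \<in> A k)" for \<omega>
        by (auto simp: PiE_iff)
      then show ?thesis unfolding all by (auto simp: selected_def B_def)
    qed
    also have "emeasure M \<dots> = emeasure M {\<omega> \<in> space M. V 0 \<omega> \<in> A 0} * (\<Prod>k<m. emeasure (distr M borel (V 1)) (B k))"
      using A by (intro optional_skipping_rect[OF Q late]) (auto simp: B_def)
    also have "(\<Prod>k<m. emeasure (distr M borel (V 1)) (B k)) = (\<Prod>k<m. emeasure (distr M borel (V 1)) (A (Suc k)))"
      by (rule prod.cong) (simp_all add: B_def)
    finally show ?thesis .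
  qed
  define T where "T = (\<lambda>(_ :: nat) (_ :: nat \<Rightarrow> real). True)"
  have T: "adapted T" by (simp add: adapted_def T_def)
  have "sel_count T k w = k" for k w by (simp add: sel_count_def T_def)
  then have "sel_pos T k w = k" for k w by (intro sel_pos_eq) (auto simp: T_def)
  then have sT: "selected T k \<omega> = V k \<omega>" for k \<omega> by (simp add: selected_def split: nat.split)
  have "distr M (path_space m) (\<lambda>\<omega>. \<lambda>k\<in>{..m}. selected Q k \<omega>) = distr M (path_space m) (\<lambda>\<omega>. \<lambda>k\<in>{..m}. selected T k \<omega>)"
  proof (rule measure_eqI_PiM_infinite[where I = "{..m}" and M = "\<lambda>_. borel"])
    fix A J' assume J': "finite J'" "J' \<subseteq> {..m}" and A: "\<And>i. i \<in> J' \<Longrightarrow> A i \<in> sets (borel :: real measure)"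
    define A' where "A' i = (if i \<in> J' then A i else UNIV)" for i
    have A': "A' i \<in> sets borel" for i using A by (simp add: A'_def)
    have emb: "prod_emb {..m} (\<lambda>_. borel) J' (Pi\<^sub>E J' A) = Pi\<^sub>E {..m} A'"
      unfolding A'_def using J'(2) by (subst prod_emb_PiE) (simp_all only: space_borel subset_UNIV)
    have late_T: "T j w" for j w by (simp add: T_def)
    show "emeasure (distr M (path_space m) (\<lambda>\<omega>. \<lambda>k\<in>{..m}. selected Q k \<omega>)) (prod_emb {..m} (\<lambda>_. borel) J' (Pi\<^sub>E J' A)) =
        emeasure (distr M (path_space m) (\<lambda>\<omega>. \<lambda>k\<in>{..m}. selected T k \<omega>)) (prod_emb {..m} (\<lambda>_. borel) J' (Pi\<^sub>E J' A))"
      unfolding emb by (rule trans[OF rect[OF Q late A'] rect[OF T late_T A', symmetric]])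
  next
    interpret D: prob_space "distr M (path_space m) (\<lambda>\<omega>. \<lambda>k\<in>{..m}. selected Q k \<omega>)"
      by (intro prob_space_distr measurable_restrict selected_measurable Q)
    show "finite_measure (distr M (path_space m) (\<lambda>\<omega>. \<lambda>k\<in>{..m}. selected Q k \<omega>))" by unfold_locales
  qed simp_all
  then show ?thesis by (simp add: sT)
qed

lemma optional_skipping_integral:
  assumes Q: "adapted Q" and late: "\<And>j w. J \<le> j \<Longrightarrow> Q j w"
    and G: "G \<in> borel_measurable (path_space m)" and G_cong: "\<And>w w'. (\<And>i. i \<le> m \<Longrightarrow> w i = w' i) \<Longrightarrow> G w = (G w' :: real)"
  shows "(\<integral>\<omega>. G (\<lambda>k. selected Q k \<omega>) \<partial>M) = (\<integral>\<omega>. G (\<lambda>k. V k \<omega>) \<partial>M)"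
proof -
  have 1: "(\<lambda>\<omega>. \<lambda>k\<in>{..m}. selected Q k \<omega>) \<in> M \<rightarrow>\<^sub>M path_space m"
    by (intro measurable_restrict selected_measurable Q)
  have 2: "(\<lambda>\<omega>. \<lambda>k\<in>{..m}. V k \<omega>) \<in> M \<rightarrow>\<^sub>M path_space m" by measurable
  have "(\<integral>\<omega>. G (\<lambda>k. selected Q k \<omega>) \<partial>M) = (\<integral>\<omega>. G (\<lambda>k\<in>{..m}. selected Q k \<omega>) \<partial>M)"
    by (intro Bochner_Integration.integral_cong refl G_cong) simp
  also have "\<dots> = (\<integral>w. G w \<partial>distr M (path_space m) (\<lambda>\<omega>. \<lambda>k\<in>{..m}. selected Q k \<omega>))"
    by (rule integral_distr[OF 1 G, symmetric])
  also have "\<dots> = (\<integral>w. G w \<partial>distr M (path_space m) (\<lambda>\<omega>. \<lambda>k\<in>{..m}. V k \<omega>))"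
    using optional_skipping[OF Q late] by simp
  also have "\<dots> = (\<integral>\<omega>. G (\<lambda>k\<in>{..m}. V k \<omega>) \<partial>M)" by (rule integral_distr[OF 2 G])
  also have "\<dots> = (\<integral>\<omega>. G (\<lambda>k. V k \<omega>) \<partial>M)"
    by (intro Bochner_Integration.integral_cong refl G_cong) simp
  finally show ?thesis .
qed

end

section \<open>Laplace exponent and increments of the process\<close>

lemma exp_compensated_bounds:
  fixes z :: real assumes "0 \<le> z"
  shows "0 \<le> exp (- z) - 1 + z" "exp (- z) - 1 + z \<le> z" "exp (- z) - 1 + z \<le> z\<^sup>2"
proof -
  show "0 \<le> exp (- z) - 1 + z" using exp_ge_add_one_self[of "- z"] by simp
  show "exp (- z) - 1 + z \<le> z" using assms by simp
  \<comment> \<open>The quadratic bound rests on \<open>(1 - z + z^2) * (1 + z) = 1 + z^3\<close>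
    and \<open>1 + z \<le> exp z\<close>.\<close>
  have "1 \<le> (1 - z + z\<^sup>2) * (1 + z)"
  proof -
    have "(1 - z + z\<^sup>2) * (1 + z) = 1 + z ^ 3" by (simp add: algebra_simps power2_eq_square power3_eq_cube)
    then show ?thesis using assms by simp
  qed
  also have "\<dots> \<le> (1 - z + z\<^sup>2) * exp z"
  proof (rule mult_left_mono)
    have "0 \<le> (z - 1/2)\<^sup>2" by simp
    then show "0 \<le> 1 - z + z\<^sup>2" by (simp add: power2_eq_square algebra_simps)
  qed (use exp_ge_add_one_self[of z] in simp)
  finally have "exp (- z) * 1 \<le> exp (- z) * ((1 - z + z\<^sup>2) * exp z)" by (intro mult_left_mono) auto
  also have "\<dots> = 1 - z + z\<^sup>2" by (simp add: exp_minus field_simps)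
  finally show "exp (- z) - 1 + z \<le> z\<^sup>2" by simp
qed

text \<open>Strictness is gained by squaring the weak inequality at \<open>z / 2\<close>; it will
  show that the exponent cannot vanish at 1.\<close>

lemma exp_gt_linear: "z \<noteq> 0 \<Longrightarrow> (1 + z::real) < exp z"
proof -
  assume z: "z \<noteq> 0"
  have "1 + z = 2 * (1 + z / 2) - 1" by simp
  also have "\<dots> < exp z"
  proof (cases "1 + z / 2 \<le> 0")
    case True
    then have "2 * (1 + z / 2) - 1 < 0" by simp
    also have "0 < exp z" by simp
    finally show ?thesis .
  next
    case False
    have "0 < z * z" using z by (cases "0 < z") (auto intro: mult_neg_neg)
    then have "2 * (1 + z / 2) - 1 < (1 + z / 2)\<^sup>2" by (simp add: power2_eq_square algebra_simps)
    also have "\<dots> \<le> (exp (z / 2))\<^sup>2" using False exp_ge_add_one_self[of "z/2"] by (intro power_mono) auto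
    also have "\<dots> = exp z" by (simp add: power2_eq_square flip: exp_add)
    finally show ?thesis .
  qed
  finally show ?thesis .
qed

definition real_exponent :: "real measure \<Rightarrow> real \<Rightarrow> real" where
  "real_exponent \<phi> l = (\<integral> y. (exp (- (l * y)) - 1 + l * y) \<partial>\<phi>)"

lemma laplace_exponent_of_real: "laplace_exponent \<phi> (of_real l) = of_real (real_exponent \<phi> l)"
proof -
  have "exp (- complex_of_real l * of_real y) - 1 + of_real l * of_real y = of_real (exp (- (l * y)) - 1 + l * y)" for y
    by (simp flip: exp_of_real)
  then show ?thesis
    unfolding laplace_exponent_def real_exponent_def by (simp only: integral_complex_of_real)
qed

context
  fixes \<phi> :: "real measure"
  assumes adm: "admissible_jump_measure \<phi>"
begin

lemma jump_measure_space: "y \<in> space \<phi> \<longleftrightarrow> 0 < y"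
  using adm sets_eq_imp_space_eq[of \<phi> "restrict_space borel {0<..}"]
  by (auto simp: admissible_jump_measure_def space_restrict_space)

lemma jump_measure_measurable: "f \<in> borel_measurable borel \<Longrightarrow> f \<in> borel_measurable \<phi>"
proof -
  assume "f \<in> borel_measurable borel"
  then have "f \<in> borel_measurable (restrict_space borel {0<..})" by (rule measurable_restrict_space1)
  then show ?thesis using adm by (simp add: admissible_jump_measure_def cong: measurable_cong_sets)
qed

lemma jump_measure_integrable: "integrable \<phi> (\<lambda>y. min (y\<^sup>2) y)"
proof (rule integrableI_nonneg)
  show "(\<lambda>y. min (y\<^sup>2) y) \<in> borel_measurable \<phi>" by (rule jump_measure_measurable) measurable
  show "AE y in \<phi>. 0 \<le> min (y\<^sup>2) y" by (rule AE_I2) (simp add: jump_measure_space)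
  show "(\<integral>\<^sup>+ y. ennreal (min (y\<^sup>2) y) \<partial>\<phi>) < \<infinity>" using adm by (simp add: admissible_jump_measure_def)
qed

lemma compensated_bound:
  fixes l y :: real
  assumes "0 < l" "0 < y"
  shows "\<bar>exp (- (l * y)) - 1 + l * y\<bar> \<le> max l (l\<^sup>2) * min (y\<^sup>2) y"
proof -
  have ly: "0 \<le> l * y" by (rule mult_nonneg_nonneg) (use assms in auto)
  have "l * y \<le> max l (l\<^sup>2) * y" using assms by (intro mult_right_mono) auto
  then have "exp (- (l * y)) - 1 + l * y \<le> max l (l\<^sup>2) * y"
    using exp_compensated_bounds(2)[OF ly] by linarith
  moreover have "exp (- (l * y)) - 1 + l * y \<le> max l (l\<^sup>2) * y\<^sup>2"
  proof -
    have "l\<^sup>2 * y\<^sup>2 \<le> max l (l\<^sup>2) * y\<^sup>2" by (intro mult_right_mono) auto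
    then show ?thesis using exp_compensated_bounds(3)[OF ly] by (simp only: power_mult_distrib)
  qed
  ultimately have "exp (- (l * y)) - 1 + l * y \<le> max l (l\<^sup>2) * min (y\<^sup>2) y" by (simp add: min_def)
  then show ?thesis using exp_compensated_bounds(1)[OF ly] by simp
qed

lemma compensated_integrable:
  assumes "0 < l" shows "integrable \<phi> (\<lambda>y. exp (- (l * y)) - 1 + l * y)"
proof (rule Bochner_Integration.integrable_bound)
  show "integrable \<phi> (\<lambda>y. max l (l\<^sup>2) * min (y\<^sup>2) y)" using jump_measure_integrable by simp
  show "(\<lambda>y. exp (- (l * y)) - 1 + l * y) \<in> borel_measurable \<phi>" by (rule jump_measure_measurable) measurable
  show "AE y in \<phi>. norm (exp (- (l * y)) - 1 + l * y) \<le> norm (max l (l\<^sup>2) * min (y\<^sup>2) y)"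
  proof (rule AE_I2)
    fix y assume "y \<in> space \<phi>"
    then show "norm (exp (- (l * y)) - 1 + l * y) \<le> norm (max l (l\<^sup>2) * min (y\<^sup>2) y)"
      using order_trans[OF compensated_bound[OF assms, of y] abs_ge_self] by (simp only: jump_measure_space real_norm_def)
  qed
qed

lemma real_exponent_nonneg: "0 < l \<Longrightarrow> 0 \<le> real_exponent \<phi> l"
  unfolding real_exponent_def
proof (intro Bochner_Integration.integral_nonneg)
  fix y assume "0 < l" "y \<in> space \<phi>"
  then show "0 \<le> exp (- (l * y)) - 1 + l * y"
    by (intro exp_compensated_bounds(1)) (simp add: jump_measure_space)
qed

text \<open>Over a time \<open>2^-n\<close> and with \<open>l^2 = 2^n\<close>, this keeps the
  exponent bounded; that scaling drives the estimate of downward steps.\<close>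

lemma real_exponent_quadratic: "\<exists>C\<ge>0. \<forall>l\<ge>1. real_exponent \<phi> l \<le> C * l\<^sup>2"
proof (intro exI[of _ "\<integral>y. min (y\<^sup>2) y \<partial>\<phi>"] conjI allI impI)
  show "0 \<le> (\<integral>y. min (y\<^sup>2) y \<partial>\<phi>)"
    by (intro Bochner_Integration.integral_nonneg) (simp add: jump_measure_space)
  fix l :: real assume l: "1 \<le> l"
  then have "l * 1 \<le> l * l" by (intro mult_left_mono) auto
  then have max: "max l (l\<^sup>2) = l\<^sup>2" by (simp add: power2_eq_square)
  have "real_exponent \<phi> l \<le> (\<integral>y. l\<^sup>2 * min (y\<^sup>2) y \<partial>\<phi>)"
    unfolding real_exponent_def
  proof (rule integral_mono)
    show "integrable \<phi> (\<lambda>y. exp (- (l * y)) - 1 + l * y)" using l by (intro compensated_integrable) auto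
    show "integrable \<phi> (\<lambda>y. l\<^sup>2 * min (y\<^sup>2) y)" using jump_measure_integrable by simp
    fix y assume "y \<in> space \<phi>"
    then show "exp (- (l * y)) - 1 + l * y \<le> l\<^sup>2 * min (y\<^sup>2) y"
      using compensated_bound[of l y] l max by (simp add: jump_measure_space abs_le_iff)
  qed
  then show "real_exponent \<phi> l \<le> (\<integral>y. min (y\<^sup>2) y \<partial>\<phi>) * l\<^sup>2" by (simp add: mult.commute)
qed

text \<open>The exponent has zero slope at 0, which means that the process is centred. For
  \<open>l \<le> 1\<close> the quotients are dominated by \<open>min (y^2) y\<close> itself.\<close>

lemma real_exponent_small:
  assumes "\<And>n. 0 < l n" "\<And>n. l n \<le> 1" "l \<longlonglongrightarrow> 0"
  shows "(\<lambda>n. real_exponent \<phi> (l n) / l n) \<longlonglongrightarrow> 0"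
proof -
  have "(\<lambda>n. \<integral>y. (exp (- (l n * y)) - 1 + l n * y) / l n \<partial>\<phi>) \<longlonglongrightarrow> (\<integral>y. 0 \<partial>\<phi>)"
  proof (rule integral_dominated_convergence[where w = "\<lambda>y. min (y\<^sup>2) y"])
    show "integrable \<phi> (\<lambda>y. min (y\<^sup>2) y)" by (rule jump_measure_integrable)
    show "(\<lambda>y. (exp (- (l n * y)) - 1 + l n * y) / l n) \<in> borel_measurable \<phi>" for n
      by (rule jump_measure_measurable) measurable
    show "AE y in \<phi>. (\<lambda>n. (exp (- (l n * y)) - 1 + l n * y) / l n) \<longlonglongrightarrow> 0"
    proof (rule AE_I2)
      fix y assume "y \<in> space \<phi>"
      then have y: "0 < y" by (simp add: jump_measure_space)
      show "(\<lambda>n. (exp (- (l n * y)) - 1 + l n * y) / l n) \<longlonglongrightarrow> 0"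
      proof (rule tendsto_sandwich[where f = "\<lambda>_. 0" and h = "\<lambda>n. l n * y\<^sup>2"])
        show "\<forall>\<^sub>F n in sequentially. 0 \<le> (exp (- (l n * y)) - 1 + l n * y) / l n"
          using assms(1) y by (intro always_eventually allI divide_nonneg_pos exp_compensated_bounds(1)) (auto intro: less_imp_le)
        show "\<forall>\<^sub>F n in sequentially. (exp (- (l n * y)) - 1 + l n * y) / l n \<le> l n * y\<^sup>2"
        proof (intro always_eventually allI)
          fix n
          have "exp (- (l n * y)) - 1 + l n * y \<le> (l n * y)\<^sup>2"
            using assms(1)[of n] y by (intro exp_compensated_bounds(3)) auto
          then show "(exp (- (l n * y)) - 1 + l n * y) / l n \<le> l n * y\<^sup>2"
            using assms(1)[of n] by (simp add: divide_simps power2_eq_square mult_ac)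
        qed
        show "(\<lambda>n. l n * y\<^sup>2) \<longlonglongrightarrow> 0" using tendsto_mult_right[OF assms(3), of "y\<^sup>2"] by simp
      qed simp
    qed
    show "AE y in \<phi>. norm ((exp (- (l n * y)) - 1 + l n * y) / l n) \<le> min (y\<^sup>2) y" for n
    proof (rule AE_I2)
      fix y assume "y \<in> space \<phi>"
      then have y: "0 < y" by (simp add: jump_measure_space)
      have "l n * l n \<le> l n * 1" using assms(1,2)[of n] by (intro mult_left_mono) auto
      then have "max (l n) ((l n)\<^sup>2) = l n" by (simp add: power2_eq_square)
      then have "\<bar>exp (- (l n * y)) - 1 + l n * y\<bar> \<le> l n * min (y\<^sup>2) y"
        using compensated_bound[OF assms(1)[of n] y] by simp
      then show "norm ((exp (- (l n * y)) - 1 + l n * y) / l n) \<le> min (y\<^sup>2) y"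
        using assms(1)[of n] by (simp only: real_norm_def abs_divide abs_of_pos pos_divide_le_eq mult.commute)
    qed
  qed simp
  then show ?thesis by (simp add: real_exponent_def)
qed

text \<open>A vanishing integral of the strictly positive integrand would make the jump measure
  null, against the infinite integral of \<open>y\<close> near 0.\<close>

lemma real_exponent_pos: "0 < real_exponent \<phi> 1"
proof (rule ccontr)
  assume "\<not> 0 < real_exponent \<phi> 1"
  then have 0: "(\<integral> y. (exp (- (1 * y)) - 1 + 1 * y) \<partial>\<phi>) = 0"
    using real_exponent_nonneg[of 1] by (simp add: real_exponent_def)
  have nn: "AE y in \<phi>. 0 \<le> exp (- (1 * y)) - 1 + 1 * y"
  proof (rule AE_I2)
    fix y assume "y \<in> space \<phi>"
    then show "0 \<le> exp (- (1 * y)) - 1 + 1 * y" by (intro exp_compensated_bounds(1)) (simp add: jump_measure_space)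
  qed
  have "integrable \<phi> (\<lambda>y. exp (- (1 * y)) - 1 + 1 * y)" by (rule compensated_integrable) simp
  then have "AE y in \<phi>. exp (- (1 * y)) - 1 + 1 * y = 0"
    using integral_nonneg_eq_0_iff_AE[OF _ nn] 0 by simp
  then have "AE y in \<phi>. False"
  proof (rule AE_mp, intro AE_I2 impI)
    fix y assume "y \<in> space \<phi>" "exp (- (1 * y)) - 1 + 1 * y = 0"
    then show False using exp_gt_linear[of "- y"] by (simp add: jump_measure_space)
  qed
  then have "(\<integral>\<^sup>+ y \<in> {0<..<1}. ennreal y \<partial>\<phi>) = (\<integral>\<^sup>+ y. 0 \<partial>\<phi>)"
    by (intro nn_integral_cong_AE) (auto elim: AE_mp)
  then show False using adm by (simp add: admissible_jump_measure_def)
qed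

end

section \<open>Laplace transforms of the increments\<close>

locale levy_process = prob_space M for M :: "'a measure" +
  fixes \<phi> :: "real measure" and Y :: "real \<Rightarrow> 'a \<Rightarrow> real"
  assumes adm: "admissible_jump_measure \<phi>"
    and levy: "cadlag_levy_process M Y"
    and exponent: "has_laplace_exponent M Y (laplace_exponent \<phi>)"
begin

lemma Y_measurable [measurable]: "0 \<le> t \<Longrightarrow> Y t \<in> borel_measurable M"
  using levy by (simp add: cadlag_levy_process_def)

lemma Y_cadlag: "\<omega> \<in> space M \<Longrightarrow> cadlag (\<lambda>t. Y t \<omega>)"
  using levy by (simp add: cadlag_levy_process_def)

definition steps :: "real \<Rightarrow> nat \<Rightarrow> 'a \<Rightarrow> real" where
  "steps h i \<omega> = (case i of 0 \<Rightarrow> Y 0 \<omega> | Suc j \<Rightarrow> grid_step (\<lambda>t. Y t \<omega>) h j)"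

lemma steps_simps [simp]:
  "steps h 0 \<omega> = Y 0 \<omega>" "steps h (Suc j) \<omega> = Y (real (Suc j) * h) \<omega> - Y (real j * h) \<omega>"
  by (simp_all add: steps_def grid_step_def)

lemma steps_iid: assumes h: "0 \<le> h" shows "iid_increments M (steps h)"
proof unfold_locales
  fix n :: nat
  define \<tau> where "\<tau> j = real j * h" for j :: nat
  have "\<tau> 0 = 0" "mono \<tau>" using h by (auto simp: \<tau>_def mono_def intro: mult_right_mono)
  then have "indep_vars (\<lambda>_. borel) (\<lambda>i \<omega>. case i of 0 \<Rightarrow> Y 0 \<omega> | Suc j \<Rightarrow> Y (\<tau> (Suc j)) \<omega> - Y (\<tau> j) \<omega>) {..n}"
    using levy unfolding cadlag_levy_process_def by blast
  moreover have "(\<lambda>i \<omega>. case i of 0 \<Rightarrow> Y 0 \<omega> | Suc j \<Rightarrow> Y (\<tau> (Suc j)) \<omega> - Y (\<tau> j) \<omega>) = steps h"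
    by (intro ext) (simp add: steps_def grid_step_def \<tau>_def split: nat.split)
  ultimately show "indep_vars (\<lambda>_. borel) (steps h) {..n}" by simp
next
  fix i
  have "distr M borel (\<lambda>\<omega>. Y (real i * h + h) \<omega> - Y (real i * h) \<omega>) = distr M borel (\<lambda>\<omega>. Y h \<omega> - Y 0 \<omega>)"
    using levy h unfolding cadlag_levy_process_def by auto
  then show "distr M borel (steps h (Suc i)) = distr M borel (steps h 1)"
    by (simp add: steps_def[abs_def] grid_step_def algebra_simps)
qed

lemma laplace_one:
  assumes "0 \<le> l"
  shows "(\<integral>\<^sup>+\<omega>. ennreal (exp (- (l * (Y 1 \<omega> - Y 0 \<omega>)))) \<partial>M) = ennreal (exp (real_exponent \<phi> l))"
proof -
  have "exp (- complex_of_real l * of_real (Y 1 \<omega> - Y 0 \<omega>)) = of_real (exp (- (l * (Y 1 \<omega> - Y 0 \<omega>))))" for \<omega>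
    by (simp flip: exp_of_real)
  then have "complex_of_real (\<integral>\<omega>. exp (- (l * (Y 1 \<omega> - Y 0 \<omega>))) \<partial>M) = exp (laplace_exponent \<phi> (of_real l))"
    using exponent[unfolded has_laplace_exponent_def, rule_format, of "of_real l"] assms
    by (simp only: integral_complex_of_real Re_complex_of_real)
  then have eq: "(\<integral>\<omega>. exp (- (l * (Y 1 \<omega> - Y 0 \<omega>))) \<partial>M) = exp (real_exponent \<phi> l)"
    unfolding laplace_exponent_of_real exp_of_real of_real_eq_iff .
  \<comment> \<open>A function that is not integrable would have Bochner integral 0, but the value
    is an exponential.\<close>
  then have "integrable M (\<lambda>\<omega>. exp (- (l * (Y 1 \<omega> - Y 0 \<omega>))))"
    using not_integrable_integral_eq by fastforce
  then show ?thesis using eq by (subst nn_integral_eq_integral) auto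
qed

lemma laplace_power:
  assumes h: "0 \<le> h"
  shows "(\<integral>\<^sup>+\<omega>. ennreal (exp (- (l * (Y (real n * h) \<omega> - Y 0 \<omega>)))) \<partial>M) =
    (\<integral>\<^sup>+\<omega>. ennreal (exp (- (l * (Y h \<omega> - Y 0 \<omega>)))) \<partial>M) ^ n"
proof -
  interpret S: iid_increments M "steps h" by (rule steps_iid[OF h])
  define E where "E i \<omega> = ennreal (exp (- (l * steps h i \<omega>)))" for i \<omega>
  have "indep_vars (\<lambda>_. borel) (steps h) {Suc 0..n}"
    by (rule indep_vars_subset[OF S.indep[of n]]) auto
  then have ind: "indep_vars (\<lambda>_. borel) E {Suc 0..n}"
    unfolding E_def by (rule indep_vars_compose2) measurable
  have id0: "distr M borel (steps h (Suc i)) = distr M borel (steps h (Suc 0))" for i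
    using S.ident[of i] by (simp only: One_nat_def)
  have same: "(\<integral>\<^sup>+\<omega>. E (Suc i) \<omega> \<partial>M) = (\<integral>\<^sup>+\<omega>. ennreal (exp (- (l * (Y h \<omega> - Y 0 \<omega>)))) \<partial>M)" for i
  proof -
    have "(\<integral>\<^sup>+\<omega>. ennreal (exp (- (l * steps h (Suc i) \<omega>))) \<partial>M) = (\<integral>\<^sup>+x. ennreal (exp (- (l * x))) \<partial>distr M borel (steps h (Suc i)))" for i
      by (rule nn_integral_distr[symmetric]) (rule S.V_measurable, measurable)
    then have "(\<integral>\<^sup>+\<omega>. E (Suc i) \<omega> \<partial>M) = (\<integral>\<^sup>+\<omega>. ennreal (exp (- (l * steps h (Suc 0) \<omega>))) \<partial>M)"
      unfolding E_def by (simp only: id0[of i])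
    then show ?thesis by simp
  qed
  have sum: "(\<Sum>i=Suc 0..n. steps h i \<omega>) = Y (real n * h) \<omega> - Y 0 \<omega>" for \<omega>
    using sum_lessThan_telescope[of "\<lambda>i. Y (real i * h) \<omega>" n] by (simp add: sum.atLeast1_atMost_eq)
  have "ennreal (exp (- (l * (Y (real n * h) \<omega> - Y 0 \<omega>)))) = (\<Prod>i=Suc 0..n. E i \<omega>)" for \<omega>
    unfolding sum[symmetric] E_def by (simp add: prod_ennreal sum_distrib_left exp_sum flip: sum_negf)
  then have "(\<integral>\<^sup>+\<omega>. ennreal (exp (- (l * (Y (real n * h) \<omega> - Y 0 \<omega>)))) \<partial>M) = (\<integral>\<^sup>+\<omega>. (\<Prod>i=Suc 0..n. E i \<omega>) \<partial>M)" by simp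
  also have "\<dots> = (\<Prod>i=Suc 0..n. \<integral>\<^sup>+\<omega>. E i \<omega> \<partial>M)" by (rule indep_vars_nn_integral[OF _ ind]) auto
  also have "\<dots> = (\<Prod>i<n. \<integral>\<^sup>+\<omega>. E (Suc i) \<omega> \<partial>M)" by (rule prod.atLeast1_atMost_eq)
  finally show ?thesis by (simp add: same)
qed

lemma laplace_nat:
  assumes "0 \<le> l"
  shows "(\<integral>\<^sup>+\<omega>. ennreal (exp (- (l * (Y (real n) \<omega> - Y 0 \<omega>)))) \<partial>M) = ennreal (exp (real n * real_exponent \<phi> l))"
proof -
  have "(\<integral>\<^sup>+\<omega>. ennreal (exp (- (l * (Y (real n) \<omega> - Y 0 \<omega>)))) \<partial>M) = ennreal (exp (real_exponent \<phi> l)) ^ n"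
    using laplace_power[of 1 l n] laplace_one[OF assms] by simp
  then show ?thesis by (simp only: ennreal_power exp_ge_zero exp_of_nat_mult)
qed

text \<open>The unit increment is a sum of \<open>2^n\<close> independent copies of the short one,
  and a nonnegative real has only one nonnegative root of order \<open>2^n\<close>. The transform
  has to be shown finite before the root is taken.\<close>

lemma laplace_dyadic:
  assumes "0 \<le> l"
  shows "(\<integral>\<^sup>+\<omega>. ennreal (exp (- (l * (Y ((1/2) ^ n) \<omega> - Y 0 \<omega>)))) \<partial>M) = ennreal (exp (real_exponent \<phi> l / 2 ^ n))"
proof -
  define L where "L = (\<integral>\<^sup>+\<omega>. ennreal (exp (- (l * (Y ((1/2) ^ n) \<omega> - Y 0 \<omega>)))) \<partial>M)"
  have "real (2 ^ n) * (1/2) ^ n = (1::real)" by (simp add: power_one_over)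
  then have L: "L ^ (2 ^ n) = ennreal (exp (real_exponent \<phi> l))"
    using laplace_power[of "(1/2)^n" l "2 ^ n"] laplace_one[OF assms] by (simp add: L_def)
  have "L \<noteq> \<infinity>"
  proof
    assume "L = \<infinity>"
    then have "\<infinity> = ennreal (exp (real_exponent \<phi> l))" using L by (simp add: power_eq_top_ennreal)
    then show False by simp
  qed
  then obtain x where x: "L = ennreal x" "0 \<le> x" by (cases L) auto
  have "x ^ (2 ^ n) = exp (real_exponent \<phi> l)" using L x by (simp add: ennreal_power)
  also have "\<dots> = exp (real_exponent \<phi> l / 2 ^ n) ^ (2 ^ n)"
    by (simp flip: exp_of_nat_mult)
  finally have "x = exp (real_exponent \<phi> l / 2 ^ n)"
    by (rule power_eq_imp_eq_base) (simp_all add: x(2))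
  then show ?thesis using x(1) by (simp add: L_def)
qed

end

section \<open>Downward steps of the sampled process\<close>

context levy_process
begin

text \<open>Chernoff's bound with \<open>l = 2^(n/2)\<close>: the exponent over a time
  \<open>2^-n\<close> is then at most \<open>C\<close>, while \<open>exp (- (l * a))\<close> decays
  faster than any power of \<open>l\<close>. The fourth power is kept, since \<open>4^-n\<close>
  remains summable after multiplication by the \<open>T * 2^n\<close> steps of a grid.\<close>

lemma down_step_prob:
  assumes "0 < a"
  shows "\<exists>D\<ge>0. \<forall>n. measure M {\<omega> \<in> space M. Y ((1/2) ^ n) \<omega> - Y 0 \<omega> \<le> - a} \<le> D / 4 ^ n"
proof -
  obtain C where C: "0 \<le> C" "\<And>l. 1 \<le> l \<Longrightarrow> real_exponent \<phi> l \<le> C * l\<^sup>2"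
    using real_exponent_quadratic[OF adm] by blast
  \<comment> \<open>\<open>256 = 4^4\<close> comes from
    \<open>(l * a / 4)^4 \<le> exp (l * a)\<close>, combined with \<open>l^4 = 4^n\<close>.\<close>
  define D where "D = exp C * (256 / a ^ 4)"
  show ?thesis
  proof (intro exI[of _ D] conjI allI)
    show "0 \<le> D" by (simp add: D_def)
    fix n
    define l where "l = sqrt (2 ^ n)"
    have l2: "l\<^sup>2 = 2 ^ n" by (simp add: l_def)
    have l1: "1 \<le> l" by (simp add: l_def)
    let ?h = "(1/2::real) ^ n"
    have [measurable]: "Y ?h \<in> borel_measurable M" "Y 0 \<in> borel_measurable M" by (auto intro: Y_measurable)
    let ?A = "{\<omega> \<in> space M. Y ?h \<omega> - Y 0 \<omega> \<le> - a}"
    have "emeasure M ?A = (\<integral>\<^sup>+\<omega>. indicator ?A \<omega> \<partial>M)" by simp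
    also have "\<dots> \<le> (\<integral>\<^sup>+\<omega>. ennreal (exp (- (l * a))) * ennreal (exp (- (l * (Y ?h \<omega> - Y 0 \<omega>)))) \<partial>M)"
    proof (rule nn_integral_mono)
      fix \<omega> assume "\<omega> \<in> space M"
      show "indicator ?A \<omega> \<le> ennreal (exp (- (l * a))) * ennreal (exp (- (l * (Y ?h \<omega> - Y 0 \<omega>))))"
      proof (cases "\<omega> \<in> ?A")
        case True
        then have "l * (a + (Y ?h \<omega> - Y 0 \<omega>)) \<le> l * 0" using l1 by (intro mult_left_mono) auto
        then have "0 \<le> - (l * a) + - (l * (Y ?h \<omega> - Y 0 \<omega>))" by (simp add: algebra_simps)
        then have "1 \<le> exp (- (l * a) + - (l * (Y ?h \<omega> - Y 0 \<omega>)))" by simp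
        then have "1 \<le> exp (- (l * a)) * exp (- (l * (Y ?h \<omega> - Y 0 \<omega>)))" by (simp only: exp_add)
        then have "ennreal 1 \<le> ennreal (exp (- (l * a)) * exp (- (l * (Y ?h \<omega> - Y 0 \<omega>))))" by (rule ennreal_leI)
        then show ?thesis using True by (simp add: ennreal_mult)
      qed simp
    qed
    also have "\<dots> = ennreal (exp (- (l * a))) * ennreal (exp (real_exponent \<phi> l / 2 ^ n))"
      using l1 by (subst nn_integral_cmult) (auto simp: laplace_dyadic)
    also have "\<dots> = ennreal (exp (- (l * a)) * exp (real_exponent \<phi> l / 2 ^ n))" by (simp add: ennreal_mult)
    also have "\<dots> \<le> ennreal (D / 4 ^ n)"
    proof (rule ennreal_leI)
      have "real_exponent \<phi> l / 2 ^ n \<le> C" using C(2)[OF l1] l2 by (simp add: divide_simps)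
      then have 1: "exp (real_exponent \<phi> l / 2 ^ n) \<le> exp C" by simp
      have la: "0 < l * a" using l1 assms by simp
      have "(l * a / 4) ^ 4 \<le> (exp (l * a / 4)) ^ 4"
      proof (rule power_mono)
        show "l * a / 4 \<le> exp (l * a / 4)" using exp_ge_add_one_self[of "l * a / 4"] by linarith
      qed (use la in simp)
      also have "\<dots> = exp (l * a)" by (simp flip: exp_of_nat_mult)
      finally have "inverse (exp (l * a)) \<le> inverse ((l * a / 4) ^ 4)"
        using la by (intro le_imp_inverse_le) auto
      then have "exp (- (l * a)) \<le> 1 / (l * a / 4) ^ 4"
        by (simp only: exp_minus inverse_eq_divide)
      also have "\<dots> = (256 / a ^ 4) / 4 ^ n"
      proof -
        have "l ^ 4 = (l\<^sup>2)\<^sup>2" by (simp flip: power_mult)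
        also have "\<dots> = 4 ^ n" unfolding l2 by (simp add: power2_eq_square flip: power_mult_distrib)
        finally show ?thesis using assms by (simp add: power_divide power_mult_distrib)
      qed
      finally have "exp (- (l * a)) * exp (real_exponent \<phi> l / 2 ^ n) \<le> (256 / a ^ 4) / 4 ^ n * exp C"
        using 1 by (intro mult_mono) auto
      then show "exp (- (l * a)) * exp (real_exponent \<phi> l / 2 ^ n) \<le> D / 4 ^ n" by (simp add: D_def mult.commute)
    qed
    finally show "measure M ?A \<le> D / 4 ^ n"
      using \<open>0 \<le> D\<close> by (simp add: emeasure_eq_measure)
  qed
qed

text \<open>The form in which the absence of negative jumps is used on paths. A union bound over
  \<open>T * 2^n\<close> steps leaves probabilities of order \<open>2^-n\<close>, so Borel-Cantelli
  applies; the thresholds \<open>1/(k+1)\<close> reduce all \<open>a\<close> to countably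
  many.\<close>

lemma small_down_steps:
  "AE \<omega> in M. \<forall>T::nat. \<forall>a>0. \<forall>\<^sub>F n in sequentially. \<forall>j<T * 2 ^ n. - a < grid_step (\<lambda>t. Y t \<omega>) ((1/2) ^ n) j"
proof -
  have "AE \<omega> in M. \<forall>\<^sub>F n in sequentially. \<forall>j<T * 2 ^ n. - a < grid_step (\<lambda>t. Y t \<omega>) ((1/2) ^ n) j"
    if a: "0 < a" for T :: nat and a :: real
  proof -
    obtain D where D: "0 \<le> D" "\<And>n. measure M {\<omega> \<in> space M. Y ((1/2) ^ n) \<omega> - Y 0 \<omega> \<le> - a} \<le> D / 4 ^ n"
      using down_step_prob[OF a] by blast
    define A where "A n = (\<Union>j<T * 2 ^ n. {\<omega> \<in> space M. steps ((1/2) ^ n) (Suc j) \<omega> \<le> - a})" for n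
    have S: "steps ((1/2) ^ n) j \<in> borel_measurable M" for n j
    proof -
      interpret S: iid_increments M "steps ((1/2) ^ n)" by (rule steps_iid) simp
      show ?thesis by (rule S.V_measurable)
    qed
    have set: "{\<omega> \<in> space M. steps ((1/2) ^ n) (Suc j) \<omega> \<le> - a} \<in> sets M" for n j using S[of n "Suc j"] by measurable
    have A: "A n \<in> sets M" for n unfolding A_def using set by auto
    have bound: "measure M (A n) \<le> (real T * D) * (1/2) ^ n" for n
    proof -
      interpret S: iid_increments M "steps ((1/2) ^ n)" by (rule steps_iid) simp
      have same: "measure M {\<omega> \<in> space M. steps ((1/2) ^ n) (Suc j) \<omega> \<le> - a} = measure M {\<omega> \<in> space M. Y ((1/2) ^ n) \<omega> - Y 0 \<omega> \<le> - a}" for j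
      proof -
        have "measure M {\<omega> \<in> space M. steps ((1/2) ^ n) (Suc j) \<omega> \<le> - a} = measure (distr M borel (steps ((1/2) ^ n) (Suc j))) {..- a}" for j
          using S by (subst measure_distr) (auto intro!: arg_cong[where f = "measure M"])
        then have "measure M {\<omega> \<in> space M. steps ((1/2) ^ n) (Suc j) \<omega> \<le> - a} = measure M {\<omega> \<in> space M. steps ((1/2) ^ n) (Suc 0) \<omega> \<le> - a}"
          using S.ident[of j] by (simp only: One_nat_def)
        then show ?thesis by simp
      qed
      have "measure M (A n) \<le> (\<Sum>j<T * 2 ^ n. measure M {\<omega> \<in> space M. steps ((1/2) ^ n) (Suc j) \<omega> \<le> - a})"
        unfolding A_def using set by (intro finite_measure_subadditive_finite) auto
      also have "\<dots> = real (T * 2 ^ n) * measure M {\<omega> \<in> space M. Y ((1/2) ^ n) \<omega> - Y 0 \<omega> \<le> - a}"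
        unfolding same by simp
      also have "\<dots> \<le> real (T * 2 ^ n) * (D / 4 ^ n)" by (intro mult_left_mono D) auto
      also have "\<dots> = (real T * D) * (1/2) ^ n"
      proof -
        have "(4::real) ^ n = 2 ^ n * 2 ^ n" by (simp flip: power_mult_distrib)
        then show ?thesis by (simp add: power_one_over)
      qed
      finally show ?thesis .
    qed
    have "summable (\<lambda>n. measure M (A n))"
    proof (rule summable_comparison_test'[where g = "\<lambda>n. (real T * D) * (1/2) ^ n"])
      show "summable (\<lambda>n. (real T * D) * (1/2) ^ n)" by (intro summable_mult summable_geometric) simp
      show "norm (measure M (A n)) \<le> (real T * D) * (1/2) ^ n" for n using bound[of n] by simp
    qed
    then have "AE \<omega> in M. \<forall>\<^sub>F n in sequentially. \<omega> \<in> space M - A n"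
      by (intro borel_cantelli_AE1 A) (auto simp: emeasure_eq_measure)
    then show ?thesis
    proof (rule AE_mp, intro AE_I2 impI)
      fix \<omega> assume w: "\<omega> \<in> space M" and ev: "\<forall>\<^sub>F n in sequentially. \<omega> \<in> space M - A n"
      show "\<forall>\<^sub>F n in sequentially. \<forall>j<T * 2 ^ n. - a < grid_step (\<lambda>t. Y t \<omega>) ((1/2) ^ n) j"
        using ev by eventually_elim (use w in \<open>auto simp: A_def steps_def not_le[symmetric]\<close>)
    qed
  qed
  then have "AE \<omega> in M. \<forall>T::nat. \<forall>k::nat. \<forall>\<^sub>F n in sequentially. \<forall>j<T * 2 ^ n. - inverse (real (Suc k)) < grid_step (\<lambda>t. Y t \<omega>) ((1/2) ^ n) j"
    by (simp add: AE_all_countable)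
  then show ?thesis
  proof (rule AE_mp, intro AE_I2 impI allI)
    fix \<omega> and T :: nat and a :: real
    assume *: "\<forall>T::nat. \<forall>k::nat. \<forall>\<^sub>F n in sequentially. \<forall>j<T * 2 ^ n. - inverse (real (Suc k)) < grid_step (\<lambda>t. Y t \<omega>) ((1/2) ^ n) j"
    assume "0 < a"
    then obtain k where k: "inverse (real (Suc k)) < a" using reals_Archimedean by blast
    have "\<forall>\<^sub>F n in sequentially. \<forall>j<T * 2 ^ n. - inverse (real (Suc k)) < grid_step (\<lambda>t. Y t \<omega>) ((1/2) ^ n) j" using * by blast
    then show "\<forall>\<^sub>F n in sequentially. \<forall>j<T * 2 ^ n. - a < grid_step (\<lambda>t. Y t \<omega>) ((1/2) ^ n) j"
      by eventually_elim (use k in force)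
  qed
qed

end

section \<open>The process is unbounded below\<close>

primrec dmin :: "nat \<Rightarrow> (nat \<Rightarrow> real) \<Rightarrow> real" where
  "dmin 0 x = 0"
| "dmin (Suc n) x = min 0 (x 0 + dmin n (\<lambda>i. x (Suc i)))"

lemma dmin_attained: "\<exists>k\<le>n. dmin n x = (\<Sum>i<k. x i)"
proof (induction n arbitrary: x)
  case (Suc n)
  obtain k where k: "k \<le> n" "dmin n (\<lambda>i. x (Suc i)) = (\<Sum>i<k. x (Suc i))" using Suc by blast
  show ?case
  proof (cases "0 \<le> x 0 + dmin n (\<lambda>i. x (Suc i))")
    case True
    then show ?thesis by (intro exI[of _ 0]) simp
  next
    case False
    then show ?thesis using k by (intro exI[of _ "Suc k"]) (simp only: dmin.simps sum.lessThan_Suc_shift, simp)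
  qed
qed simp

lemma dmin_measurable:
  "(\<And>i. i < n \<Longrightarrow> i + k \<in> I) \<Longrightarrow> (\<lambda>w. dmin n (\<lambda>i. w (i + k))) \<in> borel_measurable (Pi\<^sub>M I (\<lambda>_. borel))"
proof (induction n arbitrary: k)
  case (Suc n)
  have "(\<lambda>w. dmin n (\<lambda>i. w (i + Suc k))) \<in> borel_measurable (Pi\<^sub>M I (\<lambda>_. borel))"
  proof (rule Suc.IH)
    fix i assume "i < n"
    then show "i + Suc k \<in> I" using Suc.prems[of "Suc i"] by simp
  qed
  moreover have "(\<lambda>w. w k) \<in> borel_measurable (Pi\<^sub>M I (\<lambda>_. borel))"
    using Suc.prems[of 0] by (intro measurable_component_singleton) auto
  moreover have "(\<lambda>i. w (Suc i + k)) = (\<lambda>i. w (i + Suc k))" for w :: "nat \<Rightarrow> real" by simp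
  ultimately show ?case
    by (simp only: dmin.simps add_0_left) (intro borel_measurable_min borel_measurable_const borel_measurable_add)
qed simp

lemma dmin_cong: "(\<And>i. i < n \<Longrightarrow> x i = y i) \<Longrightarrow> dmin n x = dmin n y"
proof (induction n arbitrary: x y)
  case (Suc n)
  have "dmin n (\<lambda>i. x (Suc i)) = dmin n (\<lambda>i. y (Suc i))" using Suc.prems by (intro Suc.IH) auto
  then show ?case using Suc.prems[of 0] by simp
qed simp

context iid_increments
begin

text \<open>Dropping the first increment is a selection rule too: selecting from index 1 on gives
  the shifted sequence except at entry 0, which \<open>G\<close> ignores.\<close>

lemma shift_integral:
  assumes G: "G \<in> borel_measurable (path_space m)" and G_cong: "\<And>w w'. (\<And>i. i \<le> m \<Longrightarrow> w i = w' i) \<Longrightarrow> G w = (G w' :: real)"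
    and G0: "\<And>w x. G (w(0 := x)) = G w"
  shows "(\<integral>\<omega>. G (\<lambda>k. V (Suc k) \<omega>) \<partial>M) = (\<integral>\<omega>. G (\<lambda>k. V k \<omega>) \<partial>M)"
proof -
  define Q where "Q j w \<longleftrightarrow> 1 \<le> j" for j :: nat and w :: "nat \<Rightarrow> real"
  have "Q j = (\<lambda>w. 1 \<le> j)" for j by (auto simp: Q_def)
  then have Q: "adapted Q" by (simp add: adapted_def)
  have late: "Q j w" if "1 \<le> j" for j w using that by (simp add: Q_def)
  have "sel_count Q (Suc k) w = k" for k w
    by (induction k) (simp_all add: sel_count_Suc Q_def)
  then have pos: "sel_pos Q k w = Suc k" for k w by (intro sel_pos_eq) (simp_all add: Q_def)
  have "G (\<lambda>k. selected Q k \<omega>) = G (\<lambda>k. V (Suc k) \<omega>)" for \<omega>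
  proof -
    have "(\<lambda>k. selected Q k \<omega>) = (\<lambda>k. V (Suc k) \<omega>)(0 := V 0 \<omega>)"
      by (auto simp: fun_eq_iff selected_def pos split: nat.split)
    then show ?thesis by (simp only: G0)
  qed
  then show ?thesis using optional_skipping_integral[OF Q late G G_cong] by simp
qed

text \<open>Let \<open>dn n\<close> be the mean of minus the minimum of the first \<open>n\<close>
  partial sums. As the steps are centred, peeling off the first one, as \<open>dmin\<close> does,
  shows that \<open>dn (Suc n) - dn n\<close> is the mean of the positive part of the first step
  plus the minimum of the remaining ones. A first step above \<open>d + 1\<close> followed by a
  minimum above \<open>- d\<close> makes this at least 1, with probability at least
  \<open>p * q\<close>, so \<open>dn\<close> grows linearly. Exponential moments, however, give
  \<open>l * dn n \<le> ln (n + 1) + n * \<Psi> l\<close>. Hence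
  \<open>p * q * l \<le> \<Psi> l\<close> for all \<open>l > 0\<close>, which contradicts the
  smallness of \<open>\<Psi>\<close> near 0.\<close>

lemma running_min_unbounded:
  assumes int: "integrable M (V 1)" and mean: "expectation (V 1) = 0"
    and exp: "\<And>l k. 0 < l \<Longrightarrow> (\<integral>\<^sup>+\<omega>. ennreal (exp (- (l * (\<Sum>i<k. V (Suc i) \<omega>)))) \<partial>M) = ennreal (exp (real k * \<Psi> l))"
    and small: "\<And>e. 0 < e \<Longrightarrow> \<exists>l>0. \<Psi> l < e * l" and \<Psi>: "\<And>l. 0 < l \<Longrightarrow> 0 \<le> \<Psi> l"
    and up: "0 < prob {\<omega> \<in> space M. d + 1 < V 1 \<omega>}"
    and p: "\<And>n. p \<le> prob {\<omega> \<in> space M. - d < dmin n (\<lambda>i. V (Suc i) \<omega>)}"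
  shows "p \<le> 0"
proof (rule ccontr)
  assume "\<not> p \<le> 0"
  then have p0: "0 < p" by simp
  define q where "q = prob {\<omega> \<in> space M. d + 1 < V 1 \<omega>}"
  have intV: "integrable M (V (Suc i))" for i
  proof -
    have "integrable (distr M borel (V 1)) (\<lambda>x. x)"
      using int by (subst integrable_distr_eq) (auto intro: V_measurable)
    then have "integrable (distr M borel (V (Suc i))) (\<lambda>x. x)" by (simp only: ident)
    then show ?thesis by (subst (asm) integrable_distr_eq) (auto intro: V_measurable)
  qed
  have intD: "integrable M (\<lambda>\<omega>. dmin n (\<lambda>i. V (Suc (i + k)) \<omega>))" for n k
  proof (induction n arbitrary: k)
    case (Suc n)
    have "integrable M (\<lambda>\<omega>. dmin n (\<lambda>i. V (Suc (i + Suc k)) \<omega>))" by (rule Suc)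
    then show ?case using intV[of k] by (simp add: integrable_min)
  qed simp
  define dn where "dn n = (\<integral>\<omega>. - dmin n (\<lambda>i. V (Suc i) \<omega>) \<partial>M)" for n
  have [measurable]: "(\<lambda>\<omega>. dmin n (\<lambda>i. V (Suc (i + k)) \<omega>)) \<in> borel_measurable M" for n k
    using intD[of n k] by (rule borel_measurable_integrable)
  have [measurable]: "(\<lambda>\<omega>. dmin n (\<lambda>i. V (Suc i) \<omega>)) \<in> borel_measurable M" "(\<lambda>\<omega>. dmin n (\<lambda>i. V (Suc (Suc i)) \<omega>)) \<in> borel_measurable M" for n
    using intD[of n 0] intD[of n 1] by (auto dest: borel_measurable_integrable)
  have dm: "(\<lambda>w. dmin n (\<lambda>i. w (Suc i))) \<in> borel_measurable (path_space n)" for n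
    using dmin_measurable[of n 1 "{..n}"] by simp
  have shift1: "(\<integral>\<omega>. - dmin n (\<lambda>i. V (Suc (Suc i)) \<omega>) \<partial>M) = dn n" for n
    unfolding dn_def
    by (rule shift_integral[where G = "\<lambda>w. - dmin n (\<lambda>i. w (Suc i))" and m = n])
       (auto intro!: dmin_cong borel_measurable_uminus dm)
  have shift2: "prob {\<omega> \<in> space M. - d < dmin n (\<lambda>i. V (Suc (Suc i)) \<omega>)} = prob {\<omega> \<in> space M. - d < dmin n (\<lambda>i. V (Suc i) \<omega>)}" for n
  proof -
    have eq: "prob {\<omega> \<in> space M. - d < f \<omega>} = (\<integral>\<omega>. indicator {- d<..} (f \<omega>) \<partial>M)" if [measurable]: "f \<in> borel_measurable M" for f
    proof -
      have "(\<integral>\<omega>. (indicator {- d<..} (f \<omega>) :: real) \<partial>M) = (\<integral>\<omega>. indicator {\<omega> \<in> space M. - d < f \<omega>} \<omega> \<partial>M)"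
        by (intro Bochner_Integration.integral_cong) (auto simp: indicator_def)
      moreover have "{\<omega> \<in> space M. - d < f \<omega>} \<inter> space M = {\<omega> \<in> space M. - d < f \<omega>}" by auto
      ultimately show ?thesis by (simp only: Bochner_Integration.integral_indicator)
    qed
    have "(\<integral>\<omega>. indicator {- d<..} (dmin n (\<lambda>i. V (Suc (Suc i)) \<omega>)) \<partial>M) = (\<integral>\<omega>. (indicator {- d<..} (dmin n (\<lambda>i. V (Suc i) \<omega>)) :: real) \<partial>M)"
    proof (rule shift_integral[where G = "\<lambda>w. indicator {- d<..} (dmin n (\<lambda>i. w (Suc i)))" and m = n])
      show "(\<lambda>w. indicator {- d<..} (dmin n (\<lambda>i. w (Suc i))) :: real) \<in> borel_measurable (path_space n)"
        using dm[of n] by measurable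
      fix w w' :: "nat \<Rightarrow> real" assume "\<And>i. i \<le> n \<Longrightarrow> w i = w' i"
      then have "dmin n (\<lambda>i. w (Suc i)) = dmin n (\<lambda>i. w' (Suc i))" by (intro dmin_cong) auto
      then show "indicator {- d<..} (dmin n (\<lambda>i. w (Suc i))) = (indicator {- d<..} (dmin n (\<lambda>i. w' (Suc i))) :: real)" by simp
    qed simp
    then show ?thesis by (simp add: eq)
  qed
  have lower: "dn n + p * q \<le> dn (Suc n)" for n
  proof -
    let ?D = "\<lambda>\<omega>. dmin n (\<lambda>i. V (Suc (Suc i)) \<omega>)"
    let ?E = "{\<omega> \<in> space M. d + 1 < V 1 \<omega> \<and> - d < ?D \<omega>}"
    have intD': "integrable M ?D" using intD[of n 1] by simp
    have int1: "integrable M (V (Suc 0))" by (rule intV)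
    have Em: "?E \<in> sets M" by measurable
    have dmm: "(\<lambda>w. dmin n (\<lambda>i. w (i + 2))) \<in> borel_measurable (Pi\<^sub>M {2..Suc n} (\<lambda>_. borel))"
      by (rule dmin_measurable) auto
    have pE: "prob ?E = q * prob {\<omega> \<in> space M. - d < ?D \<omega>}"
    proof -
      have "indep_var (Pi\<^sub>M {Suc 0} (\<lambda>_. borel)) (\<lambda>\<omega>. \<lambda>i\<in>{Suc 0}. V i \<omega>) (Pi\<^sub>M {2..Suc n} (\<lambda>_. borel)) (\<lambda>\<omega>. \<lambda>i\<in>{2..Suc n}. V i \<omega>)"
        by (rule indep_var_restrict[OF indep[of "Suc n"]]) auto
      then have "indep_var borel ((\<lambda>w. w (Suc 0)) \<circ> (\<lambda>\<omega>. \<lambda>i\<in>{Suc 0}. V i \<omega>)) borel ((\<lambda>w. dmin n (\<lambda>i. w (i + 2))) \<circ> (\<lambda>\<omega>. \<lambda>i\<in>{2..Suc n}. V i \<omega>))"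
        by (rule indep_var_compose[OF _ measurable_component_singleton dmm]) simp
      moreover have "(\<lambda>w. dmin n (\<lambda>i. w (i + 2))) \<circ> (\<lambda>\<omega>. \<lambda>i\<in>{2..Suc n}. V i \<omega>) = ?D"
        by (auto simp: fun_eq_iff intro!: dmin_cong)
      ultimately have "indep_var borel (V 1) borel ?D" by (simp add: comp_def)
      from indep_varD[OF this, of "{d+1<..}" "{-d<..}"]
      have "prob ((\<lambda>x. (V 1 x, ?D x)) -` ({d + 1<..} \<times> {- d<..}) \<inter> space M) =
          prob (V 1 -` {d + 1<..} \<inter> space M) * prob (?D -` {- d<..} \<inter> space M)" by simp
      moreover have "(\<lambda>x. (V 1 x, ?D x)) -` ({d + 1<..} \<times> {- d<..}) \<inter> space M = ?E" by auto
      moreover have "V 1 -` {d + 1<..} \<inter> space M = {\<omega> \<in> space M. d + 1 < V 1 \<omega>}" by auto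
      moreover have "?D -` {- d<..} \<inter> space M = {\<omega> \<in> space M. - d < ?D \<omega>}" by auto
      ultimately show ?thesis by (simp only: q_def)
    qed
    have "p * q \<le> prob ?E" unfolding pE shift2 using p[of n] up by (simp add: q_def mult.commute mult_left_mono)
    also have "prob ?E = (\<integral>\<omega>. indicator ?E \<omega> \<partial>M)"
    proof -
      have "?E \<inter> space M = ?E" by auto
      then show ?thesis by (simp only: Bochner_Integration.integral_indicator)
    qed
    also have "\<dots> \<le> (\<integral>\<omega>. max 0 (V (Suc 0) \<omega> + ?D \<omega>) \<partial>M)"
    proof (rule integral_mono)
      show "integrable M (\<lambda>\<omega>. indicator ?E \<omega> :: real)" using Em by (intro integrable_real_indicator) (auto simp: emeasure_eq_measure)
      show "integrable M (\<lambda>\<omega>. max 0 (V (Suc 0) \<omega> + ?D \<omega>))" using intD' int1 by (intro integrable_max) auto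
      show "indicator ?E \<omega> \<le> max 0 (V (Suc 0) \<omega> + ?D \<omega>)" for \<omega> by (auto simp: indicator_def)
    qed
    also have "\<dots> = (\<integral>\<omega>. - dmin (Suc n) (\<lambda>i. V (Suc i) \<omega>) + (V (Suc 0) \<omega> - - ?D \<omega>) \<partial>M)"
      by (intro Bochner_Integration.integral_cong) (auto simp: max_def min_def)
    also have "\<dots> = dn (Suc n) + ((\<integral>\<omega>. V (Suc 0) \<omega> \<partial>M) - dn n)"
    proof -
      have a: "integrable M (\<lambda>\<omega>. - dmin (Suc n) (\<lambda>i. V (Suc i) \<omega>))" using intD[of "Suc n" 0] by simp
      have b: "integrable M (\<lambda>\<omega>. - ?D \<omega>)" using intD' by simp
      show ?thesis
        by (subst Bochner_Integration.integral_add[OF a Bochner_Integration.integrable_diff[OF int1 b]],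
            subst Bochner_Integration.integral_diff[OF int1 b]) (simp only: shift1 dn_def)
    qed
    also have "(\<integral>\<omega>. V (Suc 0) \<omega> \<partial>M) = 0" using mean by simp
    finally show ?thesis by simp
  qed
  have lin: "real n * (p * q) \<le> dn n" for n
  proof (induction n)
    case 0
    show ?case by (simp add: dn_def)
  next
    case (Suc n)
    then show ?case using lower[of n] by (simp add: algebra_simps)
  qed
  have upper: "l * dn n \<le> ln (real n + 1) + real n * \<Psi> l" if l: "0 < l" for l n
  proof -
    \<comment> \<open>\<open>exp b\<close> bounds the sum of the \<open>n + 1\<close> exponential
      moments; the tangent inequality \<open>x - b \<le> exp (x - b) - 1\<close> then bounds the
      mean of the maximum by \<open>b\<close>.\<close>
    define b where "b = ln (real n + 1) + real n * \<Psi> l"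
    let ?S = "\<lambda>k \<omega>. exp (- (l * (\<Sum>i<k. V (Suc i) \<omega>)))"
    have S: "has_bochner_integral M (?S k) (exp (real k * \<Psi> l))" for k
      by (rule has_bochner_integral_nn_integral) (auto simp: exp[OF l])
    have "l * dn n = (\<integral>\<omega>. l * - dmin n (\<lambda>i. V (Suc i) \<omega>) \<partial>M)" by (simp add: dn_def)
    also have "\<dots> \<le> (\<integral>\<omega>. exp (- b) * (\<Sum>k\<le>n. ?S k \<omega>) + (b - 1) \<partial>M)"
    proof (rule integral_mono)
      show "integrable M (\<lambda>\<omega>. l * - dmin n (\<lambda>i. V (Suc i) \<omega>))" using intD[of n 0] by simp
      show "integrable M (\<lambda>\<omega>. exp (- b) * (\<Sum>k\<le>n. ?S k \<omega>) + (b - 1))"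
        using S by (auto simp: has_bochner_integral_iff)
      fix \<omega>
      obtain k where k: "k \<le> n" "dmin n (\<lambda>i. V (Suc i) \<omega>) = (\<Sum>i<k. V (Suc i) \<omega>)" using dmin_attained by blast
      let ?x = "l * - dmin n (\<lambda>i. V (Suc i) \<omega>)"
      have "?x - b \<le> exp (?x - b) - 1" using exp_ge_add_one_self[of "?x - b"] by linarith
      also have "exp (?x - b) = exp (- b) * ?S k \<omega>" using k(2) by (simp flip: exp_add)
      also have "\<dots> \<le> exp (- b) * (\<Sum>k\<le>n. ?S k \<omega>)" using k(1) by (intro mult_left_mono member_le_sum) auto
      finally show "?x \<le> exp (- b) * (\<Sum>k\<le>n. ?S k \<omega>) + (b - 1)" by simp
    qed
    also have "\<dots> = exp (- b) * (\<Sum>k\<le>n. exp (real k * \<Psi> l)) + (b - 1)"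
    proof -
      have "has_bochner_integral M (\<lambda>\<omega>. exp (- b) * (\<Sum>k\<le>n. ?S k \<omega>)) (exp (- b) * (\<Sum>k\<le>n. exp (real k * \<Psi> l)))"
        by (intro has_bochner_integral_mult_right has_bochner_integral_sum S)
      then have a: "integrable M (\<lambda>\<omega>. exp (- b) * (\<Sum>k\<le>n. ?S k \<omega>))" and
        b: "(\<integral>\<omega>. exp (- b) * (\<Sum>k\<le>n. ?S k \<omega>) \<partial>M) = exp (- b) * (\<Sum>k\<le>n. exp (real k * \<Psi> l))"
        by (auto simp only: has_bochner_integral_iff)
      show ?thesis by (subst Bochner_Integration.integral_add[OF a]) (simp_all only: b, simp_all add: prob_space)
    qed
    also have "\<dots> \<le> exp (- b) * ((real n + 1) * exp (real n * \<Psi> l)) + (b - 1)"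
    proof -
      have "(\<Sum>k\<le>n. exp (real k * \<Psi> l)) \<le> (\<Sum>k\<le>n. exp (real n * \<Psi> l))"
        using \<Psi>[OF l] by (intro sum_mono) (auto intro!: mult_right_mono)
      also have "\<dots> = (real n + 1) * exp (real n * \<Psi> l)" by (simp add: algebra_simps)
      finally show ?thesis by (intro add_right_mono mult_left_mono) auto
    qed
    also have "(real n + 1) * exp (real n * \<Psi> l) = exp b" by (simp add: b_def exp_add)
    also have "exp (- b) * exp b + (b - 1) = b" by (simp flip: exp_add)
    finally show ?thesis by (simp add: b_def)
  qed
  have "p * q * l \<le> \<Psi> l" if l: "0 < l" for l
  proof -
    have lim: "(\<lambda>n. ln (real n) / real n + ln 2 / real n) \<longlonglongrightarrow> 0"
      using tendsto_add[OF lim_ln_over_n lim_const_over_n[of "ln 2 :: real"]] by simp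
    have "p * q * l - \<Psi> l \<le> 0"
    proof (rule LIMSEQ_le_const[OF lim], intro exI allI impI)
      fix n :: nat assume n: "1 \<le> n"
      have "l * (real n * (p * q)) \<le> l * dn n" using lin[of n] l by (intro mult_left_mono) auto
      also have "\<dots> \<le> ln (real n + 1) + real n * \<Psi> l" by (rule upper[OF l])
      finally have "(p * q * l - \<Psi> l) * real n \<le> ln (real n + 1)" by (simp add: algebra_simps)
      also have "ln (real n + 1) \<le> ln (real n * 2)" using n by (subst ln_le_cancel_iff) auto
      also have "\<dots> = ln (real n) + ln 2" using n by (simp add: ln_mult)
      finally show "p * q * l - \<Psi> l \<le> ln (real n) / real n + ln 2 / real n"
        using n by (simp add: pos_le_divide_eq flip: add_divide_distrib)
    qed
    then show ?thesis by simp
  qed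
  moreover have "0 < p * q" using p0 up by (simp add: q_def)
  ultimately show False using small[of "p * q"] by (meson not_le)
qed

lemma all_steps_prob:
  assumes B: "B \<in> sets borel"
  shows "emeasure M {\<omega> \<in> space M. \<forall>k<m. V (Suc k) \<omega> \<in> B} = emeasure (distr M borel (V 1)) B ^ m"
proof -
  define T where "T = (\<lambda>(_ :: nat) (_ :: nat \<Rightarrow> real). True)"
  have T: "adapted T" by (simp add: adapted_def T_def)
  have "sel_count T k w = k" for k w by (simp add: sel_count_def T_def)
  then have pos: "sel_pos T k w = k" for k w by (intro sel_pos_eq) (auto simp: T_def)
  have "emeasure M {\<omega> \<in> space M. V 0 \<omega> \<in> UNIV \<and> (\<forall>k<m. V (Suc (sel_pos T k (\<lambda>i. V i \<omega>))) \<omega> \<in> B)} =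
    emeasure M {\<omega> \<in> space M. V 0 \<omega> \<in> UNIV} * (\<Prod>k<m. emeasure (distr M borel (V 1)) B)"
    using B by (intro optional_skipping_rect[OF T, of 0]) (auto simp: T_def)
  then show ?thesis by (simp add: pos emeasure_space_1)
qed

end

text \<open>The difference quotients \<open>(1 - exp (- (l * X))) / l\<close> increase to
  \<open>X\<close> as \<open>l\<close> is halved, and their means tend to 0 because the exponent is
  of smaller order than \<open>l\<close>. Monotone convergence yields integrability and the mean at
  once.\<close>

lemma (in prob_space) mean_zero_of_laplace:
  fixes X :: "'a \<Rightarrow> real"
  assumes X: "X \<in> borel_measurable M"
    and exp: "\<And>l. 0 < l \<Longrightarrow> (\<integral>\<^sup>+\<omega>. ennreal (exp (- (l * X \<omega>))) \<partial>M) = ennreal (exp (\<Psi> l))"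
    and small: "(\<lambda>n. \<Psi> ((1/2) ^ n) / (1/2) ^ n) \<longlonglongrightarrow> 0"
  shows "integrable M X" "expectation X = 0"
proof -
  define l where "l n = (1/2 :: real) ^ n" for n
  define f where "f n \<omega> = (1 - exp (- (l n * X \<omega>))) / l n" for n \<omega>
  have l: "0 < l n" for n by (simp add: l_def)
  have l0: "l \<longlonglongrightarrow> 0" unfolding l_def[abs_def] by (intro LIMSEQ_power_zero) simp
  have S: "has_bochner_integral M (\<lambda>\<omega>. exp (- (l n * X \<omega>))) (exp (\<Psi> (l n)))" for n
    by (rule has_bochner_integral_nn_integral) (use X in \<open>auto simp: exp[OF l]\<close>)
  have f: "has_bochner_integral M (f n) ((1 - exp (\<Psi> (l n))) / l n)" for n
  proof -
    have "has_bochner_integral M (\<lambda>\<omega>. 1 - exp (- (l n * X \<omega>))) (1 - exp (\<Psi> (l n)))"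
      using S[of n] has_bochner_integral_diff[OF has_bochner_integral_integrable[of M "\<lambda>_. 1"] S[of n]] by (simp add: prob_space)
    then show ?thesis unfolding f_def using l[of n] by (intro has_bochner_integral_divide) auto
  qed
  \<comment> \<open>Halving \<open>l\<close> amounts to \<open>1 - q^2 \<le> 2 * (1 - q)\<close>,
    that is to \<open>(1 - q)^2 \<ge> 0\<close>.\<close>
  have mono: "f n \<omega> \<le> f (Suc n) \<omega>" for n \<omega>
  proof -
    define q where "q = exp (- (l (Suc n) * X \<omega>))"
    have ln: "l n = 2 * l (Suc n)" by (simp add: l_def)
    have "exp (- (l n * X \<omega>)) = q * q" unfolding q_def ln by (simp flip: exp_add)
    moreover have "0 \<le> (1 - q) * (1 - q)" by simp
    ultimately have "1 - exp (- (l n * X \<omega>)) \<le> 2 * (1 - q)" by (simp add: algebra_simps)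
    then have "f n \<omega> \<le> 2 * (1 - q) / l n" unfolding f_def using l[of n] by (intro divide_right_mono) auto
    also have "\<dots> = f (Suc n) \<omega>" unfolding f_def q_def ln by (rule mult_divide_mult_cancel_left) simp
    finally show ?thesis .
  qed
  have lim: "(\<lambda>n. f n \<omega>) \<longlonglongrightarrow> X \<omega>" for \<omega>
  proof -
    have "((\<lambda>x. 1 - exp (- (x * X \<omega>))) has_field_derivative X \<omega>) (at 0)"
      by (auto intro!: derivative_eq_intros)
    then have "((\<lambda>h. (1 - exp (- (h * X \<omega>))) / h) \<longlongrightarrow> X \<omega>) (at 0)" by (simp add: DERIV_def)
    moreover have "filterlim l (at 0) sequentially"
      using l0 l by (intro filterlim_atI) (auto intro!: always_eventually simp: less_imp_neq[symmetric])
    ultimately show ?thesis unfolding f_def by (rule filterlim_compose)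
  qed
  have val: "(\<lambda>n. (1 - exp (\<Psi> (l n))) / l n) \<longlonglongrightarrow> 0"
  proof -
    have \<Psi>0: "(\<lambda>n. \<Psi> (l n)) \<longlonglongrightarrow> 0"
      using tendsto_mult[OF small l0] l unfolding l_def by simp
    define g where "g x = (if x = 0 then 1 else (exp x - 1) / x)" for x :: real
    have "((\<lambda>x. (exp x - 1) / x) \<longlongrightarrow> 1) (at (0::real))"
    proof -
      have "(exp has_field_derivative 1) (at (0::real))" using DERIV_exp[of "0::real"] by simp
      then show ?thesis by (simp add: DERIV_def)
    qed
    then have "isCont g 0" unfolding isCont_def g_def
      by (simp add: LIM_equal[of 0 "\<lambda>x. if x = 0 then 1 else (exp x - 1) / x" "\<lambda>x. (exp x - 1) / x"])
    then have "(\<lambda>n. g (\<Psi> (l n))) \<longlonglongrightarrow> g 0" using \<Psi>0 by (rule isCont_tendsto_compose)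
    then have "(\<lambda>n. - (g (\<Psi> (l n)) * (\<Psi> (l n) / l n))) \<longlonglongrightarrow> - (g 0 * 0)"
      using small unfolding l_def by (intro tendsto_intros)
    moreover have "- (g x * (x / y)) = (1 - exp x) / y" for x y :: real
      by (simp add: g_def divide_simps)
    ultimately show ?thesis by simp
  qed
  have fi: "integrable M (f n)" "integral\<^sup>L M (f n) = (1 - exp (\<Psi> (l n))) / l n" for n
    using f[of n] by (auto simp: has_bochner_integral_iff)
  have "has_bochner_integral M X 0"
  proof (rule has_bochner_integral_monotone_convergence[where f = f])
    show "AE \<omega> in M. mono (\<lambda>n. f n \<omega>)" using mono by (intro AE_I2) (simp add: mono_iff_le_Suc)
    show "(\<lambda>n. integral\<^sup>L M (f n)) \<longlonglongrightarrow> 0" using val by (simp only: fi)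
  qed (use fi lim X in auto)
  then show "integrable M X" "expectation X = 0" by (auto simp: has_bochner_integral_iff)
qed

context levy_process
begin

lemma small_exponent: "(\<lambda>n. real_exponent \<phi> ((1/2) ^ n) / (1/2) ^ n) \<longlonglongrightarrow> 0"
  by (rule real_exponent_small[OF adm]) (auto simp: power_le_one intro!: LIMSEQ_power_zero)

lemma increment_mean:
  "integrable M (\<lambda>\<omega>. Y (real n) \<omega> - Y 0 \<omega>)" "expectation (\<lambda>\<omega>. Y (real n) \<omega> - Y 0 \<omega>) = 0"
proof -
  have "(\<lambda>k. real n * (real_exponent \<phi> ((1/2) ^ k) / (1/2) ^ k)) \<longlonglongrightarrow> real n * 0"
    by (intro tendsto_intros small_exponent)
  then have s: "(\<lambda>k. (real n * real_exponent \<phi> ((1/2) ^ k)) / (1/2) ^ k) \<longlonglongrightarrow> 0" by simp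
  have m: "(\<lambda>\<omega>. Y (real n) \<omega> - Y 0 \<omega>) \<in> borel_measurable M" by (intro borel_measurable_diff Y_measurable) auto
  show "integrable M (\<lambda>\<omega>. Y (real n) \<omega> - Y 0 \<omega>)" "expectation (\<lambda>\<omega>. Y (real n) \<omega> - Y 0 \<omega>) = 0"
    by (rule mean_zero_of_laplace[where \<Psi> = "\<lambda>l. real n * real_exponent \<phi> l", OF m _ s]; simp add: laplace_nat)+
qed

text \<open>A unit increment is centred and, as the exponent at 1 is positive, not almost surely 0.
  It therefore exceeds some \<open>\<delta> > 0\<close> with positive probability, and enough
  independent ones in a row add up to more than \<open>d\<close>.\<close>

lemma increment_large:
  obtains N :: nat where "0 < prob {\<omega> \<in> space M. d < Y (real N) \<omega> - Y 0 \<omega>}"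
proof -
  let ?w = "\<lambda>\<omega>. Y 1 \<omega> - Y 0 \<omega>"
  have [measurable]: "?w \<in> borel_measurable M" by (intro borel_measurable_diff Y_measurable) auto
  have "\<exists>n. 0 < prob {\<omega> \<in> space M. inverse (real (Suc n)) < ?w \<omega>}"
  proof (rule ccontr)
    assume "\<not> ?thesis"
    then have "prob {\<omega> \<in> space M. inverse (real (Suc n)) < ?w \<omega>} = 0" for n
      by (metis measure_nonneg order_le_less)
    then have "AE \<omega> in M. \<not> inverse (real (Suc n)) < ?w \<omega>" for n
      by (intro AE_I[of _ _ "{\<omega> \<in> space M. inverse (real (Suc n)) < ?w \<omega>}"]) (auto simp: emeasure_eq_measure)
    then have "AE \<omega> in M. \<forall>n. \<not> inverse (real (Suc n)) < ?w \<omega>" by (simp add: AE_all_countable)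
    then have neg: "AE \<omega> in M. 0 \<le> - ?w \<omega>"
    proof (rule AE_mp, intro AE_I2 impI)
      fix \<omega> assume "\<forall>n. \<not> inverse (real (Suc n)) < ?w \<omega>"
      then show "0 \<le> - ?w \<omega>" using reals_Archimedean[of "?w \<omega>"] by (cases "0 < ?w \<omega>") auto
    qed
    have w: "integrable M ?w" "expectation ?w = 0" using increment_mean[of 1] by simp_all
    have int: "integrable M (\<lambda>\<omega>. - ?w \<omega>)" "(\<integral>\<omega>. - ?w \<omega> \<partial>M) = 0"
      using Bochner_Integration.integrable_minus[OF w(1)] Bochner_Integration.integral_minus[of M ?w] w(2) by simp_all
    have "AE \<omega> in M. - ?w \<omega> = 0" using integral_nonneg_eq_0_iff_AE[OF int(1) neg] int(2) by simp
    then have "(\<integral>\<^sup>+\<omega>. ennreal (exp (- (1 * ?w \<omega>))) \<partial>M) = (\<integral>\<^sup>+\<omega>. 1 \<partial>M)"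
      by (intro nn_integral_cong_AE) (auto elim!: AE_mp)
    then have "ennreal (exp (real_exponent \<phi> 1)) = 1" using laplace_one[of 1] by (simp add: emeasure_space_1)
    then show False using real_exponent_pos[OF adm] by simp
  qed
  then obtain n where n: "0 < prob {\<omega> \<in> space M. inverse (real (Suc n)) < ?w \<omega>}" by blast
  define \<delta> where "\<delta> = inverse (real (Suc n))"
  have \<delta>: "0 < \<delta>" by (simp add: \<delta>_def)
  obtain N :: nat where N: "d / \<delta> < real N" using reals_Archimedean2 by blast
  have Nd: "d < real (Suc N) * \<delta>" using N \<delta> by (simp add: pos_divide_less_eq algebra_simps)
  interpret S: iid_increments M "steps 1" by (rule steps_iid) simp
  have r: "emeasure (distr M borel (steps 1 1)) {\<delta><..} \<noteq> 0"
  proof -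
    have "steps 1 1 -` {\<delta><..} \<inter> space M = {\<omega> \<in> space M. inverse (real (Suc n)) < ?w \<omega>}"
      by (auto simp: \<delta>_def)
    then have "emeasure (distr M borel (steps 1 1)) {\<delta><..} = ennreal (prob {\<omega> \<in> space M. inverse (real (Suc n)) < ?w \<omega>})"
      using emeasure_distr[OF S.V_measurable, of "{\<delta><..}" 1] by (simp only: emeasure_eq_measure) simp
    then show ?thesis using n by simp
  qed
  have "emeasure M {\<omega> \<in> space M. \<forall>k<Suc N. steps 1 (Suc k) \<omega> \<in> {\<delta><..}} \<noteq> 0"
    using S.all_steps_prob[of "{\<delta><..}" "Suc N"] r by simp
  moreover have "emeasure M {\<omega> \<in> space M. \<forall>k<Suc N. steps 1 (Suc k) \<omega> \<in> {\<delta><..}} \<le> emeasure M {\<omega> \<in> space M. d < Y (real (Suc N)) \<omega> - Y 0 \<omega>}"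
  proof (rule emeasure_mono)
    have [measurable]: "(\<lambda>\<omega>. Y (real (Suc N)) \<omega> - Y 0 \<omega>) \<in> borel_measurable M"
      by (intro borel_measurable_diff Y_measurable) auto
    show "{\<omega> \<in> space M. d < Y (real (Suc N)) \<omega> - Y 0 \<omega>} \<in> sets M" by measurable
    show "{\<omega> \<in> space M. \<forall>k<Suc N. steps 1 (Suc k) \<omega> \<in> {\<delta><..}} \<subseteq> {\<omega> \<in> space M. d < Y (real (Suc N)) \<omega> - Y 0 \<omega>}"
    proof safe
      fix \<omega> assume *: "\<forall>k<Suc N. steps 1 (Suc k) \<omega> \<in> {\<delta><..}"
      have "real (Suc N) * \<delta> = (\<Sum>k<Suc N. \<delta>)" by simp
      also have "\<dots> \<le> (\<Sum>k<Suc N. Y (real (Suc k)) \<omega> - Y (real k) \<omega>)"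
        using * by (intro sum_mono) auto
      also have "\<dots> = Y (real (Suc N)) \<omega> - Y 0 \<omega>"
        using sum_lessThan_telescope[of "\<lambda>k. Y (real k) \<omega>" "Suc N"] by simp
      finally show "d < Y (real (Suc N)) \<omega> - Y 0 \<omega>" using Nd by linarith
    qed
  qed
  ultimately have "emeasure M {\<omega> \<in> space M. d < Y (real (Suc N)) \<omega> - Y 0 \<omega>} \<noteq> 0" by auto
  then have "0 < prob {\<omega> \<in> space M. d < Y (real (Suc N)) \<omega> - Y 0 \<omega>}"
    by (simp only: emeasure_eq_measure ennreal_eq_0_iff not_le)
  then show ?thesis by (rule that)
qed

text \<open>The criterion for walks is applied along a grid whose mesh \<open>N\<close> depends on
  \<open>d\<close>: it is chosen such that a single step exceeds \<open>d + 1\<close> with positive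
  probability.\<close>

lemma unbounded_below: "AE \<omega> in M. \<forall>d. \<exists>k::nat. Y (real k) \<omega> - Y 0 \<omega> \<le> - d"
proof -
  have "AE \<omega> in M. \<exists>k::nat. Y (real k) \<omega> - Y 0 \<omega> \<le> - real d" for d :: nat
  proof -
    define E where "E = {\<omega> \<in> space M. \<forall>k::nat. - real d < Y (real k) \<omega> - Y 0 \<omega>}"
    have [measurable]: "(\<lambda>\<omega>. Y (real k) \<omega> - Y 0 \<omega>) \<in> borel_measurable M" for k
      by (intro borel_measurable_diff Y_measurable) auto
    have E: "E \<in> sets M" unfolding E_def by measurable
    obtain N where N: "0 < prob {\<omega> \<in> space M. real d + 1 < Y (real N) \<omega> - Y 0 \<omega>}" by (rule increment_large)
    interpret S: iid_increments M "steps (real N)" by (rule steps_iid) simp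
    have s1: "steps (real N) 1 = (\<lambda>\<omega>. Y (real N) \<omega> - Y 0 \<omega>)" by (auto simp: fun_eq_iff)
    have sum: "(\<Sum>i<k. steps (real N) (Suc i) \<omega>) = Y (real (k * N)) \<omega> - Y 0 \<omega>" for k \<omega>
      using sum_lessThan_telescope[of "\<lambda>i. Y (real i * real N) \<omega>" k] by simp
    have "prob E \<le> 0"
    proof (rule S.running_min_unbounded[where \<Psi> = "\<lambda>l. real N * real_exponent \<phi> l" and d = "real d"])
      show "integrable M (steps (real N) 1)" "expectation (steps (real N) 1) = 0"
        unfolding s1 by (rule increment_mean)+
      show "(\<integral>\<^sup>+\<omega>. ennreal (exp (- (l * (\<Sum>i<k. steps (real N) (Suc i) \<omega>)))) \<partial>M) = ennreal (exp (real k * (real N * real_exponent \<phi> l)))"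
        if "0 < l" for l k unfolding sum using laplace_nat[of l "k * N"] that by (simp add: mult.assoc)
      show "\<exists>l>0. real N * real_exponent \<phi> l < e * l" if "0 < e" for e
      proof -
        have "(\<lambda>k. real N * (real_exponent \<phi> ((1/2) ^ k) / (1/2) ^ k)) \<longlonglongrightarrow> real N * 0"
          by (intro tendsto_intros small_exponent)
        then have "\<forall>\<^sub>F k in sequentially. real N * (real_exponent \<phi> ((1/2) ^ k) / (1/2) ^ k) < e"
          using that by (intro order_tendstoD(2)) auto
        then obtain k where "real N * (real_exponent \<phi> ((1/2) ^ k) / (1/2) ^ k) < e"
          using eventually_happens by fastforce
        then show ?thesis by (intro exI[of _ "(1/2) ^ k"]) (simp add: divide_simps mult_ac)
      qed
      show "0 \<le> real N * real_exponent \<phi> l" if "0 < l" for l using real_exponent_nonneg[OF adm that] by simp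
      show "0 < prob {\<omega> \<in> space M. real d + 1 < steps (real N) 1 \<omega>}" unfolding s1 by (rule N)
      show "prob E \<le> prob {\<omega> \<in> space M. - real d < dmin n (\<lambda>i. steps (real N) (Suc i) \<omega>)}" for n
      proof (rule finite_measure_mono)
        have "(\<lambda>\<omega>. dmin n (\<lambda>i. steps (real N) (Suc i) \<omega>)) \<in> borel_measurable M"
          using measurable_compose[OF _ dmin_measurable[of n 1 "{..n}"], of "\<lambda>\<omega>. \<lambda>i\<in>{..n}. steps (real N) i \<omega>" M]
          by (rule measurable_cong[THEN iffD1, rotated]) (auto intro!: dmin_cong simp del: steps_simps)
        then show "{\<omega> \<in> space M. - real d < dmin n (\<lambda>i. steps (real N) (Suc i) \<omega>)} \<in> sets M" by measurable
        show "E \<subseteq> {\<omega> \<in> space M. - real d < dmin n (\<lambda>i. steps (real N) (Suc i) \<omega>)}"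
        proof
          fix \<omega> assume w: "\<omega> \<in> E"
          obtain k where "dmin n (\<lambda>i. steps (real N) (Suc i) \<omega>) = (\<Sum>i<k. steps (real N) (Suc i) \<omega>)" using dmin_attained by blast
          then show "\<omega> \<in> {\<omega> \<in> space M. - real d < dmin n (\<lambda>i. steps (real N) (Suc i) \<omega>)}"
            using w unfolding sum E_def by (auto simp del: of_nat_mult steps_simps)
        qed
      qed
    qed
    then have "emeasure M E = 0" using measure_nonneg[of M E] by (simp add: emeasure_eq_measure)
    then show ?thesis by (intro AE_I[of _ _ E]) (auto simp: E E_def not_le)
  qed
  then have "AE \<omega> in M. \<forall>d::nat. \<exists>k::nat. Y (real k) \<omega> - Y 0 \<omega> \<le> - real d" by (simp add: AE_all_countable)
  then show ?thesis
  proof (rule AE_mp, intro AE_I2 impI allI)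
    fix \<omega> and d :: real assume *: "\<forall>d::nat. \<exists>k::nat. Y (real k) \<omega> - Y 0 \<omega> \<le> - real d"
    obtain m :: nat where "d \<le> real m" using real_arch_simple by blast
    moreover obtain k :: nat where "Y (real k) \<omega> - Y 0 \<omega> \<le> - real m" using * by blast
    ultimately show "\<exists>k::nat. Y (real k) \<omega> - Y 0 \<omega> \<le> - d" by (intro exI[of _ k]) linarith
  qed
qed

end

section \<open>Time spent below \<open>1\<close>\<close>

definition occupation :: "(real \<Rightarrow> real) \<Rightarrow> ennreal" where
  "occupation f = emeasure lborel {z. 0 \<le> z \<and> reflect_left f z < 1}"

lemma reflect_left_cong:
  assumes "\<And>s. 0 \<le> s \<Longrightarrow> s \<le> t \<Longrightarrow> f s = g s" "0 \<le> t"
  shows "reflect_left f t = reflect_left g t"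
proof -
  have "(\<lambda>s. min (f s + 1) 0) ` {0..t} = (\<lambda>s. min (g s + 1) 0) ` {0..t}" using assms by (intro image_cong) auto
  then show ?thesis using assms by (simp add: reflect_left_def)
qed

lemma occupation_cong:
  assumes "\<And>s. 0 \<le> s \<Longrightarrow> f s = g s" shows "occupation f = occupation g"
proof -
  have "reflect_left f z = reflect_left g z" if "0 \<le> z" for z
    using assms that by (intro reflect_left_cong) auto
  then have "{z. 0 \<le> z \<and> reflect_left f z < 1} = {z. 0 \<le> z \<and> reflect_left g z < 1}" by auto
  then show ?thesis by (simp only: occupation_def)
qed

lemma occupation_set: "cadlag f \<Longrightarrow> {z. 0 \<le> z \<and> reflect_left f z < 1} \<in> sets borel"
  by (intro sublevel_sets_borel cadlag_reflect_left)

text \<open>Once \<open>-1\<close> has been reached, reflection has forgotten the starting height: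
  the two running infima differ exactly by \<open>f 0 + 1\<close>, as do the paths. Only the bounded
  stretch up to \<open>s\<close> is lost, so the path started at \<open>-1\<close> represents all
  others.\<close>

lemma occupation_eventually_below:
  assumes f: "cadlag f" and f0: "- 1 \<le> f 0" and s: "0 \<le> s" "f s \<le> - 1"
    and inf: "occupation (\<lambda>t. f t - f 0 - 1) = \<infinity>"
  shows "occupation f = \<infinity>"
proof -
  let ?w = "\<lambda>t. f t - f 0 - 1"
  have cw: "cadlag ?w" by (intro cadlag_diff f cadlag_const)
  have eq: "reflect_left f t = reflect_left ?w t" if t: "s \<le> t" for t
  proof -
    define a where "a = (INF u\<in>{0..t}. min (f u + 1) 0)"
    define b where "b = (INF u\<in>{0..t}. min (?w u + 1) 0)"
    have a: "a \<le> min (f u + 1) 0" if "0 \<le> u" "u \<le> t" for u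
      unfolding a_def using that by (intro cINF_lower bdd_below_reflect f) auto
    have b: "b \<le> min (?w u + 1) 0" if "0 \<le> u" "u \<le> t" for u
      unfolding b_def using that by (intro cINF_lower bdd_below_reflect cw) auto
    have "a - (f 0 + 1) \<le> b" unfolding b_def
    proof (rule cINF_greatest)
      fix u assume "u \<in> {0..t}"
      then show "a - (f 0 + 1) \<le> min (?w u + 1) 0" using a[of u] f0 by auto
    qed (use s t in auto)
    moreover have "b + (f 0 + 1) \<le> a" unfolding a_def
    proof (rule cINF_greatest)
      fix u assume "u \<in> {0..t}"
      then show "b + (f 0 + 1) \<le> min (f u + 1) 0" using b[of u] b[of s] s t by auto
    qed (use s t in auto)
    ultimately show ?thesis unfolding reflect_left_def a_def[symmetric] b_def[symmetric] by simp
  qed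
  have "{z. 0 \<le> z \<and> reflect_left ?w z < 1} \<subseteq> {0..s} \<union> {z. 0 \<le> z \<and> reflect_left f z < 1}"
    using eq by force
  then have "occupation ?w \<le> emeasure lborel ({0..s} \<union> {z. 0 \<le> z \<and> reflect_left f z < 1})"
    unfolding occupation_def using occupation_set[OF f] by (intro emeasure_mono) auto
  also have "\<dots> \<le> emeasure lborel {0..s} + occupation f"
    unfolding occupation_def using occupation_set[OF f] by (intro emeasure_subadditive) auto
  finally have "ennreal s + occupation f = \<infinity>" using s inf by (simp add: top_unique)
  then show ?thesis by (simp add: ennreal_add_eq_top)
qed

text \<open>No value of \<open>w\<close> before \<open>T\<close> is below the one at
  \<open>T\<close>, so the reflection of \<open>w - 1\<close> is back at its floor at
  \<open>T\<close> and continues as the reflection of the restarted path. The time before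
  \<open>T\<close> contributes a positive amount, because the reflected path starts at
  \<open>-1\<close> and is right-continuous.\<close>

lemma occupation_restart:
  assumes w: "cadlag w" and w0: "w 0 = 0" and T: "0 \<le> T"
    and before: "\<And>s. 0 \<le> s \<Longrightarrow> s < T \<Longrightarrow> - 1 \<le> w s" and at: "w T \<le> - 1"
  shows "\<exists>b>0. occupation (\<lambda>t. w t - 1) = b + occupation (\<lambda>t. w (T + t) - w T - 1)"
proof -
  let ?f = "\<lambda>t. w t - 1" and ?g = "\<lambda>t. w (T + t) - w T - 1"
  have cf: "cadlag ?f" by (intro cadlag_diff w cadlag_const)
  have cg: "cadlag ?g" by (rule cadlag_diff[OF cadlag_diff[OF cadlag_shift[OF w T] cadlag_const] cadlag_const])
  have eq: "reflect_left ?f (T + t) = reflect_left ?g t" if t: "0 \<le> t" for t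
  proof -
    define a where "a = (INF u\<in>{0..T + t}. min (?f u + 1) 0)"
    define b where "b = (INF u\<in>{0..t}. min (?g u + 1) 0)"
    have a: "a \<le> min (?f u + 1) 0" if "0 \<le> u" "u \<le> T + t" for u
      unfolding a_def using that by (intro cINF_lower bdd_below_reflect cf) auto
    have b: "b \<le> min (?g u + 1) 0" if "0 \<le> u" "u \<le> t" for u
      unfolding b_def using that by (intro cINF_lower bdd_below_reflect cg) auto
    have "a - w T \<le> b" unfolding b_def
    proof (rule cINF_greatest)
      fix u assume "u \<in> {0..t}"
      then show "a - w T \<le> min (?g u + 1) 0" using a[of "T + u"] a[of T] T by auto
    qed (use t in auto)
    moreover have "w T + b \<le> a" unfolding a_def
    proof (rule cINF_greatest)
      fix u assume u: "u \<in> {0..T + t}"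
      show "w T + b \<le> min (?f u + 1) 0"
      proof (cases "u < T")
        case True
        then show ?thesis using before[of u] b[of 0] at u t by auto
      next
        case False
        then show ?thesis using b[of "u - T"] at u by auto
      qed
    qed (use T t in auto)
    ultimately show ?thesis unfolding reflect_left_def a_def[symmetric] b_def[symmetric] by simp
  qed
  let ?A = "{z. 0 \<le> z \<and> z < T \<and> reflect_left ?f z < 1}" and ?B = "{z. T \<le> z \<and> reflect_left ?f z < 1}"
  have A: "?A \<in> sets borel" "?B \<in> sets borel"
  proof -
    have "?A = {z. 0 \<le> z \<and> reflect_left ?f z < 1} \<inter> {..<T}" "?B = {z. 0 \<le> z \<and> reflect_left ?f z < 1} \<inter> {T..}"
      using T by auto
    then show "?A \<in> sets borel" "?B \<in> sets borel" using occupation_set[OF cf] by auto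
  qed
  have "{z. 0 \<le> z \<and> reflect_left ?f z < 1} = ?A \<union> ?B" using T by auto
  then have "occupation ?f = emeasure lborel ?A + emeasure lborel ?B"
    unfolding occupation_def using A by (subst plus_emeasure) auto
  also have "emeasure lborel ?B = emeasure (distr lborel borel ((+) T)) ?B" by (simp add: lborel_distr_plus)
  also have "\<dots> = emeasure lborel ((+) T -` ?B)" using A by (subst emeasure_distr) auto
  also have "(+) T -` ?B = {z. 0 \<le> z \<and> reflect_left ?g z < 1}" using eq by force
  finally have "occupation ?f = emeasure lborel ?A + occupation ?g" by (simp only: occupation_def)
  moreover have "0 < emeasure lborel ?A"
  proof -
    have "T \<noteq> 0" using at w0 by auto
    then have T0: "0 < T" using T by simp
    have r0: "reflect_left ?f 0 = - 1" by (simp add: reflect_left_def w0)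
    obtain d where d: "d > 0" "\<And>u. 0 \<le> u \<Longrightarrow> u < 0 + d \<Longrightarrow> \<bar>reflect_left ?f u - reflect_left ?f 0\<bar> < 1"
      using cadlag_right_eps[OF cadlag_reflect_left[OF cf], of 0 1] by auto
    have "0 < emeasure lborel {0..<min d T}" using d T0 by simp
    also have "\<dots> \<le> emeasure lborel ?A"
    proof (rule emeasure_mono)
      show "{0..<min d T} \<subseteq> ?A"
      proof
        fix u assume u: "u \<in> {0..<min d T}"
        then have "\<bar>reflect_left ?f u - reflect_left ?f 0\<bar> < 1" using d(2)[of u] by auto
        then show "u \<in> ?A" using u unfolding r0 by (auto simp: abs_less_iff)
      qed
    qed (use A in simp)
    finally show ?thesis .
  qed
  ultimately show ?thesis by blast
qed

lemma occupation_measurable_cadlag_space: "(\<lambda>p. occupation (\<lambda>t. p t - 1)) \<in> borel_measurable cadlag_space"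
proof -
  have m: "(\<lambda>p. p t - 1) \<in> borel_measurable cadlag_space" if "0 \<le> t" for t
    unfolding cadlag_space_def using that by (intro borel_measurable_diff measurable_restrict_space1 measurable_component_singleton) auto
  have c: "cadlag (\<lambda>t. p t - 1)" if "p \<in> space cadlag_space" for p
    using that by (intro cadlag_diff cadlag_const) (auto simp: cadlag_space_def space_restrict_space)
  have "(\<lambda>p. emeasure lborel {z. 0 \<le> z \<and> reflect_left (\<lambda>t. p t - 1) z < 1}) \<in> borel_measurable cadlag_space"
    by (rule occupation_measurable(1)[where X = "\<lambda>t p. reflect_left (\<lambda>t. p t - 1) t"])
       (auto intro: reflect_left_measurable[where X = "\<lambda>t p. p t - 1"] m c cadlag_reflect_left)
  then show ?thesis by (simp only: occupation_def)
qed

text \<open>A bounded, strictly decreasing function of an extended time, so that equality in law can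
  be exploited through finite expectations. Infinity is treated separately because
  \<open>enn2real\<close> sends it to 0.\<close>

definition decay :: "ennreal \<Rightarrow> real" where
  "decay b = (if b = \<infinity> then 0 else exp (- enn2real b))"

lemma decay_bounds: "0 \<le> decay b" "decay b \<le> 1"
  by (auto simp: decay_def)

lemma decay_measurable: "decay \<in> borel_measurable borel"
  unfolding decay_def by measurable

lemma decay_strict: "0 < b \<Longrightarrow> decay (b + c) \<le> decay c \<and> (decay (b + c) = decay c \<longrightarrow> c = \<infinity>)"
proof (cases "b = \<infinity> \<or> c = \<infinity>")
  case True
  then show ?thesis by (auto simp: decay_def)
next
  case False
  assume "0 < b"
  then have "0 < enn2real b" using False by (simp add: enn2real_positive_iff top.not_eq_extremum)
  moreover have "enn2real (b + c) = enn2real b + enn2real c"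
    using False by (intro enn2real_plus) (auto simp: top.not_eq_extremum)
  ultimately show ?thesis using False by (auto simp: decay_def ennreal_add_eq_top)
qed

text \<open>For a rule that stays true once it is true, selection is a shift by the first index at
  which it holds. Optional skipping then specialises to the Markov property at a stopping
  index.\<close>

lemma sel_pos_upward:
  assumes up: "\<And>j. Q j w \<Longrightarrow> Q (Suc j) w" and ex: "Q J w"
  shows "sel_pos Q k w = (LEAST j. Q j w) + k"
proof -
  define n where "n = (LEAST j. Q j w)"
  have "Q (n + k) w" for k
  proof (induction k)
    case 0
    then show ?case unfolding n_def using LeastI[of "\<lambda>j. Q j w", OF ex] by simp
  qed (use up in simp)
  moreover have "sel_count Q n w = 0"
  proof -
    have "{j. j < n \<and> Q j w} = {}" unfolding n_def by (auto dest: not_less_Least)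
    then show ?thesis by (simp add: sel_count_def)
  qed
  then have "sel_count Q (n + k) w = k" for k
    using \<open>\<And>k. Q (n + k) w\<close> by (induction k) (simp_all add: sel_count_Suc)
  ultimately show ?thesis unfolding n_def[symmetric] by (intro sel_pos_eq)
qed

lemma dyadic_eventually_below:
  assumes f: "cadlag f" and s: "0 \<le> s" "f s < c" "s < b"
  shows "\<forall>\<^sub>F n in sequentially. f (real (nat \<lceil>s * 2 ^ n\<rceil>) * (1/2) ^ n) < c \<and> real (nat \<lceil>s * 2 ^ n\<rceil>) * (1/2) ^ n < b"
proof (rule eventually_conj)
  note d = dyadic_ceiling_tendsto[OF s(1)]
  have "(\<lambda>n. f (real (nat \<lceil>s * 2 ^ n\<rceil>) * (1/2) ^ n)) \<longlonglongrightarrow> f s"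
    using d by (intro cadlag_tendsto[OF f s(1)] always_eventually) auto
  then show "\<forall>\<^sub>F n in sequentially. f (real (nat \<lceil>s * 2 ^ n\<rceil>) * (1/2) ^ n) < c" using s(2) by (rule order_tendstoD(2))
  show "\<forall>\<^sub>F n in sequentially. real (nat \<lceil>s * 2 ^ n\<rceil>) * (1/2) ^ n < b" using d(1) s(3) by (rule order_tendstoD(2))
qed

section \<open>Restarting the process at a first passage\<close>

context levy_process
begin

text \<open>Truncation at \<open>i\<close> bounds the time on every outcome. By right-continuity a
  strict inequality persists for a while, so that the passage is seen on fine grids.\<close>

definition passage :: "nat \<Rightarrow> 'a \<Rightarrow> real" where
  "passage i \<omega> = Inf (insert (real i) {t. 0 \<le> t \<and> Y t \<omega> - Y 0 \<omega> < - 1})"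

text \<open>The quantifier over earlier indices makes the rule persistent, as
  \<open>sel_pos_upward\<close> requires.\<close>

definition passage_rule :: "nat \<Rightarrow> nat \<Rightarrow> nat \<Rightarrow> (nat \<Rightarrow> real) \<Rightarrow> bool" where
  "passage_rule n i j v \<longleftrightarrow> (\<exists>k\<in>{..j}. (\<Sum>l<k. v (Suc l)) < - 1) \<or> i * 2 ^ n \<le> j"

definition passage_index :: "nat \<Rightarrow> nat \<Rightarrow> 'a \<Rightarrow> nat" where
  "passage_index n i \<omega> = (LEAST j. passage_rule n i j (\<lambda>l. steps ((1/2) ^ n) l \<omega>))"

lemma steps_sum: "(\<Sum>l<k. steps h (Suc l) \<omega>) = Y (real k * h) \<omega> - Y 0 \<omega>"
  using sum_lessThan_telescope[of "\<lambda>l. Y (real l * h) \<omega>" k] by simp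

lemma passage_rule_steps:
  "passage_rule n i j (\<lambda>l. steps ((1/2) ^ n) l \<omega>) \<longleftrightarrow>
    (\<exists>k\<le>j. Y (real k * (1/2) ^ n) \<omega> - Y 0 \<omega> < - 1) \<or> i * 2 ^ n \<le> j"
  unfolding passage_rule_def steps_sum by auto

lemma passage_rule_upward: "passage_rule n i j v \<Longrightarrow> passage_rule n i (Suc j) v"
  unfolding passage_rule_def by (auto simp: atMost_Suc)

lemma passage_bounds:
  shows "bdd_below (insert (real i) {t. 0 \<le> t \<and> Y t \<omega> - Y 0 \<omega> < - 1})" "0 \<le> passage i \<omega>" "passage i \<omega> \<le> real i"
proof -
  show bdd: "bdd_below (insert (real i) {t. 0 \<le> t \<and> Y t \<omega> - Y 0 \<omega> < - 1})" by (rule bdd_belowI[of _ 0]) auto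
  show "0 \<le> passage i \<omega>" unfolding passage_def by (rule cInf_greatest) auto
  show "passage i \<omega> \<le> real i" unfolding passage_def by (rule cInf_lower[OF _ bdd]) auto
qed

text \<open>A hit on the grid is a hit of the path, so the discrete passage is never early; a hit at
  \<open>s\<close> is seen at the dyadic times just after \<open>s\<close>, so it is not late in the
  limit. Convergence from above fits the right-continuity of \<open>Y\<close>.\<close>

lemma passage_index_tendsto:
  assumes w: "\<omega> \<in> space M"
  shows "(\<lambda>n. real (passage_index n i \<omega>) * (1/2) ^ n) \<longlonglongrightarrow> passage i \<omega>"
    and "passage i \<omega> \<le> real (passage_index n i \<omega>) * (1/2) ^ n"
proof -
  let ?S = "insert (real i) {t. 0 \<le> t \<and> Y t \<omega> - Y 0 \<omega> < - 1}"
  have top: "passage_rule n i (i * 2 ^ n) v" for n v by (simp add: passage_rule_def)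
  have le_top: "passage_index n i \<omega> \<le> i * 2 ^ n" for n unfolding passage_index_def by (rule Least_le, rule top)
  have i_eq: "real (i * 2 ^ n) * (1/2) ^ n = real i" for n by (simp add: power_one_over)
  have le_i: "real (passage_index n i \<omega>) * (1/2) ^ n \<le> real i" for n
  proof -
    have "real (passage_index n i \<omega>) \<le> real (i * 2 ^ n)" using le_top[of n] by (simp only: of_nat_le_iff)
    then have "real (passage_index n i \<omega>) * (1/2) ^ n \<le> real (i * 2 ^ n) * (1/2) ^ n" by (rule mult_right_mono) simp
    then show ?thesis unfolding i_eq .
  qed
  have mem: "real (passage_index n i \<omega>) * (1/2) ^ n \<in> ?S" for n
  proof -
    have "passage_rule n i (passage_index n i \<omega>) (\<lambda>l. steps ((1/2) ^ n) l \<omega>)"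
      unfolding passage_index_def by (rule LeastI[where P = "\<lambda>j. passage_rule n i j (\<lambda>l. steps ((1/2) ^ n) l \<omega>)"], rule top)
    then consider (hit) k where "k \<le> passage_index n i \<omega>" "Y (real k * (1/2) ^ n) \<omega> - Y 0 \<omega> < - 1"
      | (late) "i * 2 ^ n \<le> passage_index n i \<omega>" unfolding passage_rule_steps by blast
    then show ?thesis
    proof cases
      case hit
      then have "passage_rule n i k (\<lambda>l. steps ((1/2) ^ n) l \<omega>)" unfolding passage_rule_steps by blast
      then have "passage_index n i \<omega> \<le> k" unfolding passage_index_def by (rule Least_le)
      then have "k = passage_index n i \<omega>" using hit by simp
      then show ?thesis using hit by simp
    next
      case late
      then have "passage_index n i \<omega> = i * 2 ^ n" using le_top[of n] by simp
      then show ?thesis using i_eq[of n] by simp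
    qed
  qed
  show lower: "passage i \<omega> \<le> real (passage_index n i \<omega>) * (1/2) ^ n" for n
    unfolding passage_def by (rule cInf_lower[OF mem passage_bounds(1)])
  show "(\<lambda>n. real (passage_index n i \<omega>) * (1/2) ^ n) \<longlonglongrightarrow> passage i \<omega>"
  proof (rule order_tendstoI)
    fix a assume "a < passage i \<omega>"
    then show "\<forall>\<^sub>F n in sequentially. a < real (passage_index n i \<omega>) * (1/2) ^ n"
      using lower by (intro always_eventually allI) (rule less_le_trans)
  next
    fix b assume "passage i \<omega> < b"
    then obtain s where s: "s \<in> ?S" "s < b" unfolding passage_def using cInf_less_iff[OF _ passage_bounds(1)] by blast
    show "\<forall>\<^sub>F n in sequentially. real (passage_index n i \<omega>) * (1/2) ^ n < b"
    proof (cases "s = real i")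
      case True
      then show ?thesis using le_i s(2) by (intro always_eventually allI) (rule le_less_trans, auto)
    next
      case False
      then have s': "0 \<le> s" "Y s \<omega> - Y 0 \<omega> < - 1" using s by auto
      have c: "cadlag (\<lambda>t. Y t \<omega> - Y 0 \<omega>)" by (intro cadlag_diff Y_cadlag[OF w] cadlag_const)
      from dyadic_eventually_below[OF c s' s(2)] show ?thesis
      proof eventually_elim
        case (elim n)
        then have "passage_rule n i (nat \<lceil>s * 2 ^ n\<rceil>) (\<lambda>l. steps ((1/2) ^ n) l \<omega>)" unfolding passage_rule_steps by blast
        then have "passage_index n i \<omega> \<le> nat \<lceil>s * 2 ^ n\<rceil>" unfolding passage_index_def by (rule Least_le)
        then have "real (passage_index n i \<omega>) * (1/2) ^ n \<le> real (nat \<lceil>s * 2 ^ n\<rceil>) * (1/2) ^ n" by (intro mult_right_mono) auto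
        then show ?case using elim by linarith
      qed
    qed
  qed
qed

lemma passage_rule_adapted: "iid_increments.adapted (passage_rule n i)"
proof -
  \<comment> \<open>Adaptedness concerns the rule alone, so any instance of the locale gives access
    to its definition.\<close>
  interpret S: iid_increments M "steps 1" by (rule steps_iid) simp
  show ?thesis unfolding S.adapted_def
  proof (intro conjI allI impI)
    fix j
    have "Measurable.pred (Pi\<^sub>M {..j} (\<lambda>_. borel)) (\<lambda>v. \<exists>k\<in>{..j}. (\<Sum>l<k. v (Suc l)) < (- 1 :: real))"
    proof (rule pred_intros_finite(4))
      fix k assume k: "k \<in> {..j}"
      have [measurable]: "(\<lambda>v. \<Sum>l<k. v (Suc l)) \<in> borel_measurable (Pi\<^sub>M {..j} (\<lambda>_. borel :: real measure))"
        using k by (intro borel_measurable_sum measurable_component_singleton) auto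
      show "Measurable.pred (Pi\<^sub>M {..j} (\<lambda>_. borel)) (\<lambda>v. (\<Sum>l<k. v (Suc l)) < (- 1 :: real))" by measurable
    qed simp
    then have "Measurable.pred (Pi\<^sub>M {..j} (\<lambda>_. borel)) (\<lambda>v. (\<exists>k\<in>{..j}. (\<Sum>l<k. v (Suc l)) < (- 1 :: real)) \<or> i * 2 ^ n \<le> j)"
      by (rule pred_intros_logic) simp
    then show "Measurable.pred (Pi\<^sub>M {..j} (\<lambda>_. borel)) (passage_rule n i j)"
      unfolding passage_rule_def[abs_def] .
    fix v v' :: "nat \<Rightarrow> real" assume eq: "\<forall>l\<le>j. v l = v' l"
    have "(\<Sum>l<k. v (Suc l)) = (\<Sum>l<k. v' (Suc l))" if "k \<le> j" for k
      using eq that by (intro sum.cong) auto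
    then show "passage_rule n i j v = passage_rule n i j v'" unfolding passage_rule_def by auto
  qed
qed

lemma passage_index_measurable: "(\<lambda>\<omega>. passage_index n i \<omega>) \<in> M \<rightarrow>\<^sub>M count_space UNIV"
  unfolding passage_index_def
proof (rule measurable_Least)
  fix j
  have [measurable]: "(\<lambda>\<omega>. Y (real k * (1/2) ^ n) \<omega> - Y 0 \<omega>) \<in> borel_measurable M" for k
    by (intro borel_measurable_diff Y_measurable) auto
  show "Measurable.pred M (\<lambda>\<omega>. passage_rule n i j (\<lambda>l. steps ((1/2) ^ n) l \<omega>))"
    unfolding passage_rule_steps by measurable
qed

lemma passage_measurable: "passage i \<in> borel_measurable M"
proof (rule borel_measurable_LIMSEQ_real[where u = "\<lambda>n \<omega>. real (passage_index n i \<omega>) * (1/2) ^ n"])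
  show "(\<lambda>n. real (passage_index n i \<omega>) * (1/2) ^ n) \<longlonglongrightarrow> passage i \<omega>" if "\<omega> \<in> space M" for \<omega>
    by (rule passage_index_tendsto(1)[OF that])
  show "(\<lambda>\<omega>. real (passage_index n i \<omega>) * (1/2) ^ n) \<in> borel_measurable M" for n
    using passage_index_measurable[of n i] by measurable
qed

text \<open>The strong Markov property at the (truncated) first passage time below \<open>-1\<close>.\<close>

lemma passage_restart_law:
  "equal_in_law M (\<lambda>\<omega> t. Y (passage i \<omega> + t) \<omega> - Y (passage i \<omega>) \<omega>) (\<lambda>\<omega> t. Y t \<omega> - Y 0 \<omega>)"
proof (rule equal_in_lawI)
  show "prob_space M" by unfold_locales
  have eval: "(\<lambda>\<omega>. Y (passage i \<omega> + t) \<omega>) \<in> borel_measurable M" if "0 \<le> t" for t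
  proof (rule cadlag_eval_measurable[where X = Y and \<tau> = "\<lambda>\<omega>. passage i \<omega> + t"])
    show "(\<lambda>\<omega>. passage i \<omega> + t) \<in> borel_measurable M" using passage_measurable by measurable
  qed (use that passage_bounds(2) in \<open>auto intro: Y_measurable Y_cadlag\<close>)
  show m1: "(\<lambda>\<omega>. Y (passage i \<omega> + t) \<omega> - Y (passage i \<omega>) \<omega>) \<in> borel_measurable M" if "0 \<le> t" for t
    using eval[OF that] eval[of 0] by simp
  show m2: "(\<lambda>\<omega>. Y t \<omega> - Y 0 \<omega>) \<in> borel_measurable M" if "0 \<le> t" for t
    using that by (intro borel_measurable_diff Y_measurable) auto
  show "cadlag (\<lambda>t. Y (passage i \<omega> + t) \<omega> - Y (passage i \<omega>) \<omega>)" if "\<omega> \<in> space M" for \<omega>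
    by (rule cadlag_diff[OF cadlag_shift[OF Y_cadlag[OF that] passage_bounds(2)] cadlag_const])
  show "cadlag (\<lambda>t. Y t \<omega> - Y 0 \<omega>)" if "\<omega> \<in> space M" for \<omega>
    by (rule cadlag_diff[OF Y_cadlag[OF that] cadlag_const])
  fix J :: "real set" and g :: "real \<Rightarrow> real \<Rightarrow> real"
  assume J: "finite J" "J \<subseteq> {0..}" and g: "\<And>t. continuous_on UNIV (g t)" "\<And>t x. 0 \<le> g t x \<and> g t x \<le> 1"
  define k where "k n t = nat \<lceil>t * 2 ^ n\<rceil>" for n :: nat and t :: real
  define h where "h n = (1/2 :: real) ^ n" for n :: nat
  have gm: "g t \<in> borel_measurable borel" for t using g(1) by (rule borel_measurable_continuous_onI)
  have pb: "norm (\<Prod>t\<in>J. g t (x t)) \<le> 1" for x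
  proof -
    have "0 \<le> (\<Prod>t\<in>J. g t (x t))" "(\<Prod>t\<in>J. g t (x t)) \<le> 1" using g(2) by (auto intro!: prod_nonneg prod_le_1)
    then show ?thesis by simp
  qed
  have cont: "(\<lambda>n. \<Prod>t\<in>J. g t (x n t)) \<longlonglongrightarrow> (\<Prod>t\<in>J. g t (y t))" if "\<And>t. t \<in> J \<Longrightarrow> (\<lambda>n. x n t) \<longlonglongrightarrow> y t" for x y
  proof (rule tendsto_prod)
    fix t assume "t \<in> J"
    have "isCont (g t) (y t)" using g(1)[of t] by (simp add: continuous_on_eq_continuous_at)
    then show "(\<lambda>n. g t (x n t)) \<longlonglongrightarrow> g t (y t)" using that[OF \<open>t \<in> J\<close>] by (rule isCont_tendsto_compose)
  qed
  \<comment> \<open>On the grid, the increments after the passage are the ones selected by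
    \<open>passage_rule\<close>, so optional skipping gives equality for each \<open>n\<close>
    before any limit is taken.\<close>
  have step: "(\<integral>\<omega>. (\<Prod>t\<in>J. g t (Y (real (passage_index n i \<omega> + k n t) * h n) \<omega> - Y (real (passage_index n i \<omega>) * h n) \<omega>)) \<partial>M) =
      (\<integral>\<omega>. (\<Prod>t\<in>J. g t (Y (real (k n t) * h n) \<omega> - Y 0 \<omega>)) \<partial>M)" for n
  proof -
    interpret S: iid_increments M "steps (h n)" by (rule steps_iid) (simp add: h_def)
    define m where "m = Max (insert 0 (k n ` J))"
    have m: "k n t \<le> m" if "t \<in> J" for t using that J by (auto simp: m_def)
    define G where "G v = (\<Prod>t\<in>J. g t (\<Sum>l<k n t. v (Suc l)))" for v :: "nat \<Rightarrow> real"
    have "(\<integral>\<omega>. G (\<lambda>l. S.selected (passage_rule n i) l \<omega>) \<partial>M) = (\<integral>\<omega>. G (\<lambda>l. steps (h n) l \<omega>) \<partial>M)"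
    proof (rule S.optional_skipping_integral[OF _ _, where J = "i * 2 ^ n" and m = m])
      show "S.adapted (passage_rule n i)" by (rule passage_rule_adapted)
      show "passage_rule n i j v" if "i * 2 ^ n \<le> j" for j v using that by (simp add: passage_rule_def)
      show "G \<in> borel_measurable (Pi\<^sub>M {..m} (\<lambda>_. borel))"
        unfolding G_def
      proof (intro borel_measurable_prod measurable_compose[OF _ gm] borel_measurable_sum measurable_component_singleton)
        fix t l assume "t \<in> J" "l \<in> {..<k n t}"
        then show "Suc l \<in> {..m}" using m[of t] by auto
      qed
      fix v v' :: "nat \<Rightarrow> real" assume eq: "\<And>l. l \<le> m \<Longrightarrow> v l = v' l"
      have "(\<Sum>l<k n t. v (Suc l)) = (\<Sum>l<k n t. v' (Suc l))" if "t \<in> J" for t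
        using eq m[OF that] by (intro sum.cong) auto
      then show "G v = G v'" unfolding G_def by (intro prod.cong) auto
    qed
    moreover have "S.selected (passage_rule n i) (Suc l) \<omega> = steps (h n) (Suc (passage_index n i \<omega> + l)) \<omega>" for l \<omega>
    proof -
      have "sel_pos (passage_rule n i) l (\<lambda>l. steps (h n) l \<omega>) = passage_index n i \<omega> + l"
        unfolding passage_index_def h_def[symmetric]
        by (rule sel_pos_upward[where J = "i * 2 ^ n"]) (auto intro: passage_rule_upward simp: passage_rule_def[of n i "i * 2 ^ n"])
      then show ?thesis by (simp only: S.selected_def nat.case)
    qed
    moreover have "(\<Sum>l<c. steps (h n) (Suc (a + l)) \<omega>) = Y (real (a + c) * h n) \<omega> - Y (real a * h n) \<omega>" for a c \<omega>
      using sum_lessThan_telescope[of "\<lambda>l. Y (real (a + l) * h n) \<omega>" c] by simp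
    ultimately show ?thesis unfolding G_def by (simp only: steps_sum)
  qed
  have l1: "(\<lambda>n. \<integral>\<omega>. (\<Prod>t\<in>J. g t (Y (real (passage_index n i \<omega> + k n t) * h n) \<omega> - Y (real (passage_index n i \<omega>) * h n) \<omega>)) \<partial>M)
      \<longlonglongrightarrow> (\<integral>\<omega>. (\<Prod>t\<in>J. g t (Y (passage i \<omega> + t) \<omega> - Y (passage i \<omega>) \<omega>)) \<partial>M)"
  proof (rule integral_dominated_convergence[where w = "\<lambda>_. 1"])
    show "(\<lambda>\<omega>. \<Prod>t\<in>J. g t (Y (passage i \<omega> + t) \<omega> - Y (passage i \<omega>) \<omega>)) \<in> borel_measurable M"
      using J m1 by (intro borel_measurable_prod measurable_compose[OF _ gm]) auto
    have ev: "(\<lambda>\<omega>. Y (real (passage_index n i \<omega> + c) * h n) \<omega>) \<in> borel_measurable M" for n c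
    proof (rule measurable_compose_countable[where g = "passage_index n i" and f = "\<lambda>a \<omega>. Y (real (a + c) * h n) \<omega>"])
      show "Y (real (a + c) * h n) \<in> borel_measurable M" for a by (intro Y_measurable) (simp add: h_def)
    qed (rule passage_index_measurable)
    show "(\<lambda>\<omega>. \<Prod>t\<in>J. g t (Y (real (passage_index n i \<omega> + k n t) * h n) \<omega> - Y (real (passage_index n i \<omega>) * h n) \<omega>)) \<in> borel_measurable M" for n
      using ev[of n 0] by (intro borel_measurable_prod measurable_compose[OF _ gm] borel_measurable_diff ev) simp
    show "AE \<omega> in M. (\<lambda>n. \<Prod>t\<in>J. g t (Y (real (passage_index n i \<omega> + k n t) * h n) \<omega> - Y (real (passage_index n i \<omega>) * h n) \<omega>))
        \<longlonglongrightarrow> (\<Prod>t\<in>J. g t (Y (passage i \<omega> + t) \<omega> - Y (passage i \<omega>) \<omega>))"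
    proof (intro AE_I2 cont tendsto_diff)
      fix \<omega> t assume w: "\<omega> \<in> space M" and "t \<in> J"
      then have t: "0 \<le> t" using J by auto
      note p = passage_index_tendsto[OF w, of i, folded h_def]
      note d = dyadic_ceiling_tendsto[OF t, folded h_def k_def]
      have eq: "real (passage_index n i \<omega> + k n t) * h n = real (passage_index n i \<omega>) * h n + real (k n t) * h n" for n
        by (simp add: distrib_right)
      show "(\<lambda>n. Y (real (passage_index n i \<omega> + k n t) * h n) \<omega>) \<longlonglongrightarrow> Y (passage i \<omega> + t) \<omega>"
        unfolding eq
      proof (rule cadlag_tendsto[OF Y_cadlag[OF w]])
        show "(\<lambda>n. real (passage_index n i \<omega>) * h n + real (k n t) * h n) \<longlonglongrightarrow> passage i \<omega> + t"
          by (intro tendsto_add p d)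
        show "\<forall>\<^sub>F n in sequentially. passage i \<omega> + t \<le> real (passage_index n i \<omega>) * h n + real (k n t) * h n"
          by (intro always_eventually allI add_mono p d)
      qed (use t passage_bounds(2) in auto)
      show "(\<lambda>n. Y (real (passage_index n i \<omega>) * h n) \<omega>) \<longlonglongrightarrow> Y (passage i \<omega>) \<omega>"
        by (rule cadlag_tendsto[OF Y_cadlag[OF w] passage_bounds(2) p(1)]) (intro always_eventually allI p)
    qed
    show "AE \<omega> in M. norm (\<Prod>t\<in>J. g t (Y (real (passage_index n i \<omega> + k n t) * h n) \<omega> - Y (real (passage_index n i \<omega>) * h n) \<omega>)) \<le> 1" for n
      by (intro AE_I2 pb)
  qed simp
  have l2: "(\<lambda>n. \<integral>\<omega>. (\<Prod>t\<in>J. g t (Y (real (k n t) * h n) \<omega> - Y 0 \<omega>)) \<partial>M) \<longlonglongrightarrow> (\<integral>\<omega>. (\<Prod>t\<in>J. g t (Y t \<omega> - Y 0 \<omega>)) \<partial>M)"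
  proof (rule integral_dominated_convergence[where w = "\<lambda>_. 1"])
    show "(\<lambda>\<omega>. \<Prod>t\<in>J. g t (Y t \<omega> - Y 0 \<omega>)) \<in> borel_measurable M"
      using J m2 by (intro borel_measurable_prod measurable_compose[OF _ gm]) auto
    show "(\<lambda>\<omega>. \<Prod>t\<in>J. g t (Y (real (k n t) * h n) \<omega> - Y 0 \<omega>)) \<in> borel_measurable M" for n
      by (intro borel_measurable_prod measurable_compose[OF _ gm] m2) (simp add: h_def)
    show "AE \<omega> in M. (\<lambda>n. \<Prod>t\<in>J. g t (Y (real (k n t) * h n) \<omega> - Y 0 \<omega>)) \<longlonglongrightarrow> (\<Prod>t\<in>J. g t (Y t \<omega> - Y 0 \<omega>))"
    proof (intro AE_I2 cont tendsto_diff tendsto_const)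
      fix \<omega> t assume w: "\<omega> \<in> space M" and "t \<in> J"
      then have t: "0 \<le> t" using J by auto
      note d = dyadic_ceiling_tendsto[OF t, folded h_def k_def]
      show "(\<lambda>n. Y (real (k n t) * h n) \<omega>) \<longlonglongrightarrow> Y t \<omega>"
        by (rule cadlag_tendsto[OF Y_cadlag[OF w] t d(1)]) (intro always_eventually allI d)
    qed
    show "AE \<omega> in M. norm (\<Prod>t\<in>J. g t (Y (real (k n t) * h n) \<omega> - Y 0 \<omega>)) \<le> 1" for n by (intro AE_I2 pb)
  qed simp
  show "(\<integral>\<omega>. (\<Prod>t\<in>J. g t (Y (passage i \<omega> + t) \<omega> - Y (passage i \<omega>) \<omega>)) \<partial>M) = (\<integral>\<omega>. (\<Prod>t\<in>J. g t (Y t \<omega> - Y 0 \<omega>)) \<partial>M)"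
    by (rule LIMSEQ_unique[OF l1]) (use l2 in \<open>simp only: step\<close>)
qed

text \<open>Under \<open>decay\<close> the restarted occupation time has the same mean as the
  original one but is pointwise at least as large, with equality only where it is infinite; a
  nonnegative variable of mean 0 vanishes almost surely. The truncated passage times agree with the
  true one only from an \<open>i\<close> on that depends on the outcome, so the comparison is made
  for the limit \<open>L\<close> of the differences.\<close>

lemma infinite_occupation:
  "AE \<omega> in M. occupation (\<lambda>t. Y t \<omega> - Y 0 \<omega> - 1) = \<infinity>"
proof -
  define F where "F p = decay (occupation (\<lambda>t. p t - 1))" for p
  have F: "F \<in> borel_measurable cadlag_space"
    unfolding F_def by (rule measurable_compose[OF occupation_measurable_cadlag_space decay_measurable])
  define X where "X i \<omega> t = Y (passage i \<omega> + t) \<omega> - Y (passage i \<omega>) \<omega>" for i \<omega> t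
  define W where "W \<omega> t = Y t \<omega> - Y 0 \<omega>" for \<omega> t
  have law: "equal_in_law M (X i) W" for i
    using passage_restart_law[of i] unfolding X_def[abs_def] W_def[abs_def] .
  have F_restrict: "F (restrict p {0..}) = F p" for p
    unfolding F_def by (intro arg_cong[where f = decay] occupation_cong) simp
  have mX: "(\<lambda>\<omega>. F (X i \<omega>)) \<in> borel_measurable M" and mW: "(\<lambda>\<omega>. F (W \<omega>)) \<in> borel_measurable M"
    and eq: "(\<integral>\<omega>. F (X i \<omega>) \<partial>M) = (\<integral>\<omega>. F (W \<omega>) \<partial>M)" for i
  proof -
    have m: "(\<lambda>\<omega>. restrict (X i \<omega>) {0..}) \<in> M \<rightarrow>\<^sub>M cadlag_space" "(\<lambda>\<omega>. restrict (W \<omega>) {0..}) \<in> M \<rightarrow>\<^sub>M cadlag_space"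
      and d: "distr M cadlag_space (\<lambda>\<omega>. restrict (X i \<omega>) {0..}) = distr M cadlag_space (\<lambda>\<omega>. restrict (W \<omega>) {0..})"
      using law[of i] by (auto simp: equal_in_law_def)
    show "(\<lambda>\<omega>. F (X i \<omega>)) \<in> borel_measurable M" "(\<lambda>\<omega>. F (W \<omega>)) \<in> borel_measurable M"
      using measurable_compose[OF m(1) F] measurable_compose[OF m(2) F] by (simp_all only: F_restrict)
    show "(\<integral>\<omega>. F (X i \<omega>) \<partial>M) = (\<integral>\<omega>. F (W \<omega>) \<partial>M)"
      using integral_distr[OF m(1) F] integral_distr[OF m(2) F] d by (simp only: F_restrict)
  qed
  define D where "D i \<omega> = F (X i \<omega>) - F (W \<omega>)" for i \<omega>
  have F_bounds: "0 \<le> F p" "F p \<le> 1" for p unfolding F_def by (rule decay_bounds)+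
  have int: "integrable M (\<lambda>\<omega>. F (X i \<omega>))" "integrable M (\<lambda>\<omega>. F (W \<omega>))" for i
    using mX mW F_bounds by (auto intro!: integrable_const_bound[of _ 1])
  have D0: "(\<integral>\<omega>. D i \<omega> \<partial>M) = 0" for i
    unfolding D_def using Bochner_Integration.integral_diff[OF int] eq by simp
  have Dm: "D i \<in> borel_measurable M" for i unfolding D_def using mX mW by measurable
  define L where "L \<omega> = lim (\<lambda>i. D i \<omega>)" for \<omega>
  have Lm: "L \<in> borel_measurable M" unfolding L_def by (rule borel_measurable_lim_metric[OF Dm])
  have key: "AE \<omega> in M. (\<lambda>i. D i \<omega>) \<longlonglongrightarrow> L \<omega> \<and> 0 \<le> L \<omega> \<and> (L \<omega> = 0 \<longrightarrow> occupation (\<lambda>t. Y t \<omega> - Y 0 \<omega> - 1) = \<infinity>)"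
    using unbounded_below
  proof (rule AE_mp, intro AE_I2 impI)
    fix \<omega> assume w: "\<omega> \<in> space M" and unb: "\<forall>d. \<exists>k::nat. Y (real k) \<omega> - Y 0 \<omega> \<le> - d"
    let ?H = "{t. 0 \<le> t \<and> Y t \<omega> - Y 0 \<omega> < - 1}"
    obtain k :: nat where "Y (real k) \<omega> - Y 0 \<omega> \<le> - 2" using unb by blast
    then have ne: "real k \<in> ?H" by simp
    have bdd: "bdd_below ?H" by (rule bdd_belowI[of _ 0]) auto
    define T where "T = Inf ?H"
    have T0: "0 \<le> T" unfolding T_def by (rule cInf_greatest) (use ne in blast, simp)
    have Tk: "T \<le> real k" unfolding T_def by (rule cInf_lower[OF ne bdd])
    have pT: "passage i \<omega> = T" if "k \<le> i" for i
    proof -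
      have ne': "?H \<noteq> {}" using ne by blast
      have "passage i \<omega> = min (real i) T"
        unfolding passage_def T_def using cInf_insert[OF ne' bdd, of "real i"] by (simp only: inf_min)
      then show ?thesis using Tk that by simp
    qed
    have c: "cadlag (W \<omega>)" unfolding W_def by (rule cadlag_diff[OF Y_cadlag[OF w] cadlag_const])
    have before: "- 1 \<le> W \<omega> s" if "0 \<le> s" "s < T" for s
    proof (rule ccontr)
      assume "\<not> - 1 \<le> W \<omega> s"
      then have "s \<in> ?H" using that by (simp add: W_def)
      then have "T \<le> s" unfolding T_def by (rule cInf_lower[OF _ bdd])
      then show False using that by simp
    qed
    have at: "W \<omega> T \<le> - 1"
    proof (rule ccontr)
      assume "\<not> W \<omega> T \<le> - 1"
      then have e: "0 < W \<omega> T + 1" by simp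
      obtain d where d: "d > 0" "\<And>u. T \<le> u \<Longrightarrow> u < T + d \<Longrightarrow> \<bar>W \<omega> u - W \<omega> T\<bar> < W \<omega> T + 1"
        using cadlag_right_eps[OF c T0 e] by blast
      have "Inf ?H < T + d" using d(1) by (simp add: T_def)
      moreover have "?H \<noteq> {}" using ne by blast
      ultimately obtain u where u: "u \<in> ?H" "u < T + d" using cInf_less_iff[OF _ bdd] by blast
      then have "T \<le> u" unfolding T_def by (intro cInf_lower[OF _ bdd])
      then show False using d(2)[of u] u by (auto simp: W_def abs_less_iff)
    qed
    have "W \<omega> 0 = 0" by (simp add: W_def)
    from occupation_restart[OF c this T0 before at] obtain b where
      b: "b > 0" "occupation (\<lambda>t. W \<omega> t - 1) = b + occupation (\<lambda>t. W \<omega> (T + t) - W \<omega> T - 1)" by blast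
    have X_eq: "(\<lambda>t. X i \<omega> t - 1) = (\<lambda>t. W \<omega> (T + t) - W \<omega> T - 1)" if "k \<le> i" for i
      unfolding X_def W_def pT[OF that] by simp
    define D\<^sub>0 where "D\<^sub>0 = decay (occupation (\<lambda>t. W \<omega> (T + t) - W \<omega> T - 1)) - F (W \<omega>)"
    have D_eq: "D i \<omega> = D\<^sub>0" if "k \<le> i" for i
      unfolding D_def D\<^sub>0_def F_def X_eq[OF that] ..
    have lim: "(\<lambda>i. D i \<omega>) \<longlonglongrightarrow> D\<^sub>0"
      by (rule tendsto_eventually) (use D_eq in \<open>auto intro!: eventually_sequentiallyI[of k]\<close>)
    then have L: "L \<omega> = D\<^sub>0" unfolding L_def by (rule limI)
    have D\<^sub>0: "0 \<le> D\<^sub>0 \<and> (D\<^sub>0 = 0 \<longrightarrow> occupation (\<lambda>t. W \<omega> (T + t) - W \<omega> T - 1) = \<infinity>)"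
      unfolding D\<^sub>0_def F_def b(2) using decay_strict[OF b(1)] by simp
    have "occupation (\<lambda>t. Y t \<omega> - Y 0 \<omega> - 1) = b + occupation (\<lambda>t. W \<omega> (T + t) - W \<omega> T - 1)"
      using b(2) unfolding W_def .
    then show "(\<lambda>i. D i \<omega>) \<longlonglongrightarrow> L \<omega> \<and> 0 \<le> L \<omega> \<and> (L \<omega> = 0 \<longrightarrow> occupation (\<lambda>t. Y t \<omega> - Y 0 \<omega> - 1) = \<infinity>)"
      using D\<^sub>0 lim unfolding L by simp
  qed
  have Db: "norm (D i \<omega>) \<le> 1" for i \<omega>
    using F_bounds[of "X i \<omega>"] F_bounds[of "W \<omega>"] unfolding D_def real_norm_def abs_le_iff by linarith
  have "(\<lambda>i. \<integral>\<omega>. D i \<omega> \<partial>M) \<longlonglongrightarrow> (\<integral>\<omega>. L \<omega> \<partial>M)"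
    by (rule integral_dominated_convergence[where w = "\<lambda>_. 1"]) (use Lm Dm Db key in auto)
  then have L0: "(\<integral>\<omega>. L \<omega> \<partial>M) = 0" unfolding D0 by (simp add: LIMSEQ_const_iff)
  have nn: "AE \<omega> in M. 0 \<le> L \<omega>" using key by auto
  have L1: "AE \<omega> in M. norm (L \<omega>) \<le> 1"
    using key
  proof (rule AE_mp, intro AE_I2 impI)
    fix \<omega> assume "(\<lambda>i. D i \<omega>) \<longlonglongrightarrow> L \<omega> \<and> 0 \<le> L \<omega> \<and> (L \<omega> = 0 \<longrightarrow> occupation (\<lambda>t. Y t \<omega> - Y 0 \<omega> - 1) = \<infinity>)"
    then have "(\<lambda>i. norm (D i \<omega>)) \<longlonglongrightarrow> norm (L \<omega>)" by (intro tendsto_norm) simp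
    then show "norm (L \<omega>) \<le> 1" by (rule LIMSEQ_le_const2) (use Db in auto)
  qed
  have "integrable M L" using L1 Lm by (rule integrable_const_bound)
  then have "AE \<omega> in M. L \<omega> = 0" using integral_nonneg_eq_0_iff_AE[OF _ nn] L0 by simp
  then show ?thesis using key by auto
qed

end

section \<open>Convergence of the walk of low increments\<close>

text \<open>Deleting the steps taken above \<open>1 - e\<close> from the walk reflected at \<open>-1\<close> leaves, up to
  \<open>e + d\<close>, the walk reflected at both ends and driven by the remaining steps: after each deletion
  the first walk resumes just below \<open>1 - e\<close>, the second one at or slightly below \<open>1\<close>, and the
  distance never grows in between.\<close>

lemma walk_comparison:
  assumes x: "- 1 \<le> x" "x \<le> 1" and e: "0 < e" "e < 2" and d: "0 \<le> d" "\<And>j. j < N \<Longrightarrow> - d \<le> \<xi> j"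
    and p: "\<And>k. p k < p (Suc k)" "\<And>k. p k < N \<Longrightarrow> walk1 x \<xi> (p k) < 1 - e"
    and before: "\<And>j. j < p 0 \<Longrightarrow> 1 - e \<le> walk1 x \<xi> j"
    and between: "\<And>k j. p k < j \<Longrightarrow> j < p (Suc k) \<Longrightarrow> 1 - e \<le> walk1 x \<xi> j"
  shows "p k < N \<Longrightarrow> 0 \<le> walk2 x (\<lambda>l. \<xi> (p l)) k - walk1 x \<xi> (p k) \<and>
    walk2 x (\<lambda>l. \<xi> (p l)) k - walk1 x \<xi> (p k) \<le> e + d"
proof (induction k)
  case 0
  show ?case
  \<comment> \<open>If the first steps are deleted, the start lies in \<open>[1 - e, 1]\<close> and
    the second walk is still there, while the first resumes in
    \<open>[1 - e - d, 1 - e)\<close>.\<close>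
  proof (cases "p 0")
    case 0
    then show ?thesis using e d by simp
  next
    case (Suc j)
    have "1 - e \<le> walk1 x \<xi> 0" using before[of 0] Suc by simp
    then have "1 - e \<le> x" by simp
    moreover have "1 - e - d \<le> walk1 x \<xi> (p 0)"
      using before[of j] d(2)[of j] 0 unfolding Suc by simp
    ultimately show ?thesis using p(2)[OF 0] x by simp
  qed
next
  case (Suc k)
  have kN: "p k < N" using Suc.prems p(1)[of k] by simp
  define z where "z = walk1 x \<xi> (p k)"
  define r where "r = walk2 x (\<lambda>l. \<xi> (p l)) k"
  define y where "y = z + \<xi> (p k)"
  have zr: "0 \<le> r - z" "r - z \<le> e + d" using Suc.IH[OF kN] by (auto simp: z_def r_def)
  have z1: "walk1 x \<xi> (Suc (p k)) = max (-1) y" by (simp add: y_def z_def)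
  have r1: "walk2 x (\<lambda>l. \<xi> (p l)) (Suc k) = max (-1) (min 1 (y + (r - z)))" by (simp add: y_def r_def)
  note last = p(2)[OF Suc.prems]
  show ?case
  proof (cases "p (Suc k) = Suc (p k)")
    case True
    \<comment> \<open>Both walks take the same step. The common floor can only shrink their gap, and
      the ceiling 1 cannot push the upper walk below the lower one, which stays under
      \<open>1 - e\<close>.\<close>
    have "max (-1) y < 1 - e" using last unfolding True z1 .
    then show ?thesis unfolding True z1 r1 using zr e by (auto simp: max_def min_def)
  next
    case False
    then have gap: "Suc (p k) < p (Suc k)" using p(1)[of k] by simp
    have "1 - e \<le> max (-1) y" using between[of k "Suc (p k)"] gap z1 by simp
    then have "1 - e \<le> y" using e by (auto simp: max_def split: if_splits)
    then have "1 - e \<le> walk2 x (\<lambda>l. \<xi> (p l)) (Suc k)" "walk2 x (\<lambda>l. \<xi> (p l)) (Suc k) \<le> 1"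
      unfolding r1 using zr e by (auto simp: max_def min_def)
    moreover obtain j where j: "p (Suc k) = Suc j" using gap by (cases "p (Suc k)") auto
    \<comment> \<open>The last deleted step starts at or above \<open>1 - e\<close> and descends by
      at most \<open>d\<close>, while the other walk has waited in
      \<open>[1 - e, 1]\<close>.\<close>
    have "1 - e \<le> walk1 x \<xi> j" using between[of k j] gap j by simp
    then have "1 - e - d \<le> walk1 x \<xi> (p (Suc k))" using d(2)[of j] Suc.prems j by simp
    ultimately show ?thesis using last by simp
  qed
qed

text \<open>Index \<open>j\<close> stands for the cell \<open>((j - 1) * h, j * h]\<close>, on which
  the ceiling of \<open>u / h\<close> is \<open>j\<close>; counting indices from 1 on thus becomes
  measuring time.\<close>

lemma measure_card:
  assumes h: "0 < h"
  shows "measure lborel {u. 0 < u \<and> u \<le> real N * h \<and> P (nat \<lceil>u / h\<rceil>)} = real (card {j \<in> {1..N}. P j}) * h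
    \<and> {u. 0 < u \<and> u \<le> real N * h \<and> P (nat \<lceil>u / h\<rceil>)} \<in> sets borel"
proof (induction N)
  case 0
  have empty: "{u. 0 < u \<and> u \<le> real 0 * h \<and> P (nat \<lceil>u / h\<rceil>)} = {}" by auto
  show ?case unfolding empty by simp
next
  case (Suc N)
  let ?A = "\<lambda>N. {u. 0 < u \<and> u \<le> real N * h \<and> P (nat \<lceil>u / h\<rceil>)}"
  let ?B = "{real N * h<..real (Suc N) * h}"
  have ceil: "nat \<lceil>u / h\<rceil> = Suc N" if "u \<in> ?B" for u
  proof -
    have "real N < u / h" "u / h \<le> real (Suc N)" using that h by (auto simp: field_simps)
    then have "\<lceil>u / h\<rceil> = int (Suc N)" by (intro ceiling_unique) auto
    then show ?thesis by simp
  qed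
  have split: "?A (Suc N) = ?A N \<union> (if P (Suc N) then ?B else {})"
  proof (intro set_eqI iffI)
    fix u assume u: "u \<in> ?A (Suc N)"
    show "u \<in> ?A N \<union> (if P (Suc N) then ?B else {})"
    proof (cases "u \<le> real N * h")
      case True
      then show ?thesis using u by simp
    next
      case False
      then have "u \<in> ?B" using u by simp
      then show ?thesis using ceil[of u] u by simp
    qed
  next
    fix u assume u: "u \<in> ?A N \<union> (if P (Suc N) then ?B else {})"
    have le: "real N * h \<le> real (Suc N) * h" using h by (intro mult_right_mono) auto
    have N0: "0 \<le> real N * h" using h by simp
    show "u \<in> ?A (Suc N)"
    proof (cases "u \<in> ?A N")
      case True
      then show ?thesis using le by auto
    next
      case False
      then have "P (Suc N)" "u \<in> ?B" using u by (auto split: if_splits)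
      then show ?thesis using ceil[of u] N0 by auto
    qed
  qed
  have B: "?B \<in> sets borel" "measure lborel ?B = h"
    using h by (auto simp: algebra_simps)
  have A: "?A N \<in> sets borel" "measure lborel (?A N) = real (card {j \<in> {1..N}. P j}) * h" using Suc by auto
  have card: "card {j \<in> {1..Suc N}. P j} = card {j \<in> {1..N}. P j} + (if P (Suc N) then 1 else 0)"
  proof -
    have "{j \<in> {1..Suc N}. P j} = (if P (Suc N) then insert (Suc N) {j \<in> {1..N}. P j} else {j \<in> {1..N}. P j})"
      by (auto simp: le_Suc_eq)
    then show ?thesis by simp
  qed
  have fin: "emeasure lborel (?A N) \<noteq> \<infinity>"
  proof -
    have "emeasure lborel (?A N) \<le> emeasure lborel {0..real N * h}" by (intro emeasure_mono) auto
    also have "\<dots> < \<infinity>" using h by simp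
    finally show ?thesis by simp
  qed
  show ?case
  proof (cases "P (Suc N)")
    case True
    have "measure lborel (?A N \<union> ?B) = measure lborel (?A N) + measure lborel ?B"
      by (rule measure_Union) (use A B fin h in auto)
    then show ?thesis unfolding split card using True A B by (simp add: algebra_simps)
  next
    case False
    then show ?thesis unfolding split card using A by simp
  qed
qed

text \<open>Fatou's lemma for strict sublevel sets: a point with \<open>q u < c\<close> eventually
  satisfies \<open>qn n u < c\<close>, whereas nothing is known where \<open>q u = c\<close>. Only
  lower bounds result; an upper bound on a time spent low is obtained by applying this to the
  negated path.\<close>

lemma sublevel_measure_liminf:
  fixes q :: "real \<Rightarrow> real"
  assumes qn: "\<And>n. {u \<in> {0<..b}. qn n u < c} \<in> sets borel" and q: "{u \<in> {0<..b}. q u < c} \<in> sets borel"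
    and lim: "\<And>u. 0 < u \<Longrightarrow> u \<le> b \<Longrightarrow> (\<lambda>n. qn n u) \<longlonglongrightarrow> q u"
    and a: "a < measure lborel {u \<in> {0<..b}. q u < c}"
  shows "\<forall>\<^sub>F n in sequentially. a < measure lborel {u \<in> {0<..b}. qn n u < c}"
proof -
  let ?A = "\<lambda>n. {u \<in> {0<..b}. qn n u < c}"
  define B where "B k = {u \<in> {0<..b}. q u < c} \<inter> (\<Inter>n\<in>{k..}. ?A n)" for k
  have B: "B k \<in> sets borel" for k unfolding B_def using qn q by (intro sets.Int sets.countable_INT') auto
  have fin: "emeasure lborel S \<noteq> \<infinity>" if "S \<subseteq> {0<..b}" for S
  proof -
    have "emeasure lborel S \<le> emeasure lborel {0<..b}" using that by (intro emeasure_mono) auto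
    also have "\<dots> < \<infinity>" by (cases "0 \<le> b") auto
    finally show ?thesis by simp
  qed
  have "(\<lambda>k. measure lborel (B k)) \<longlonglongrightarrow> measure lborel (\<Union>k. B k)"
  proof (rule Lim_measure_incseq)
    show "incseq B" unfolding B_def by (intro monoI) (auto simp: le_fun_def)
    show "emeasure lborel (\<Union>k. B k) \<noteq> \<infinity>" by (rule fin) (auto simp: B_def)
  qed (use B in auto)
  also have "(\<Union>k. B k) = {u \<in> {0<..b}. q u < c}"
  proof (intro set_eqI iffI)
    fix u assume u: "u \<in> {u \<in> {0<..b}. q u < c}"
    then have "\<forall>\<^sub>F n in sequentially. qn n u < c" using lim[of u] by (intro order_tendstoD(2)[of _ "q u"]) auto
    then obtain k where "\<And>n. k \<le> n \<Longrightarrow> qn n u < c" by (auto simp: eventually_sequentially)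
    then show "u \<in> (\<Union>k. B k)" using u by (auto simp: B_def)
  qed (auto simp: B_def)
  finally have "\<forall>\<^sub>F k in sequentially. a < measure lborel (B k)" using a by (rule order_tendstoD(1))
  then obtain k where k: "a < measure lborel (B k)" using eventually_happens by fastforce
  show ?thesis
  proof (rule eventually_sequentiallyI[of k])
    fix n assume n: "k \<le> n"
    have "emeasure lborel (B k) \<le> emeasure lborel (?A n)" using n qn by (intro emeasure_mono) (auto simp: B_def)
    then have "measure lborel (B k) \<le> measure lborel (?A n)"
    proof -
      have "?A n \<subseteq> {0<..b}" by auto
      from fin[OF this] have "emeasure lborel (?A n) < top" by (simp only: infinity_ennreal_def top.not_eq_extremum)
      then show ?thesis unfolding measure_def using \<open>emeasure lborel (B k) \<le> emeasure lborel (?A n)\<close> by (intro enn2real_mono)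
    qed
    then show "a < measure lborel (?A n)" using k by simp
  qed
qed

text \<open>Margin and horizon are tied to one index: as \<open>i\<close> grows, the threshold
  approaches 1 and the time \<open>i\<close>, grid index \<open>i * 2 ^ n\<close>, from which every
  step is selected moves to infinity.\<close>

definition low_rule :: "nat \<Rightarrow> nat \<Rightarrow> nat \<Rightarrow> (nat \<Rightarrow> real) \<Rightarrow> bool" where
  "low_rule n i j v \<longleftrightarrow> walk1 (v 0) (\<lambda>l. v (Suc l)) j < 1 - inverse (real (Suc i)) \<or> i * 2 ^ n \<le> j"

text \<open>The shift by \<open>inverse (real (Suc i))\<close> outweighs the rounding errors and
  pushes the step with this number to the right of \<open>time_below_inv\<close>, where the path is
  right-continuous.\<close>

definition target_index :: "nat \<Rightarrow> nat \<Rightarrow> real \<Rightarrow> nat" where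
  "target_index n i t = nat \<lceil>(t + inverse (real (Suc i))) * 2 ^ n\<rceil>"

definition path_steps :: "(real \<Rightarrow> real) \<Rightarrow> nat \<Rightarrow> nat \<Rightarrow> real" where
  "path_steps f n l = (case l of 0 \<Rightarrow> f 0 | Suc j \<Rightarrow> grid_step f ((1/2) ^ n) j)"

context
  fixes f Z :: "real \<Rightarrow> real"
  assumes f: "cadlag f" and f0: "f 0 \<in> {-1..1}"
    and Z_def: "Z = reflect_left f"
    and inf: "emeasure lborel {z. 0 \<le> z \<and> Z z < 1} = \<infinity>"
    and down: "\<And>T a. 0 < a \<Longrightarrow> \<forall>\<^sub>F n in sequentially. \<forall>j<T * 2 ^ n. - a < grid_step f ((1/2) ^ n) j"
begin

lemma Z_cadlag: "cadlag Z"
  unfolding Z_def by (rule cadlag_reflect_left[OF f])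

definition zwalk :: "nat \<Rightarrow> nat \<Rightarrow> real" where
  "zwalk n = walk1 (f 0) (grid_step f ((1/2) ^ n))"

lemma low_rule_path_steps:
  "low_rule n i j (path_steps f n) \<longleftrightarrow> zwalk n j < 1 - inverse (real (Suc i)) \<or> i * 2 ^ n \<le> j"
  by (simp add: low_rule_def path_steps_def zwalk_def)

lemma zwalk_uniform:
  assumes "0 < e"
  shows "\<forall>\<^sub>F n in sequentially. \<forall>j. real j * (1/2) ^ n \<le> T \<longrightarrow> \<bar>zwalk n j - Z (real j * (1/2) ^ n)\<bar> \<le> e"
proof -
  obtain h0 where h0: "0 < h0" "\<And>h k. 0 < h \<Longrightarrow> h < h0 \<Longrightarrow> real k * h \<le> max T 0 \<Longrightarrow>
      \<bar>walk1 (f 0) (grid_step f h) k - reflect_left f (real k * h)\<bar> \<le> e"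
    using walk1_sampling[OF f _ _ assms, of "max T 0"] f0 by auto
  have "(\<lambda>n. (1/2 :: real) ^ n) \<longlonglongrightarrow> 0" by (intro LIMSEQ_power_zero) simp
  then have "\<forall>\<^sub>F n in sequentially. (1/2 :: real) ^ n < h0" using h0(1) by (rule order_tendstoD(2))
  then show ?thesis
    by eventually_elim (use h0(2) in \<open>auto simp: zwalk_def Z_def\<close>)
qed

lemma zwalk_tendsto:
  assumes "0 \<le> u"
  shows "(\<lambda>n. zwalk n (nat \<lceil>u * 2 ^ n\<rceil>)) \<longlonglongrightarrow> Z u"
proof -
  note d = dyadic_ceiling_tendsto[OF assms]
  have 1: "(\<lambda>n. Z (real (nat \<lceil>u * 2 ^ n\<rceil>) * (1/2) ^ n)) \<longlonglongrightarrow> Z u"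
    by (rule cadlag_tendsto[OF Z_cadlag assms d(1)]) (intro always_eventually allI d)
  have 2: "(\<lambda>n. zwalk n (nat \<lceil>u * 2 ^ n\<rceil>) - Z (real (nat \<lceil>u * 2 ^ n\<rceil>) * (1/2) ^ n)) \<longlonglongrightarrow> 0"
  proof (rule tendstoI)
    fix e :: real assume e: "0 < e"
    have "\<forall>\<^sub>F n in sequentially. real (nat \<lceil>u * 2 ^ n\<rceil>) * (1/2) ^ n < u + 1" using d(1) by (rule order_tendstoD(2)) simp
    moreover have "\<forall>\<^sub>F n in sequentially. \<forall>j. real j * (1/2) ^ n \<le> u + 1 \<longrightarrow> \<bar>zwalk n j - Z (real j * (1/2) ^ n)\<bar> \<le> e / 2"
      by (rule zwalk_uniform) (use e in simp)
    ultimately show "\<forall>\<^sub>F n in sequentially. dist (zwalk n (nat \<lceil>u * 2 ^ n\<rceil>) - Z (real (nat \<lceil>u * 2 ^ n\<rceil>) * (1/2) ^ n)) 0 < e"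
    proof eventually_elim
      case (elim n)
      then have "\<bar>zwalk n (nat \<lceil>u * 2 ^ n\<rceil>) - Z (real (nat \<lceil>u * 2 ^ n\<rceil>) * (1/2) ^ n)\<bar> \<le> e / 2" by (meson less_imp_le)
      then show ?case using e by (simp add: dist_real_def)
    qed
  qed
  show ?thesis using tendsto_add[OF 2 1] by simp
qed

lemma zwalk_sets: "{u \<in> {0<..b :: real}. P (zwalk n (nat \<lceil>u * 2 ^ n\<rceil>))} \<in> sets borel"
proof -
  have "{u \<in> {0<..b}. P (zwalk n (nat \<lceil>u * 2 ^ n\<rceil>))} = {0<..b} \<inter> (\<lambda>u. nat \<lceil>u * 2 ^ n\<rceil>) -` {j. P (zwalk n j)}" by auto
  also have "(\<lambda>u::real. nat \<lceil>u * 2 ^ n\<rceil>) -` {j. P (zwalk n j)} \<in> sets borel"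
  proof -
    have "(\<lambda>u::real. nat \<lceil>u * 2 ^ n\<rceil>) \<in> borel \<rightarrow>\<^sub>M count_space UNIV" by measurable
    from measurable_sets[OF this, of "{j. P (zwalk n j)}"] show ?thesis by simp
  qed
  then have "{0<..b} \<inter> (\<lambda>u. nat \<lceil>u * 2 ^ n\<rceil>) -` {j. P (zwalk n j)} \<in> sets borel" by auto
  finally show ?thesis .
qed

lemma Z_sets: "{u \<in> {0<..b}. Z u < c} \<in> sets borel" "{u \<in> {0<..b}. c < Z u} \<in> sets borel"
proof -
  have "{u \<in> {0<..b}. Z u < c} = {0<..b} \<inter> {u. Z (max u 0) < c}" "{u \<in> {0<..b}. c < Z u} = {0<..b} \<inter> {u. c < Z (max u 0)}"
    by (auto simp: max_def)
  moreover have [measurable]: "(\<lambda>u. Z (max u 0)) \<in> borel_measurable borel" by (rule cadlag_borel[OF Z_cadlag])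
  ultimately show "{u \<in> {0<..b}. Z u < c} \<in> sets borel" "{u \<in> {0<..b}. c < Z u} \<in> sets borel" by simp_all
qed

lemma sub_finite: "S \<subseteq> {0<..b} \<Longrightarrow> emeasure lborel S < \<infinity>" for b :: real
proof -
  assume "S \<subseteq> {0<..b}"
  then have "emeasure lborel S \<le> emeasure lborel {0<..b}" by (intro emeasure_mono) auto
  also have "\<dots> < \<infinity>" by (cases "0 \<le> b") auto
  finally show ?thesis .
qed

lemma sub_measure_mono:
  fixes b :: real
  assumes "S \<subseteq> S'" "S' \<in> sets borel" "S' \<subseteq> {0<..b}" shows "measure lborel S \<le> measure lborel S'"
  unfolding measure_def using assms sub_finite[OF assms(3)] by (intro enn2real_mono emeasure_mono) auto

lemma count_measure:
  "measure lborel {u \<in> {0<..real N * (1/2) ^ n}. P (zwalk n (nat \<lceil>u * 2 ^ n\<rceil>))} = real (card {j \<in> {1..N}. P (zwalk n j)}) * (1/2) ^ n"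
proof -
  have "u / (1/2) ^ n = u * 2 ^ n" for u :: real by (simp add: power_one_over)
  then have "{u \<in> {0<..real N * (1/2) ^ n}. P (zwalk n (nat \<lceil>u * 2 ^ n\<rceil>))} =
      {u. 0 < u \<and> u \<le> real N * (1/2) ^ n \<and> P (zwalk n (nat \<lceil>u / (1/2) ^ n\<rceil>))}" by auto
  then show ?thesis using measure_card[of "(1/2) ^ n" N "\<lambda>j. P (zwalk n j)"] by simp
qed

lemma time_below_Z: "0 \<le> b \<Longrightarrow> time_below Z b = measure lborel {u \<in> {0<..b}. Z u < 1}"
proof -
  assume b: "0 \<le> b"
  have 1: "{z. 0 \<le> z \<and> z \<le> b \<and> Z z < 1} \<subseteq> insert 0 {u \<in> {0<..b}. Z u < 1}" by auto
  have "emeasure lborel {z. 0 \<le> z \<and> z \<le> b \<and> Z z < 1} \<le> emeasure lborel (insert 0 {u \<in> {0<..b}. Z u < 1})"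
    using Z_sets by (intro emeasure_mono 1) auto
  also have "\<dots> \<le> emeasure lborel {0::real} + emeasure lborel {u \<in> {0<..b}. Z u < 1}"
    using emeasure_subadditive[of "{0::real}" lborel "{u \<in> {0<..b}. Z u < 1}"] Z_sets by simp
  also have "\<dots> = emeasure lborel {u \<in> {0<..b}. Z u < 1}" by simp
  finally have "emeasure lborel {z. 0 \<le> z \<and> z \<le> b \<and> Z z < 1} \<le> emeasure lborel {u \<in> {0<..b}. Z u < 1}" .
  moreover have "emeasure lborel {u \<in> {0<..b}. Z u < 1} \<le> emeasure lborel {z. 0 \<le> z \<and> z \<le> b \<and> Z z < 1}"
    using time_below_sets[OF Z_cadlag, of b] by (intro emeasure_mono) auto
  ultimately show ?thesis unfolding time_below_eq measure_def by (simp add: antisym)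
qed

lemma measure_extend:
  fixes b b' :: real
  assumes "b' \<le> b" "{u \<in> {0<..b'}. P u} \<in> sets borel"
  shows "measure lborel {u \<in> {0<..b}. P u} \<le> measure lborel {u \<in> {0<..b'}. P u} + (b - b')"
proof -
  let ?S = "{u \<in> {0<..b'}. P u} \<union> {max 0 b'<..b}"
  have "measure lborel {u \<in> {0<..b}. P u} \<le> measure lborel ?S"
    by (rule sub_measure_mono[of _ _ b]) (use assms in auto)
  also have "\<dots> \<le> measure lborel {u \<in> {0<..b'}. P u} + measure lborel {max 0 b'<..b}"
  proof (rule measure_subadditive)
    have "emeasure lborel {u \<in> {0<..b'}. P u} < \<infinity>" by (rule sub_finite[of _ b']) auto
    then show "emeasure lborel {u \<in> {0<..b'}. P u} \<noteq> \<infinity>" by simp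
    have "emeasure lborel {max 0 b'<..b} < \<infinity>" by (rule sub_finite[of _ b]) auto
    then show "emeasure lborel {max 0 b'<..b} \<noteq> \<infinity>" by simp
  qed (use assms in simp_all)
  also have "measure lborel {max 0 b'<..b} \<le> b - b'"
    using assms(1) by (cases "max 0 b' \<le> b") auto
  finally show ?thesis by simp
qed

text \<open>\<open>count_measure\<close> turns numbers of low steps into measures, and
  \<open>sublevel_measure_liminf\<close> compares these with the path. Up to \<open>b\<close> there
  are more low steps than the target asks for, by \<open>big\<close>. Up to the value
  \<open>s\<close> of the inverse clock there are fewer: in \<open>(0, s]\<close> the path is below
  1 only for time \<open>t\<close>, hence above \<open>1 - e\<close> for at least
  \<open>s - t\<close>, which leaves little more than \<open>t\<close> to the low steps, whereas the
  target is \<open>t + e\<close>.\<close>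

lemma position_window:
  assumes t: "0 \<le> t" and b: "time_below_inv Z t < b" "b < real i"
    and big: "t + inverse (real (Suc i)) < measure lborel {u \<in> {0<..b}. Z u < 1 - inverse (real (Suc i))}"
  shows "\<forall>\<^sub>F n in sequentially. sel_pos (low_rule n i) (target_index n i t) (path_steps f n) < i * 2 ^ n \<and>
    time_below_inv Z t \<le> real (sel_pos (low_rule n i) (target_index n i t) (path_steps f n)) * (1/2) ^ n \<and>
    real (sel_pos (low_rule n i) (target_index n i t) (path_steps f n)) * (1/2) ^ n < b"
proof -
  define s where "s = time_below_inv Z t"
  define e where "e = inverse (real (Suc i))"
  have e: "0 < e" by (simp add: e_def)
  have s0: "0 \<le> s" unfolding s_def by (rule time_below_inv_nonneg[OF Z_cadlag inf])
  have b0: "0 < b" using b(1) s0 by (simp add: s_def)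
  have As: "measure lborel {u \<in> {0<..s}. Z u < 1} = t"
    using time_below_at_inv[OF Z_cadlag inf t] time_below_Z[OF s0] by (simp add: s_def)
  \<comment> \<open>The gap between \<open>t + e\<close> and \<open>a\<close> absorbs the rounding
    to whole cells.\<close>
  obtain a where a: "t + e < a" "a < measure lborel {u \<in> {0<..b}. Z u < 1 - e}"
    using dense[OF big] unfolding e_def by blast
  have ev1: "\<forall>\<^sub>F n in sequentially. a < measure lborel {u \<in> {0<..b}. zwalk n (nat \<lceil>u * 2 ^ n\<rceil>) < 1 - e}"
    by (rule sublevel_measure_liminf[OF zwalk_sets Z_sets(1) _ a(2)]) (simp add: zwalk_tendsto)
  have eqS: "{u \<in> {0<..s}. - Z u < - (1 - e)} = {u \<in> {0<..s}. 1 - e < Z u}" by auto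
  have setS: "{u \<in> {0<..s}. - Z u < - (1 - e)} \<in> sets borel" unfolding eqS by (rule Z_sets)
  \<comment> \<open>The sets where \<open>Z\<close> is below 1 and where it is above
    \<open>1 - e\<close> overlap and so cover \<open>(0, s]\<close>, whatever time is spent exactly
    at 1.\<close>
  have "s - t - e / 2 < measure lborel {u \<in> {0<..s}. - Z u < - (1 - e)}"
  proof -
    have "s = measure lborel {0<..s}" using s0 by simp
    also have "\<dots> \<le> measure lborel ({u \<in> {0<..s}. Z u < 1} \<union> {u \<in> {0<..s}. 1 - e < Z u})"
    proof (rule sub_measure_mono)
      show "{0<..s} \<subseteq> {u \<in> {0<..s}. Z u < 1} \<union> {u \<in> {0<..s}. 1 - e < Z u}" using e by auto
      show "{u \<in> {0<..s}. Z u < 1} \<union> {u \<in> {0<..s}. 1 - e < Z u} \<in> sets borel" using Z_sets by auto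
    qed auto
    also have "\<dots> \<le> measure lborel {u \<in> {0<..s}. Z u < 1} + measure lborel {u \<in> {0<..s}. 1 - e < Z u}"
    proof (rule measure_subadditive)
      have "emeasure lborel {u \<in> {0<..s}. Z u < 1} < \<infinity>" by (rule sub_finite[of _ s]) auto
      moreover have "emeasure lborel {u \<in> {0<..s}. 1 - e < Z u} < \<infinity>" by (rule sub_finite[of _ s]) auto
      ultimately show "emeasure lborel {u \<in> {0<..s}. Z u < 1} \<noteq> \<infinity>" "emeasure lborel {u \<in> {0<..s}. 1 - e < Z u} \<noteq> \<infinity>" by simp_all
    qed (use Z_sets in simp_all)
    also note eqS[symmetric]
    finally show ?thesis using As e by linarith
  qed
  then have "\<forall>\<^sub>F n in sequentially. s - t - e / 2 < measure lborel {u \<in> {0<..s}. - zwalk n (nat \<lceil>u * 2 ^ n\<rceil>) < - (1 - e)}"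
    using setS
    by (intro sublevel_measure_liminf[where q = "\<lambda>u. - Z u"] zwalk_sets[where P = "\<lambda>x. - x < - (1 - e)"] tendsto_minus zwalk_tendsto) auto
  then have ev2: "\<forall>\<^sub>F n in sequentially. measure lborel {u \<in> {0<..s}. zwalk n (nat \<lceil>u * 2 ^ n\<rceil>) < 1 - e} < t + e / 2"
  proof eventually_elim
    case (elim n)
    let ?A = "{u \<in> {0<..s}. zwalk n (nat \<lceil>u * 2 ^ n\<rceil>) < 1 - e}" and ?B = "{u \<in> {0<..s}. - zwalk n (nat \<lceil>u * 2 ^ n\<rceil>) < - (1 - e)}"
    have AB: "?A \<in> sets borel" "?B \<in> sets borel" by (rule zwalk_sets)+
    have "emeasure lborel ?A < \<infinity>" by (rule sub_finite[of _ s]) auto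
    moreover have "emeasure lborel ?B < \<infinity>" by (rule sub_finite[of _ s]) auto
    ultimately have fin: "emeasure lborel ?A \<noteq> \<infinity>" "emeasure lborel ?B \<noteq> \<infinity>" by simp_all
    have "measure lborel (?A \<union> ?B) = measure lborel ?A + measure lborel ?B"
      by (rule measure_Union) (use AB fin in auto)
    moreover have "measure lborel (?A \<union> ?B) \<le> measure lborel {0<..s}"
      by (rule sub_measure_mono[of _ _ s]) auto
    ultimately show ?case using elim s0 by simp
  qed
  have "(\<lambda>n. (1/2 :: real) ^ n) \<longlonglongrightarrow> 0" by (intro LIMSEQ_power_zero) simp
  then have ev3: "\<forall>\<^sub>F n in sequentially. (1/2 :: real) ^ n < min (e / 4) ((a - (t + e)) / 4)"
    using e a(1) by (intro order_tendstoD(2)) auto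
  show ?thesis using ev1 ev2 ev3
  proof eventually_elim
    case (elim n)
    define h where "h = (1/2 :: real) ^ n"
    have h: "0 < h" "4 * h < e" "4 * h < a - (t + e)" using elim(3) by (auto simp: h_def)
    define Q where "Q = low_rule n i"
    define w where "w = path_steps f n"
    define m where "m = target_index n i t"
    have Q: "Q j w \<longleftrightarrow> zwalk n j < 1 - e \<or> i * 2 ^ n \<le> j" for j
      unfolding Q_def w_def e_def by (rule low_rule_path_steps)
    have te: "0 \<le> t + e" using t e by simp
    have m: "t + e \<le> real m * h" "real m * h < t + e + h"
      using dyadic_ceiling_tendsto(2,3)[OF te, of n] by (simp_all add: m_def target_index_def e_def h_def)
    let ?C = "\<lambda>N. card {j \<in> {1..N}. zwalk n j < 1 - e}"
    have cnt: "measure lborel {u \<in> {0<..real N * h}. zwalk n (nat \<lceil>u * 2 ^ n\<rceil>) < 1 - e} = real (?C N) * h" for N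
      unfolding h_def by (rule count_measure)
    have i_eq: "real (i * 2 ^ n) * h = real i" by (simp add: h_def power_one_over)
    define N1 where "N1 = nat \<lfloor>b * 2 ^ n\<rfloor>"
    have hb: "b * 2 ^ n * h = b" by (simp add: h_def power_one_over)
    have N1: "real N1 * h \<le> b" "b \<le> real N1 * h + h"
    proof -
      have "0 \<le> b * 2 ^ n" using b0 by simp
      then have "real N1 \<le> b * 2 ^ n" "b * 2 ^ n \<le> real N1 + 1" unfolding N1_def by linarith+
      then have "real N1 * h \<le> b * 2 ^ n * h" "b * 2 ^ n * h \<le> (real N1 + 1) * h" using h by (intro mult_right_mono; simp)+
      then show "real N1 * h \<le> b" "b \<le> real N1 * h + h" unfolding hb by (simp_all add: algebra_simps)
    qed
    have "m < sel_count Q N1 w"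
    proof -
      have "measure lborel {u \<in> {0<..b}. zwalk n (nat \<lceil>u * 2 ^ n\<rceil>) < 1 - e} \<le>
          measure lborel {u \<in> {0<..real N1 * h}. zwalk n (nat \<lceil>u * 2 ^ n\<rceil>) < 1 - e} + (b - real N1 * h)"
        by (rule measure_extend[OF N1(1) zwalk_sets])
      then have 1: "a < real (?C N1) * h + h" using elim(1) N1(2) unfolding cnt by linarith
      \<comment> \<open>\<open>?C\<close> counts the indices \<open>1..N1\<close>,
        \<open>sel_count\<close> those below \<open>N1\<close>; the difference costs at most one
        cell.\<close>
      have "?C N1 \<le> card (insert N1 {j. j < N1 \<and> Q j w})" by (rule card_mono) (auto simp: Q)
      also have "\<dots> \<le> Suc (sel_count Q N1 w)" unfolding sel_count_def by (rule card_insert_le_m1) auto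
      finally have "real (?C N1) * h \<le> (real (sel_count Q N1 w) + 1) * h" using h by (intro mult_right_mono) auto
      then have "real m * h < real (sel_count Q N1 w) * h" using 1 h m unfolding distrib_right by linarith
      then show ?thesis using h by simp
    qed
    note p = sel_pos[OF this]
    have "real (sel_pos Q m w) * h < real N1 * h" using p(3) h by simp
    then have lt_b: "real (sel_pos Q m w) * h < b" using N1(1) by simp
    have lt_i: "sel_pos Q m w < i * 2 ^ n"
    proof -
      have "real (sel_pos Q m w) * h < real (i * 2 ^ n) * h" using lt_b b(2) unfolding i_eq by linarith
      then have "real (sel_pos Q m w) < real (i * 2 ^ n)" using h(1) mult_less_cancel_right_pos by blast
      then show ?thesis by (simp only: of_nat_less_iff)
    qed
    have ge_s: "s \<le> real (sel_pos Q m w) * h"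
    proof (rule ccontr)
      assume "\<not> s \<le> real (sel_pos Q m w) * h"
      then have less: "real (sel_pos Q m w) * h < s" by simp
      define N2 where "N2 = nat \<lceil>s * 2 ^ n\<rceil>"
      have N2: "s \<le> real N2 * h" "real N2 * h < s + h"
        using dyadic_ceiling_tendsto(2,3)[OF s0, of n] by (simp_all add: N2_def h_def)
      have "real (sel_pos Q m w) * h < real N2 * h" using less N2 by linarith
      then have "Suc (sel_pos Q m w) \<le> N2" using h by simp
      then have "sel_count Q (Suc (sel_pos Q m w)) w \<le> sel_count Q N2 w" by (rule sel_count_mono)
      then have m1: "m + 1 \<le> sel_count Q N2 w" using p(1,2) by (simp add: sel_count_Suc)
      have "N2 \<le> i * 2 ^ n"
      proof -
        have "s * 2 ^ n \<le> real i * 2 ^ n" using b by (simp add: s_def)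
        then have "\<lceil>s * 2 ^ n\<rceil> \<le> int (i * 2 ^ n)" by (simp add: ceiling_le_iff)
        then show ?thesis unfolding N2_def by linarith
      qed
      \<comment> \<open>Index 0 has no cell of its own and is added by hand;
        \<open>N2 \<le> i * 2 ^ n\<close> ensures that no index below \<open>N2\<close> is selected
        merely because of the horizon.\<close>
      then have "{j. j < N2 \<and> Q j w} \<subseteq> insert 0 {j \<in> {1..N2}. zwalk n j < 1 - e}" by (auto simp: Q)
      then have "sel_count Q N2 w \<le> card (insert 0 {j \<in> {1..N2}. zwalk n j < 1 - e})"
        unfolding sel_count_def by (intro card_mono) auto
      also have "\<dots> \<le> Suc (?C N2)" by (rule card_insert_le_m1) auto
      finally have "real (m + 1) * h \<le> real (Suc (?C N2)) * h" using m1 h by (intro mult_right_mono) linarith+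
      then have "real m * h \<le> real (?C N2) * h" by (simp add: distrib_right)
      also have "real (?C N2) * h = measure lborel {u \<in> {0<..real N2 * h}. zwalk n (nat \<lceil>u * 2 ^ n\<rceil>) < 1 - e}" by (rule cnt[symmetric])
      also have "\<dots> \<le> measure lborel {u \<in> {0<..s}. zwalk n (nat \<lceil>u * 2 ^ n\<rceil>) < 1 - e} + (real N2 * h - s)"
        by (rule measure_extend[OF N2(1) zwalk_sets])
      also have "\<dots> < t + e / 2 + h" using elim(2) N2(2) by linarith
      finally show False using m(1) h by linarith
    qed
    show ?case using lt_i ge_s lt_b unfolding Q_def w_def m_def s_def h_def by blast
  qed
qed

text \<open>Right-continuity at the value \<open>s\<close> of the inverse clock fixes a window
  \<open>[s, b)\<close>. \<open>position_window\<close> puts the target step there once the time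
  below \<open>1 - 1/(i+1)\<close> up to \<open>b\<close> exceeds \<open>t + 1/(i+1)\<close>; this
  happens for large \<open>i\<close>, because that time increases to the time below 1, which exceeds
  \<open>t\<close>. The error \<open>r\<close> is shared in quarters by the margin, the downward
  steps, the sampling, and the oscillation of the path in the window.\<close>

lemma selection_convergence:
  assumes t: "0 \<le> t" and r: "0 < r"
  shows "\<exists>i0. \<forall>i\<ge>i0. \<forall>\<^sub>F n in sequentially.
    \<bar>walk2 (f 0) (\<lambda>l. path_steps f n (Suc (sel_pos (low_rule n i) l (path_steps f n)))) (target_index n i t) - fast_forward_right Z t\<bar> \<le> r"
proof -
  define s where "s = time_below_inv Z t"
  have s0: "0 \<le> s" unfolding s_def by (rule time_below_inv_nonneg[OF Z_cadlag inf])
  obtain d where d: "d > 0" "\<And>u. s \<le> u \<Longrightarrow> u < s + d \<Longrightarrow> \<bar>Z u - Z s\<bar> < r / 4"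
    using cadlag_right_eps[OF Z_cadlag s0, of "r / 4"] r by auto
  define b where "b = s + d / 2"
  have b: "s < b" "b < s + d" using d(1) by (auto simp: b_def)
  have tb: "t < measure lborel {u \<in> {0<..b}. Z u < 1}"
    using less_time_below[OF Z_cadlag inf, of t b] time_below_Z[of b] b s0 by (simp add: s_def)
  let ?S = "\<lambda>i. {u \<in> {0<..b}. Z u < 1 - inverse (real (Suc i))}"
  have inv0: "(\<lambda>i. inverse (real (Suc i))) \<longlonglongrightarrow> 0" by (rule LIMSEQ_inverse_real_of_nat)
  have "(\<lambda>i. measure lborel (?S i)) \<longlonglongrightarrow> measure lborel (\<Union>i. ?S i)"
  proof (rule Lim_measure_incseq)
    show "range ?S \<subseteq> sets lborel" using Z_sets by auto
    show "incseq ?S"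
    proof (rule incseq_SucI, rule subsetI)
      fix i u assume "u \<in> ?S i"
      then have "u \<in> {0<..b}" "Z u < 1 - inverse (real (Suc i))" by blast+
      moreover have "inverse (real (Suc (Suc i))) \<le> inverse (real (Suc i))" by (rule le_imp_inverse_le) auto
      ultimately have "u \<in> {0<..b}" "Z u < 1 - inverse (real (Suc (Suc i)))" by linarith+
      then show "u \<in> ?S (Suc i)" by blast
    qed
    have "emeasure lborel (\<Union>i. ?S i) < \<infinity>" by (rule sub_finite[of _ b]) auto
    then show "emeasure lborel (\<Union>i. ?S i) \<noteq> \<infinity>" by simp
  qed
  also have "(\<Union>i. ?S i) = {u \<in> {0<..b}. Z u < 1}"
  proof (intro set_eqI iffI)
    fix u assume u: "u \<in> {u \<in> {0<..b}. Z u < 1}"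
    then obtain i where "inverse (real (Suc i)) < 1 - Z u" using reals_Archimedean[of "1 - Z u"] by auto
    then have "u \<in> ?S i" using u by simp
    then show "u \<in> (\<Union>i. ?S i)" by blast
  next
    fix u assume "u \<in> (\<Union>i. ?S i)"
    then obtain i where "u \<in> ?S i" by blast
    then have "u \<in> {0<..b}" "Z u < 1 - inverse (real (Suc i))" by blast+
    moreover have "0 < inverse (real (Suc i))" by simp
    ultimately have "u \<in> {0<..b}" "Z u < 1" by linarith+
    then show "u \<in> {u \<in> {0<..b}. Z u < 1}" by blast
  qed
  finally have "(\<lambda>i. measure lborel (?S i) - inverse (real (Suc i))) \<longlonglongrightarrow> measure lborel {u \<in> {0<..b}. Z u < 1} - 0"
    by (intro tendsto_diff inv0)
  then have "\<forall>\<^sub>F i in sequentially. t < measure lborel (?S i) - inverse (real (Suc i))"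
    using tb by (intro order_tendstoD(1)) auto
  moreover have "\<forall>\<^sub>F i in sequentially. inverse (real (Suc i)) < r / 4"
    using inv0 r by (intro order_tendstoD(2)) auto
  moreover have "\<forall>\<^sub>F i in sequentially. b < real i"
    using filterlim_real_sequentially by (simp add: filterlim_at_top_dense)
  ultimately have "\<forall>\<^sub>F i in sequentially. \<forall>\<^sub>F n in sequentially.
    \<bar>walk2 (f 0) (\<lambda>l. path_steps f n (Suc (sel_pos (low_rule n i) l (path_steps f n)))) (target_index n i t) - fast_forward_right Z t\<bar> \<le> r"
  proof eventually_elim
    case (elim i)
    define e where "e = inverse (real (Suc i))"
    have e: "0 < e" "e \<le> 1" "e < r / 4" using elim(2) by (auto simp: e_def inverse_le_1_iff)
    have win: "\<forall>\<^sub>F n in sequentially. sel_pos (low_rule n i) (target_index n i t) (path_steps f n) < i * 2 ^ n \<and>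
      time_below_inv Z t \<le> real (sel_pos (low_rule n i) (target_index n i t) (path_steps f n)) * (1/2) ^ n \<and>
      real (sel_pos (low_rule n i) (target_index n i t) (path_steps f n)) * (1/2) ^ n < b"
      by (rule position_window[OF t]) (use b elim in \<open>auto simp: s_def\<close>)
    have unif: "\<forall>\<^sub>F n in sequentially. \<forall>j. real j * (1/2) ^ n \<le> b \<longrightarrow> \<bar>zwalk n j - Z (real j * (1/2) ^ n)\<bar> \<le> r / 4"
      by (rule zwalk_uniform) (use r in simp)
    have dn: "\<forall>\<^sub>F n in sequentially. \<forall>j<i * 2 ^ n. - (r / 4) < grid_step f ((1/2) ^ n) j"
      by (rule down) (use r in simp)
    show ?case using win unif dn
    proof eventually_elim
      case n: (elim n)
      define Q where "Q = low_rule n i"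
      define w where "w = path_steps f n"
      define m where "m = target_index n i t"
      define p where "p k = sel_pos Q k w" for k
      have Q: "Q j w \<longleftrightarrow> zwalk n j < 1 - e \<or> i * 2 ^ n \<le> j" for j
        unfolding Q_def w_def e_def by (rule low_rule_path_steps)
      \<comment> \<open>The horizon makes every position exist, including those beyond it.\<close>
      have ge: "k < sel_count Q (i * 2 ^ n + Suc k) w" for k
        using sel_count_ge[of "i * 2 ^ n" Q w "Suc k"] Q by simp
      have pk: "Q (p k) w" "sel_count Q (p k) w = k" for k unfolding p_def using sel_pos[OF ge[of k]] by simp_all
      have strict: "p k < p (Suc k)" for k
      proof (rule ccontr)
        assume "\<not> p k < p (Suc k)"
        then have "sel_count Q (p (Suc k)) w \<le> sel_count Q (p k) w" by (intro sel_count_mono) simp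
        then show False by (simp add: pk)
      qed
      have before: "1 - e \<le> zwalk n j" if "j < p 0" for j
      proof (rule ccontr)
        assume "\<not> 1 - e \<le> zwalk n j"
        then have "Q j w" by (simp add: Q)
        then have "1 \<le> sel_count Q (Suc j) w" by (simp add: sel_count_Suc)
        also have "\<dots> \<le> sel_count Q (p 0) w" using that by (intro sel_count_mono) simp
        finally show False by (simp add: pk)
      qed
      have between: "1 - e \<le> zwalk n j" if "p k < j" "j < p (Suc k)" for k j
      proof (rule ccontr)
        assume "\<not> 1 - e \<le> zwalk n j"
        then have "Q j w" by (simp add: Q)
        have "Suc k = sel_count Q (Suc (p k)) w" by (simp add: sel_count_Suc pk)
        also have "\<dots> \<le> sel_count Q j w" using that by (intro sel_count_mono) simp
        also have "Suc (sel_count Q j w) = sel_count Q (Suc j) w" using \<open>Q j w\<close> by (simp add: sel_count_Suc)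
        then have "Suc (sel_count Q j w) \<le> sel_count Q (p (Suc k)) w" using that sel_count_mono[of "Suc j" "p (Suc k)" Q w] by simp
        ultimately show False by (simp add: pk)
      qed
      have pm: "p m < i * 2 ^ n" "s \<le> real (p m) * (1/2) ^ n" "real (p m) * (1/2) ^ n < b"
        using n(1) by (auto simp: p_def m_def Q_def w_def s_def)
      have comp: "0 \<le> walk2 (f 0) (\<lambda>l. grid_step f ((1/2) ^ n) (p l)) m - walk1 (f 0) (grid_step f ((1/2) ^ n)) (p m) \<and>
          walk2 (f 0) (\<lambda>l. grid_step f ((1/2) ^ n) (p l)) m - walk1 (f 0) (grid_step f ((1/2) ^ n)) (p m) \<le> e + r / 4"
      proof (rule walk_comparison[where N = "i * 2 ^ n"])
        show "- (r / 4) \<le> grid_step f ((1/2) ^ n) j" if "j < i * 2 ^ n" for j using n(3) that by (simp add: less_imp_le)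
        show "walk1 (f 0) (grid_step f ((1/2) ^ n)) (p k) < 1 - e" if "p k < i * 2 ^ n" for k
          using pk(1)[of k] that unfolding Q zwalk_def by simp
        show "1 - e \<le> walk1 (f 0) (grid_step f ((1/2) ^ n)) j" if "j < p 0" for j
          using before[OF that] by (simp add: zwalk_def)
        show "1 - e \<le> walk1 (f 0) (grid_step f ((1/2) ^ n)) j" if "p k < j" "j < p (Suc k)" for k j
          using between[OF that] by (simp add: zwalk_def)
      qed (use f0 e r pm(1) strict in auto)
      have z1: "\<bar>zwalk n (p m) - Z (real (p m) * (1/2) ^ n)\<bar> \<le> r / 4" using n(2) pm(3) by simp
      have z2: "\<bar>Z (real (p m) * (1/2) ^ n) - Z s\<bar> < r / 4" using pm b by (intro d(2)) auto
      have ps: "path_steps f n (Suc (sel_pos (low_rule n i) l (path_steps f n))) = grid_step f ((1/2) ^ n) (p l)" for l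
        by (simp add: path_steps_def p_def Q_def w_def)
      have X: "fast_forward_right Z t = Z s" unfolding s_def by (rule fast_forward_eq[OF Z_cadlag inf])
      show ?case
        using comp z1 z2 e(3) unfolding ps X m_def[symmetric] zwalk_def[symmetric] abs_le_iff abs_less_iff by linarith
    qed
  qed
  then show ?thesis by (simp add: eventually_sequentially)
qed

end

section \<open>Identification of the law\<close>

text \<open>Convergence is available only in the iterated sense, so there is no single sequence for
  dominated convergence. Reverse Fatou with the constant bound 1 is applied to the upper limit in
  \<open>n\<close> and then to the one in \<open>i\<close>; upper limits always exist and are
  measurable.\<close>

lemma (in prob_space) iterated_limit_expectation:
  fixes F :: "nat \<Rightarrow> nat \<Rightarrow> 'a \<Rightarrow> real" and G :: "'a \<Rightarrow> real"
  assumes F [measurable]: "\<And>n i. F n i \<in> borel_measurable M" and G [measurable]: "G \<in> borel_measurable M"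
    and bd: "\<And>n i \<omega>. 0 \<le> F n i \<omega> \<and> F n i \<omega> \<le> 1" "\<And>\<omega>. 0 \<le> G \<omega> \<and> G \<omega> \<le> 1"
    and conv: "AE \<omega> in M. \<forall>r>0. \<forall>\<^sub>F i in sequentially. \<forall>\<^sub>F n in sequentially. \<bar>F n i \<omega> - G \<omega>\<bar> \<le> r"
    and lim: "\<And>i. (\<lambda>n. expectation (F n i)) \<longlonglongrightarrow> b i" "b \<longlonglongrightarrow> B"
  shows "expectation G = B"
proof -
  define h where "h i \<omega> = limsup (\<lambda>n. ennreal \<bar>F n i \<omega> - G \<omega>\<bar>)" for i \<omega>
  have hm [measurable]: "h i \<in> borel_measurable M" for i unfolding h_def by measurable
  have d1: "\<bar>F n i \<omega> - G \<omega>\<bar> \<le> 1" for n i \<omega> using bd(1)[of n i \<omega>] bd(2)[of \<omega>] by linarith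
  have h1: "h i \<omega> \<le> 1" for i \<omega>
    unfolding h_def using d1 by (intro Limsup_bounded always_eventually allI) (simp add: ennreal_le_1)
  have intF: "integrable M (F n i)" for n i by (rule integrable_const_bound[where B = 1]) (use bd in auto)
  have intG: "integrable M G" by (rule integrable_const_bound[where B = 1]) (use bd in auto)
  have one: "ennreal \<bar>b i - expectation G\<bar> \<le> (\<integral>\<^sup>+\<omega>. h i \<omega> \<partial>M)" for i
  proof -
    have "(\<lambda>n. ennreal \<bar>expectation (F n i) - expectation G\<bar>) \<longlonglongrightarrow> ennreal \<bar>b i - expectation G\<bar>"
      by (intro tendsto_ennrealI tendsto_rabs tendsto_diff lim tendsto_const)
    then have "ennreal \<bar>b i - expectation G\<bar> = limsup (\<lambda>n. ennreal \<bar>expectation (F n i) - expectation G\<bar>)"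
      by (intro lim_imp_Limsup[symmetric]) auto
    also have "\<dots> \<le> limsup (\<lambda>n. \<integral>\<^sup>+\<omega>. ennreal \<bar>F n i \<omega> - G \<omega>\<bar> \<partial>M)"
    proof (intro Limsup_mono always_eventually allI)
      fix n
      have "ennreal (norm (\<integral>\<omega>. F n i \<omega> - G \<omega> \<partial>M)) \<le> (\<integral>\<^sup>+\<omega>. ennreal (norm (F n i \<omega> - G \<omega>)) \<partial>M)"
        by (intro integral_norm_bound_ennreal Bochner_Integration.integrable_diff intF intG)
      then show "ennreal \<bar>expectation (F n i) - expectation G\<bar> \<le> (\<integral>\<^sup>+\<omega>. ennreal \<bar>F n i \<omega> - G \<omega>\<bar> \<partial>M)"
        using intF intG by simp
    qed
    also have "\<dots> \<le> (\<integral>\<^sup>+\<omega>. h i \<omega> \<partial>M)"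
      unfolding h_def
      by (rule nn_integral_limsup[where w = "\<lambda>_. 1"]) (use d1 in \<open>auto simp: ennreal_le_1 emeasure_space_1\<close>)
    finally show ?thesis .
  qed
  have "(\<lambda>i. ennreal \<bar>b i - expectation G\<bar>) \<longlonglongrightarrow> ennreal \<bar>B - expectation G\<bar>"
    by (intro tendsto_ennrealI tendsto_rabs tendsto_diff lim tendsto_const)
  then have "ennreal \<bar>B - expectation G\<bar> = limsup (\<lambda>i. ennreal \<bar>b i - expectation G\<bar>)"
    by (intro lim_imp_Limsup[symmetric]) auto
  also have "\<dots> \<le> limsup (\<lambda>i. \<integral>\<^sup>+\<omega>. h i \<omega> \<partial>M)" by (intro Limsup_mono always_eventually allI one)
  also have "\<dots> \<le> (\<integral>\<^sup>+\<omega>. limsup (\<lambda>i. h i \<omega>) \<partial>M)"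
    by (rule nn_integral_limsup[where w = "\<lambda>_. 1"]) (use h1 in \<open>auto simp: emeasure_space_1\<close>)
  also have "\<dots> = (\<integral>\<^sup>+\<omega>. 0 \<partial>M)"
  proof (rule nn_integral_cong_AE, use conv in eventually_elim)
    case (elim \<omega>)
    have "limsup (\<lambda>i. h i \<omega>) \<le> 0 + ennreal r" if "0 < r" for r
    proof -
      have "\<forall>\<^sub>F i in sequentially. h i \<omega> \<le> ennreal r"
        using elim[rule_format, OF that]
      proof eventually_elim
        case (elim i)
        then show ?case unfolding h_def by (intro Limsup_bounded) (auto elim: eventually_mono intro: ennreal_leI)
      qed
      then show ?thesis by (simp add: Limsup_bounded)
    qed
    then have "limsup (\<lambda>i. h i \<omega>) \<le> 0" by (rule ennreal_le_epsilon)
    then show ?case by simp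
  qed
  finally have "ennreal \<bar>B - expectation G\<bar> = 0" by simp
  then show ?thesis by (simp add: ennreal_eq_0_iff)
qed

lemma walk1_cong: "(\<And>l. l < k \<Longrightarrow> \<xi> l = \<zeta> l) \<Longrightarrow> walk1 x \<xi> k = walk1 x \<zeta> k"
proof (induction k)
  case (Suc k)
  have "walk1 x \<xi> k = walk1 x \<zeta> k" by (rule Suc.IH) (use Suc.prems in simp)
  moreover have "\<xi> k = \<zeta> k" by (rule Suc.prems) simp
  ultimately show ?case by simp
qed simp

lemma walk2_cong: "(\<And>l. l < k \<Longrightarrow> \<xi> l = \<zeta> l) \<Longrightarrow> walk2 x \<xi> k = walk2 x \<zeta> k"
proof (induction k)
  case (Suc k)
  have "walk2 x \<xi> k = walk2 x \<zeta> k" by (rule Suc.IH) (use Suc.prems in simp)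
  moreover have "\<xi> k = \<zeta> k" by (rule Suc.prems) simp
  ultimately show ?case by simp
qed simp

lemma walk1_measurable:
  assumes x: "x \<in> borel_measurable K"
  shows "(\<And>l. l < k \<Longrightarrow> \<xi> l \<in> borel_measurable K) \<Longrightarrow> (\<lambda>v. walk1 (x v) (\<lambda>l. \<xi> l v) k) \<in> borel_measurable K"
proof (induction k)
  case (Suc k)
  have [measurable]: "(\<lambda>v. walk1 (x v) (\<lambda>l. \<xi> l v) k) \<in> borel_measurable K" "\<xi> k \<in> borel_measurable K"
    using Suc by auto
  show ?case by simp
qed (use x in simp)

lemma walk2_measurable:
  assumes x: "x \<in> borel_measurable K"
  shows "(\<And>l. l < k \<Longrightarrow> \<xi> l \<in> borel_measurable K) \<Longrightarrow> (\<lambda>v. walk2 (x v) (\<lambda>l. \<xi> l v) k) \<in> borel_measurable K"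
proof (induction k)
  case (Suc k)
  have [measurable]: "(\<lambda>v. walk2 (x v) (\<lambda>l. \<xi> l v) k) \<in> borel_measurable K" "\<xi> k \<in> borel_measurable K"
    using Suc by auto
  show ?case by simp
qed (use x in simp)

lemma cadlag_two_sided_reflection:
  assumes f: "cadlag f" and f0: "f 0 \<in> {-1..1}"
  shows "cadlag (two_sided_reflection f)"
proof -
  obtain L U where LU: "skorokhod_pair f L U" using skorokhod_pair_exists[OF f f0] by blast
  then have "cadlag L" "cadlag U" by (auto simp: skorokhod_pair_def regulator_def)
  then show ?thesis unfolding two_sided_reflection_eq[OF f LU] by (intro cadlag_diff cadlag_add f)
qed

text \<open>The walk is uniformly close to the reflection at grid points, and the grid points chosen
  approach \<open>t\<close> from the right.\<close>

lemma walk2_dyadic_tendsto: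
  assumes f: "cadlag f" and f0: "f 0 \<in> {-1..1}" and t: "0 \<le> t"
  shows "(\<lambda>n. walk2 (f 0) (grid_step f ((1/2) ^ n)) (nat \<lceil>t * 2 ^ n\<rceil>)) \<longlonglongrightarrow> two_sided_reflection f t"
proof -
  let ?k = "\<lambda>n. nat \<lceil>t * 2 ^ n\<rceil>" and ?h = "\<lambda>n. (1/2 :: real) ^ n"
  note d = dyadic_ceiling_tendsto[OF t]
  have 1: "(\<lambda>n. two_sided_reflection f (real (?k n) * ?h n)) \<longlonglongrightarrow> two_sided_reflection f t"
    by (rule cadlag_tendsto[OF cadlag_two_sided_reflection[OF f f0] t d(1)]) (intro always_eventually allI d)
  have "(\<lambda>n. walk2 (f 0) (grid_step f (?h n)) (?k n) - two_sided_reflection f (real (?k n) * ?h n)) \<longlonglongrightarrow> 0"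
  proof (rule tendstoI)
    fix e :: real assume e: "0 < e"
    have T: "0 \<le> t + 1" and e2: "0 < e / 2" using t e by auto
    obtain h0 where h0: "0 < h0" "\<And>h k. 0 < h \<Longrightarrow> h < h0 \<Longrightarrow> real k * h \<le> t + 1 \<Longrightarrow>
        \<bar>walk2 (f 0) (grid_step f h) k - two_sided_reflection f (real k * h)\<bar> \<le> e / 2"
      using walk2_sampling[OF f f0 T e2] by blast
    have "?h \<longlonglongrightarrow> 0" by (intro LIMSEQ_power_zero) simp
    then have "\<forall>\<^sub>F n in sequentially. ?h n < h0" using h0(1) by (intro order_tendstoD(2)) auto
    then show "\<forall>\<^sub>F n in sequentially. dist (walk2 (f 0) (grid_step f (?h n)) (?k n) - two_sided_reflection f (real (?k n) * ?h n)) 0 < e"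
    proof eventually_elim
      case (elim n)
      have "?h n \<le> 1" by (intro power_le_one) auto
      then have "real (?k n) * ?h n \<le> t + 1" using d(3)[of n] by linarith
      then have "\<bar>walk2 (f 0) (grid_step f (?h n)) (?k n) - two_sided_reflection f (real (?k n) * ?h n)\<bar> \<le> e / 2"
        by (intro h0(2)) (use elim in auto)
      then show ?case using e by (simp add: dist_real_def)
    qed
  qed
  from tendsto_add[OF this 1] show ?thesis by simp
qed

lemma iterated_limit_prod:
  fixes g :: "real \<Rightarrow> real \<Rightarrow> real"
  assumes J: "finite J" and g: "\<And>t. continuous_on UNIV (g t)" "\<And>t x. 0 \<le> g t x \<and> g t x \<le> 1"
    and x: "\<And>t r. t \<in> J \<Longrightarrow> 0 < r \<Longrightarrow> \<forall>\<^sub>F i in sequentially. \<forall>\<^sub>F n in sequentially. \<bar>x n i t - y t\<bar> \<le> r"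
    and r: "0 < r"
  shows "\<forall>\<^sub>F i in sequentially. \<forall>\<^sub>F n in sequentially. \<bar>(\<Prod>t\<in>J. g t (x n i t)) - (\<Prod>t\<in>J. g t (y t))\<bar> \<le> (r :: real)"
proof -
  \<comment> \<open>Products of factors in \<open>[0,1]\<close> differ by at most the sum of the
    differences of the factors; the added 1 covers empty \<open>J\<close>.\<close>
  define q where "q = r / (real (card J) + 1)"
  have q: "0 < q" "real (card J) * q \<le> r" using r by (auto simp: q_def field_simps)
  have "\<forall>\<^sub>F i in sequentially. \<forall>\<^sub>F n in sequentially. \<bar>g t (x n i t) - g t (y t)\<bar> \<le> q" if t: "t \<in> J" for t
  proof -
    have "isCont (g t) (y t)" using g(1)[of t] by (simp add: continuous_on_eq_continuous_at)
    then obtain d where d: "d > 0" "\<And>z. \<bar>z - y t\<bar> < d \<Longrightarrow> \<bar>g t z - g t (y t)\<bar> < q"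
      using q(1) unfolding continuous_at_eps_delta by (auto simp: dist_real_def)
    have d2: "0 < d / 2" using d(1) by simp
    show ?thesis using x[OF t d2]
    proof eventually_elim
      case (elim i)
      then show ?case
      proof eventually_elim
        case (elim n)
        then show ?case using d(1) d(2)[of "x n i t"] by linarith
      qed
    qed
  qed
  then have "\<forall>\<^sub>F i in sequentially. \<forall>t\<in>J. \<forall>\<^sub>F n in sequentially. \<bar>g t (x n i t) - g t (y t)\<bar> \<le> q"
    by (intro eventually_ball_finite J) auto
  then show ?thesis
  proof eventually_elim
    case (elim i)
    then have "\<forall>\<^sub>F n in sequentially. \<forall>t\<in>J. \<bar>g t (x n i t) - g t (y t)\<bar> \<le> q"
      by (intro eventually_ball_finite J)
    then show ?case
    proof eventually_elim
      case (elim n)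
      have "norm ((\<Prod>t\<in>J. g t (x n i t)) - (\<Prod>t\<in>J. g t (y t))) \<le> (\<Sum>t\<in>J. norm (g t (x n i t) - g t (y t)))"
        by (rule norm_prod_diff) (use g(2) in auto)
      also have "\<dots> \<le> real (card J) * q" using elim by (intro sum_bounded_above) auto
      finally show ?case using q(2) by simp
    qed
  qed
qed

context levy_process
begin

lemma path_steps_eq: "path_steps (\<lambda>t. Y t \<omega>) n = (\<lambda>l. steps ((1/2) ^ n) l \<omega>)"
  unfolding path_steps_def[abs_def] steps_def[abs_def] ..

lemma low_rule_adapted: "iid_increments.adapted (low_rule n i)"
proof -
  interpret S: iid_increments M "steps 1" by (rule steps_iid) simp
  show ?thesis unfolding S.adapted_def
  proof (intro conjI allI impI)
    fix j
    have [measurable]: "(\<lambda>v. walk1 (v 0) (\<lambda>l. v (Suc l)) j) \<in> borel_measurable (Pi\<^sub>M {..j} (\<lambda>_. borel :: real measure))"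
      by (rule walk1_measurable[where x = "\<lambda>v. v 0" and \<xi> = "\<lambda>l v. v (Suc l)"]) (auto intro!: measurable_component_singleton)
    show "Measurable.pred (Pi\<^sub>M {..j} (\<lambda>_. borel)) (low_rule n i j)"
      unfolding low_rule_def[abs_def] by measurable
    fix v v' :: "nat \<Rightarrow> real" assume eq: "\<forall>l\<le>j. v l = v' l"
    then have "walk1 (v 0) (\<lambda>l. v (Suc l)) j = walk1 (v' 0) (\<lambda>l. v' (Suc l)) j"
      using walk1_cong[of j "\<lambda>l. v (Suc l)" "\<lambda>l. v' (Suc l)"] by auto
    then show "low_rule n i j v = low_rule n i j v'" unfolding low_rule_def by simp
  qed
qed

definition skipped_walk :: "nat \<Rightarrow> nat \<Rightarrow> real \<Rightarrow> 'a \<Rightarrow> real" where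
  "skipped_walk n i t \<omega> = walk2 (Y 0 \<omega>)
    (\<lambda>l. steps ((1/2) ^ n) (Suc (sel_pos (low_rule n i) l (\<lambda>l. steps ((1/2) ^ n) l \<omega>))) \<omega>) (target_index n i t)"

definition plain_walk :: "nat \<Rightarrow> nat \<Rightarrow> 'a \<Rightarrow> real" where
  "plain_walk n k \<omega> = walk2 (Y 0 \<omega>) (grid_step (\<lambda>t. Y t \<omega>) ((1/2) ^ n)) k"

lemma skipped_walk_measurable: "skipped_walk n i t \<in> borel_measurable M"
proof -
  interpret S: iid_increments M "steps ((1/2) ^ n)" by (rule steps_iid) simp
  have "(\<lambda>\<omega>. S.selected (low_rule n i) (Suc l) \<omega>) \<in> borel_measurable M" for l
    by (rule S.selected_measurable[OF low_rule_adapted])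
  then have "(\<lambda>\<omega>. steps ((1/2) ^ n) (Suc (sel_pos (low_rule n i) l (\<lambda>l. steps ((1/2) ^ n) l \<omega>))) \<omega>) \<in> borel_measurable M" for l
    by (simp only: S.selected_def nat.case)
  then show ?thesis unfolding skipped_walk_def[abs_def]
    by (rule walk2_measurable[where \<xi> = "\<lambda>l \<omega>. steps ((1/2) ^ n) (Suc (sel_pos (low_rule n i) l (\<lambda>l. steps ((1/2) ^ n) l \<omega>))) \<omega>",
        OF Y_measurable[OF order_refl]])
qed

lemma plain_walk_measurable: "plain_walk n k \<in> borel_measurable M"
proof -
  have "(\<lambda>\<omega>. grid_step (\<lambda>t. Y t \<omega>) ((1/2) ^ n) l) \<in> borel_measurable M" for l
    unfolding grid_step_def by (rule borel_measurable_diff; rule Y_measurable; simp)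
  then show ?thesis
    unfolding plain_walk_def[abs_def]
    by (rule walk2_measurable[where \<xi> = "\<lambda>l \<omega>. grid_step (\<lambda>t. Y t \<omega>) ((1/2) ^ n) l", OF Y_measurable[OF order_refl]])
qed

text \<open>Both walks are the same functional of a sequence, driven by the selected and by all
  increments respectively. Optional skipping makes the laws equal for each fixed \<open>n\<close>
  and \<open>i\<close>.\<close>

lemma skipped_walk_law:
  fixes g :: "real \<Rightarrow> real \<Rightarrow> real"
  assumes J: "finite J" and g: "\<And>t. continuous_on UNIV (g t)"
  shows "(\<integral>\<omega>. (\<Prod>t\<in>J. g t (skipped_walk n i t \<omega>)) \<partial>M) = (\<integral>\<omega>. (\<Prod>t\<in>J. g t (plain_walk n (target_index n i t) \<omega>)) \<partial>M)"
proof -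
  interpret S: iid_increments M "steps ((1/2) ^ n)" by (rule steps_iid) simp
  define m where "m = Max (insert 0 (target_index n i ` J))"
  have m: "target_index n i t \<le> m" if "t \<in> J" for t using that J by (auto simp: m_def)
  have gm: "g t \<in> borel_measurable borel" for t using g(1) by (rule borel_measurable_continuous_onI)
  define G where "G v = (\<Prod>t\<in>J. g t (walk2 (v 0) (\<lambda>l. v (Suc l)) (target_index n i t)))" for v :: "nat \<Rightarrow> real"
  have "(\<integral>\<omega>. G (\<lambda>l. S.selected (low_rule n i) l \<omega>) \<partial>M) = (\<integral>\<omega>. G (\<lambda>l. steps ((1/2) ^ n) l \<omega>) \<partial>M)"
  proof (rule S.optional_skipping_integral[OF _ _, where J = "i * 2 ^ n" and m = m])
    show "S.adapted (low_rule n i)" by (rule low_rule_adapted)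
    show "low_rule n i j v" if "i * 2 ^ n \<le> j" for j v using that by (simp add: low_rule_def)
    show "G \<in> borel_measurable (Pi\<^sub>M {..m} (\<lambda>_. borel))"
      unfolding G_def
    proof (intro borel_measurable_prod measurable_compose[OF _ gm])
      fix t assume t: "t \<in> J"
      show "(\<lambda>v. walk2 (v 0) (\<lambda>l. v (Suc l)) (target_index n i t)) \<in> borel_measurable (Pi\<^sub>M {..m} (\<lambda>_. borel))"
        by (rule walk2_measurable[where x = "\<lambda>v. v 0" and \<xi> = "\<lambda>l v. v (Suc l)"])
          (use m[OF t] in \<open>auto intro!: measurable_component_singleton\<close>)
    qed
    fix v v' :: "nat \<Rightarrow> real" assume eq: "\<And>l. l \<le> m \<Longrightarrow> v l = v' l"
    have "walk2 (v 0) (\<lambda>l. v (Suc l)) (target_index n i t) = walk2 (v' 0) (\<lambda>l. v' (Suc l)) (target_index n i t)" if "t \<in> J" for t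
      using eq[of 0] walk2_cong[of "target_index n i t" "\<lambda>l. v (Suc l)" "\<lambda>l. v' (Suc l)" "v 0"] eq m[OF that] by simp
    then show "G v = G v'" unfolding G_def by (intro prod.cong) auto
  qed
  moreover have "G (\<lambda>l. S.selected (low_rule n i) l \<omega>) = (\<Prod>t\<in>J. g t (skipped_walk n i t \<omega>))" for \<omega>
    unfolding G_def skipped_walk_def by (simp only: S.selected_def nat.case steps_simps(1))
  moreover have "G (\<lambda>l. steps ((1/2) ^ n) l \<omega>) = (\<Prod>t\<in>J. g t (plain_walk n (target_index n i t) \<omega>))" for \<omega>
    unfolding G_def plain_walk_def by (simp only: steps_def nat.case)
  ultimately show ?thesis by simp
qed

text \<open>The result for the path started at \<open>-1\<close> carries over to every start in the
  interval, because the process is unbounded below and therefore comes down to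
  \<open>-1\<close>.\<close>

lemma infinite_time_below:
  assumes start: "\<And>\<omega>. \<omega> \<in> space M \<Longrightarrow> Y 0 \<omega> \<in> {-1..1}"
  shows "AE \<omega> in M. emeasure lborel {z. 0 \<le> z \<and> reflect_left (\<lambda>t. Y t \<omega>) z < 1} = \<infinity>"
  using infinite_occupation unbounded_below AE_space
proof eventually_elim
  case (elim \<omega>)
  obtain k :: nat where "Y (real k) \<omega> - Y 0 \<omega> \<le> - 2" using elim(2) by blast
  then have "Y (real k) \<omega> \<le> - 1" using start[OF elim(3)] by simp
  then have "occupation (\<lambda>t. Y t \<omega>) = \<infinity>"
    using start[OF elim(3)]
    by (intro occupation_eventually_below[where s = "real k", OF Y_cadlag[OF elim(3)] _ _ _ elim(1)]) simp_all
  then show ?case by (simp only: occupation_def)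
qed

text \<open>For fixed \<open>i\<close>, refining the grid sends the expectations of the walks to
  that of the two-sided reflection at the shifted times \<open>t + e i\<close>; the skipped walks
  approach the fast-forwarded path only as \<open>i\<close> grows too. The shifted reflection
  therefore provides the intermediate limit \<open>b i\<close>, and its right-continuity removes the
  shift.\<close>

lemma fast_forward_law:
  assumes start: "\<And>\<omega>. \<omega> \<in> space M \<Longrightarrow> Y 0 \<omega> \<in> {-1..1}"
  shows "equal_in_law M (\<lambda>\<omega>. fast_forward_right (reflect_left (\<lambda>t. Y t \<omega>))) (\<lambda>\<omega>. two_sided_reflection (\<lambda>t. Y t \<omega>))"
proof (rule equal_in_lawI)
  show "prob_space M" by unfold_locales
  let ?X = "\<lambda>\<omega>. fast_forward_right (reflect_left (\<lambda>t. Y t \<omega>))" and ?R = "\<lambda>\<omega>. two_sided_reflection (\<lambda>t. Y t \<omega>)"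
  show Xm: "(\<lambda>\<omega>. ?X \<omega> t) \<in> borel_measurable M" if "0 \<le> t" for t
  proof (rule fast_forward_measurable[OF _ _ that])
    show "(\<lambda>\<omega>. reflect_left (\<lambda>t. Y t \<omega>) t) \<in> borel_measurable M" if "0 \<le> t" for t
      by (rule reflect_left_measurable[OF Y_measurable Y_cadlag that])
    show "cadlag (\<lambda>t. reflect_left (\<lambda>t. Y t \<omega>) t)" if "\<omega> \<in> space M" for \<omega>
      by (rule cadlag_reflect_left[OF Y_cadlag[OF that]])
  qed
  show "cadlag (?X \<omega>)" if "\<omega> \<in> space M" for \<omega>
    by (rule cadlag_fast_forward[OF cadlag_reflect_left[OF Y_cadlag[OF that]]])
  have plain: "(\<lambda>n. plain_walk n (nat \<lceil>t * 2 ^ n\<rceil>) \<omega>) \<longlonglongrightarrow> ?R \<omega> t" if "\<omega> \<in> space M" "0 \<le> t" for \<omega> t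
    unfolding plain_walk_def by (rule walk2_dyadic_tendsto[OF Y_cadlag[OF that(1)] start[OF that(1)] that(2)])
  show Rm: "(\<lambda>\<omega>. ?R \<omega> t) \<in> borel_measurable M" if "0 \<le> t" for t
    by (rule borel_measurable_LIMSEQ_real[where u = "\<lambda>n. plain_walk n (nat \<lceil>t * 2 ^ n\<rceil>)"])
      (use plain that plain_walk_measurable in auto)
  show Rc: "cadlag (?R \<omega>)" if "\<omega> \<in> space M" for \<omega>
    by (rule cadlag_two_sided_reflection[OF Y_cadlag[OF that] start[OF that]])
  fix J :: "real set" and g :: "real \<Rightarrow> real \<Rightarrow> real"
  assume J: "finite J" "J \<subseteq> {0..}" and g: "\<And>t. continuous_on UNIV (g t)" "\<And>t x. 0 \<le> g t x \<and> g t x \<le> 1"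
  have infinite: "AE \<omega> in M. emeasure lborel {z. 0 \<le> z \<and> reflect_left (\<lambda>t. Y t \<omega>) z < 1} = \<infinity>"
    by (rule infinite_time_below) (rule start)
  have gm: "g t \<in> borel_measurable borel" for t using g(1) by (rule borel_measurable_continuous_onI)
  have pb: "0 \<le> (\<Prod>t\<in>J. g t (x t)) \<and> (\<Prod>t\<in>J. g t (x t)) \<le> 1" for x
    using g(2) by (auto intro!: prod_nonneg prod_le_1)
  have cont: "(\<lambda>n. \<Prod>t\<in>J. g t (x n t)) \<longlonglongrightarrow> (\<Prod>t\<in>J. g t (y t))" if "\<And>t. t \<in> J \<Longrightarrow> (\<lambda>n. x n t) \<longlonglongrightarrow> y t" for x y
  proof (rule tendsto_prod)
    fix t assume "t \<in> J"
    have "isCont (g t) (y t)" using g(1)[of t] by (simp add: continuous_on_eq_continuous_at)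
    then show "(\<lambda>n. g t (x n t)) \<longlonglongrightarrow> g t (y t)" using that[OF \<open>t \<in> J\<close>] by (rule isCont_tendsto_compose)
  qed
  define e where "e i = inverse (real (Suc i))" for i
  have e: "0 < e i" "e \<longlonglongrightarrow> 0" for i
    unfolding e_def using LIMSEQ_inverse_real_of_nat by auto
  have J0: "0 \<le> t" if "t \<in> J" for t using J(2) that by auto
  have te: "0 \<le> t + e i" if "t \<in> J" for t i using J0[OF that] e(1)[of i] by simp
  show "(\<integral>\<omega>. (\<Prod>t\<in>J. g t (?X \<omega> t)) \<partial>M) = (\<integral>\<omega>. (\<Prod>t\<in>J. g t (?R \<omega> t)) \<partial>M)"
  proof (rule iterated_limit_expectation[where F = "\<lambda>n i \<omega>. \<Prod>t\<in>J. g t (skipped_walk n i t \<omega>)"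
        and b = "\<lambda>i. \<integral>\<omega>. (\<Prod>t\<in>J. g t (?R \<omega> (t + e i))) \<partial>M"])
    show "(\<lambda>\<omega>. \<Prod>t\<in>J. g t (skipped_walk n i t \<omega>)) \<in> borel_measurable M" for n i
      by (intro borel_measurable_prod measurable_compose[OF _ gm] skipped_walk_measurable)
    show "(\<lambda>\<omega>. \<Prod>t\<in>J. g t (?X \<omega> t)) \<in> borel_measurable M"
      using J Xm by (intro borel_measurable_prod measurable_compose[OF _ gm]) auto
    have "AE \<omega> in M. \<forall>T::nat. \<forall>a>0. \<forall>\<^sub>F n in sequentially. \<forall>j<T * 2 ^ n. - a < grid_step (\<lambda>t. Y t \<omega>) ((1/2) ^ n) j"
      by (rule small_down_steps)
    then show "AE \<omega> in M. \<forall>r>0. \<forall>\<^sub>F i in sequentially. \<forall>\<^sub>F n in sequentially.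
        \<bar>(\<Prod>t\<in>J. g t (skipped_walk n i t \<omega>)) - (\<Prod>t\<in>J. g t (?X \<omega> t))\<bar> \<le> r"
      using infinite AE_space
    proof eventually_elim
      case (elim \<omega>)
      show ?case
      proof (intro allI impI, rule iterated_limit_prod[OF J(1) g])
        fix t r :: real assume "t \<in> J" and r: "0 < r"
        then have t: "0 \<le> t" by (intro J0)
        have "\<exists>i0. \<forall>i\<ge>i0. \<forall>\<^sub>F n in sequentially.
            \<bar>walk2 (Y 0 \<omega>) (\<lambda>l. path_steps (\<lambda>t. Y t \<omega>) n (Suc (sel_pos (low_rule n i) l (path_steps (\<lambda>t. Y t \<omega>) n)))) (target_index n i t)
              - fast_forward_right (reflect_left (\<lambda>t. Y t \<omega>)) t\<bar> \<le> r"
          by (rule selection_convergence[OF Y_cadlag[OF elim(3)] start[OF elim(3)] refl elim(2) _ t r])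
            (use elim(1) in blast)
        then show "\<forall>\<^sub>F i in sequentially. \<forall>\<^sub>F n in sequentially. \<bar>skipped_walk n i t \<omega> - ?X \<omega> t\<bar> \<le> r"
          unfolding skipped_walk_def path_steps_eq by (rule eventually_sequentially[THEN iffD2])
      qed
    qed
    show "(\<lambda>n. \<integral>\<omega>. (\<Prod>t\<in>J. g t (skipped_walk n i t \<omega>)) \<partial>M) \<longlonglongrightarrow> (\<integral>\<omega>. (\<Prod>t\<in>J. g t (?R \<omega> (t + e i))) \<partial>M)" for i
      unfolding skipped_walk_law[OF J(1) g(1)]
    proof (rule integral_dominated_convergence[where w = "\<lambda>_. 1"])
      show "(\<lambda>\<omega>. \<Prod>t\<in>J. g t (?R \<omega> (t + e i))) \<in> borel_measurable M"
        by (intro borel_measurable_prod measurable_compose[OF _ gm] Rm te)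
      show "(\<lambda>\<omega>. \<Prod>t\<in>J. g t (plain_walk n (target_index n i t) \<omega>)) \<in> borel_measurable M" for n
        by (intro borel_measurable_prod measurable_compose[OF _ gm] plain_walk_measurable)
      show "AE \<omega> in M. (\<lambda>n. \<Prod>t\<in>J. g t (plain_walk n (target_index n i t) \<omega>)) \<longlonglongrightarrow> (\<Prod>t\<in>J. g t (?R \<omega> (t + e i)))"
        unfolding target_index_def e_def[symmetric] by (intro AE_I2 cont plain te)
      show "AE \<omega> in M. norm (\<Prod>t\<in>J. g t (plain_walk n (target_index n i t) \<omega>)) \<le> 1" for n
        using pb by (intro AE_I2) simp
    qed simp
    show "(\<lambda>i. \<integral>\<omega>. (\<Prod>t\<in>J. g t (?R \<omega> (t + e i))) \<partial>M) \<longlonglongrightarrow> (\<integral>\<omega>. (\<Prod>t\<in>J. g t (?R \<omega> t)) \<partial>M)"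
    proof (rule integral_dominated_convergence[where w = "\<lambda>_. 1"])
      show "(\<lambda>\<omega>. \<Prod>t\<in>J. g t (?R \<omega> (t + e i))) \<in> borel_measurable M" for i
        by (intro borel_measurable_prod measurable_compose[OF _ gm] Rm te)
      show "(\<lambda>\<omega>. \<Prod>t\<in>J. g t (?R \<omega> t)) \<in> borel_measurable M"
        by (intro borel_measurable_prod measurable_compose[OF _ gm] Rm J0)
      show "AE \<omega> in M. (\<lambda>i. \<Prod>t\<in>J. g t (?R \<omega> (t + e i))) \<longlonglongrightarrow> (\<Prod>t\<in>J. g t (?R \<omega> t))"
      proof (intro AE_I2 cont)
        fix \<omega> t assume w: "\<omega> \<in> space M" and "t \<in> J"
        then have t: "0 \<le> t" by (intro J0)
        show "(\<lambda>i. ?R \<omega> (t + e i)) \<longlonglongrightarrow> ?R \<omega> t"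
        proof (rule cadlag_tendsto[OF Rc[OF w] t])
          show "(\<lambda>i. t + e i) \<longlonglongrightarrow> t" using tendsto_add[OF tendsto_const[of t] e(2)] by simp
          show "\<forall>\<^sub>F i in sequentially. t \<le> t + e i" using e(1) by (intro always_eventually allI) (simp add: less_imp_le)
        qed
      qed
      show "AE \<omega> in M. norm (\<Prod>t\<in>J. g t (?R \<omega> (t + e i))) \<le> 1" for i using pb by (intro AE_I2) simp
    qed simp
  qed (use pb in auto)
qed

end

theorem corollary5p2:
  fixes \<phi> :: "real measure" and M :: "'a measure" and Y :: "real \<Rightarrow> 'a \<Rightarrow> real"
  assumes "admissible_jump_measure \<phi>"
    and "cadlag_levy_process M Y"
    and "has_laplace_exponent M Y (laplace_exponent \<phi>)"
    and "\<And>\<omega>. \<omega> \<in> space M \<Longrightarrow> Y 0 \<omega> \<in> {-1..1}"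
  shows "equal_in_law M
           (\<lambda>\<omega>. fast_forward_right (reflect_left (\<lambda>t. Y t \<omega>)))
           (\<lambda>\<omega>. two_sided_reflection (\<lambda>t. Y t \<omega>))"
proof -
  interpret levy_process M \<phi> Y
  proof (rule levy_process.intro)
    show "prob_space M" using assms(2) unfolding cadlag_levy_process_def by blast
    show "levy_process_axioms M \<phi> Y" by (rule levy_process_axioms.intro) (rule assms)+
  qed
  show ?thesis by (rule fast_forward_law[OF assms(4)])
qed

end
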